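(* Let $P\in K$ be the unique solution of the obstacle problem $a(P,v-P)\ge(f,v-P)_\Omega$ for all $v\in K$, assume that $\lambda:=-\nabla\cdot(d^3\nabla P)-f$ belongs to $L_2(\Omega)$, and let $P_h\in K_h$ be the pressure of the nodal mixed method. Then $$\|P-P_h\|_{H^1(\Omega)}\le C\inf_{v_h\in K_h}\left(\|P-v_h\|_{H^1(\Omega)}+\|\lambda\|_{L_2(\Omega)}^{1/2}\|P-v_h\|_{L_2(\Omega)}^{1/2}\right)$$ with $C$ depending only on $d_0$, on $\|d^3\|_{L_\infty}$ and on $\Omega$. If in addition $P\in H^2(\Omega)$, then $$\|P-P_h\|_{H^1(\Omega)}\le Ch\left(|P|_{H^2(\Omega)}+\|\lambda\|_{L_2(\Omega)}^{1/2}|P|_{H^2(\Omega)}^{1/2}\right),$$ where the constant $C$ may in addition depend on the shape regularity of the mesh but not on $h$.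
   Context: $\Omega\subset\mathbb R^2$ is a bounded polygonal domain, $\mathcal T$ belongs to a shape-regular family of conforming triangulations with mesh size $h$; $d^3\in L_\infty(\Omega)$ with $d^3\ge d_0^3>0$; $f\in L_2(\Omega)$; $a(v,w)=(d^3\nabla v,\nabla w)_\Omega$; $K=\{v\in H^1_0(\Omega):v\ge0\text{ a.e. in }\Omega\}$. $V_h$ is the space of continuous piecewise linears on $\mathcal T$ vanishing on $\partial\Omega$, with nodal basis $\varphi_i$, and $K_h=\{v_h\in V_h:v_h\ge0\text{ in }\Omega\}$. Nodal mixed method: find nodal vectors $(P_i)$, $(\lambda_i)$ such that, with $A_{ij}=a(\varphi_j,\varphi_i)$, $F_i=(f,\varphi_i)_\Omega$, $m_i=\int_\Omega\varphi_i$ and any $\gamma>0$, $(AP)_i-m_i\gamma^{-1}[\gamma\lambda_i-P_i]_+=F_i$ and $\lambda_i=\gamma^{-1}[\gamma\lambda_i-P_i]_+$ at every interior node, where $[x]_+=\max(0,x)$; $P_h=\sum_iP_i\varphi_i$. Equivalently, $P_h$ is the unique minimiser of $\frac12a(v_h,v_h)-(f,v_h)_\Omega$ over $K_h$. *)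

theory Defs
  imports "HOL-Analysis.Analysis" "HOL-Probability.Essential_Supremum"
begin

section \<open>Lebesgue spaces on a domain\<close>

text \<open>Elements of \<open>L\<^sub>2(\<Omega>)\<close>, \<open>H\<^sup>1(\<Omega>)\<close> etc. are represented by functions on the whole space whose
  values outside \<open>\<Omega>\<close> are irrelevant; functions equal a.e. in \<open>\<Omega>\<close> are not identified.\<close>

definition L2_inner :: "'a::euclidean_space set \<Rightarrow> ('a \<Rightarrow> real) \<Rightarrow> ('a \<Rightarrow> real) \<Rightarrow> real" where
  "L2_inner \<Omega> u v = (LINT x|lebesgue_on \<Omega>. u x * v x)"

definition L2 :: "'a::euclidean_space set \<Rightarrow> ('a \<Rightarrow> real) set" where
  "L2 \<Omega> = {u \<in> borel_measurable (lebesgue_on \<Omega>). integrable (lebesgue_on \<Omega>) (\<lambda>x. (u x)\<^sup>2)}"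

definition L2_norm :: "'a::euclidean_space set \<Rightarrow> ('a \<Rightarrow> real) \<Rightarrow> real" where
  "L2_norm \<Omega> u = sqrt (L2_inner \<Omega> u u)"

definition Linf :: "'a::euclidean_space set \<Rightarrow> ('a \<Rightarrow> real) set" where
  "Linf \<Omega> = {u \<in> borel_measurable (lebesgue_on \<Omega>). \<exists>M. AE x in lebesgue_on \<Omega>. \<bar>u x\<bar> \<le> M}"

definition Linf_norm :: "'a::euclidean_space set \<Rightarrow> ('a \<Rightarrow> real) \<Rightarrow> real" where
  "Linf_norm \<Omega> u = real_of_ereal (esssup (lebesgue_on \<Omega>) (\<lambda>x. ereal \<bar>u x\<bar>))"

definition loc_integrable :: "'a::euclidean_space set \<Rightarrow> ('a \<Rightarrow> real) \<Rightarrow> bool" where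
  "loc_integrable \<Omega> u \<longleftrightarrow> (\<forall>S. compact S \<and> S \<subseteq> \<Omega> \<longrightarrow> integrable (lebesgue_on S) u)"

section \<open>Test functions and weak derivatives\<close>

definition pderiv_dir :: "'a::euclidean_space \<Rightarrow> ('a \<Rightarrow> real) \<Rightarrow> 'a \<Rightarrow> real" where
  "pderiv_dir b \<phi> x = frechet_derivative \<phi> (at x) b"

primrec Ck :: "nat \<Rightarrow> ('a::euclidean_space \<Rightarrow> real) \<Rightarrow> bool" where
  "Ck 0 \<phi> \<longleftrightarrow> continuous_on UNIV \<phi>"
| "Ck (Suc k) \<phi> \<longleftrightarrow> (\<forall>x. \<phi> differentiable (at x)) \<and> (\<forall>b\<in>Basis. Ck k (pderiv_dir b \<phi>))"

definition test_fun :: "'a::euclidean_space set \<Rightarrow> ('a \<Rightarrow> real) set" where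
  "test_fun \<Omega> = {\<phi>. (\<forall>k. Ck k \<phi>) \<and> compact (closure {x. \<phi> x \<noteq> 0}) \<and> closure {x. \<phi> x \<noteq> 0} \<subseteq> \<Omega>}"

definition has_weak_pderiv ::
  "'a::euclidean_space set \<Rightarrow> 'a \<Rightarrow> ('a \<Rightarrow> real) \<Rightarrow> ('a \<Rightarrow> real) \<Rightarrow> bool" where
  "has_weak_pderiv \<Omega> b u g \<longleftrightarrow> loc_integrable \<Omega> u \<and> loc_integrable \<Omega> g \<and>
     (\<forall>\<phi>\<in>test_fun \<Omega>. L2_inner \<Omega> u (pderiv_dir b \<phi>) = - L2_inner \<Omega> g \<phi>)"

text \<open>Weak derivatives are unique only up to null sets, so this picks a representative.\<close>

definition weak_pderiv :: "'a::euclidean_space set \<Rightarrow> 'a \<Rightarrow> ('a \<Rightarrow> real) \<Rightarrow> 'a \<Rightarrow> real" where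
  "weak_pderiv \<Omega> b u = (SOME g. has_weak_pderiv \<Omega> b u g)"

definition weak_grad :: "'a::euclidean_space set \<Rightarrow> ('a \<Rightarrow> real) \<Rightarrow> 'a \<Rightarrow> 'a" where
  "weak_grad \<Omega> u x = (\<Sum>b\<in>Basis. weak_pderiv \<Omega> b u x *\<^sub>R b)"

definition has_weak_div ::
  "'a::euclidean_space set \<Rightarrow> ('a \<Rightarrow> 'a) \<Rightarrow> ('a \<Rightarrow> real) \<Rightarrow> bool" where
  "has_weak_div \<Omega> q g \<longleftrightarrow> (\<forall>b\<in>Basis. loc_integrable \<Omega> (\<lambda>x. q x \<bullet> b)) \<and> loc_integrable \<Omega> g \<and>
     (\<forall>\<phi>\<in>test_fun \<Omega>.
        (LINT x|lebesgue_on \<Omega>. q x \<bullet> (\<Sum>b\<in>Basis. pderiv_dir b \<phi> x *\<^sub>R b)) = - L2_inner \<Omega> g \<phi>)"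

section \<open>Sobolev spaces\<close>

definition H1 :: "'a::euclidean_space set \<Rightarrow> ('a \<Rightarrow> real) set" where
  "H1 \<Omega> = {u \<in> L2 \<Omega>. \<forall>b\<in>Basis. \<exists>g\<in>L2 \<Omega>. has_weak_pderiv \<Omega> b u g}"

definition H1_norm :: "'a::euclidean_space set \<Rightarrow> ('a \<Rightarrow> real) \<Rightarrow> real" where
  "H1_norm \<Omega> u = sqrt ((L2_norm \<Omega> u)\<^sup>2 + (\<Sum>b\<in>Basis. (L2_norm \<Omega> (weak_pderiv \<Omega> b u))\<^sup>2))"

definition H10 :: "'a::euclidean_space set \<Rightarrow> ('a \<Rightarrow> real) set" where
  "H10 \<Omega> = {u \<in> H1 \<Omega>. \<forall>\<epsilon>>0. \<exists>\<phi>\<in>test_fun \<Omega>. H1_norm \<Omega> (\<lambda>x. u x - \<phi> x) < \<epsilon>}"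

definition H2 :: "'a::euclidean_space set \<Rightarrow> ('a \<Rightarrow> real) set" where
  "H2 \<Omega> = {u \<in> H1 \<Omega>. \<forall>b\<in>Basis. weak_pderiv \<Omega> b u \<in> H1 \<Omega>}"

definition H2_seminorm :: "'a::euclidean_space set \<Rightarrow> ('a \<Rightarrow> real) \<Rightarrow> real" where
  "H2_seminorm \<Omega> u =
     sqrt (\<Sum>b\<in>Basis. \<Sum>c\<in>Basis. (L2_norm \<Omega> (weak_pderiv \<Omega> c (weak_pderiv \<Omega> b u)))\<^sup>2)"

section \<open>Polygonal domains and triangulations\<close>

text \<open>The condition \<open>interior (closure \<Omega>) = \<Omega>\<close> excludes slits and isolated boundary points.\<close>

definition polygonal_domain :: "(real^2) set \<Rightarrow> bool" where
  "polygonal_domain \<Omega> \<longleftrightarrow> \<Omega> \<noteq> {} \<and> open \<Omega> \<and> connected \<Omega> \<and> bounded \<Omega> \<and>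
     interior (closure \<Omega>) = \<Omega> \<and>
     (\<exists>E. finite E \<and> frontier \<Omega> = (\<Union>(a, b)\<in>E. closed_segment a b))"

definition conforming_triangulation :: "(real^2) set \<Rightarrow> (real^2) set set \<Rightarrow> bool" where
  "conforming_triangulation \<Omega> \<T> \<longleftrightarrow>
     triangulation \<T> \<and> (\<forall>K\<in>\<T>. 2 simplex K) \<and> \<Union>\<T> = closure \<Omega>"

definition mesh_size :: "(real^2) set set \<Rightarrow> real" where
  "mesh_size \<T> = Max (diameter ` \<T>)"

definition incircle_diameter :: "(real^2) set \<Rightarrow> real" where
  "incircle_diameter K = Sup {2 * r |r. 0 < r \<and> (\<exists>x. cball x r \<subseteq> K)}"

definition shape_regular :: "real \<Rightarrow> (real^2) set set \<Rightarrow> bool" where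
  "shape_regular \<sigma> \<T> \<longleftrightarrow> (\<forall>K\<in>\<T>. diameter K \<le> \<sigma> * incircle_diameter K)"

definition interior_nodes :: "(real^2) set \<Rightarrow> (real^2) set set \<Rightarrow> (real^2) set" where
  "interior_nodes \<Omega> \<T> = {z \<in> \<Omega>. \<exists>K\<in>\<T>. z extreme_point_of K}"

text \<open>Finite element functions are extended by zero outside \<open>\<Omega>\<close>, which makes them, and in
  particular the nodal basis, unique as functions on the whole plane.\<close>

definition Vh :: "(real^2) set \<Rightarrow> (real^2) set set \<Rightarrow> (real^2 \<Rightarrow> real) set" where
  "Vh \<Omega> \<T> = {v. continuous_on (closure \<Omega>) v \<and>
     (\<forall>K\<in>\<T>. \<exists>c g. \<forall>x\<in>K. v x = c + g \<bullet> x) \<and> (\<forall>x. x \<notin> \<Omega> \<longrightarrow> v x = 0)}"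

definition nodal_basis :: "(real^2) set \<Rightarrow> (real^2) set set \<Rightarrow> real^2 \<Rightarrow> real^2 \<Rightarrow> real" where
  "nodal_basis \<Omega> \<T> i =
     (THE v. v \<in> Vh \<Omega> \<T> \<and> (\<forall>j\<in>interior_nodes \<Omega> \<T>. v j = (if j = i then 1 else 0)))"

section \<open>The obstacle problem and the nodal mixed method\<close>

definition bilin_a ::
  "(real^2) set \<Rightarrow> (real^2 \<Rightarrow> real) \<Rightarrow> (real^2 \<Rightarrow> real) \<Rightarrow> (real^2 \<Rightarrow> real) \<Rightarrow> real" where
  "bilin_a \<Omega> d v w = (LINT x|lebesgue_on \<Omega>. (d x ^ 3 *\<^sub>R weak_grad \<Omega> v x) \<bullet> weak_grad \<Omega> w x)"

definition Kset :: "(real^2) set \<Rightarrow> (real^2 \<Rightarrow> real) set" where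
  "Kset \<Omega> = {v \<in> H10 \<Omega>. AE x in lebesgue_on \<Omega>. 0 \<le> v x}"

definition Kh :: "(real^2) set \<Rightarrow> (real^2) set set \<Rightarrow> (real^2 \<Rightarrow> real) set" where
  "Kh \<Omega> \<T> = {v \<in> Vh \<Omega> \<T>. \<forall>x\<in>\<Omega>. 0 \<le> v x}"

definition solves_obstacle ::
  "(real^2) set \<Rightarrow> (real^2 \<Rightarrow> real) \<Rightarrow> (real^2 \<Rightarrow> real) \<Rightarrow> (real^2 \<Rightarrow> real) \<Rightarrow> bool" where
  "solves_obstacle \<Omega> d f P \<longleftrightarrow> P \<in> Kset \<Omega> \<and>
     (\<forall>v\<in>Kset \<Omega>. bilin_a \<Omega> d P (\<lambda>x. v x - P x) \<ge> L2_inner \<Omega> f (\<lambda>x. v x - P x))"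

text \<open>Nodal vectors are functions on nodes; only their values at interior nodes matter.\<close>

definition solves_nodal_mixed ::
  "(real^2) set \<Rightarrow> (real^2) set set \<Rightarrow> (real^2 \<Rightarrow> real) \<Rightarrow> (real^2 \<Rightarrow> real) \<Rightarrow> real \<Rightarrow>
   (real^2 \<Rightarrow> real) \<Rightarrow> (real^2 \<Rightarrow> real) \<Rightarrow> bool" where
  "solves_nodal_mixed \<Omega> \<T> d f \<gamma> p l \<longleftrightarrow>
     (\<forall>i\<in>interior_nodes \<Omega> \<T>.
        (\<Sum>j\<in>interior_nodes \<Omega> \<T>. bilin_a \<Omega> d (nodal_basis \<Omega> \<T> j) (nodal_basis \<Omega> \<T> i) * p j)
          - (LINT x|lebesgue_on \<Omega>. nodal_basis \<Omega> \<T> i x) * (inverse \<gamma> * max 0 (\<gamma> * l i - p i))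
          = L2_inner \<Omega> f (nodal_basis \<Omega> \<T> i) \<and>
        l i = inverse \<gamma> * max 0 (\<gamma> * l i - p i))"

definition nodal_fun ::
  "(real^2) set \<Rightarrow> (real^2) set set \<Rightarrow> (real^2 \<Rightarrow> real) \<Rightarrow> real^2 \<Rightarrow> real" where
  "nodal_fun \<Omega> \<T> p x = (\<Sum>i\<in>interior_nodes \<Omega> \<T>. p i * nodal_basis \<Omega> \<T> i x)"

end

theory Submission
  imports Defs
begin

text \<open>The nodal equations say that the residual of \<open>P\<^sub>h\<close> at an interior node is a nonnegative multiple of
  the multiplier there, and that multiplier and pressure are complementary; hence \<open>P\<^sub>h\<close> solves the discrete
  variational inequality over \<open>K\<^sub>h\<close>. Testing it with \<open>v\<^sub>h\<close> and the continuous one with \<open>P\<^sub>h\<close> bounds the energy of the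
  error by \<open>a(P - P\<^sub>h, P - v\<^sub>h) + (\<lambda>, v\<^sub>h - P)\<close> (Falk), and coercivity with the Poincare inequality gives the
  quasi-optimal estimate.

  For \<open>P \<in> H\<^sup>2(\<Omega>)\<close> the comparison function is the nodal interpolant. First order Taylor expansion of mollifications at
  a vertex, in the mean over a triangle, shows that point values exist and that the three Taylor remainders are of
  second order in \<open>L\<^sub>2\<close>. On a triangle the interpolation error and its gradient are combinations of these
  remainders, with the gradient weighted by the inverse of the incircle diameter. This needs no trace or embedding
  theorem; point values at boundary vertices vanish because a polygonal domain has exterior cones.\<close>

section \<open>Square integrable functions\<close>

text \<open>Two obstacles shape the proof. Weak derivatives are representatives picked by Hilbert
  choice, so nothing can be computed from \<open>weak_pderiv\<close> until the fundamental lemma of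
  the calculus of variations shows that any two candidates agree almost everywhere. And zero
  boundary values exist only as membership in the closure of the test functions. Finite element
  functions must therefore be approximated by functions of compact support before they may be
  compared with \<open>P\<close>, and conversely the boundary values of \<open>P\<close> are felt
  only through means: a translation out of the domain bounds \<open>P\<close> near a boundary vertex
  by its gradient there. The square root in the estimate comes from the one term that is linear in
  the approximation error, its pairing with lambda: the energy \<open>E\<close> of the error
  satisfies an inequality of the form \<open>E\<^sup>2 \<le> a * E + s\<^sup>2\<close>, where
  \<open>s\<^sup>2\<close> is a product of two norms. Since the interpolation error is of second
  order in the L2 norm and of first order in the H1 norm, both contributions are of order h, and the
  multiplier costs no power of h.\<close>

lemma L2_measurable: "u \<in> L2 S \<Longrightarrow> u \<in> borel_measurable (lebesgue_on S)"
  and L2_square_integrable: "u \<in> L2 S \<Longrightarrow> integrable (lebesgue_on S) (\<lambda>x. (u x)\<^sup>2)"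
  by (auto simp: L2_def)

lemma L2_mult_integrable:
  assumes "u \<in> L2 S" "v \<in> L2 S"
  shows "integrable (lebesgue_on S) (\<lambda>x. u x * v x)"
proof (rule Bochner_Integration.integrable_bound)
  show "integrable (lebesgue_on S) (\<lambda>x. (u x)\<^sup>2 + (v x)\<^sup>2)"
    using assms by (auto simp: L2_def)
  show "(\<lambda>x. u x * v x) \<in> borel_measurable (lebesgue_on S)"
    using assms by (auto simp: L2_def)
  have "\<bar>a * b\<bar> \<le> a\<^sup>2 + b\<^sup>2" for a b :: real
  proof -
    have "0 \<le> (\<bar>a\<bar> - \<bar>b\<bar>)\<^sup>2" by simp
    then have "2 * \<bar>a * b\<bar> \<le> a\<^sup>2 + b\<^sup>2" by (simp add: power2_diff abs_mult)
    then show ?thesis by (smt (verit) abs_ge_zero)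
  qed
  then show "AE x in lebesgue_on S. norm (u x * v x) \<le> norm ((u x)\<^sup>2 + (v x)\<^sup>2)"
    by (auto intro!: AE_I2)
qed

lemma L2_mono:
  assumes "u \<in> borel_measurable (lebesgue_on S)" "v \<in> L2 S" "AE x in lebesgue_on S. \<bar>u x\<bar> \<le> \<bar>v x\<bar>"
  shows "u \<in> L2 S"
proof -
  have "integrable (lebesgue_on S) (\<lambda>x. (u x)\<^sup>2)"
  proof (rule Bochner_Integration.integrable_bound[OF L2_square_integrable[OF assms(2)]])
    show "AE x in lebesgue_on S. norm ((u x)\<^sup>2) \<le> norm ((v x)\<^sup>2)"
      using assms(3) by eventually_elim (simp add: abs_le_square_iff)
  qed (use assms(1) in auto)
  then show ?thesis using assms(1) by (auto simp: L2_def)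
qed

lemma L2_zero [simp]: "(\<lambda>x. 0) \<in> L2 S"
  by (simp add: L2_def)

lemma L2_add:
  assumes "u \<in> L2 S" "v \<in> L2 S" shows "(\<lambda>x. u x + v x) \<in> L2 S"
proof -
  have "integrable (lebesgue_on S) (\<lambda>x. (u x)\<^sup>2 + (v x)\<^sup>2 + 2 * (u x * v x))"
    using L2_mult_integrable[OF assms] assms
    by (intro Bochner_Integration.integrable_add integrable_mult_right) (auto simp: L2_def)
  then have "integrable (lebesgue_on S) (\<lambda>x. (u x + v x)\<^sup>2)"
    by (simp add: power2_sum mult.assoc)
  then show ?thesis using assms by (auto simp: L2_def)
qed

lemma L2_cmult: "u \<in> L2 S \<Longrightarrow> (\<lambda>x. c * u x) \<in> L2 S"
  by (auto simp: L2_def power_mult_distrib)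

lemma L2_minus: "u \<in> L2 S \<Longrightarrow> (\<lambda>x. - u x) \<in> L2 S"
  by (auto simp: L2_def)

lemma L2_diff: "u \<in> L2 S \<Longrightarrow> v \<in> L2 S \<Longrightarrow> (\<lambda>x. u x - v x) \<in> L2 S"
  using L2_add[OF _ L2_minus, of u S v] by simp

lemma L2_sum: "(\<And>i. i \<in> I \<Longrightarrow> u i \<in> L2 S) \<Longrightarrow> (\<lambda>x. \<Sum>i\<in>I. u i x) \<in> L2 S"
  by (induction I rule: infinite_finite_induct) (auto intro!: L2_add)

lemma L2_norm_nonneg [simp]: "0 \<le> L2_norm S u"
  by (simp add: L2_norm_def L2_inner_def)

lemma L2_norm_square: "(L2_norm S u)\<^sup>2 = (LINT x|lebesgue_on S. (u x)\<^sup>2)"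
  by (simp add: L2_norm_def L2_inner_def power2_eq_square)

lemma L2_norm_zero [simp]: "L2_norm S (\<lambda>x. 0) = 0"
  by (simp add: L2_norm_def L2_inner_def)

lemma L2_norm_cmult: "L2_norm S (\<lambda>x. c * u x) = \<bar>c\<bar> * L2_norm S u"
proof (rule power2_eq_imp_eq)
  show "(L2_norm S (\<lambda>x. c * u x))\<^sup>2 = (\<bar>c\<bar> * L2_norm S u)\<^sup>2"
    by (simp add: L2_norm_square power_mult_distrib)
qed auto

lemma L2_norm_minus: "L2_norm S (\<lambda>x. - u x) = L2_norm S u"
  by (simp add: L2_norm_def L2_inner_def)

lemma L2_norm_minus_commute: "L2_norm S (\<lambda>x. u x - v x) = L2_norm S (\<lambda>x. v x - u x)"
  using L2_norm_minus[of S "\<lambda>x. u x - v x"] by simp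

lemma L2_inner_diff_left:
  "u \<in> L2 S \<Longrightarrow> v \<in> L2 S \<Longrightarrow> w \<in> L2 S \<Longrightarrow> L2_inner S (\<lambda>x. u x - v x) w = L2_inner S u w - L2_inner S v w"
  by (simp add: L2_inner_def left_diff_distrib L2_mult_integrable)

lemma L2_inner_commute: "L2_inner S u v = L2_inner S v u"
  by (simp add: L2_inner_def mult.commute)

lemma L2_inner_diff_right:
  "u \<in> L2 S \<Longrightarrow> v \<in> L2 S \<Longrightarrow> w \<in> L2 S \<Longrightarrow> L2_inner S w (\<lambda>x. u x - v x) = L2_inner S w u - L2_inner S w v"
  using L2_inner_diff_left[of u S v w] by (simp add: L2_inner_commute)

lemma L2_Cauchy_Schwarz:
  assumes "u \<in> L2 S" "v \<in> L2 S"
  shows "\<bar>L2_inner S u v\<bar> \<le> L2_norm S u * L2_norm S v"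
proof -
  define A B C where "A = (LINT x|lebesgue_on S. (u x)\<^sup>2)" and "B = (LINT x|lebesgue_on S. (v x)\<^sup>2)"
    and "C = L2_inner S u v"
  \<comment> \<open>The squared norm of \<open>u + t * v\<close> as a quadratic in \<open>t\<close>;
    for positive \<open>B\<close> its value at the minimiser \<open>- C / B\<close> gives the
    inequality.\<close>
  have q: "0 \<le> A + 2 * t * C + t\<^sup>2 * B" for t
  proof -
    have i: "integrable (lebesgue_on S) (\<lambda>x. (u x)\<^sup>2)" "integrable (lebesgue_on S) (\<lambda>x. t\<^sup>2 * (v x)\<^sup>2)"
      "integrable (lebesgue_on S) (\<lambda>x. 2 * t * (u x * v x))"
      using L2_square_integrable[OF assms(1)] L2_square_integrable[OF assms(2)] L2_mult_integrable[OF assms] by auto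
    have "0 \<le> (LINT x|lebesgue_on S. (u x + t * v x)\<^sup>2)" by simp
    also have "(\<lambda>x. (u x + t * v x)\<^sup>2) = (\<lambda>x. (u x)\<^sup>2 + 2 * t * (u x * v x) + t\<^sup>2 * (v x)\<^sup>2)"
      by (auto simp: power2_sum power_mult_distrib)
    also have "(LINT x|lebesgue_on S. (u x)\<^sup>2 + 2 * t * (u x * v x) + t\<^sup>2 * (v x)\<^sup>2) = A + 2 * t * C + t\<^sup>2 * B"
      using i by (simp add: A_def B_def C_def L2_inner_def)
    finally show ?thesis .
  qed
  have B0: "B \<ge> 0" and A0: "A \<ge> 0" by (simp_all add: A_def B_def)
  have "C\<^sup>2 \<le> A * B"
  proof (cases "B = 0")
    case True
    have "C = 0"
    proof (rule ccontr)
      assume "C \<noteq> 0"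
      \<comment> \<open>This \<open>t\<close> makes the affine function \<open>A + 2 * t * C\<close>
        equal to \<open>-1\<close>.\<close>
      then show False using q[of "- (A + 1) / (2 * C)"] True by (simp add: field_simps)
    qed
    then show ?thesis using True by simp
  next
    case False
    then have "B > 0" using B0 by simp
    then show ?thesis using q[of "- C / B"] by (simp add: field_simps power2_eq_square)
  qed
  then have "\<bar>C\<bar> \<le> sqrt (A * B)" using real_le_rsqrt by (metis power2_abs)
  then show ?thesis
    by (simp add: C_def A_def B_def real_sqrt_mult L2_norm_def L2_inner_def power2_eq_square)
qed

lemma L2_triangle:
  assumes "u \<in> L2 S" "v \<in> L2 S"
  shows "L2_norm S (\<lambda>x. u x + v x) \<le> L2_norm S u + L2_norm S v"
proof (rule power2_le_imp_le)
  have i: "integrable (lebesgue_on S) (\<lambda>x. (u x)\<^sup>2)" "integrable (lebesgue_on S) (\<lambda>x. (v x)\<^sup>2)"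
      "integrable (lebesgue_on S) (\<lambda>x. 2 * u x * v x)"
    using assms L2_mult_integrable[OF assms] by (auto simp: L2_def mult.assoc)
  have "(L2_norm S (\<lambda>x. u x + v x))\<^sup>2 = (L2_norm S u)\<^sup>2 + (L2_norm S v)\<^sup>2 + 2 * L2_inner S u v"
    using i by (simp add: L2_norm_square power2_sum L2_inner_def mult.assoc)
  also have "\<dots> \<le> (L2_norm S u + L2_norm S v)\<^sup>2"
    using L2_Cauchy_Schwarz[OF assms] by (simp add: power2_sum)
  finally show "(L2_norm S (\<lambda>x. u x + v x))\<^sup>2 \<le> (L2_norm S u + L2_norm S v)\<^sup>2" .
qed auto

lemma L2_triangle_diff:
  assumes "u \<in> L2 S" "v \<in> L2 S"
  shows "L2_norm S (\<lambda>x. u x - v x) \<le> L2_norm S u + L2_norm S v"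
  using L2_triangle[OF assms(1) L2_minus[OF assms(2)]] by (simp add: L2_norm_minus)

lemma L2_norm_sum_le:
  "(\<And>i. i \<in> I \<Longrightarrow> u i \<in> L2 S) \<Longrightarrow> L2_norm S (\<lambda>x. \<Sum>i\<in>I. u i x) \<le> (\<Sum>i\<in>I. L2_norm S (u i))"
proof (induction I rule: infinite_finite_induct)
  case (insert i I)
  then show ?case using L2_triangle[of "u i" S "\<lambda>x. \<Sum>i\<in>I. u i x"] L2_sum[of I u S] by force
qed auto

lemma L2_norm_mono_AE:
  assumes "u \<in> borel_measurable (lebesgue_on S)" "v \<in> L2 S" "AE x in lebesgue_on S. \<bar>u x\<bar> \<le> \<bar>v x\<bar>"
  shows "L2_norm S u \<le> L2_norm S v"
proof (rule power2_le_imp_le)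
  have "AE x in lebesgue_on S. (u x)\<^sup>2 \<le> (v x)\<^sup>2"
    using assms(3) by eventually_elim (simp add: abs_le_square_iff)
  then show "(L2_norm S u)\<^sup>2 \<le> (L2_norm S v)\<^sup>2"
    unfolding L2_norm_square using L2_mono[OF assms] assms(2)
    by (intro integral_mono_AE) (auto simp: L2_def)
qed simp

text \<open>Completeness of Lebesgue measure is the reason. It is needed because
  \<open>weak_pderiv\<close> is a chosen representative, known only to agree almost everywhere with
  a square integrable function.\<close>

lemma measurable_lebesgue_on_AE:
  fixes f g :: "'a::euclidean_space \<Rightarrow> real"
  assumes S: "S \<in> sets lebesgue" and "f \<in> borel_measurable (lebesgue_on S)" "AE x in lebesgue_on S. f x = g x"
  shows "g \<in> borel_measurable (lebesgue_on S)"
proof -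
  have "AE x in lebesgue. x \<in> S \<longrightarrow> f x = g x"
    using assms(3) S by (simp add: AE_restrict_space_iff)
  then have "AE x in lebesgue. (if x \<in> S then f x else 0) = (if x \<in> S then g x else 0)"
    by eventually_elim auto
  then have "(\<lambda>x. if x \<in> S then g x else 0) \<in> borel_measurable lebesgue"
    by (rule borel_measurable_AE[OF borel_measurable_if_I[OF assms(2) S]])
  then show ?thesis using S by (simp add: borel_measurable_if)
qed

lemma L2_cong_AE:
  assumes "S \<in> sets lebesgue" "u \<in> L2 S" "AE x in lebesgue_on S. u x = v x"
  shows "v \<in> L2 S"
proof (rule L2_mono[OF _ assms(2)])
  show "v \<in> borel_measurable (lebesgue_on S)"
    by (rule measurable_lebesgue_on_AE[OF assms(1) L2_measurable[OF assms(2)] assms(3)])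
qed (use assms(3) in auto)

lemma L2_norm_cong_AE:
  assumes "S \<in> sets lebesgue" "u \<in> L2 S" "AE x in lebesgue_on S. u x = v x"
  shows "L2_norm S v = L2_norm S u"
proof (rule antisym)
  have v: "v \<in> L2 S" by (rule L2_cong_AE[OF assms])
  show "L2_norm S v \<le> L2_norm S u"
    using assms(3) by (intro L2_norm_mono_AE[OF L2_measurable[OF v] assms(2)]) auto
  show "L2_norm S u \<le> L2_norm S v"
    using assms(3) by (intro L2_norm_mono_AE[OF L2_measurable[OF assms(2)] v]) auto
qed

text \<open>Extension by zero lets tools on the whole space, above all convolution, act on functions
  given on a domain.\<close>

lemma L2_restrict_iff:
  assumes "S \<in> sets lebesgue"
  shows "(\<lambda>x. if x \<in> S then u x else 0) \<in> L2 UNIV \<longleftrightarrow> u \<in> L2 S"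
proof -
  have "(\<lambda>x. (if x \<in> S then u x else 0)\<^sup>2) = (\<lambda>x. if x \<in> S then (u x)\<^sup>2 else 0)" by auto
  then show ?thesis
    using assms by (simp add: L2_def borel_measurable_if lebesgue_on_UNIV_eq Lebesgue_Measure.integrable_restrict_UNIV)
qed

lemma L2_norm_restrict:
  assumes "S \<in> sets lebesgue"
  shows "L2_norm UNIV (\<lambda>x. if x \<in> S then u x else 0) = L2_norm S u"
proof -
  have "(\<lambda>x. (if x \<in> S then u x else 0) * (if x \<in> S then u x else 0)) = (\<lambda>x. if x \<in> S then u x * u x else 0)"
    by auto
  then show ?thesis
    using assms by (simp add: L2_norm_def L2_inner_def lebesgue_on_UNIV_eq Lebesgue_Measure.integral_restrict_UNIV)
qed

lemma L2_subset:
  assumes "S \<in> sets lebesgue" "T \<in> sets lebesgue" "T \<subseteq> S" "u \<in> L2 S"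
  shows "u \<in> L2 T" and "L2_norm T u \<le> L2_norm S u"
proof -
  let ?S = "\<lambda>x. if x \<in> S then u x else 0" and ?T = "\<lambda>x. if x \<in> T then u x else 0"
  have S: "?S \<in> L2 UNIV" using assms L2_restrict_iff by blast
  have "u \<in> borel_measurable (lebesgue_on T)"
    using L2_measurable[OF assms(4)] assms(1,2,3) by (meson measurable_restrict_mono)
  then have m: "?T \<in> borel_measurable (lebesgue_on UNIV)"
    using assms(2) by (simp add: borel_measurable_if lebesgue_on_UNIV_eq)
  have b: "AE x in lebesgue_on UNIV. \<bar>?T x\<bar> \<le> \<bar>?S x\<bar>" using assms(3) by auto
  show "u \<in> L2 T" using L2_mono[OF m S b] L2_restrict_iff assms(2) by blast
  show "L2_norm T u \<le> L2_norm S u" using L2_norm_mono_AE[OF m S b] assms L2_norm_restrict by metis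
qed

lemma L2_const: "S \<in> lmeasurable \<Longrightarrow> (\<lambda>x. c) \<in> L2 S"
  using finite_measure_lebesgue_on[of S] by (simp add: L2_def finite_measure.integrable_const)

lemma L2_norm_const: "S \<in> lmeasurable \<Longrightarrow> L2_norm S (\<lambda>x. c) = \<bar>c\<bar> * sqrt (measure lebesgue S)"
  by (simp add: L2_norm_def L2_inner_def measure_restrict_space fmeasurableD real_sqrt_mult mult.commute)

lemma L2_integrable: "S \<in> lmeasurable \<Longrightarrow> u \<in> L2 S \<Longrightarrow> integrable (lebesgue_on S) u"
  using L2_mult_integrable[OF _ L2_const, of u S 1] by simp

lemma L2_bounded_mult:
  assumes "u \<in> L2 S" "w \<in> borel_measurable (lebesgue_on S)" "AE x in lebesgue_on S. \<bar>w x\<bar> \<le> M"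
  shows "(\<lambda>x. w x * u x) \<in> L2 S" and "L2_norm S (\<lambda>x. w x * u x) \<le> \<bar>M\<bar> * L2_norm S u"
proof -
  have m: "(\<lambda>x. w x * u x) \<in> borel_measurable (lebesgue_on S)"
    using assms(2) L2_measurable[OF assms(1)] by simp
  have b: "AE x in lebesgue_on S. \<bar>w x * u x\<bar> \<le> \<bar>M * u x\<bar>"
    using assms(3) by eventually_elim (auto simp: abs_mult intro: mult_right_mono)
  show "(\<lambda>x. w x * u x) \<in> L2 S" by (rule L2_mono[OF m L2_cmult[OF assms(1)] b])
  show "L2_norm S (\<lambda>x. w x * u x) \<le> \<bar>M\<bar> * L2_norm S u"
    using L2_norm_mono_AE[OF m L2_cmult[OF assms(1)] b] by (simp add: L2_norm_cmult)
qed

lemma L2_norm_le_triangle: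
  assumes "u \<in> L2 S" "v \<in> L2 S"
  shows "L2_norm S u \<le> L2_norm S v + L2_norm S (\<lambda>x. v x - u x)"
  using L2_triangle_diff[OF assms(2) L2_diff[OF assms(2,1)]] by simp

lemma L2_norm_tendsto:
  assumes "\<And>n. u n \<in> L2 S" "v \<in> L2 S" "(\<lambda>n. L2_norm S (\<lambda>x. u n x - v x)) \<longlonglongrightarrow> 0"
  shows "(\<lambda>n. L2_norm S (u n)) \<longlonglongrightarrow> L2_norm S v"
proof -
  have "\<bar>L2_norm S (u n) - L2_norm S v\<bar> \<le> L2_norm S (\<lambda>x. u n x - v x)" for n
    using L2_norm_le_triangle[OF assms(1)[of n] assms(2)] L2_norm_le_triangle[OF assms(2) assms(1)[of n]]
      L2_norm_minus_commute[of S "u n" v] by linarith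
  then have "(\<lambda>n. L2_norm S (u n) - L2_norm S v) \<longlonglongrightarrow> 0"
    by (intro Lim_null_comparison[OF _ assms(3)]) auto
  then show ?thesis by (simp add: LIM_zero_iff)
qed

lemma L2_norm_dominated_convergence:
  assumes "\<And>n. u n \<in> borel_measurable (lebesgue_on S)" "v \<in> borel_measurable (lebesgue_on S)" "w \<in> L2 S"
    and "AE x in lebesgue_on S. (\<lambda>n. u n x) \<longlonglongrightarrow> v x"
    and "\<And>n. AE x in lebesgue_on S. \<bar>u n x - v x\<bar> \<le> w x"
  shows "(\<lambda>n. L2_norm S (\<lambda>x. u n x - v x)) \<longlonglongrightarrow> 0"
proof -
  have "(\<lambda>n. LINT x|lebesgue_on S. (u n x - v x)\<^sup>2) \<longlonglongrightarrow> (LINT x|lebesgue_on S. 0)"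
  proof (rule integral_dominated_convergence)
    show "AE x in lebesgue_on S. (\<lambda>n. (u n x - v x)\<^sup>2) \<longlonglongrightarrow> 0"
      using assms(4) by eventually_elim (metis LIM_zero tendsto_null_power zero_less_numeral)
    show "AE x in lebesgue_on S. norm ((u n x - v x)\<^sup>2) \<le> (w x)\<^sup>2" for n
      using assms(5)[of n] by eventually_elim (simp, metis abs_ge_zero power2_abs power_mono)
  qed (use assms(1,2) L2_square_integrable[OF assms(3)] in auto)
  then have "(\<lambda>n. sqrt ((L2_norm S (\<lambda>x. u n x - v x))\<^sup>2)) \<longlonglongrightarrow> sqrt 0"
    unfolding L2_norm_square by (intro tendsto_real_sqrt) simp
  then show ?thesis by simp
qed

text \<open>Dominated convergence with \<open>\<bar>u\<bar>\<close> as majorant. It serves for the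
  gradient near a boundary vertex, on sets that shrink to that vertex.\<close>

lemma L2_square_tendsto_0:
  assumes "u \<in> L2 S" "S \<in> sets lebesgue" "\<And>n. A n \<in> sets lebesgue" "\<And>n. A n \<subseteq> S"
    and "AE x in lebesgue_on S. \<forall>\<^sub>F n in sequentially. x \<notin> A n"
  shows "(\<lambda>n. L2_norm (A n) u) \<longlonglongrightarrow> 0"
proof -
  have A: "L2_norm (A n) u = L2_norm S (\<lambda>x. (if x \<in> A n then u x else 0) - 0)" for n
  proof -
    have "(\<lambda>x. if x \<in> S then if x \<in> A n then u x else 0 else 0) = (\<lambda>x. if x \<in> A n then u x else 0)"
      using assms(4)[of n] by (auto simp: fun_eq_iff)
    then have "L2_norm S (\<lambda>x. if x \<in> A n then u x else 0) = L2_norm (A n) u"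
      using L2_norm_restrict[OF assms(2), of "\<lambda>x. if x \<in> A n then u x else 0"]
        L2_norm_restrict[OF assms(3)[of n], of u] by (metis (no_types, lifting))
    then show ?thesis by (simp only: diff_zero)
  qed
  show ?thesis unfolding A
  proof (rule L2_norm_dominated_convergence)
    show "(\<lambda>x. if x \<in> A n then u x else 0) \<in> borel_measurable (lebesgue_on S)" for n
      using borel_measurable_if_lebesgue_on[OF assms(3,2,4), of n u] L2_subset[OF assms(2,3,4,1)] L2_measurable by blast
    show "(\<lambda>x. \<bar>u x\<bar>) \<in> L2 S" using assms(1) by (auto simp: L2_def)
    show "AE x in lebesgue_on S. (\<lambda>n. if x \<in> A n then u x else 0) \<longlonglongrightarrow> 0"
      using assms(5) by eventually_elim (simp add: tendsto_eventually eventually_mono)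
  qed auto
qed

text \<open>Taylor estimates are available on compact convex subsets only; this carries a uniform
  bound on such sets over to the interior of a triangle.\<close>

lemma L2_norm_le_exhaustion:
  assumes "u \<in> L2 S" "S \<in> sets lebesgue" "\<And>n. A n \<in> sets lebesgue" "\<And>n. A n \<subseteq> S"
    and "AE x in lebesgue_on S. \<forall>\<^sub>F n in sequentially. x \<in> A n"
    and "\<And>n. L2_norm (A n) u \<le> B"
  shows "L2_norm S u \<le> B"
proof -
  have u: "u \<in> L2 (A n)" for n using L2_subset[OF assms(2,3,4,1)] by blast
  have "(\<lambda>n. L2_norm S (\<lambda>x. (if x \<in> A n then u x else 0) - u x)) \<longlonglongrightarrow> 0"
  proof (rule L2_norm_dominated_convergence)
    show "(\<lambda>x. if x \<in> A n then u x else 0) \<in> borel_measurable (lebesgue_on S)" for n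
      using borel_measurable_if_lebesgue_on[OF assms(3,2,4), of n u] u L2_measurable by blast
    show "(\<lambda>x. \<bar>u x\<bar>) \<in> L2 S" using assms(1) by (auto simp: L2_def)
    show "AE x in lebesgue_on S. (\<lambda>n. if x \<in> A n then u x else 0) \<longlonglongrightarrow> u x"
      using assms(5) by eventually_elim (simp add: tendsto_eventually eventually_mono)
  qed (use assms(1) in \<open>auto simp: L2_def\<close>)
  then have "(\<lambda>n. L2_norm S (\<lambda>x. if x \<in> A n then u x else 0)) \<longlonglongrightarrow> L2_norm S u"
  proof (intro L2_norm_tendsto)
    show "(\<lambda>x. if x \<in> A n then u x else 0) \<in> L2 S" for n
      using L2_subset(1)[OF _ assms(2) subset_UNIV L2_restrict_iff[THEN iffD2, OF assms(3) u]] sets.top[of lebesgue]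
        by simp
  qed (use assms(1) in auto)
  moreover have "L2_norm S (\<lambda>x. if x \<in> A n then u x else 0) \<le> B" for n
  proof -
    have "(\<lambda>x. if x \<in> A n then u x else 0) \<in> L2 UNIV" using L2_restrict_iff[THEN iffD2, OF assms(3) u] .
    then have "L2_norm S (\<lambda>x. if x \<in> A n then u x else 0) \<le> L2_norm UNIV (\<lambda>x. if x \<in> A n then u x else 0)"
      using L2_subset(2)[OF _ assms(2) subset_UNIV] sets.top[of lebesgue] by simp
    then show ?thesis using L2_norm_restrict[OF assms(3)] assms(6)[of n] by simp
  qed
  ultimately show ?thesis by (intro LIMSEQ_le_const2[where a=B]) auto
qed

lemma L2_norm_cong:
  assumes "\<And>x. x \<in> T \<Longrightarrow> f x = g x" shows "L2_norm T f = L2_norm T g"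
  unfolding L2_norm_def L2_inner_def
  by (intro arg_cong[where f=sqrt] Bochner_Integration.integral_cong) (use assms in auto)

text \<open>Inclusion up to a null set matters when a vertex is adjoined to the interior of its
  triangle.\<close>

lemma L2_norm_mono_set_AE:
  assumes "S \<in> sets lebesgue" "T \<in> sets lebesgue" "AE x in lebesgue. x \<in> T \<longrightarrow> x \<in> S" "f \<in> L2 S" "f \<in> L2 T"
  shows "L2_norm T f \<le> L2_norm S f"
proof -
  have "L2_norm UNIV (\<lambda>x. if x \<in> T then f x else 0) \<le> L2_norm UNIV (\<lambda>x. if x \<in> S then f x else 0)"
  proof (rule L2_norm_mono_AE)
    show "(\<lambda>x. if x \<in> T then f x else 0) \<in> borel_measurable (lebesgue_on UNIV)"
      using L2_restrict_iff[OF assms(2)] assms(5) by (intro L2_measurable) blast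
    show "(\<lambda>x. if x \<in> S then f x else 0) \<in> L2 UNIV" using L2_restrict_iff[OF assms(1)] assms(4) by blast
    show "AE x in lebesgue_on UNIV. \<bar>if x \<in> T then f x else 0\<bar> \<le> \<bar>if x \<in> S then f x else 0\<bar>"
      unfolding lebesgue_on_UNIV_eq using assms(3) by eventually_elim auto
  qed
  then show ?thesis by (simp only: L2_norm_restrict[OF assms(1)] L2_norm_restrict[OF assms(2)])
qed

lemma L2_norm_le_add3:
  assumes "f \<in> L2 T" "g \<in> L2 T" "\<And>i. i \<in> I \<Longrightarrow> h i \<in> L2 T"
  shows "L2_norm T (\<lambda>x. f x + g x + (\<Sum>i\<in>I. h i x)) \<le> L2_norm T f + L2_norm T g + (\<Sum>i\<in>I. L2_norm T (h i))"
proof -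
  have s: "(\<lambda>x. \<Sum>i\<in>I. h i x) \<in> L2 T" by (rule L2_sum[OF assms(3)])
  show ?thesis
    using L2_triangle[OF L2_add[OF assms(1,2)] s] L2_triangle[OF assms(1,2)] L2_norm_sum_le[of I h T, OF assms(3)] by linarith
qed

section \<open>Smooth functions and test functions\<close>

definition smooth :: "('a::euclidean_space \<Rightarrow> real) \<Rightarrow> bool" where
  "smooth f \<longleftrightarrow> (\<forall>k. Ck k f)"

lemma pderiv_dir_eqI: "(f has_derivative f') (at x) \<Longrightarrow> pderiv_dir b f x = f' b"
  unfolding pderiv_dir_def using frechet_derivative_at by metis

lemma has_derivative_pderiv_dir:
  fixes f :: "'a::euclidean_space \<Rightarrow> real"
  assumes "f differentiable (at x)"
  shows "(f has_derivative (\<lambda>h. \<Sum>b\<in>Basis. (h \<bullet> b) * pderiv_dir b f x)) (at x)"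
proof -
  have d: "(f has_derivative frechet_derivative f (at x)) (at x)"
    using assms frechet_derivative_works by blast
  have "frechet_derivative f (at x) h = (\<Sum>b\<in>Basis. (h \<bullet> b) * pderiv_dir b f x)" for h
  proof -
    have l: "linear (frechet_derivative f (at x))" using has_derivative_linear[OF d] .
    have "frechet_derivative f (at x) (\<Sum>b\<in>Basis. (h \<bullet> b) *\<^sub>R b) = (\<Sum>b\<in>Basis. (h \<bullet> b) * pderiv_dir b f x)"
      by (simp add: linear_sum[OF l] linear_scale[OF l] pderiv_dir_def)
    then show ?thesis by (simp only: euclidean_representation)
  qed
  then have "frechet_derivative f (at x) = (\<lambda>h. \<Sum>b\<in>Basis. (h \<bullet> b) * pderiv_dir b f x)" by (rule ext)
  then show ?thesis using d by simp
qed

lemma Ck_mono: "Ck (Suc k) f \<Longrightarrow> Ck k f"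
proof (induction k arbitrary: f)
  case 0
  then show ?case by (auto intro!: continuous_at_imp_continuous_on differentiable_imp_continuous_within)
qed auto

text \<open>The induction on the order runs over a whole family closed under partial derivatives, so
  no formula for higher derivatives is ever written down.\<close>

lemma Ck_coinduct:
  assumes "f \<in> F" "\<And>f x. f \<in> F \<Longrightarrow> f differentiable (at x)"
    "\<And>f b. f \<in> F \<Longrightarrow> b \<in> Basis \<Longrightarrow> pderiv_dir b f \<in> F"
  shows "smooth f"
proof -
  have "Ck k f" if "f \<in> F" for k f using that
  proof (induction k arbitrary: f)
    case 0
    then show ?case using assms(2)
      by (auto intro!: continuous_at_imp_continuous_on differentiable_imp_continuous_within)
  qed (use assms in auto)
  then show ?thesis using assms(1) by (simp add: smooth_def)
qed

lemma smooth_differentiable: "smooth f \<Longrightarrow> f differentiable (at x)"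
  unfolding smooth_def by (metis Ck.simps(2))

lemma smooth_pderiv: "smooth f \<Longrightarrow> b \<in> Basis \<Longrightarrow> smooth (pderiv_dir b f)"
  unfolding smooth_def by (metis Ck.simps(2))

lemma smooth_continuous: "smooth f \<Longrightarrow> continuous_on S f"
  unfolding smooth_def by (metis Ck.simps(1) continuous_on_subset subset_UNIV)

lemma smooth_has_derivative:
  "smooth f \<Longrightarrow> (f has_derivative (\<lambda>h. \<Sum>b\<in>Basis. (h \<bullet> b) * pderiv_dir b f x)) (at x)"
  by (intro has_derivative_pderiv_dir smooth_differentiable)

lemma pderiv_dir_const [simp]: "pderiv_dir b (\<lambda>x. c) = (\<lambda>x. 0)"
  by (rule ext, rule pderiv_dir_eqI[where f'="\<lambda>h. 0"]) simp

lemma smooth_const [simp]: "smooth (\<lambda>x. c)"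
  by (rule Ck_coinduct[where F="range (\<lambda>c x. c)"]) auto

lemma smooth_inner [simp]: "smooth (\<lambda>x. x \<bullet> a)"
proof -
  have d: "((\<lambda>x. x \<bullet> a) has_derivative (\<lambda>h. h \<bullet> a)) (at x)" for x :: 'a
    by (auto intro!: derivative_eq_intros)
  have "pderiv_dir b (\<lambda>x. x \<bullet> a) = (\<lambda>x. b \<bullet> a)" for b
    by (rule ext, rule pderiv_dir_eqI[OF d])
  then show ?thesis
    using differentiableI[OF d] by (intro Ck_coinduct[where F="insert (\<lambda>x. x \<bullet> a) (range (\<lambda>c x. c))"]) auto
qed

lemma pderiv_dir_add:
  assumes "f differentiable (at x)" "g differentiable (at x)"
  shows "pderiv_dir b (\<lambda>x. f x + g x) x = pderiv_dir b f x + pderiv_dir b g x"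
proof -
  have "(f has_derivative frechet_derivative f (at x)) (at x)" "(g has_derivative frechet_derivative g (at x)) (at x)"
    using assms frechet_derivative_works by blast+
  from pderiv_dir_eqI[OF has_derivative_add[OF this]] show ?thesis by (simp only: pderiv_dir_def)
qed

lemma Ck_add: "Ck k f \<Longrightarrow> Ck k g \<Longrightarrow> Ck k (\<lambda>x. f x + g x)"
proof (induction k arbitrary: f g)
  case (Suc k)
  have "pderiv_dir b (\<lambda>x. f x + g x) = (\<lambda>x. pderiv_dir b f x + pderiv_dir b g x)" for b
    using Suc.prems by (intro ext pderiv_dir_add) auto
  then show ?case using Suc by (auto intro!: differentiable_add)
qed (auto intro!: continuous_intros)

lemma pderiv_dir_mult:
  assumes "f differentiable (at x)" "g differentiable (at x)"
  shows "pderiv_dir b (\<lambda>x. f x * g x) x = f x * pderiv_dir b g x + pderiv_dir b f x * g x"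
proof -
  have "(f has_derivative frechet_derivative f (at x)) (at x)" "(g has_derivative frechet_derivative g (at x)) (at x)"
    using assms frechet_derivative_works by blast+
  from pderiv_dir_eqI[OF has_derivative_mult[OF this]] show ?thesis by (simp only: pderiv_dir_def)
qed

lemma Ck_mult: "Ck k f \<Longrightarrow> Ck k g \<Longrightarrow> Ck k (\<lambda>x. f x * g x)"
proof (induction k arbitrary: f g)
  case (Suc k)
  have "pderiv_dir b (\<lambda>x. f x * g x) = (\<lambda>x. f x * pderiv_dir b g x + pderiv_dir b f x * g x)" for b
    using Suc.prems by (intro ext pderiv_dir_mult) auto
  moreover have "Ck k f" "Ck k g" using Suc.prems Ck_mono by blast+
  ultimately show ?case using Suc.prems
    by (auto intro!: differentiable_mult Ck_add Suc.IH)
qed (auto intro!: continuous_intros)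

lemma smooth_add: "smooth f \<Longrightarrow> smooth g \<Longrightarrow> smooth (\<lambda>x. f x + g x)"
  and smooth_mult: "smooth f \<Longrightarrow> smooth g \<Longrightarrow> smooth (\<lambda>x. f x * g x)"
  by (auto simp: smooth_def Ck_add Ck_mult)

lemma smooth_diff: "smooth f \<Longrightarrow> smooth g \<Longrightarrow> smooth (\<lambda>x. f x - g x)"
  using smooth_add[of f "\<lambda>x. (-1) * g x"] smooth_mult[of "\<lambda>x. -1" g] by simp

lemma pderiv_dir_diff:
  "smooth f \<Longrightarrow> smooth g \<Longrightarrow> pderiv_dir b (\<lambda>x. f x - g x) = (\<lambda>x. pderiv_dir b f x - pderiv_dir b g x)"
proof (rule ext)
  fix x assume "smooth f" "smooth g"
  then have "(f has_derivative frechet_derivative f (at x)) (at x)" "(g has_derivative frechet_derivative g (at x)) (at x)"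
    using smooth_differentiable frechet_derivative_works by blast+
  from pderiv_dir_eqI[OF has_derivative_diff[OF this]]
  show "pderiv_dir b (\<lambda>x. f x - g x) x = pderiv_dir b f x - pderiv_dir b g x" by (simp only: pderiv_dir_def)
qed

lemma pderiv_dir_affine:
  assumes "smooth f"
  shows "pderiv_dir b (\<lambda>x. f (a + r *\<^sub>R x)) = (\<lambda>x. r * pderiv_dir b f (a + r *\<^sub>R x))"
proof (rule ext)
  fix x
  have "((\<lambda>x. f (a + r *\<^sub>R x)) has_derivative (\<lambda>h. frechet_derivative f (at (a + r *\<^sub>R x)) (r *\<^sub>R h))) (at x)"
    by (rule has_derivative_compose[of "\<lambda>x. a + r *\<^sub>R x"])
      (use assms smooth_differentiable frechet_derivative_works in \<open>auto intro!: derivative_eq_intros\<close>)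
  moreover have "linear (frechet_derivative f (at (a + r *\<^sub>R x)))"
    using linear_frechet_derivative assms smooth_differentiable by blast
  ultimately show "pderiv_dir b (\<lambda>x. f (a + r *\<^sub>R x)) x = r * pderiv_dir b f (a + r *\<^sub>R x)"
    by (subst pderiv_dir_eqI) (auto simp: pderiv_dir_def linear_scale)
qed

lemma smooth_affine:
  assumes "smooth f" shows "smooth (\<lambda>x. f (a + r *\<^sub>R x))"
proof -
  have "(\<lambda>x. f (a + r *\<^sub>R x)) differentiable (at x)" if "smooth f" for f x
  proof -
    have "f \<circ> (\<lambda>x. a + r *\<^sub>R x) differentiable (at x)"
      by (intro differentiable_chain_at) (use that smooth_differentiable in \<open>auto intro!: derivative_intros\<close>)
    then show ?thesis by (simp add: o_def)
  qed
  note d = this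
  \<comment> \<open>The free factor \<open>c\<close> collects the powers of \<open>r\<close> that
    the chain rule produces.\<close>
  show ?thesis
  proof (rule Ck_coinduct[where F="{\<lambda>x. c * g (a + r *\<^sub>R x) |c g. smooth g}"])
    show "(\<lambda>x. f (a + r *\<^sub>R x)) \<in> {\<lambda>x. c * g (a + r *\<^sub>R x) |c g. smooth g}"
      using assms by (auto intro!: exI[of _ 1] exI[of _ f])
    fix F :: "'a \<Rightarrow> real"
    assume "F \<in> {\<lambda>x. c * g (a + r *\<^sub>R x) |c g. smooth g}"
    then obtain c g where F: "F = (\<lambda>x. c * g (a + r *\<^sub>R x))" and g: "smooth g" by auto
    show "F differentiable at x" for x
      unfolding F by (intro differentiable_mult differentiable_const d g)
    fix b :: 'a assume "b \<in> Basis"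
    moreover have "pderiv_dir b F = (\<lambda>x. (c * r) * pderiv_dir b g (a + r *\<^sub>R x))"
      unfolding F by (rule ext) (simp add: pderiv_dir_mult[OF differentiable_const d[OF g]] pderiv_dir_affine[OF g])
    ultimately show "pderiv_dir b F \<in> {\<lambda>x. c * g (a + r *\<^sub>R x) |c g. smooth g}"
      using smooth_pderiv[OF g] by blast
  qed
qed

subsection \<open>A smooth bump\<close>

text \<open>The powers of \<open>1 / t\<close> are included so that the family is closed under differentiation.\<close>

definition exp_inv :: "nat \<Rightarrow> real \<Rightarrow> real" where
  "exp_inv n t = (if t > 0 then exp (- inverse t) * inverse t ^ n else 0)"

text \<open>A single term of the exponential series is below its sum, so
  \<open>inverse t ^ Suc n\<close> is at most \<open>fact (Suc n) * exp (inverse t)\<close>. One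
  power more than \<open>n\<close> is spent in order to gain the factor
  \<open>\<bar>t\<bar>\<close>.\<close>

lemma exp_inv_le: "\<bar>exp_inv n t\<bar> \<le> fact (Suc n) * \<bar>t\<bar>"
proof (cases "t > 0")
  case True
  have "inverse t ^ Suc n \<le> fact (Suc n) * exp (inverse t)"
  proof -
    have s: "(\<lambda>k. inverse t ^ k /\<^sub>R fact k) sums exp (inverse t)" by (rule exp_converges)
    have "(\<Sum>k\<in>{Suc n}. inverse t ^ k /\<^sub>R fact k) \<le> (\<Sum>k. inverse t ^ k /\<^sub>R fact k)"
      using True s by (intro sum_le_suminf) (auto simp: sums_iff)
    then have "inverse t ^ Suc n / fact (Suc n) \<le> exp (inverse t)"
      using s by (simp add: sums_iff divide_inverse mult.commute del: fact_Suc power_Suc)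
    then show ?thesis by (simp add: divide_le_eq mult.commute del: fact_Suc power_Suc)
  qed
  then have "t * (exp (- inverse t) * inverse t ^ Suc n) \<le> t * fact (Suc n)"
    using True by (intro mult_left_mono) (auto simp: exp_minus inverse_eq_divide divide_le_eq simp del: fact_Suc power_Suc)
  moreover have "exp_inv n t = t * (exp (- inverse t) * inverse t ^ Suc n)"
    using True by (simp add: exp_inv_def)
  moreover have "0 \<le> exp_inv n t" by (simp add: exp_inv_def)
  ultimately have "\<bar>exp_inv n t\<bar> \<le> t * fact (Suc n)" by (simp only: abs_of_nonneg)
  then show ?thesis by (simp only: abs_of_pos[OF True] mult.commute)
qed (simp only: exp_inv_def if_False abs_zero mult_nonneg_nonneg fact_ge_zero abs_ge_zero)

lemma exp_inv_has_derivative: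
  "(exp_inv n has_real_derivative (exp_inv (n + 2) t - real n * exp_inv (n + 1) t)) (at t)"
proof (cases rule: linorder_cases[of t 0])
  case less
  have "((\<lambda>t. 0) has_real_derivative 0) (at t)" by simp
  moreover have "\<forall>\<^sub>F s in nhds t. exp_inv n s = 0"
    by (rule eventually_mono[OF eventually_nhds_in_open[of "{..<0}"]]) (use less in \<open>auto simp: exp_inv_def\<close>)
  ultimately show ?thesis using less DERIV_cong_ev[OF refl _ refl, THEN iffD2, of "exp_inv n" "\<lambda>t. 0" t 0] by (simp add: exp_inv_def)
next
  case greater
  let ?f = "\<lambda>t. exp (- inverse t) * inverse t ^ n"
  have "((\<lambda>t. exp (- inverse t)) has_real_derivative exp (- inverse t) * inverse t ^ 2) (at t)"
    using greater DERIV_inverse[of t UNIV]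
    by (auto intro!: derivative_eq_intros simp: power2_eq_square)
  moreover have "((\<lambda>t. inverse t ^ n) has_real_derivative real n * (inverse t ^ (n - 1) * - (inverse t ^ 2))) (at t)"
    using greater DERIV_power[OF DERIV_inverse[of t UNIV], of n] by (simp add: numeral_2_eq_2 mult_ac)
  ultimately have "(?f has_real_derivative exp (- inverse t) * inverse t ^ 2 * inverse t ^ n
      + real n * (inverse t ^ (n - 1) * - (inverse t ^ 2)) * exp (- inverse t)) (at t)"
    by (rule DERIV_mult)
  moreover have "exp (- inverse t) * inverse t ^ 2 * inverse t ^ n
      + real n * (inverse t ^ (n - 1) * - (inverse t ^ 2)) * exp (- inverse t) = exp_inv (n + 2) t - real n * exp_inv (n + 1) t"
    using greater by (cases n) (auto simp: exp_inv_def power2_eq_square algebra_simps)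
  ultimately have "(?f has_real_derivative (exp_inv (n + 2) t - real n * exp_inv (n + 1) t)) (at t)"
    by (simp only:)
  moreover have "\<forall>\<^sub>F s in nhds t. exp_inv n s = ?f s"
    by (rule eventually_mono[OF eventually_nhds_in_open[of "{0<..}"]]) (use greater in \<open>auto simp: exp_inv_def\<close>)
  ultimately show ?thesis by (subst DERIV_cong_ev[OF refl _ refl, of _ ?f])
next
  case equal
  \<comment> \<open>At the origin the difference quotient is the next member of the family, which
    has a linear bound.\<close>
  have "((\<lambda>h. exp_inv n h / h) \<longlongrightarrow> 0) (at 0)"
  proof (rule Lim_null_comparison)
    show "\<forall>\<^sub>F h in at 0. norm (exp_inv n h / h) \<le> fact (Suc (Suc n)) * \<bar>h\<bar>"
    proof (rule always_eventually, rule allI)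
      fix h :: real
      have "exp_inv n h / h = exp_inv (Suc n) h"
        by (cases "h > 0") (simp_all add: exp_inv_def divide_inverse mult_ac)
      then show "norm (exp_inv n h / h) \<le> fact (Suc (Suc n)) * \<bar>h\<bar>" using exp_inv_le[of "Suc n" h] by (simp only: real_norm_def)
    qed
    have "((\<lambda>h. fact (Suc (Suc n)) * \<bar>h\<bar>) \<longlongrightarrow> fact (Suc (Suc n)) * \<bar>0::real\<bar>) (at 0)"
      by (intro tendsto_intros)
    then show "((\<lambda>h. fact (Suc (Suc n)) * \<bar>h\<bar>) \<longlongrightarrow> (0::real)) (at 0)" by (simp only: abs_zero mult_zero_right)
  qed
  then show ?thesis using equal by (simp add: DERIV_def exp_inv_def)
qed

text \<open>Induction on the order for all \<open>n\<close> at once, since each derivative shifts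
  \<open>n\<close> by one and by two.\<close>

lemma smooth_exp_inv_comp:
  assumes "smooth q" shows "smooth (\<lambda>x. exp_inv n (q x))"
proof -
  have d: "((\<lambda>x. exp_inv n (q x)) has_derivative
      (\<lambda>h. (exp_inv (n + 2) (q x) - real n * exp_inv (n + 1) (q x)) * frechet_derivative q (at x) h)) (at x)" for n x
  proof -
    have "(q has_derivative frechet_derivative q (at x)) (at x)"
      using smooth_differentiable[OF assms] frechet_derivative_works by blast
    from has_derivative_compose[OF this exp_inv_has_derivative[unfolded has_field_derivative_def, of n "q x"]]
    show ?thesis by simp
  qed
  have p: "pderiv_dir b (\<lambda>x. exp_inv n (q x)) =
     (\<lambda>x. (exp_inv (n + 2) (q x) + (\<lambda>x. - real n) x * exp_inv (n + 1) (q x)) * pderiv_dir b q x)" for n b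
    by (rule ext, subst pderiv_dir_eqI[OF d]) (simp add: pderiv_dir_def)
  have "Ck k (\<lambda>x. exp_inv n (q x))" for k n
  proof (induction k arbitrary: n)
    case 0
    then show ?case
      by (auto intro!: continuous_at_imp_continuous_on has_derivative_continuous[OF d])
  next
    case (Suc k)
    have c: "Ck k (\<lambda>x. c)" for c using smooth_const by (auto simp: smooth_def simp del: smooth_const)
    have "Ck k (pderiv_dir b q)" if "b \<in> Basis" for b using smooth_pderiv[OF assms that] by (auto simp: smooth_def)
    then have "Ck k (pderiv_dir b (\<lambda>x. exp_inv n (q x)))" if "b \<in> Basis" for b
      unfolding p using that by (intro Ck_mult Ck_add Suc.IH c)
    then show ?case using d by (auto simp: differentiable_def)
  qed
  then show ?thesis by (simp add: smooth_def)
qed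

lemma smooth_sum: "(\<And>i. i \<in> I \<Longrightarrow> smooth (f i)) \<Longrightarrow> smooth (\<lambda>x. \<Sum>i\<in>I. f i x)"
  by (induction I rule: infinite_finite_induct) (auto intro: smooth_add)

text \<open>This is exp(-1/(1 - |x|^2)) inside the unit ball and zero outside. The inner product in
  place of the norm keeps the inner function polynomial, hence smooth.\<close>

definition bump :: "'a::euclidean_space \<Rightarrow> real" where
  "bump x = exp_inv 0 (1 - x \<bullet> x)"

lemma smooth_bump: "smooth bump"
proof -
  have "smooth (\<lambda>x::'a. 1 - (\<Sum>b\<in>Basis. (x \<bullet> b) * (x \<bullet> b)))"
    by (intro smooth_diff smooth_sum smooth_mult) auto
  then have "smooth (\<lambda>x::'a. exp_inv 0 (1 - x \<bullet> x))"
    by (subst euclidean_inner) (rule smooth_exp_inv_comp)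
  then show ?thesis by (simp add: bump_def[abs_def])
qed

lemma bump_nonneg: "0 \<le> bump x" by (simp add: bump_def exp_inv_def)

lemma bump_pos: "norm x < 1 \<Longrightarrow> 0 < bump x"
  by (simp add: bump_def exp_inv_def dot_square_norm power_less_one_iff)

lemma bump_eq_0: "norm x \<ge> 1 \<Longrightarrow> bump x = 0"
  by (simp add: bump_def exp_inv_def dot_square_norm not_less)

subsection \<open>Compactly supported smooth functions\<close>

lemma test_fun_smooth: "\<phi> \<in> test_fun \<Omega> \<Longrightarrow> smooth \<phi>"
  by (simp add: test_fun_def smooth_def)

lemma test_funI:
  assumes "smooth \<phi>" "compact S" "S \<subseteq> \<Omega>" "\<And>x. x \<notin> S \<Longrightarrow> \<phi> x = 0"
  shows "\<phi> \<in> test_fun \<Omega>"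
proof -
  have "closure {x. \<phi> x \<noteq> 0} \<subseteq> S"
    using assms by (intro closure_minimal compact_imp_closed) auto
  moreover from this have "compact (closure {x. \<phi> x \<noteq> 0})"
    using compact_Int_closed[OF assms(2) closed_closure, of "{x. \<phi> x \<noteq> 0}"] by (simp only: Int_absorb1)
  ultimately show ?thesis using assms(1,3) by (auto simp: test_fun_def smooth_def)
qed

lemma test_fun_support:
  assumes "\<phi> \<in> test_fun \<Omega>"
  obtains S where "compact S" "S \<subseteq> \<Omega>" "\<And>x. x \<notin> S \<Longrightarrow> \<phi> x = 0" "\<And>b x. x \<notin> S \<Longrightarrow> pderiv_dir b \<phi> x = 0"
proof
  let ?S = "closure {x. \<phi> x \<noteq> 0}"
  show "compact ?S" "?S \<subseteq> \<Omega>" using assms by (auto simp: test_fun_def)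
  show z: "\<phi> x = 0" if "x \<notin> ?S" for x using that closure_subset[of "{x. \<phi> x \<noteq> 0}"] by auto
  show "pderiv_dir b \<phi> x = 0" if "x \<notin> ?S" for b x
  proof (rule pderiv_dir_eqI[where f'="\<lambda>h. 0"])
    show "(\<phi> has_derivative (\<lambda>h. 0)) (at x)"
  proof (rule has_derivative_transform_within_open)
      show "((\<lambda>x. 0) has_derivative (\<lambda>h. 0)) (at x)" by (rule has_derivative_const)
      show "open (- ?S)" by auto
      show "x \<in> - ?S" using that by auto
      show "0 = \<phi> y" if "y \<in> - ?S" for y using z[of y] that by simp
    qed
  qed
qed

lemma pderiv_test_fun:
  assumes "\<phi> \<in> test_fun \<Omega>" "b \<in> Basis" shows "pderiv_dir b \<phi> \<in> test_fun \<Omega>"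
proof -
  obtain S where "compact S" "S \<subseteq> \<Omega>" "\<And>x. x \<notin> S \<Longrightarrow> \<phi> x = 0" "\<And>b x. x \<notin> S \<Longrightarrow> pderiv_dir b \<phi> x = 0"
    using test_fun_support[OF assms(1)] by blast
  then show ?thesis by (intro test_funI smooth_pderiv[OF test_fun_smooth[OF assms(1)] assms(2)])
qed

lemma test_fun_diff:
  assumes "\<phi> \<in> test_fun \<Omega>" "\<psi> \<in> test_fun \<Omega>" shows "(\<lambda>x. \<phi> x - \<psi> x) \<in> test_fun \<Omega>"
proof -
  obtain S where S: "compact S" "S \<subseteq> \<Omega>" "\<And>x. x \<notin> S \<Longrightarrow> \<phi> x = 0" "\<And>b x. x \<notin> S \<Longrightarrow> pderiv_dir b \<phi> x = 0"
    using test_fun_support[OF assms(1)] by blast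
  obtain T where T: "compact T" "T \<subseteq> \<Omega>" "\<And>x. x \<notin> T \<Longrightarrow> \<psi> x = 0" "\<And>b x. x \<notin> T \<Longrightarrow> pderiv_dir b \<psi> x = 0"
    using test_fun_support[OF assms(2)] by blast
  show ?thesis
  proof (rule test_funI[where S="S \<union> T"])
    show "smooth (\<lambda>x. \<phi> x - \<psi> x)" by (intro smooth_diff test_fun_smooth[OF assms(1)] test_fun_smooth[OF assms(2)])
    show "compact (S \<union> T)" "S \<union> T \<subseteq> \<Omega>" using S T by (auto intro: compact_Un)
    show "\<phi> x - \<psi> x = 0" if "x \<notin> S \<union> T" for x using S(3)[of x] T(3)[of x] that by simp
  qed
qed

lemma test_fun_reflect:
  assumes "\<eta> \<in> test_fun UNIV" shows "(\<lambda>y. \<eta> (x - y)) \<in> test_fun UNIV"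
proof -
  obtain S where S: "compact S" "S \<subseteq> UNIV" "\<And>x. x \<notin> S \<Longrightarrow> \<eta> x = 0" "\<And>b x. x \<notin> S \<Longrightarrow> pderiv_dir b \<eta> x = 0"
    using test_fun_support[OF assms] by blast
  have "smooth (\<lambda>y. \<eta> (x + (-1) *\<^sub>R y))" by (rule smooth_affine[OF test_fun_smooth[OF assms]])
  moreover have "compact ((\<lambda>y. x - y) ` S)"
    by (intro compact_continuous_image continuous_intros S)
  moreover have "\<eta> (x - y) = 0" if "y \<notin> (\<lambda>y. x - y) ` S" for y
    using that S(3)[of "x - y"] by force
  ultimately show ?thesis by (intro test_funI) auto
qed

lemma pderiv_dir_reflect:
  assumes "smooth \<eta>" shows "pderiv_dir b (\<lambda>y. \<eta> (x - y)) = (\<lambda>y. - pderiv_dir b \<eta> (x - y))"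
  using pderiv_dir_affine[OF assms, of b x "-1"] by simp

lemma test_fun_continuous: "\<phi> \<in> test_fun \<Omega> \<Longrightarrow> continuous_on S \<phi>"
  by (intro smooth_continuous test_fun_smooth)

lemma test_fun_bounded:
  assumes "\<phi> \<in> test_fun \<Omega>" obtains M where "M \<ge> 0" "\<And>x. \<bar>\<phi> x\<bar> \<le> M"
proof -
  obtain S where S: "compact S" "S \<subseteq> \<Omega>" "\<And>x. x \<notin> S \<Longrightarrow> \<phi> x = 0" "\<And>b x. x \<notin> S \<Longrightarrow> pderiv_dir b \<phi> x = 0"
    using test_fun_support[OF assms] by blast
  have "bounded (\<phi> ` S)"
    by (intro compact_imp_bounded compact_continuous_image test_fun_continuous[OF assms] S)
  then obtain M where "\<And>x. x \<in> S \<Longrightarrow> \<bar>\<phi> x\<bar> \<le> M" by (auto simp: bounded_iff)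
  then have "\<bar>\<phi> x\<bar> \<le> \<bar>M\<bar>" for x using S(3)[of x] by (cases "x \<in> S") (force intro: order_trans[of _ M])+
  then show ?thesis by (intro that[of "\<bar>M\<bar>"]) auto
qed

text \<open>One constant bounds both increments and differential, so a first order remainder is at
  most \<open>2 * L\<close> times the length of the increment. That is the majorant for
  differentiating a convolution.\<close>

lemma test_fun_Lipschitz:
  assumes "\<phi> \<in> test_fun \<Omega>"
  obtains L where "L \<ge> 0" "\<And>x y. \<bar>\<phi> x - \<phi> y\<bar> \<le> L * norm (x - y)"
    "\<And>x h. \<bar>\<Sum>b\<in>Basis. (h \<bullet> b) * pderiv_dir b \<phi> x\<bar> \<le> L * norm h"
proof -
  have "\<forall>b\<in>Basis. \<exists>M. M \<ge> 0 \<and> (\<forall>x. \<bar>pderiv_dir b \<phi> x\<bar> \<le> M)"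
  proof
    fix b :: 'a assume "b \<in> Basis"
    from test_fun_bounded[OF pderiv_test_fun[OF assms this]]
    show "\<exists>M. M \<ge> 0 \<and> (\<forall>x. \<bar>pderiv_dir b \<phi> x\<bar> \<le> M)" by blast
  qed
  then obtain M where M: "\<And>b. b \<in> Basis \<Longrightarrow> M b \<ge> 0" "\<And>b x. b \<in> Basis \<Longrightarrow> \<bar>pderiv_dir b \<phi> x\<bar> \<le> M b" by metis
  define L where "L = (\<Sum>b\<in>Basis. M b)"
  have D: "\<bar>\<Sum>b\<in>Basis. (h \<bullet> b) * pderiv_dir b \<phi> x\<bar> \<le> L * norm h" for x h
  proof -
    have "\<bar>\<Sum>b\<in>Basis. (h \<bullet> b) * pderiv_dir b \<phi> x\<bar> \<le> (\<Sum>b\<in>Basis. \<bar>(h \<bullet> b) * pderiv_dir b \<phi> x\<bar>)" by (rule sum_abs)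
    also have "\<dots> \<le> (\<Sum>b\<in>Basis. norm h * M b)"
      using M Basis_le_norm by (intro sum_mono) (auto simp: abs_mult intro!: mult_mono)
    finally show ?thesis by (simp add: L_def sum_distrib_left mult.commute)
  qed
  have "norm (\<phi> x - \<phi> y) \<le> L * norm (x - y)" for x y
  proof (rule differentiable_bound[of UNIV \<phi> "\<lambda>x h. \<Sum>b\<in>Basis. (h \<bullet> b) * pderiv_dir b \<phi> x"])
    show "(\<phi> has_derivative (\<lambda>h. \<Sum>b\<in>Basis. (h \<bullet> b) * pderiv_dir b \<phi> x)) (at x within UNIV)" for x
      using smooth_has_derivative[OF test_fun_smooth[OF assms]] by blast
    show "onorm (\<lambda>h. \<Sum>b\<in>Basis. (h \<bullet> b) * pderiv_dir b \<phi> x) \<le> L" for x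
      using D[of _ x] by (intro onorm_le) (auto simp: mult.commute)
  qed auto
  moreover have "L \<ge> 0" using M(1) by (auto simp: L_def intro: sum_nonneg)
  ultimately show ?thesis using D by (intro that[of L]) auto
qed

section \<open>Convolution and mollification\<close>

lemma nn_integral_lborel_affine:
  fixes f :: "'a::euclidean_space \<Rightarrow> ennreal"
  assumes "f \<in> borel_measurable borel" "c \<noteq> 0"
  shows "(\<integral>\<^sup>+x. f x \<partial>lborel) = ennreal (\<bar>c\<bar> ^ DIM('a)) * (\<integral>\<^sup>+x. f (t + c *\<^sub>R x) \<partial>lborel)"
  by (subst lborel_affine[OF assms(2), of t])
    (use assms in \<open>simp add: nn_integral_density nn_integral_distr nn_integral_cmult\<close>)

lemma lebesgue_integral_affine:
  fixes f :: "'a::euclidean_space \<Rightarrow> real"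
  assumes f: "f \<in> borel_measurable borel" and c: "c \<noteq> 0"
  shows "(LINT x|lebesgue. f x) = \<bar>c\<bar> ^ DIM('a) * (LINT x|lebesgue. f (t + c *\<^sub>R x))"
proof -
  have m: "(\<lambda>x. f (t + c *\<^sub>R x)) \<in> borel_measurable borel" using f by measurable
  have "(LINT x|lborel. f x) = \<bar>c\<bar> ^ DIM('a) * (LINT x|lborel. f (t + c *\<^sub>R x))"
    by (subst lborel_affine[OF c, of t]) (use f m in \<open>simp add: integral_density integral_distr\<close>)
  then show ?thesis using f m by (simp add: integral_completion)
qed

lemma continuous_compact_support_integrable:
  fixes f :: "'a::euclidean_space \<Rightarrow> real"
  assumes "continuous_on UNIV f" "compact S" "\<And>x. x \<notin> S \<Longrightarrow> f x = 0"
  shows "integrable lebesgue f"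
proof -
  have "integrable lborel (\<lambda>x. indicator S x *\<^sub>R f x)"
    using assms by (intro borel_integrable_compact) (auto intro: continuous_on_subset)
  moreover have "(\<lambda>x. indicator S x *\<^sub>R f x) = f" using assms(3) by (auto simp: indicator_def fun_eq_iff)
  ultimately have "integrable lborel f" by simp
  then show ?thesis using assms(1) by (simp add: integrable_completion borel_measurable_continuous_onI)
qed

lemma continuous_lebesgue_measurable:
  fixes f :: "'a::euclidean_space \<Rightarrow> real"
  assumes "continuous_on UNIV f" shows "f \<in> borel_measurable (lebesgue_on S)"
  by (intro measurable_restrict_space1 measurable_completion) (simp add: assms borel_measurable_continuous_onI)

lemma test_fun_measurable: "\<phi> \<in> test_fun \<Omega> \<Longrightarrow> \<phi> \<in> borel_measurable (lebesgue_on S)"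
  by (intro continuous_lebesgue_measurable test_fun_continuous)

lemma test_fun_integrable: "\<phi> \<in> test_fun \<Omega> \<Longrightarrow> integrable lebesgue \<phi>"
  by (rule test_fun_support[of \<phi> \<Omega>], assumption) (rule continuous_compact_support_integrable[OF test_fun_continuous[of _ \<Omega>]])

lemma test_fun_mult_integrable:
  assumes "\<phi> \<in> test_fun \<Omega>" "integrable lebesgue u"
  shows "integrable lebesgue (\<lambda>x. \<phi> x * u x)"
proof -
  obtain M where M: "M \<ge> 0" "\<And>x. \<bar>\<phi> x\<bar> \<le> M" using test_fun_bounded[OF assms(1)] by blast
  show ?thesis
  proof (rule Bochner_Integration.integrable_bound)
    show "integrable lebesgue (\<lambda>x. M * u x)" using assms(2) by simp
    show "(\<lambda>x. \<phi> x * u x) \<in> borel_measurable lebesgue"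
      using test_fun_measurable[OF assms(1), of UNIV] assms(2) by (auto simp: lebesgue_on_UNIV_eq)
    show "AE x in lebesgue. norm (\<phi> x * u x) \<le> norm (M * u x)"
      using M by (auto simp: abs_mult intro!: mult_right_mono)
  qed
qed

section \<open>Convolution with a smooth kernel\<close>

definition conv :: "('a::euclidean_space \<Rightarrow> real) \<Rightarrow> ('a \<Rightarrow> real) \<Rightarrow> 'a \<Rightarrow> real" where
  "conv \<eta> u x = (LINT y|lebesgue. \<eta> (x - y) * u y)"

lemma conv_integrable:
  "\<eta> \<in> test_fun UNIV \<Longrightarrow> integrable lebesgue u \<Longrightarrow> integrable lebesgue (\<lambda>y. \<eta> (x - y) * u y)"
  by (rule test_fun_mult_integrable[OF test_fun_reflect])

text \<open>Differentiation under the integral sign. The limit is taken along sequences, as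
  dominated convergence demands; the remainder quotients of \<open>\<eta>\<close> stay below
  \<open>2 * L\<close> and tend to zero pointwise.\<close>

lemma conv_has_derivative:
  assumes \<eta>: "\<eta> \<in> test_fun UNIV" and u: "integrable lebesgue u"
  shows "(conv \<eta> u has_derivative (\<lambda>h. \<Sum>b\<in>Basis. (h \<bullet> b) * conv (pderiv_dir b \<eta>) u x)) (at x)"
  unfolding has_derivative_at_within
proof
  show "bounded_linear (\<lambda>h. \<Sum>b\<in>Basis. (h \<bullet> b) * conv (pderiv_dir b \<eta>) u x)"
    by (intro bounded_linear_intros)
  obtain L where L: "L \<ge> 0" "\<And>x y. \<bar>\<eta> x - \<eta> y\<bar> \<le> L * norm (x - y)"
    "\<And>x h. \<bar>\<Sum>b\<in>Basis. (h \<bullet> b) * pderiv_dir b \<eta> x\<bar> \<le> L * norm h" using test_fun_Lipschitz[OF \<eta>] by blast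
  show "((\<lambda>z. (conv \<eta> u z - conv \<eta> u x - (\<Sum>b\<in>Basis. ((z - x) \<bullet> b) * conv (pderiv_dir b \<eta>) u x)) /\<^sub>R norm (z - x)) \<longlongrightarrow> 0) (at x)"
    unfolding tendsto_at_iff_sequentially
  proof (intro allI impI)
    fix X :: "nat \<Rightarrow> 'a" assume X: "\<forall>i. X i \<in> UNIV - {x}" and lim: "X \<longlonglongrightarrow> x"
    define q where "q i y = (\<eta> (X i - y) - \<eta> (x - y) - (\<Sum>b\<in>Basis. ((X i - x) \<bullet> b) * pderiv_dir b \<eta> (x - y))) /\<^sub>R norm (X i - x)" for i y
    have i1: "integrable lebesgue (\<lambda>y. \<eta> (z - y) * u y)" for z by (rule conv_integrable[OF \<eta> u])
    have i2: "integrable lebesgue (\<lambda>y. (z \<bullet> b) * (pderiv_dir b \<eta> (x - y) * u y))" if "b \<in> Basis" for z b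
      using conv_integrable[OF pderiv_test_fun[OF \<eta> that] u] by simp
    have e: "(conv \<eta> u (X i) - conv \<eta> u x - (\<Sum>b\<in>Basis. ((X i - x) \<bullet> b) * conv (pderiv_dir b \<eta>) u x)) /\<^sub>R norm (X i - x)
        = (LINT y|lebesgue. q i y * u y)" for i
    proof -
      have s: "(\<Sum>b\<in>Basis. ((X i - x) \<bullet> b) * conv (pderiv_dir b \<eta>) u x)
          = (LINT y|lebesgue. (\<Sum>b\<in>Basis. ((X i - x) \<bullet> b) * (pderiv_dir b \<eta> (x - y) * u y)))"
        unfolding conv_def by (subst Bochner_Integration.integral_sum) (use i2 in auto)
      have "(LINT y|lebesgue. (\<eta> (X i - y) * u y - \<eta> (x - y) * u y) - (\<Sum>b\<in>Basis. ((X i - x) \<bullet> b) * (pderiv_dir b \<eta> (x - y) * u y)))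
        = (LINT y|lebesgue. \<eta> (X i - y) * u y - \<eta> (x - y) * u y) - (LINT y|lebesgue. (\<Sum>b\<in>Basis. ((X i - x) \<bullet> b) * (pderiv_dir b \<eta> (x - y) * u y)))"
        by (intro Bochner_Integration.integral_diff Bochner_Integration.integrable_diff i1 Bochner_Integration.integrable_sum i2)
      also have "(LINT y|lebesgue. \<eta> (X i - y) * u y - \<eta> (x - y) * u y) = conv \<eta> u (X i) - conv \<eta> u x"
        unfolding conv_def by (intro Bochner_Integration.integral_diff i1)
      finally have "conv \<eta> u (X i) - conv \<eta> u x - (\<Sum>b\<in>Basis. ((X i - x) \<bullet> b) * conv (pderiv_dir b \<eta>) u x)
         = (LINT y|lebesgue. (\<eta> (X i - y) * u y - \<eta> (x - y) * u y) - (\<Sum>b\<in>Basis. ((X i - x) \<bullet> b) * (pderiv_dir b \<eta> (x - y) * u y)))"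
        by (simp only: s)
      also have "\<dots> = (LINT y|lebesgue. norm (X i - x) * (q i y * u y))"
      proof (intro Bochner_Integration.integral_cong refl)
        fix y
        have "norm (X i - x) * q i y = \<eta> (X i - y) - \<eta> (x - y) - (\<Sum>b\<in>Basis. ((X i - x) \<bullet> b) * pderiv_dir b \<eta> (x - y))"
          using X by (simp add: q_def)
        then have "norm (X i - x) * (q i y * u y) = (\<eta> (X i - y) - \<eta> (x - y) - (\<Sum>b\<in>Basis. ((X i - x) \<bullet> b) * pderiv_dir b \<eta> (x - y))) * u y"
          by (simp only: mult.assoc[symmetric])
        then show "(\<eta> (X i - y) * u y - \<eta> (x - y) * u y) - (\<Sum>b\<in>Basis. ((X i - x) \<bullet> b) * (pderiv_dir b \<eta> (x - y) * u y))
            = norm (X i - x) * (q i y * u y)"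
          by (simp only: left_diff_distrib sum_distrib_right mult.assoc)
      qed
      finally show ?thesis using X by simp
    qed
    have "(\<lambda>i. LINT y|lebesgue. q i y * u y) \<longlonglongrightarrow> (LINT (y::'a)|lebesgue. 0)"
    proof (rule integral_dominated_convergence[where w="\<lambda>y. 2 * L * \<bar>u y\<bar>"])
      show "integrable lebesgue (\<lambda>y. 2 * L * \<bar>u y\<bar>)" using u by simp
      have "continuous_on UNIV (\<lambda>y. q i y)" for i
        unfolding q_def
        by (intro continuous_intros continuous_on_compose2[OF test_fun_continuous[OF \<eta>, of UNIV]]
          continuous_on_compose2[OF test_fun_continuous[OF pderiv_test_fun[OF \<eta>], of _ UNIV]]) auto
      then show "(\<lambda>y. q i y * u y) \<in> borel_measurable lebesgue" for i
        using u continuous_lebesgue_measurable[of "q i" UNIV] by (auto simp: lebesgue_on_UNIV_eq)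
      have "\<bar>q i y\<bar> \<le> 2 * L" for i y
      proof -
        have p: "norm (X i - x) > 0" using X by auto
        have "\<bar>\<eta> (X i - y) - \<eta> (x - y) - (\<Sum>b\<in>Basis. ((X i - x) \<bullet> b) * pderiv_dir b \<eta> (x - y))\<bar> \<le> 2 * L * norm (X i - x)"
          using L(2)[of "X i - y" "x - y"] L(3)[of "X i - x" "x - y"] by simp
        then show ?thesis using p unfolding q_def by (simp add: abs_mult field_simps)
      qed
      then show "AE y in lebesgue. norm (q i y * u y) \<le> 2 * L * \<bar>u y\<bar>" for i
        by (auto simp: abs_mult intro!: mult_right_mono)
      have "(\<lambda>i. q i y) \<longlonglongrightarrow> 0" for y
      proof -
        have d: "((\<lambda>w. ((\<eta> w - \<eta> (x - y)) - (\<Sum>b\<in>Basis. ((w - (x - y)) \<bullet> b) * pderiv_dir b \<eta> (x - y))) /\<^sub>R norm (w - (x - y))) \<longlongrightarrow> 0) (at (x - y))"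
          using smooth_has_derivative[OF test_fun_smooth[OF \<eta>], of "x - y"] unfolding has_derivative_at_within by simp
        have "filterlim (\<lambda>i. X i - y) (at (x - y)) sequentially"
          using X lim by (auto simp: filterlim_at intro!: tendsto_intros always_eventually)
        from filterlim_compose[OF d this] show ?thesis by (simp add: q_def)
      qed
      then show "AE y in lebesgue. (\<lambda>i. q i y * u y) \<longlonglongrightarrow> 0" by (auto intro!: tendsto_mult_left_zero)
    qed simp
    then show "((\<lambda>z. (conv \<eta> u z - conv \<eta> u x - (\<Sum>b\<in>Basis. ((z - x) \<bullet> b) * conv (pderiv_dir b \<eta>) u x)) /\<^sub>R norm (z - x)) \<circ> X) \<longlonglongrightarrow> 0"
      using e by (simp add: o_def)
  qed
qed

lemma pderiv_dir_conv:
  assumes "\<eta> \<in> test_fun UNIV" "integrable lebesgue u" "b \<in> Basis"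
  shows "pderiv_dir b (conv \<eta> u) = conv (pderiv_dir b \<eta>) u"
proof
  fix x
  have "pderiv_dir b (conv \<eta> u) x = (\<Sum>c\<in>Basis. (b \<bullet> c) * conv (pderiv_dir c \<eta>) u x)"
    by (rule pderiv_dir_eqI[OF conv_has_derivative[OF assms(1,2)]])
  also have "\<dots> = (\<Sum>c\<in>Basis. if c = b then conv (pderiv_dir b \<eta>) u x else 0)"
    using assms(3) by (intro sum.cong) (auto simp: inner_Basis)
  finally show "pderiv_dir b (conv \<eta> u) x = conv (pderiv_dir b \<eta>) u x" using assms(3) by simp
qed

lemma smooth_conv:
  assumes "\<eta> \<in> test_fun UNIV" "integrable lebesgue u" shows "smooth (conv \<eta> u)"
proof (rule Ck_coinduct[where F="{conv \<eta> u |\<eta>. \<eta> \<in> test_fun UNIV}"])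
  show "conv \<eta> u \<in> {conv \<eta> u |\<eta>. \<eta> \<in> test_fun UNIV}" using assms(1) by blast
next
  fix f x assume "f \<in> {conv \<eta> u |\<eta>. \<eta> \<in> test_fun UNIV}"
  then show "f differentiable (at x)" using conv_has_derivative[OF _ assms(2)] differentiableI by blast
next
  fix f and b :: 'a assume "f \<in> {conv \<eta> u |\<eta>. \<eta> \<in> test_fun UNIV}" "b \<in> Basis"
  then show "pderiv_dir b f \<in> {conv \<eta> u |\<eta>. \<eta> \<in> test_fun UNIV}"
    using pderiv_dir_conv[OF _ assms(2)] pderiv_test_fun by blast
qed

lemma conv_diff:
  assumes "\<eta> \<in> test_fun UNIV" "integrable lebesgue u" "integrable lebesgue v"
  shows "conv \<eta> (\<lambda>x. u x - v x) x = conv \<eta> u x - conv \<eta> v x"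
  using conv_integrable[OF assms(1,2)] conv_integrable[OF assms(1,3)] by (simp add: conv_def right_diff_distrib)

text \<open>Splitting \<open>\<eta>\<close> into two square roots and applying the Cauchy-Schwarz
  inequality bounds the square of the convolution by the convolution of the square, because
  \<open>\<eta>\<close> has total mass one; Tonelli's theorem finishes. Working in the extended
  nonnegative reals avoids integrability questions on the product space.\<close>

lemma conv_L2:
  fixes u :: "'a::euclidean_space \<Rightarrow> real"
  assumes \<eta>: "\<eta> \<in> test_fun UNIV" "\<And>x. \<eta> x \<ge> 0" "(LINT x|lebesgue. \<eta> x) = 1"
    and u: "integrable lebesgue u" "u \<in> L2 UNIV"
  shows "conv \<eta> u \<in> L2 UNIV" "L2_norm UNIV (conv \<eta> u) \<le> L2_norm UNIV u"
proof -
  have um: "u \<in> borel_measurable lebesgue" using u(1) by auto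
  have \<eta>m [measurable]: "\<eta> \<in> borel_measurable borel"
    using test_fun_continuous[OF \<eta>(1), of UNIV] by (rule borel_measurable_continuous_onI)
  \<comment> \<open>Tonelli's theorem for the product of Borel measures needs a Borel representative
    of the Lebesgue measurable \<open>u\<close>.\<close>
  obtain v where v [measurable]: "v \<in> borel_measurable lborel" and uv: "AE x in lborel. u x = v x"
    using completion_ex_borel_measurable_real[OF um] by blast
  have uv': "AE x in lebesgue. u x = v x" using uv by (rule AE_completion)
  have i\<eta>: "(\<integral>\<^sup>+x. ennreal (\<eta> x) \<partial>lborel) = 1"
  proof -
    have "integrable lborel \<eta>" using test_fun_integrable[OF \<eta>(1)] by (simp add: integrable_completion)
    then have "(\<integral>\<^sup>+x. ennreal (\<eta> x) \<partial>lborel) = ennreal (LINT x|lborel. \<eta> x)"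
      using \<eta>(2) by (intro nn_integral_eq_integral) auto
    then show ?thesis using \<eta>(3) by (simp add: integral_completion)
  qed
  have i1: "(\<integral>\<^sup>+y. ennreal (\<eta> (x - y)) \<partial>lborel) = 1" for x
    using nn_integral_lborel_affine[of "\<lambda>y. ennreal (\<eta> y)" "-1" x] i\<eta> by simp
  have i2: "(\<integral>\<^sup>+x. ennreal (\<eta> (x - y)) \<partial>lborel) = 1" for y
    using nn_integral_lborel_affine[of "\<lambda>y. ennreal (\<eta> y)" 1 "- y"] i\<eta> by simp
  have cm: "conv \<eta> u \<in> borel_measurable (lebesgue_on UNIV)"
    by (intro continuous_lebesgue_measurable smooth_continuous smooth_conv[OF \<eta>(1) u(1)])
  have cb: "conv \<eta> u \<in> borel_measurable borel"
    by (intro borel_measurable_continuous_onI smooth_continuous smooth_conv[OF \<eta>(1) u(1)])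
  have pt: "ennreal ((conv \<eta> u x)\<^sup>2) \<le> (\<integral>\<^sup>+y. ennreal (\<eta> (x - y) * (v y)\<^sup>2) \<partial>lborel)" for x
  proof -
    have mv: "(\<lambda>y. \<eta> (x - y) * v y) \<in> borel_measurable lborel" by measurable
    have ae: "AE y in lebesgue. \<eta> (x - y) * u y = \<eta> (x - y) * v y" using uv' by eventually_elim simp
    have iu: "integrable lebesgue (\<lambda>y. \<eta> (x - y) * u y)" by (rule conv_integrable[OF \<eta>(1) u(1)])
    have "integrable lebesgue (\<lambda>y. \<eta> (x - y) * v y)"
      by (rule integrable_cong_AE_imp[OF iu measurable_completion[OF mv]]) (use ae in auto)
    then have iv: "integrable lborel (\<lambda>y. \<eta> (x - y) * v y)" using mv by (simp add: integrable_completion)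
    have "conv \<eta> u x = (LINT y|lebesgue. \<eta> (x - y) * v y)"
      unfolding conv_def by (rule integral_cong_AE[OF borel_measurable_integrable[OF iu] measurable_completion[OF mv] ae])
    also have "\<dots> = (LINT y|lborel. \<eta> (x - y) * v y)" using mv by (simp add: integral_completion)
    finally have "ennreal (norm (conv \<eta> u x)) \<le> (\<integral>\<^sup>+y. ennreal (norm (\<eta> (x - y) * v y)) \<partial>lborel)"
      using integral_norm_bound_ennreal[OF iv] by simp
    also have "\<dots> = (\<integral>\<^sup>+y. ennreal (sqrt (\<eta> (x - y))) * ennreal (sqrt (\<eta> (x - y)) * \<bar>v y\<bar>) \<partial>lborel)"
      using \<eta>(2) by (intro nn_integral_cong) (simp add: ennreal_mult[symmetric] abs_mult mult.assoc[symmetric])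
    finally have "(ennreal (norm (conv \<eta> u x)))\<^sup>2 \<le> (\<integral>\<^sup>+y. ennreal (sqrt (\<eta> (x - y))) * ennreal (sqrt (\<eta> (x - y)) * \<bar>v y\<bar>) \<partial>lborel)\<^sup>2"
      by (rule power_mono) simp
    also have "\<dots> \<le> (\<integral>\<^sup>+y. (ennreal (sqrt (\<eta> (x - y))))\<^sup>2 \<partial>lborel) * (\<integral>\<^sup>+y. (ennreal (sqrt (\<eta> (x - y)) * \<bar>v y\<bar>))\<^sup>2 \<partial>lborel)"
      by (rule Cauchy_Schwarz_nn_integral) auto
    also have "(\<integral>\<^sup>+y. (ennreal (sqrt (\<eta> (x - y))))\<^sup>2 \<partial>lborel) = 1"
      unfolding i1[of x, symmetric] using \<eta>(2) by (intro nn_integral_cong) (simp add: ennreal_power)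
    also have "(\<integral>\<^sup>+y. (ennreal (sqrt (\<eta> (x - y)) * \<bar>v y\<bar>))\<^sup>2 \<partial>lborel) = (\<integral>\<^sup>+y. ennreal (\<eta> (x - y) * (v y)\<^sup>2) \<partial>lborel)"
      using \<eta>(2) by (intro nn_integral_cong) (simp add: ennreal_power power_mult_distrib)
    finally show ?thesis by (simp add: ennreal_power)
  qed
  have "(\<integral>\<^sup>+x. ennreal ((conv \<eta> u x)\<^sup>2) \<partial>lborel) \<le> (\<integral>\<^sup>+x. \<integral>\<^sup>+y. ennreal (\<eta> (x - y) * (v y)\<^sup>2) \<partial>lborel \<partial>lborel)"
    by (intro nn_integral_mono pt)
  also have "\<dots> = (\<integral>\<^sup>+y. \<integral>\<^sup>+x. ennreal (\<eta> (x - y) * (v y)\<^sup>2) \<partial>lborel \<partial>lborel)"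
    by (rule lborel_pair.Fubini'[symmetric]) measurable
  also have "\<dots> = (\<integral>\<^sup>+y. ennreal ((v y)\<^sup>2) \<partial>lborel)"
  proof (rule nn_integral_cong)
    fix y
    have "(\<integral>\<^sup>+x. ennreal (\<eta> (x - y) * (v y)\<^sup>2) \<partial>lborel) = (\<integral>\<^sup>+x. ennreal (\<eta> (x - y)) * ennreal ((v y)\<^sup>2) \<partial>lborel)"
      using \<eta>(2) by (simp add: ennreal_mult)
    also have "\<dots> = (\<integral>\<^sup>+x. ennreal (\<eta> (x - y)) \<partial>lborel) * ennreal ((v y)\<^sup>2)"
      by (rule nn_integral_multc) measurable
    finally show "(\<integral>\<^sup>+x. ennreal (\<eta> (x - y) * (v y)\<^sup>2) \<partial>lborel) = ennreal ((v y)\<^sup>2)" by (simp add: i2)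
  qed
  also have "\<dots> = (\<integral>\<^sup>+y. ennreal ((u y)\<^sup>2) \<partial>lebesgue)"
    unfolding nn_integral_completion[symmetric, of lborel] using uv' by (intro nn_integral_cong_AE) auto
  also have "\<dots> = ennreal ((L2_norm UNIV u)\<^sup>2)"
    unfolding L2_norm_square lebesgue_on_UNIV_eq
    using L2_square_integrable[OF u(2)] by (intro nn_integral_eq_integral) (auto simp: lebesgue_on_UNIV_eq)
  finally have le: "(\<integral>\<^sup>+x. ennreal ((conv \<eta> u x)\<^sup>2) \<partial>lebesgue) \<le> ennreal ((L2_norm UNIV u)\<^sup>2)"
    by (simp add: nn_integral_completion)
  have int: "integrable lebesgue (\<lambda>x. (conv \<eta> u x)\<^sup>2)"
    using le cm by (intro integrableI_nonneg) (auto simp: lebesgue_on_UNIV_eq intro: le_less_trans)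
  then show "conv \<eta> u \<in> L2 UNIV" using cm by (simp add: L2_def lebesgue_on_UNIV_eq)
  have "ennreal ((L2_norm UNIV (conv \<eta> u))\<^sup>2) = (\<integral>\<^sup>+x. ennreal ((conv \<eta> u x)\<^sup>2) \<partial>lebesgue)"
    unfolding L2_norm_square lebesgue_on_UNIV_eq using int by (intro nn_integral_eq_integral[symmetric]) auto
  then have "ennreal ((L2_norm UNIV (conv \<eta> u))\<^sup>2) \<le> ennreal ((L2_norm UNIV u)\<^sup>2)" using le by (simp only:)
  then have "(L2_norm UNIV (conv \<eta> u))\<^sup>2 \<le> (L2_norm UNIV u)\<^sup>2" by (subst (asm) ennreal_le_iff) auto
  then show "L2_norm UNIV (conv \<eta> u) \<le> L2_norm UNIV u" by (rule power2_le_imp_le) simp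
qed

section \<open>Mollifiers and approximation in L2\<close>

definition moll :: "nat \<Rightarrow> 'a::euclidean_space \<Rightarrow> real" where
  "moll n x = bump (real (Suc n) *\<^sub>R x) / (LINT y|lebesgue. bump (real (Suc n) *\<^sub>R (y::'a)))"

lemma scaled_bump_test_fun: "(\<lambda>x::'a::euclidean_space. bump (real (Suc n) *\<^sub>R x)) \<in> test_fun UNIV"
proof (rule test_funI[where S="cball 0 1"])
  show "smooth (\<lambda>x::'a. bump (real (Suc n) *\<^sub>R x))" using smooth_affine[OF smooth_bump, of 0] by simp
  show "bump (real (Suc n) *\<^sub>R x) = 0" if "x \<notin> cball 0 1" for x :: 'a
  proof -
    have "1 * 1 \<le> real (Suc n) * norm x" using that by (intro mult_mono) auto
    then show ?thesis by (intro bump_eq_0) simp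
  qed
qed auto

lemma scaled_bump_integral_pos: "0 < (LINT y|lebesgue. bump (real (Suc n) *\<^sub>R (y::'a::euclidean_space)))"
proof -
  let ?f = "\<lambda>y::'a. bump (real (Suc n) *\<^sub>R y)"
  have i: "integrable lebesgue ?f" by (rule test_fun_integrable[OF scaled_bump_test_fun])
  have "(LINT y|lebesgue. ?f y) \<noteq> 0"
  proof
    assume "(LINT y|lebesgue. ?f y) = 0"
    then have "AE y in lebesgue. ?f y = 0"
      using integral_nonneg_eq_0_iff_AE[OF i] bump_nonneg by auto
    then have "AE y in lebesgue. y \<notin> ball (0::'a) (1 / real (Suc n))"
    proof eventually_elim
      case (elim y)
      have "norm (real (Suc n) *\<^sub>R y) < 1" if "y \<in> ball 0 (1 / real (Suc n))"
        using that by (simp add: pos_less_divide_eq mult.commute del: of_nat_Suc)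
      then show ?case using bump_pos[of "real (Suc n) *\<^sub>R y"] elim by auto
    qed
    then have "negligible (ball (0::'a) (1 / real (Suc n)))"
      by (simp add: negligible_iff_null_sets AE_iff_null_sets)
    then show False using open_not_negligible[of "ball (0::'a) (1 / real (Suc n))"] by simp
  qed
  moreover have "(LINT y|lebesgue. ?f y) \<ge> 0" using bump_nonneg by (intro Bochner_Integration.integral_nonneg)
  ultimately show ?thesis by simp
qed

lemma moll_test_fun: "moll n \<in> test_fun UNIV"
proof -
  let ?c = "LINT y|lebesgue. bump (real (Suc n) *\<^sub>R (y::'a))"
  obtain S where S: "compact S" "S \<subseteq> UNIV" "\<And>x. x \<notin> S \<Longrightarrow> bump (real (Suc n) *\<^sub>R (x::'a)) = 0"
    "\<And>b x. x \<notin> S \<Longrightarrow> pderiv_dir b (\<lambda>x::'a. bump (real (Suc n) *\<^sub>R x)) x = 0"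
    using test_fun_support[OF scaled_bump_test_fun[where 'a='a]] by blast
  have "smooth (\<lambda>x::'a. inverse ?c * bump (real (Suc n) *\<^sub>R x))"
    by (intro smooth_mult smooth_const test_fun_smooth[OF scaled_bump_test_fun])
  moreover have "moll n = (\<lambda>x::'a. inverse ?c * bump (real (Suc n) *\<^sub>R x))"
    by (simp add: moll_def fun_eq_iff divide_inverse)
  ultimately show ?thesis using S by (intro test_funI[OF _ S(1)]) auto
qed

lemma moll_nonneg: "0 \<le> moll n x"
  unfolding moll_def using scaled_bump_integral_pos[of n, where 'a='a] bump_nonneg by (intro divide_nonneg_pos)

text \<open>The index is shifted by one, so that the support radius 1/(n+1) makes sense from n = 0
  on.\<close>

lemma moll_eq_0: "1 / real (Suc n) \<le> norm x \<Longrightarrow> moll n x = 0"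
  unfolding moll_def by (subst bump_eq_0) (simp_all add: pos_divide_le_eq mult.commute del: of_nat_Suc)

lemma moll_integral: "(LINT x|lebesgue. moll n (x::'a::euclidean_space)) = 1"
  using scaled_bump_integral_pos[of n, where 'a='a] by (simp add: moll_def)


lemma conv_moll_L2:
  assumes "integrable lebesgue u" "u \<in> L2 UNIV"
  shows "conv (moll n) u \<in> L2 UNIV" "L2_norm UNIV (conv (moll n) u) \<le> L2_norm UNIV u"
  by (intro conv_L2[OF moll_test_fun moll_nonneg moll_integral assms])+

text \<open>Lebesgue measurability supplies continuous approximants off a null set. Clipping their
  values at \<open>M\<close> and multiplying by a cutoff around \<open>S\<close> preserves the
  limit, since \<open>\<psi>\<close> obeys both constraints already.\<close>

lemma bounded_measurable_limit_continuous:
  fixes \<psi> :: "'a::euclidean_space \<Rightarrow> real"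
  assumes "\<psi> \<in> borel_measurable lebesgue" "M \<ge> 0" "\<And>x. \<bar>\<psi> x\<bar> \<le> M"
    and S: "compact S" "S \<noteq> {}" "\<And>x. x \<notin> S \<Longrightarrow> \<psi> x = 0" and r: "r > 0"
  obtains h where "\<And>n::nat. continuous_on UNIV (h n)" "\<And>n x. \<bar>h n x\<bar> \<le> M"
    "\<And>n x. infdist x S > r \<Longrightarrow> h n x = 0" "AE x in lebesgue. (\<lambda>n. h n x) \<longlonglongrightarrow> \<psi> x"
proof -
  have "\<psi> measurable_on UNIV" using assms(1) measurable_on_iff_borel_measurable[of UNIV \<psi>] by (simp add: lebesgue_on_UNIV_eq)
  then obtain N g where N: "negligible N" and g: "\<And>n::nat. continuous_on UNIV (g n)"
    "\<And>x. x \<notin> N \<Longrightarrow> (\<lambda>n. g n x) \<longlonglongrightarrow> \<psi> x" unfolding measurable_on_def by auto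
  define ct where "ct x = max 0 (1 - infdist x S / r)" for x
  have ct: "0 \<le> ct x" "ct x \<le> 1" for x using r infdist_nonneg[of x S] by (auto simp: ct_def)
  have ct1: "ct x = 1" if "x \<in> S" for x using that by (simp add: ct_def)
  define h where "h n x = max (- M) (min M (g n x)) * ct x" for n x
  show ?thesis
  proof
    show "continuous_on UNIV (h n)" for n unfolding h_def ct_def by (intro continuous_intros g) (use r in auto)
    show "\<bar>h n x\<bar> \<le> M" for n x
    proof -
      have "\<bar>max (- M) (min M (g n x))\<bar> \<le> M" using assms(2) by auto
      then have "\<bar>h n x\<bar> \<le> M * 1" unfolding h_def abs_mult using ct[of x] assms(2) by (intro mult_mono) auto
      then show ?thesis by simp
    qed
    show "h n x = 0" if "infdist x S > r" for n x using that r by (simp add: h_def ct_def field_simps)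
    have "(\<lambda>n. h n x) \<longlonglongrightarrow> \<psi> x" if "x \<notin> N" for x
    proof -
      have l: "(\<lambda>n. max (- M) (min M (g n x)) * ct x) \<longlonglongrightarrow> max (- M) (min M (\<psi> x)) * ct x"
        by (intro tendsto_intros g that)
      have "max (- M) (min M (\<psi> x)) = \<psi> x" using assms(3)[of x] by auto
      then have "max (- M) (min M (\<psi> x)) * ct x = \<psi> x" using ct1[of x] S(3)[of x] by (cases "x \<in> S") auto
      then show ?thesis using l by (simp add: h_def)
    qed
    moreover have "AE x in lebesgue. x \<notin> N"
      using N by (simp add: negligible_iff_null_sets AE_not_in)
    ultimately show "AE x in lebesgue. (\<lambda>n. h n x) \<longlonglongrightarrow> \<psi> x" by (auto elim: eventually_mono)
  qed
qed

lemma conv_moll_eq_0: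
  assumes "\<And>y. dist x y < 1 / real (Suc n) \<Longrightarrow> u y = 0" shows "conv (moll n) u x = 0"
proof -
  have "moll n (x - y) * u y = 0" for y
    using assms[of y] moll_eq_0[of n "x - y"] by (cases "dist x y < 1 / real (Suc n)") (auto simp: dist_norm not_less)
  then show ?thesis unfolding conv_def by (simp only: Bochner_Integration.integral_zero)
qed

lemma moll_reflect_integral: "(LINT y|lebesgue. moll n (x - (y::'a::euclidean_space))) = 1"
  using lebesgue_integral_affine[of "moll n :: 'a \<Rightarrow> real" "-1" x]
    borel_measurable_continuous_onI[OF test_fun_continuous[OF moll_test_fun[of n]]] by (simp add: moll_integral)

text \<open>A mollification is a weighted mean over a ball of radius 1/(n+1) with total weight one,
  so it deviates from the central value no more than the function does on that ball.\<close>

lemma conv_moll_close: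
  assumes h: "integrable lebesgue h" and e: "\<And>y. dist x y < 1 / real (Suc n) \<Longrightarrow> \<bar>h y - h x\<bar> \<le> e"
  shows "\<bar>conv (moll n) h x - h x\<bar> \<le> e"
proof -
  have i: "integrable lebesgue (\<lambda>y. moll n (x - y))" by (rule test_fun_integrable[OF test_fun_reflect[OF moll_test_fun]])
  have i1: "integrable lebesgue (\<lambda>y. moll n (x - y) * h y)" by (rule conv_integrable[OF moll_test_fun h])
  have i2: "integrable lebesgue (\<lambda>y. moll n (x - y) * c)" for c using i by simp
  have c: "(LINT y|lebesgue. moll n (x - y) * c) = c" for c using moll_reflect_integral[of n x] by simp
  have "conv (moll n) h x - h x = (LINT y|lebesgue. moll n (x - y) * h y - moll n (x - y) * h x)"
    using i1 i2 c by (simp add: conv_def)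
  moreover have "\<bar>LINT y|lebesgue. moll n (x - y) * h y - moll n (x - y) * h x\<bar>
      \<le> (LINT y|lebesgue. \<bar>moll n (x - y) * h y - moll n (x - y) * h x\<bar>)"
    by (rule integral_abs_bound)
  moreover have "(LINT y|lebesgue. \<bar>moll n (x - y) * h y - moll n (x - y) * h x\<bar>) \<le> (LINT y|lebesgue. moll n (x - y) * e)"
  proof (rule integral_mono)
    fix y
    show "\<bar>moll n (x - y) * h y - moll n (x - y) * h x\<bar> \<le> moll n (x - y) * e"
    proof (cases "dist x y < 1 / real (Suc n)")
      case True
      then show ?thesis using e[of y] moll_nonneg[of n "x - y"]
        by (simp add: right_diff_distrib[symmetric] abs_mult mult_left_mono)
    next
      case False
      then show ?thesis using moll_eq_0[of n "x - y"] by (simp add: dist_norm not_less del: of_nat_Suc)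
    qed
  qed (use i1 i2 in auto)
  ultimately show ?thesis using c by (simp only:)
qed

lemma compact_support_uniformly_continuous:
  fixes h :: "'a::euclidean_space \<Rightarrow> real"
  assumes h: "continuous_on UNIV h" "\<And>x. norm x > R \<Longrightarrow> h x = 0" and e: "e > 0"
  obtains d where "d > 0" "d \<le> 1" "\<And>x y. dist x y < d \<Longrightarrow> \<bar>h y - h x\<bar> \<le> e"
proof -
  \<comment> \<open>The margin one goes with \<open>min d 1\<close> below: if one of two points at
    distance less than one lies beyond \<open>R + 1\<close>, both lie where \<open>h\<close>
    vanishes.\<close>
  have "uniformly_continuous_on (cball 0 (R + 1)) h"
    using h(1) by (intro compact_uniformly_continuous) (auto intro: continuous_on_subset)
  from this[unfolded uniformly_continuous_on_def, rule_format, OF e]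
  obtain d where d: "d > 0" "\<And>x y. x \<in> cball 0 (R + 1) \<Longrightarrow> y \<in> cball 0 (R + 1) \<Longrightarrow> dist y x < d \<Longrightarrow> dist (h y) (h x) < e"
    by blast
  show ?thesis
  proof (rule that[of "min d 1"])
    fix x y :: 'a assume xy: "dist x y < min d 1"
    show "\<bar>h y - h x\<bar> \<le> e"
    proof (cases "norm x \<le> R + 1 \<and> norm y \<le> R + 1")
      case True
      then show ?thesis using d(2)[of x y] xy by (simp add: dist_norm norm_minus_commute)
    next
      case False
      have "norm x \<le> norm y + norm (x - y)" "norm y \<le> norm x + norm (x - y)"
        using norm_triangle_sub[of x y] norm_triangle_sub[of y x] by (auto simp: norm_minus_commute)
      then have "norm x > R" "norm y > R" using False xy by (auto simp: dist_norm)
      then show ?thesis using h(2) e by simp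
    qed
  qed (use d in auto)
qed

text \<open>The function is clipped in range and in space; then the bounded function of compact
  support is replaced by continuous functions with the same bound and a slightly larger support.
  Both steps are dominated convergence.\<close>

lemma L2_dense_continuous:
  fixes u :: "'a::euclidean_space \<Rightarrow> real"
  assumes u: "u \<in> L2 UNIV" and e: "e > 0"
  obtains h R where "continuous_on UNIV h" "\<And>x. norm x > R \<Longrightarrow> h x = 0" "h \<in> L2 UNIV" "L2_norm UNIV (\<lambda>x. h x - u x) < e"
proof -
  have um: "u \<in> borel_measurable (lebesgue_on UNIV)" using u by (rule L2_measurable)
  define v where "v k x = (if x \<in> cball 0 (real k) then max (- real k) (min (real k) (u x)) else 0)" for k x
  have vm: "v k \<in> borel_measurable (lebesgue_on UNIV)" for k
  proof -
    have "(\<lambda>x. max (- real k) (min (real k) (u x))) \<in> borel_measurable (lebesgue_on (cball 0 (real k)))"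
      using um by (intro borel_measurable_max borel_measurable_min measurable_restrict_mono[OF um]) auto
    then show ?thesis unfolding v_def lebesgue_on_UNIV_eq by (intro borel_measurable_if_I) auto
  qed
  have vu: "\<bar>v k x - u x\<bar> \<le> \<bar>u x\<bar>" for k x by (auto simp: v_def)
  have au: "(\<lambda>x. \<bar>u x\<bar>) \<in> L2 UNIV" using u by (auto simp: L2_def)
  have "(\<lambda>k. L2_norm UNIV (\<lambda>x. v k x - u x)) \<longlonglongrightarrow> 0"
  proof (rule L2_norm_dominated_convergence[OF vm um au])
    have "(\<lambda>k. v k x) \<longlonglongrightarrow> u x" for x
    proof (rule tendsto_eventually)
      obtain K where K: "real K \<ge> max (norm x) \<bar>u x\<bar>" using real_arch_simple by blast
      have "v k x = u x" if "k \<ge> K" for k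
      proof -
        have "real k \<ge> norm x" "real k \<ge> \<bar>u x\<bar>" using K that by linarith+
        then show ?thesis by (auto simp: v_def)
      qed
      then show "\<forall>\<^sub>F k in sequentially. v k x = u x" by (auto simp: eventually_sequentially)
    qed
    then show "AE x in lebesgue_on UNIV. (\<lambda>k. v k x) \<longlonglongrightarrow> u x" by simp
  qed (use vu in auto)
  from LIMSEQ_D[OF this, of "e / 2"] obtain k where k: "L2_norm UNIV (\<lambda>x. v k x - u x) < e / 2"
    using e by fastforce
  have bk: "\<bar>v k x\<bar> \<le> real k" for x by (auto simp: v_def)
  obtain h where h: "\<And>n::nat. continuous_on UNIV (h n)" "\<And>n x. \<bar>h n x\<bar> \<le> real k"
    "\<And>n x. infdist x (cball 0 (real k)) > 1 \<Longrightarrow> h n x = 0" "AE x in lebesgue. (\<lambda>n. h n x) \<longlonglongrightarrow> v k x"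
    by (rule bounded_measurable_limit_continuous[of "v k" "real k" "cball 0 (real k)" 1])
      (use vm[of k] bk in \<open>auto simp: lebesgue_on_UNIV_eq v_def\<close>)
  have inf: "infdist x (cball 0 (real k)) > 1" if "norm x > real k + 1" for x :: 'a
  proof -
    have "norm x - real k \<le> (INF y\<in>cball 0 (real k). dist x y)"
    proof (rule cINF_greatest)
      fix y :: 'a assume "y \<in> cball 0 (real k)"
      then show "norm x - real k \<le> dist x y" using norm_triangle_sub[of x y] by (simp add: dist_norm)
    qed auto
    then show ?thesis using that by (simp add: infdist_notempty)
  qed
  have h0: "h n x = 0" if "norm x > real k + 1" for n x using h(3) inf that by blast
  have hm: "h n \<in> borel_measurable (lebesgue_on UNIV)" for n by (rule continuous_lebesgue_measurable[OF h(1)])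
  have c: "(\<lambda>x. if x \<in> cball 0 (real k + 1) then 2 * real k else 0) \<in> L2 (UNIV :: 'a set)"
    by (subst L2_restrict_iff) (auto intro!: L2_const)
  have "(\<lambda>n. L2_norm UNIV (\<lambda>x. h n x - v k x)) \<longlonglongrightarrow> 0"
  proof (rule L2_norm_dominated_convergence[OF hm vm c])
    show "AE x in lebesgue_on UNIV. (\<lambda>n. h n x) \<longlonglongrightarrow> v k x" unfolding lebesgue_on_UNIV_eq by (rule h(4))
    have "\<bar>h n x - v k x\<bar> \<le> (if x \<in> cball 0 (real k + 1) then 2 * real k else 0)" for n x
      using h(2)[of n x] bk[of x] h0[of x n] by (auto simp: v_def)
    then show "AE x in lebesgue_on UNIV. \<bar>h n x - v k x\<bar> \<le> (if x \<in> cball 0 (real k + 1) then 2 * real k else 0)" for n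
      by simp
  qed
  from LIMSEQ_D[OF this, of "e / 2"] obtain n where n: "L2_norm UNIV (\<lambda>x. h n x - v k x) < e / 2"
    using e by fastforce
  have hL: "h n \<in> L2 UNIV"
  proof (rule L2_mono[OF hm c])
    have "\<bar>h n x\<bar> \<le> \<bar>if x \<in> cball 0 (real k + 1) then 2 * real k else 0\<bar>" for x
      using h(2)[of n x] h0[of x n] by auto
    then show "AE x in lebesgue_on UNIV. \<bar>h n x\<bar> \<le> \<bar>if x \<in> cball 0 (real k + 1) then 2 * real k else 0\<bar>" by simp
  qed
  have vL: "v k \<in> L2 UNIV"
    by (rule L2_mono[OF vm u]) (auto simp: v_def)
  have "L2_norm UNIV (\<lambda>x. h n x - u x) \<le> L2_norm UNIV (\<lambda>x. h n x - v k x) + L2_norm UNIV (\<lambda>x. v k x - u x)"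
    using L2_triangle[OF L2_diff[OF hL vL] L2_diff[OF vL u]] by simp
  then have "L2_norm UNIV (\<lambda>x. h n x - u x) < e" using k n by simp
  then show ?thesis using that[OF h(1)[of n] h0 hL] by blast
qed

text \<open>Mollification does not increase the L2 norm, so a dense class suffices. For continuous
  functions of compact support the convergence is uniform and takes place inside one fixed
  ball.\<close>

lemma conv_moll_tendsto_L2:
  fixes u :: "'a::euclidean_space \<Rightarrow> real"
  assumes ui: "integrable lebesgue u" and u: "u \<in> L2 UNIV"
  shows "(\<lambda>n. L2_norm UNIV (\<lambda>x. conv (moll n) u x - u x)) \<longlonglongrightarrow> 0"
proof (rule LIMSEQ_I)
  fix e :: real assume "e > 0"
  then have e: "e / 4 > 0" by simp
  obtain h R where h: "continuous_on UNIV h" "\<And>x. norm x > R \<Longrightarrow> h x = 0" "h \<in> L2 UNIV" "L2_norm UNIV (\<lambda>x. h x - u x) < e / 4"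
    using L2_dense_continuous[OF u e] by blast
  have hi: "integrable lebesgue h"
    by (rule continuous_compact_support_integrable[OF h(1), of "cball 0 R"]) (use h(2) in auto)
  \<comment> \<open>The difference between \<open>h\<close> and its mollification lives in this
    ball, so a uniform bound \<open>d\<close> costs at most \<open>d * m\<close> in norm; the
    divisor \<open>m + 1\<close> in \<open>d\<close> is positive in any case.\<close>
  define m where "m = sqrt (measure lebesgue (cball (0::'a) (R + 1)))"
  have m0: "m \<ge> 0" by (simp add: m_def)
  define d where "d = e / 4 / (m + 1)"
  have d: "d > 0" using \<open>e > 0\<close> m0 by (simp add: d_def)
  obtain r where r: "r > 0" "r \<le> 1" "\<And>x y. dist x y < r \<Longrightarrow> \<bar>h y - h x\<bar> \<le> d"
    using compact_support_uniformly_continuous[OF h(1,2) d] by blast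
  obtain N where N: "1 / real (Suc N) < r" using r(1) nat_approx_posE by blast
  have "norm (L2_norm UNIV (\<lambda>x. conv (moll n) u x - u x) - 0) < e" if n: "n \<ge> N" for n
  proof -
    have nr: "1 / real (Suc n) < r"
    proof -
      have "1 / real (Suc n) \<le> 1 / real (Suc N)" using n by (simp add: frac_le)
      then show ?thesis using N by simp
    qed
    have cu: "conv (moll n) u \<in> L2 UNIV" "conv (moll n) h \<in> L2 UNIV" using conv_moll_L2(1) ui u hi h(3) by blast+
    have hu: "(\<lambda>x. u x - h x) \<in> L2 UNIV" "integrable lebesgue (\<lambda>x. u x - h x)" using L2_diff u h(3) ui hi by auto
    have 1: "L2_norm UNIV (\<lambda>x. conv (moll n) u x - conv (moll n) h x) < e / 4"
    proof -
      have "(\<lambda>x. conv (moll n) u x - conv (moll n) h x) = conv (moll n) (\<lambda>x. u x - h x)"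
        using conv_diff[OF moll_test_fun ui hi] by (auto simp: fun_eq_iff)
      then show ?thesis using conv_moll_L2(2)[OF hu(2,1), of n] h(4) L2_norm_minus_commute[of UNIV u h] by simp
    qed
    have pt: "\<bar>conv (moll n) h x - h x\<bar> \<le> \<bar>if x \<in> cball 0 (R + 1) then d else 0\<bar>" for x
    proof (cases "x \<in> cball 0 (R + 1)")
      case True
      have "\<bar>conv (moll n) h x - h x\<bar> \<le> d"
        by (rule conv_moll_close[OF hi]) (use r(3) nr in \<open>meson order_less_trans\<close>)
      then show ?thesis using True d by simp
    next
      case False
      have "conv (moll n) h x = 0"
      proof (rule conv_moll_eq_0)
        fix y assume "dist x y < 1 / real (Suc n)"
        then have "dist x y < 1" using nr r(2) by linarith
        then show "h y = 0" using False norm_triangle_sub[of x y] by (intro h(2)) (simp add: dist_norm)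
      qed
      then show ?thesis using False h(2)[of x] by simp
    qed
    have c: "(\<lambda>x. if x \<in> cball 0 (R + 1) then d else 0) \<in> L2 (UNIV::'a set)"
      by (subst L2_restrict_iff) (auto intro!: L2_const)
    have 2: "L2_norm UNIV (\<lambda>x. conv (moll n) h x - h x) \<le> d * m"
    proof -
      have "L2_norm UNIV (\<lambda>x. conv (moll n) h x - h x) \<le> L2_norm UNIV (\<lambda>x::'a. if x \<in> cball 0 (R + 1) then d else 0)"
        using pt by (intro L2_norm_mono_AE[OF L2_measurable[OF L2_diff[OF cu(2) h(3)]] c]) simp
      also have "\<dots> = d * m" using d by (subst L2_norm_restrict) (auto simp: L2_norm_const m_def)
      finally show ?thesis .
    qed
    have "d * m \<le> d * (m + 1)" using d by (intro mult_left_mono) auto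
    also have "d * (m + 1) = e / 4" using m0 unfolding d_def by (intro nonzero_eq_divide_eq[THEN iffD1, OF _ refl]) simp
    finally have 3: "d * m \<le> e / 4" .
    have "L2_norm UNIV (\<lambda>x. conv (moll n) u x - u x) \<le> L2_norm UNIV (\<lambda>x. conv (moll n) u x - conv (moll n) h x)
       + L2_norm UNIV (\<lambda>x. (conv (moll n) h x - h x) + (h x - u x))"
      using L2_triangle[OF L2_diff[OF cu] L2_add[OF L2_diff[OF cu(2) h(3)] L2_diff[OF h(3) u]]] by simp
    also have "L2_norm UNIV (\<lambda>x. (conv (moll n) h x - h x) + (h x - u x)) \<le> L2_norm UNIV (\<lambda>x. conv (moll n) h x - h x) + L2_norm UNIV (\<lambda>x. h x - u x)"
      by (rule L2_triangle[OF L2_diff[OF cu(2) h(3)] L2_diff[OF h(3) u]])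
    finally have "L2_norm UNIV (\<lambda>x. conv (moll n) u x - u x) < e" using 1 2 3 h(4) \<open>e > 0\<close> by simp
    then show ?thesis by simp
  qed
  then show "\<exists>N. \<forall>n\<ge>N. norm (L2_norm UNIV (\<lambda>x. conv (moll n) u x - u x) - 0) < e" by blast
qed

text \<open>Doubling the radius puts the point into an open set on which the mollifier vanishes, so
  that its derivative can be read off.\<close>

lemma pderiv_moll_eq_0:
  assumes "2 / real (Suc n) \<le> norm z" shows "pderiv_dir b (moll n) z = 0"
proof (rule pderiv_dir_eqI[where f'="\<lambda>h. 0"], rule has_derivative_transform_within_open)
  let ?S = "- cball (0::'a) (1 / real (Suc n))"
  show "((\<lambda>x. 0) has_derivative (\<lambda>h. 0)) (at z)" by (rule has_derivative_const)
  show "open ?S" by (intro open_Compl closed_cball)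
  have "1 / real (Suc n) < 2 / real (Suc n)" by (simp add: divide_strict_right_mono)
  then show "z \<in> ?S" using assms by (simp del: of_nat_Suc)
  show "0 = moll n y" if "y \<in> ?S" for y using that by (intro moll_eq_0[symmetric]) (simp del: of_nat_Suc)
qed

section \<open>Weak derivatives\<close>

lemma loc_integrable_diff: "loc_integrable \<Omega> u \<Longrightarrow> loc_integrable \<Omega> v \<Longrightarrow> loc_integrable \<Omega> (\<lambda>x. u x - v x)"
  by (auto simp: loc_integrable_def)

lemma loc_integrable_mult:
  assumes "\<Omega> \<in> sets lebesgue" "loc_integrable \<Omega> g" "compact S" "S \<subseteq> \<Omega>" "\<And>x. x \<notin> S \<Longrightarrow> w x = 0"
    "w \<in> borel_measurable lebesgue" "\<And>x. \<bar>w x\<bar> \<le> M"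
  shows "integrable lebesgue (\<lambda>x. if x \<in> S then g x * w x else 0)"
    "integrable (lebesgue_on \<Omega>) (\<lambda>x. g x * w x)"
    "L2_inner \<Omega> g w = (LINT x|lebesgue. (if x \<in> S then g x * w x else 0))"
proof -
  have Sm: "S \<in> sets lebesgue" using assms(3) lmeasurable_compact by blast
  have gS: "integrable lebesgue (\<lambda>x. if x \<in> S then g x else 0)"
    using assms(2,3,4) Sm by (simp add: loc_integrable_def Lebesgue_Measure.integrable_restrict_UNIV)
  have eq: "(\<lambda>x. if x \<in> S then g x * w x else 0) = (\<lambda>x. w x * (if x \<in> S then g x else 0))" by auto
  show i: "integrable lebesgue (\<lambda>x. if x \<in> S then g x * w x else 0)" unfolding eq
  proof (rule Bochner_Integration.integrable_bound[where f="\<lambda>x. M * (if x \<in> S then g x else 0)"])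
    show "integrable lebesgue (\<lambda>x. M * (if x \<in> S then g x else 0))" using gS by simp
    show "(\<lambda>x. w x * (if x \<in> S then g x else 0)) \<in> borel_measurable lebesgue"
      using assms(6) borel_measurable_integrable[OF gS] by (rule borel_measurable_times)
    have M: "0 \<le> M" using assms(7)[of undefined] by linarith
    show "AE x in lebesgue. norm (w x * (if x \<in> S then g x else 0)) \<le> norm (M * (if x \<in> S then g x else 0))"
      using assms(7) M by (auto simp: abs_mult intro!: mult_right_mono)
  qed
  have eq2: "(\<lambda>x. if x \<in> S then g x * w x else 0) = (\<lambda>x. if x \<in> \<Omega> then g x * w x else 0)"
    using assms(4,5) by (auto simp: fun_eq_iff)
  show "integrable (lebesgue_on \<Omega>) (\<lambda>x. g x * w x)"
    using i assms(1) unfolding eq2 by (simp add: Lebesgue_Measure.integrable_restrict_UNIV)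
  show "L2_inner \<Omega> g w = (LINT x|lebesgue. (if x \<in> S then g x * w x else 0))"
    unfolding eq2 L2_inner_def using assms(1) by (simp add: Lebesgue_Measure.integral_restrict_UNIV)
qed

lemma loc_integrable_test_fun:
  assumes "\<Omega> \<in> sets lebesgue" "loc_integrable \<Omega> g" "\<phi> \<in> test_fun \<Omega>"
  shows "integrable (lebesgue_on \<Omega>) (\<lambda>x. g x * \<phi> x)"
proof -
  obtain S where S: "compact S" "S \<subseteq> \<Omega>" "\<And>x. x \<notin> S \<Longrightarrow> \<phi> x = 0" "\<And>b x. x \<notin> S \<Longrightarrow> pderiv_dir b \<phi> x = 0"
    using test_fun_support[OF assms(3)] by blast
  obtain M where M: "M \<ge> 0" "\<And>x. \<bar>\<phi> x\<bar> \<le> M" using test_fun_bounded[OF assms(3)] by blast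
  have m: "\<phi> \<in> borel_measurable lebesgue"
    using test_fun_measurable[OF assms(3), of UNIV] unfolding lebesgue_on_UNIV_eq .
  show ?thesis by (rule loc_integrable_mult(2)[OF assms(1,2) S(1,2,3) m M(2)])
qed

lemma compact_infdist_neighbourhood:
  fixes S :: "'a::euclidean_space set"
  assumes "compact S" "S \<noteq> {}" "open \<Omega>" "S \<subseteq> \<Omega>"
  obtains r where "r > 0" "{x. infdist x S \<le> r} \<subseteq> \<Omega>" "compact {x. infdist x S \<le> r}"
proof -
  obtain r where "r > 0" "{x. infdist x S \<le> r} \<subseteq> \<Omega>"
    using compact_in_open_separated[OF assms(2,1,3,4)] by blast
  then show ?thesis using that compact_infdist_le[OF assms(2,1)] by blast
qed

text \<open>On a compact \<open>S\<close> the sign of \<open>g\<close> is approximated by test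
  functions supported near \<open>S\<close>; the vanishing pairings converge to the integral of
  \<open>\<bar>g\<bar>\<close> over \<open>S\<close>. Local integrability gives a majorant on
  compact sets only, hence the detour through them.\<close>

lemma du_Bois_Reymond:
  fixes g :: "'a::euclidean_space \<Rightarrow> real"
  assumes \<Omega>: "open \<Omega>" and g: "loc_integrable \<Omega> g" and z: "\<And>\<phi>. \<phi> \<in> test_fun \<Omega> \<Longrightarrow> L2_inner \<Omega> g \<phi> = 0"
  shows "AE x in lebesgue_on \<Omega>. g x = 0"
proof -
  have \<Omega>m: "\<Omega> \<in> sets lebesgue" using \<Omega> by auto
  have K: "AE x in lebesgue. x \<in> S \<longrightarrow> g x = 0" if S: "compact S" "S \<subseteq> \<Omega>" "S \<noteq> {}" for S
  proof -
    obtain r where r: "r > 0" "{x. infdist x S \<le> r} \<subseteq> \<Omega>" "compact {x. infdist x S \<le> r}"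
      using compact_infdist_neighbourhood[OF S(1,3) \<Omega> S(2)] by blast
    define T where "T = {x. infdist x S \<le> r}"
    have T: "compact T" "T \<subseteq> \<Omega>" using r by (auto simp: T_def)
    have Sm: "S \<in> sets lebesgue" using S(1) lmeasurable_compact by blast
    define \<psi> where "\<psi> x = (if x \<in> S then sgn (g x) else 0)" for x
    have "g \<in> borel_measurable (lebesgue_on S)" using g S by (auto simp: loc_integrable_def)
    then have "(\<lambda>x. sgn (g x)) \<in> borel_measurable (lebesgue_on S)" unfolding sgn_real_def by measurable
    then have \<psi>m: "\<psi> \<in> borel_measurable lebesgue" unfolding \<psi>_def using Sm by (rule borel_measurable_if_I)
    have \<psi>1: "\<bar>\<psi> x\<bar> \<le> 1" for x by (simp add: \<psi>_def sgn_if)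
    have r2: "r / 2 > 0" using r by simp
    obtain h where h: "\<And>n::nat. continuous_on UNIV (h n)" "\<And>n x. \<bar>h n x\<bar> \<le> 1"
      "\<And>n x. infdist x S > r / 2 \<Longrightarrow> h n x = 0" "AE x in lebesgue. (\<lambda>n. h n x) \<longlonglongrightarrow> \<psi> x"
      by (rule bounded_measurable_limit_continuous[OF \<psi>m _ \<psi>1 S(1,3) _ r2]) (auto simp: \<psi>_def)
    obtain R where R: "\<And>x. x \<in> T \<Longrightarrow> norm x \<le> R" using compact_imp_bounded[OF T(1)] by (auto simp: bounded_iff)
    have hT: "h n x = 0" if "x \<notin> T" for n x using that r by (intro h(3)) (simp add: T_def)
    have hi: "integrable lebesgue (h n)" for n by (rule continuous_compact_support_integrable[OF h(1) T(1) hT])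
    \<comment> \<open>The mollification radius is chosen after \<open>n\<close>: small enough to be
      uniformly close to \<open>h n\<close>, and less than \<open>r / 2\<close>, so that the
      support, already within \<open>r / 2\<close> of \<open>S\<close>, stays inside
      \<open>T\<close>.\<close>
    have "\<exists>m. 1 / real (Suc m) < r / 2 \<and> (\<forall>x. \<bar>conv (moll m) (h n) x - h n x\<bar> \<le> 1 / real (Suc n))" for n
    proof -
      have h0: "norm x > R \<Longrightarrow> h n x = 0" for x using R[of x] by (intro hT) force
      have e0: "0 < 1 / real (Suc n)" by simp
      obtain d where d: "d > 0" "d \<le> 1" "\<And>x y. dist x y < d \<Longrightarrow> \<bar>h n y - h n x\<bar> \<le> 1 / real (Suc n)"
        using compact_support_uniformly_continuous[OF h(1) h0 e0] by blast
      obtain m where m: "1 / real (Suc m) < min d (r / 2)" using nat_approx_posE[of "min d (r / 2)"] d(1) r2 by auto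
      show ?thesis
      proof (intro exI[of _ m] conjI allI)
        show "1 / real (Suc m) < r / 2" using m by simp
        show "\<bar>conv (moll m) (h n) x - h n x\<bar> \<le> 1 / real (Suc n)" for x
        proof (rule conv_moll_close[OF hi])
          fix y assume "dist x y < 1 / real (Suc m)"
          then show "\<bar>h n y - h n x\<bar> \<le> 1 / real (Suc n)" using m by (intro d(3)) simp
        qed
      qed
    qed
    then obtain m where m: "\<And>n. 1 / real (Suc (m n)) < r / 2"
      "\<And>n x. \<bar>conv (moll (m n)) (h n) x - h n x\<bar> \<le> 1 / real (Suc n)" by metis
    define \<phi> where "\<phi> n = conv (moll (m n)) (h n)" for n
    have \<phi>T: "\<phi> n x = 0" if "x \<notin> T" for n x unfolding \<phi>_def
    proof (rule conv_moll_eq_0)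
      fix y assume y: "dist x y < 1 / real (Suc (m n))"
      have "infdist x S \<le> infdist y S + dist x y" by (rule infdist_triangle)
      then show "h n y = 0" using that y m(1)[of n] by (intro h(3)) (simp add: T_def)
    qed
    have \<phi>s: "smooth (\<phi> n)" for n unfolding \<phi>_def by (rule smooth_conv[OF moll_test_fun hi])
    have \<phi>t: "\<phi> n \<in> test_fun \<Omega>" for n by (rule test_funI[OF \<phi>s T \<phi>T])
    have \<phi>2: "\<bar>\<phi> n x\<bar> \<le> 2" for n x
    proof -
      have "1 / real (Suc n) \<le> 1" by simp
      then show ?thesis using m(2)[of n x] h(2)[of n x] unfolding \<phi>_def by linarith
    qed
    have lim: "AE x in lebesgue. (\<lambda>n. \<phi> n x) \<longlonglongrightarrow> \<psi> x" using h(4)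
    proof eventually_elim
      case (elim x)
      have "(\<lambda>n. \<phi> n x - h n x) \<longlonglongrightarrow> 0"
        by (rule Lim_null_comparison[OF _ LIMSEQ_Suc[OF lim_1_over_n]]) (use m(2) in \<open>simp add: \<phi>_def del: of_nat_Suc\<close>)
      from tendsto_add[OF this elim] show ?case by simp
    qed
    have \<phi>m: "\<phi> n \<in> borel_measurable lebesgue" for n
      using test_fun_measurable[OF \<phi>t, of n UNIV] by (simp only: lebesgue_on_UNIV_eq)
    have zero: "(LINT x|lebesgue. (if x \<in> T then g x * \<phi> n x else 0)) = 0" for n
      using loc_integrable_mult(3)[OF \<Omega>m g T \<phi>T \<phi>m \<phi>2] z[OF \<phi>t] by simp
    have \<psi>T: "\<psi> x = 0" if "x \<notin> T" for x using that r(1) by (auto simp: \<psi>_def T_def)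
    have "(\<lambda>n. LINT x|lebesgue. (if x \<in> T then g x * \<phi> n x else 0)) \<longlonglongrightarrow> (LINT x|lebesgue. (if x \<in> T then g x * \<psi> x else 0))"
    proof (rule integral_dominated_convergence[where w="\<lambda>x. 2 * \<bar>if x \<in> T then g x else 0\<bar>"])
      have "T \<in> sets lebesgue" using T(1) lmeasurable_compact by blast
      then have "integrable lebesgue (\<lambda>x. if x \<in> T then g x else 0)"
        using g T by (simp add: loc_integrable_def Lebesgue_Measure.integrable_restrict_UNIV)
      then show "integrable lebesgue (\<lambda>x. 2 * \<bar>if x \<in> T then g x else 0\<bar>)" by (intro integrable_mult_right integrable_abs)
      show "(\<lambda>x. if x \<in> T then g x * \<phi> n x else 0) \<in> borel_measurable lebesgue" for n
        using loc_integrable_mult(1)[OF \<Omega>m g T \<phi>T \<phi>m \<phi>2] by (rule borel_measurable_integrable)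
      show "(\<lambda>x. if x \<in> T then g x * \<psi> x else 0) \<in> borel_measurable lebesgue"
        using loc_integrable_mult(1)[OF \<Omega>m g T \<psi>T \<psi>m \<psi>1] by (rule borel_measurable_integrable)
      show "AE x in lebesgue. (\<lambda>n. if x \<in> T then g x * \<phi> n x else 0) \<longlonglongrightarrow> (if x \<in> T then g x * \<psi> x else 0)"
        using lim by eventually_elim (auto intro!: tendsto_intros)
      show "AE x in lebesgue. norm (if x \<in> T then g x * \<phi> n x else 0) \<le> 2 * \<bar>if x \<in> T then g x else 0\<bar>" for n
        using mult_left_mono[OF \<phi>2 abs_ge_zero] by (intro AE_I2) (auto simp: abs_mult mult.commute[of 2])
    qed
    then have "(LINT x|lebesgue. (if x \<in> T then g x * \<psi> x else 0)) = 0" unfolding zero by (simp add: LIMSEQ_const_iff)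
    moreover have "integrable lebesgue (\<lambda>x. if x \<in> T then g x * \<psi> x else 0)"
      using loc_integrable_mult(1)[OF \<Omega>m g T \<psi>T \<psi>m \<psi>1] .
    moreover have nn: "0 \<le> (if x \<in> T then g x * \<psi> x else 0)" for x by (auto simp: \<psi>_def sgn_if mult_nonneg_nonneg)
    ultimately have "AE x in lebesgue. (if x \<in> T then g x * \<psi> x else 0) = 0"
      using integral_nonneg_eq_0_iff_AE by blast
    then show ?thesis
    proof eventually_elim
      case (elim x)
      have "x \<in> S \<Longrightarrow> x \<in> T" using r(1) by (simp add: T_def)
      then show ?case using elim by (auto simp: \<psi>_def sgn_if split: if_splits)
    qed
  qed
  \<comment> \<open>Countably many compact sets exhaust the domain, so the exceptional null sets may
    be united.\<close>
  have "\<exists>C::nat \<Rightarrow> 'a set. (\<forall>n. compact (C n)) \<and> (\<forall>n. C n \<subseteq> \<Omega>) \<and> \<Union>(range C) = \<Omega>"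
    by (rule open_Union_compact_subsets[OF \<Omega>]) blast
  then obtain C :: "nat \<Rightarrow> 'a set" where C: "\<And>n. compact (C n)" "\<And>n. C n \<subseteq> \<Omega>" "\<Union>(range C) = \<Omega>" by blast
  have "AE x in lebesgue. \<forall>n. x \<in> C n \<longrightarrow> g x = 0"
    unfolding AE_all_countable
  proof
    fix n show "AE x in lebesgue. x \<in> C n \<longrightarrow> g x = 0" using K[OF C(1,2), of n] by (cases "C n = {}") auto
  qed
  then have "AE x in lebesgue. x \<in> \<Omega> \<longrightarrow> g x = 0" by eventually_elim (use C(3) in auto)
  then show ?thesis using \<Omega>m by (simp add: AE_restrict_space_iff)
qed

lemma has_weak_pderiv_diff:
  assumes \<Omega>: "\<Omega> \<in> sets lebesgue" and b: "b \<in> Basis" and u: "has_weak_pderiv \<Omega> b u g" and v: "has_weak_pderiv \<Omega> b v h"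
  shows "has_weak_pderiv \<Omega> b (\<lambda>x. u x - v x) (\<lambda>x. g x - h x)"
proof -
  have l: "loc_integrable \<Omega> u" "loc_integrable \<Omega> v" "loc_integrable \<Omega> g" "loc_integrable \<Omega> h"
    using u v by (auto simp: has_weak_pderiv_def)
  have d: "L2_inner \<Omega> (\<lambda>x. p x - q x) \<phi> = L2_inner \<Omega> p \<phi> - L2_inner \<Omega> q \<phi>"
    if "loc_integrable \<Omega> p" "loc_integrable \<Omega> q" "\<phi> \<in> test_fun \<Omega>" for p q \<phi>
    using loc_integrable_test_fun[OF \<Omega> that(1,3)] loc_integrable_test_fun[OF \<Omega> that(2,3)]
    by (simp add: L2_inner_def left_diff_distrib)
  show ?thesis unfolding has_weak_pderiv_def
  proof (intro conjI ballI loc_integrable_diff l)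
    fix \<phi> assume \<phi>: "\<phi> \<in> test_fun \<Omega>"
    show "L2_inner \<Omega> (\<lambda>x. u x - v x) (pderiv_dir b \<phi>) = - L2_inner \<Omega> (\<lambda>x. g x - h x) \<phi>"
      using u v \<phi> d[OF l(1,2) pderiv_test_fun[OF \<phi> b]] d[OF l(3,4) \<phi>] by (simp add: has_weak_pderiv_def)
  qed
qed

lemma has_weak_pderiv_unique:
  assumes "open \<Omega>" "b \<in> Basis" "has_weak_pderiv \<Omega> b u g" "has_weak_pderiv \<Omega> b u h"
  shows "AE x in lebesgue_on \<Omega>. g x = h x"
proof -
  have \<Omega>: "\<Omega> \<in> sets lebesgue" using assms(1) by auto
  have w: "has_weak_pderiv \<Omega> b (\<lambda>x. u x - u x) (\<lambda>x. g x - h x)"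
    by (rule has_weak_pderiv_diff[OF \<Omega> assms(2,3,4)])
  have "AE x in lebesgue_on \<Omega>. g x - h x = 0"
  proof (rule du_Bois_Reymond[OF assms(1)])
    show "loc_integrable \<Omega> (\<lambda>x. g x - h x)" using w by (simp add: has_weak_pderiv_def)
    fix \<phi> assume \<phi>: "\<phi> \<in> test_fun \<Omega>"
    have "L2_inner \<Omega> (\<lambda>x. u x - u x) (pderiv_dir b \<phi>) = - L2_inner \<Omega> (\<lambda>x. g x - h x) \<phi>"
      using w \<phi> unfolding has_weak_pderiv_def by blast
    then show "L2_inner \<Omega> (\<lambda>x. g x - h x) \<phi> = 0" by (simp add: L2_inner_def)
  qed
  then show ?thesis by eventually_elim simp
qed

lemma has_weak_pderiv_some: "has_weak_pderiv \<Omega> b u g \<Longrightarrow> has_weak_pderiv \<Omega> b u (weak_pderiv \<Omega> b u)"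
  unfolding weak_pderiv_def by (rule someI[where P="has_weak_pderiv \<Omega> b u"])

text \<open>This is the access to the chosen representative: exhibit any weak derivative and
  transfer its properties off a null set.\<close>

lemma weak_pderiv_AE:
  assumes "open \<Omega>" "b \<in> Basis" "has_weak_pderiv \<Omega> b u g"
  shows "AE x in lebesgue_on \<Omega>. g x = weak_pderiv \<Omega> b u x"
  by (rule has_weak_pderiv_unique[OF assms has_weak_pderiv_some[OF assms(3)]])

lemma H1_L2: "u \<in> H1 \<Omega> \<Longrightarrow> u \<in> L2 \<Omega>" by (simp add: H1_def)

lemma H1_weak_pderiv:
  assumes "open \<Omega>" "u \<in> H1 \<Omega>" "b \<in> Basis"
  shows "has_weak_pderiv \<Omega> b u (weak_pderiv \<Omega> b u)" "weak_pderiv \<Omega> b u \<in> L2 \<Omega>"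
proof -
  obtain g where g: "g \<in> L2 \<Omega>" "has_weak_pderiv \<Omega> b u g" using assms by (auto simp: H1_def)
  show "has_weak_pderiv \<Omega> b u (weak_pderiv \<Omega> b u)" by (rule has_weak_pderiv_some[OF g(2)])
  show "weak_pderiv \<Omega> b u \<in> L2 \<Omega>"
    by (rule L2_cong_AE[OF _ g(1) weak_pderiv_AE[OF assms(1,3) g(2)]]) (use assms(1) in auto)
qed

lemma H1I: "u \<in> L2 \<Omega> \<Longrightarrow> (\<And>b. b \<in> Basis \<Longrightarrow> g b \<in> L2 \<Omega> \<and> has_weak_pderiv \<Omega> b u (g b)) \<Longrightarrow> u \<in> H1 \<Omega>"
  by (auto simp: H1_def)

lemma H1_diff:
  assumes "open \<Omega>" "u \<in> H1 \<Omega>" "v \<in> H1 \<Omega>"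
  shows "(\<lambda>x. u x - v x) \<in> H1 \<Omega>"
    and "b \<in> Basis \<Longrightarrow> AE x in lebesgue_on \<Omega>. weak_pderiv \<Omega> b u x - weak_pderiv \<Omega> b v x = weak_pderiv \<Omega> b (\<lambda>x. u x - v x) x"
proof -
  have \<Omega>: "\<Omega> \<in> sets lebesgue" using assms(1) by auto
  have w: "has_weak_pderiv \<Omega> b (\<lambda>x. u x - v x) (\<lambda>x. weak_pderiv \<Omega> b u x - weak_pderiv \<Omega> b v x)" if "b \<in> Basis" for b
    using H1_weak_pderiv(1)[OF assms(1) _ that] assms(2,3) by (intro has_weak_pderiv_diff[OF \<Omega> that])
  show "(\<lambda>x. u x - v x) \<in> H1 \<Omega>"
  proof (rule H1I[where g="\<lambda>b x. weak_pderiv \<Omega> b u x - weak_pderiv \<Omega> b v x"])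
    show "(\<lambda>x. u x - v x) \<in> L2 \<Omega>" by (rule L2_diff[OF H1_L2[OF assms(2)] H1_L2[OF assms(3)]])
    fix b :: 'a assume b: "b \<in> Basis"
    show "(\<lambda>x. weak_pderiv \<Omega> b u x - weak_pderiv \<Omega> b v x) \<in> L2 \<Omega> \<and>
        has_weak_pderiv \<Omega> b (\<lambda>x. u x - v x) (\<lambda>x. weak_pderiv \<Omega> b u x - weak_pderiv \<Omega> b v x)"
      using L2_diff[OF H1_weak_pderiv(2)[OF assms(1,2) b] H1_weak_pderiv(2)[OF assms(1,3) b]] w[OF b] by simp
  qed
  show "AE x in lebesgue_on \<Omega>. weak_pderiv \<Omega> b u x - weak_pderiv \<Omega> b v x = weak_pderiv \<Omega> b (\<lambda>x. u x - v x) x" if "b \<in> Basis"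
    by (rule weak_pderiv_AE[OF assms(1) that w[OF that]])
qed

lemma L2_norm_le_H1_norm: "L2_norm \<Omega> u \<le> H1_norm \<Omega> u"
  unfolding H1_norm_def by (rule real_le_rsqrt) (simp add: sum_nonneg)

lemma weak_pderiv_le_H1_norm:
  assumes "b \<in> Basis" shows "L2_norm \<Omega> (weak_pderiv \<Omega> b u) \<le> H1_norm \<Omega> u"
  unfolding H1_norm_def
proof (rule real_le_rsqrt)
  have "(L2_norm \<Omega> (weak_pderiv \<Omega> b u))\<^sup>2 \<le> (\<Sum>b\<in>Basis. (L2_norm \<Omega> (weak_pderiv \<Omega> b u))\<^sup>2)"
    using assms by (intro member_le_sum) auto
  then show "(L2_norm \<Omega> (weak_pderiv \<Omega> b u))\<^sup>2 \<le> (L2_norm \<Omega> u)\<^sup>2 + (\<Sum>b\<in>Basis. (L2_norm \<Omega> (weak_pderiv \<Omega> b u))\<^sup>2)"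
    by (simp add: add_increasing)
qed

lemma H1_norm_le: "H1_norm \<Omega> u \<le> L2_norm \<Omega> u + (\<Sum>b\<in>Basis. L2_norm \<Omega> (weak_pderiv \<Omega> b u))"
proof -
  have "(\<Sum>b\<in>B. (f b)\<^sup>2) \<le> (\<Sum>b\<in>B. f b)\<^sup>2" if "finite B" "\<And>b. f b \<ge> 0" for f :: "'a \<Rightarrow> real" and B
    using that(1)
  proof (induction B)
    case (insert b B)
    have "0 \<le> f b * (\<Sum>b\<in>B. f b)" using that(2) by (intro mult_nonneg_nonneg sum_nonneg) auto
    then show ?case using insert by (simp add: power2_sum)
  qed simp
  note s = this
  have "(\<Sum>b\<in>Basis. (L2_norm \<Omega> (weak_pderiv \<Omega> b u))\<^sup>2) \<le> (\<Sum>b\<in>Basis. L2_norm \<Omega> (weak_pderiv \<Omega> b u))\<^sup>2"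
    by (intro s) auto
  moreover have "0 \<le> L2_norm \<Omega> u * (\<Sum>b\<in>Basis. L2_norm \<Omega> (weak_pderiv \<Omega> b u))"
    by (intro mult_nonneg_nonneg sum_nonneg) auto
  ultimately have "(L2_norm \<Omega> u)\<^sup>2 + (\<Sum>b\<in>Basis. (L2_norm \<Omega> (weak_pderiv \<Omega> b u))\<^sup>2)
      \<le> (L2_norm \<Omega> u + (\<Sum>b\<in>Basis. L2_norm \<Omega> (weak_pderiv \<Omega> b u)))\<^sup>2"
    by (simp add: power2_sum)
  then show ?thesis unfolding H1_norm_def by (intro real_le_lsqrt add_nonneg_nonneg sum_nonneg) auto
qed

text \<open>For fixed \<open>x\<close> the reflected kernel
  \<open>\<lambda>y. \<eta> (x - y)\<close> is itself a test function supported in the ball, so the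
  definition of the weak derivative applies to it. The sign from the reflection cancels the sign
  from the integration by parts.\<close>

lemma conv_weak_pderiv:
  fixes u :: "'a::euclidean_space \<Rightarrow> real"
  assumes \<Omega>: "open \<Omega>" and b: "b \<in> Basis" and w: "has_weak_pderiv \<Omega> b u g"
    and \<eta>: "\<eta> \<in> test_fun UNIV" "\<And>z. r \<le> norm z \<Longrightarrow> \<eta> z = 0" and x: "cball x r \<subseteq> \<Omega>"
  shows "conv (pderiv_dir b \<eta>) (\<lambda>x. if x \<in> \<Omega> then u x else 0) x = conv \<eta> (\<lambda>x. if x \<in> \<Omega> then g x else 0) x"
proof -
  have \<Omega>m: "\<Omega> \<in> sets lebesgue" using \<Omega> by auto
  have "(\<lambda>y. \<eta> (x - y)) \<in> test_fun \<Omega>"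
  proof (rule test_funI[OF test_fun_smooth[OF test_fun_reflect[OF \<eta>(1)]] compact_cball x])
    show "\<eta> (x - y) = 0" if "y \<notin> cball x r" for y using that by (intro \<eta>(2)) (auto simp: dist_norm)
  qed
  then have "L2_inner \<Omega> u (pderiv_dir b (\<lambda>y. \<eta> (x - y))) = - L2_inner \<Omega> g (\<lambda>y. \<eta> (x - y))"
    using w unfolding has_weak_pderiv_def by blast
  then have "(LINT y|lebesgue_on \<Omega>. pderiv_dir b \<eta> (x - y) * u y) = (LINT y|lebesgue_on \<Omega>. \<eta> (x - y) * g y)"
    by (simp add: pderiv_dir_reflect[OF test_fun_smooth[OF \<eta>(1)]] L2_inner_def mult.commute)
  moreover have "conv \<eta> (\<lambda>x. if x \<in> \<Omega> then u x else 0) x = (LINT y|lebesgue_on \<Omega>. \<eta> (x - y) * u y)" for \<eta> u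
  proof -
    have "(\<lambda>y. \<eta> (x - y) * (if y \<in> \<Omega> then u y else 0)) = (\<lambda>y. if y \<in> \<Omega> then \<eta> (x - y) * u y else 0)" by auto
    then show ?thesis unfolding conv_def using \<Omega>m by (simp add: Lebesgue_Measure.integral_restrict_UNIV)
  qed
  ultimately show ?thesis by simp
qed

text \<open>Discrete integration by parts: translation invariance moves a difference quotient from
  \<open>\<phi>\<close> to \<open>v\<close>, and dominated convergence passes to the limit on both
  sides, with the two Lipschitz constants in the majorants. Differentiability along \<open>b\<close>
  almost everywhere is assumed, so Rademacher's theorem does not enter.\<close>

lemma Lipschitz_has_weak_pderiv:
  fixes v :: "'a::euclidean_space \<Rightarrow> real"
  assumes b: "b \<in> Basis" and L: "\<And>x y. \<bar>v x - v y\<bar> \<le> L * norm (x - y)"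
    and d: "AE x in lebesgue. ((\<lambda>t. (v (x + t *\<^sub>R b) - v x) / t) \<longlongrightarrow> G x) (at 0)"
    and G: "G \<in> borel_measurable lebesgue" and \<Omega>: "\<Omega> \<in> sets lebesgue"
  shows "has_weak_pderiv \<Omega> b v G"
proof -
  have La: "\<bar>v x - v y\<bar> \<le> \<bar>L\<bar> * norm (x - y)" for x y
    by (rule order_trans[OF L mult_right_mono]) auto
  have vc: "continuous_on UNIV v"
    by (rule lipschitz_on_continuous_on[of "\<bar>L\<bar>"], rule lipschitz_onI) (use La in \<open>auto simp: dist_norm\<close>)
  have vm: "v \<in> borel_measurable lebesgue" using continuous_lebesgue_measurable[OF vc, of UNIV] unfolding lebesgue_on_UNIV_eq .
  have nb: "norm b = 1" using b by simp
  have q: "\<bar>(v (x + t *\<^sub>R b) - v x) / t\<bar> \<le> \<bar>L\<bar>" if "t \<noteq> 0" for x t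
  proof -
    have "\<bar>v (x + t *\<^sub>R b) - v x\<bar> \<le> \<bar>L\<bar> * \<bar>t\<bar>" using La[of "x + t *\<^sub>R b" x] nb by simp
    then show ?thesis using that by (simp add: abs_divide divide_le_eq)
  qed
  have GL: "AE x in lebesgue. \<bar>G x\<bar> \<le> \<bar>L\<bar>" using d
  proof eventually_elim
    case (elim x)
    show ?case
    proof (rule tendsto_upperbound[OF tendsto_rabs[OF elim]])
      show "\<forall>\<^sub>F t in at 0. \<bar>(v (x + t *\<^sub>R b) - v x) / t\<bar> \<le> \<bar>L\<bar>"
        using q by (auto simp: eventually_at_filter intro!: always_eventually)
    qed simp
  qed
  have li: "loc_integrable \<Omega> w" if wm: "w \<in> borel_measurable lebesgue" and wb: "\<And>S. compact S \<Longrightarrow> \<exists>M. AE x in lebesgue. x \<in> S \<longrightarrow> \<bar>w x\<bar> \<le> M"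
    for w :: "'a \<Rightarrow> real"
    unfolding loc_integrable_def
  proof (intro allI impI)
    fix S assume S: "compact S \<and> S \<subseteq> \<Omega>"
    then have Sm: "S \<in> lmeasurable" by (simp add: lmeasurable_compact)
    obtain M where M: "AE x in lebesgue. x \<in> S \<longrightarrow> \<bar>w x\<bar> \<le> M" using wb S by blast
    show "integrable (lebesgue_on S) w"
    proof (rule finite_measure.integrable_const_bound[OF finite_measure_lebesgue_on[OF Sm]])
      show "AE x in lebesgue_on S. norm (w x) \<le> M" using M Sm by (simp add: AE_restrict_space_iff fmeasurableD)
      show "w \<in> borel_measurable (lebesgue_on S)" by (rule measurable_restrict_space1[OF wm])
    qed
  qed
  show ?thesis unfolding has_weak_pderiv_def
  proof (intro conjI ballI)
    show "loc_integrable \<Omega> v"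
    proof (rule li[OF vm])
      fix S :: "'a set" assume "compact S"
      then have "bounded (v ` S)"
        by (intro compact_imp_bounded compact_continuous_image continuous_on_subset[OF vc]) auto
      then obtain M where "\<And>x. x \<in> S \<Longrightarrow> \<bar>v x\<bar> \<le> M" by (auto simp: bounded_iff)
      then show "\<exists>M. AE x in lebesgue. x \<in> S \<longrightarrow> \<bar>v x\<bar> \<le> M" by auto
    qed
    show "loc_integrable \<Omega> G"
      by (rule li[OF G]) (use GL in \<open>auto elim: eventually_mono intro!: exI[of _ "\<bar>L\<bar>"]\<close>)
    fix \<phi> assume \<phi>: "\<phi> \<in> test_fun \<Omega>"
    obtain S where S: "compact S" "S \<subseteq> \<Omega>" "\<And>x. x \<notin> S \<Longrightarrow> \<phi> x = 0" "\<And>b x. x \<notin> S \<Longrightarrow> pderiv_dir b \<phi> x = 0"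
      using test_fun_support[OF \<phi>] by blast
    obtain R where R: "\<And>x. x \<in> S \<Longrightarrow> norm x \<le> R" using compact_imp_bounded[OF S(1)] by (auto simp: bounded_iff)
    obtain L' where L': "L' \<ge> 0" "\<And>x y. \<bar>\<phi> x - \<phi> y\<bar> \<le> L' * norm (x - y)"
      "\<And>x h. \<bar>\<Sum>b\<in>Basis. (h \<bullet> b) * pderiv_dir b \<phi> x\<bar> \<le> L' * norm h"
      using test_fun_Lipschitz[OF \<phi>] by blast
    have \<phi>c: "continuous_on UNIV \<phi>" by (rule test_fun_continuous[OF \<phi>])
    have full: "L2_inner \<Omega> w \<theta> = (LINT x|lebesgue. w x * \<theta> x)" if "\<And>x. x \<notin> S \<Longrightarrow> \<theta> x = 0" for w \<theta> :: "'a \<Rightarrow> real"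
    proof -
      have "(\<lambda>x. if x \<in> \<Omega> then w x * \<theta> x else 0) = (\<lambda>x. w x * \<theta> x)" using S(2) that by (auto simp: fun_eq_iff)
      then show ?thesis unfolding L2_inner_def
        using Lebesgue_Measure.integral_restrict_UNIV[OF \<Omega>, of "\<lambda>x. w x * \<theta> x"] by simp
    qed
    define t where "t n = 1 / real (Suc n)" for n
    have t: "t n > 0" "t n \<le> 1" for n by (auto simp: t_def)
    have tl: "t \<longlonglongrightarrow> 0" unfolding t_def by (rule LIMSEQ_Suc[OF lim_1_over_n])
    \<comment> \<open>Shifts of length at most one keep all supports inside the ball of radius
      \<open>R + 1\<close>.\<close>
    have far: "\<phi> (x + t n *\<^sub>R b) = 0" "\<phi> x = 0" if "x \<notin> cball 0 (R + 1)" for x n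
    proof -
      have "norm x \<le> norm (x + t n *\<^sub>R b) + norm (t n *\<^sub>R b)" using norm_triangle_sub[of x "x + t n *\<^sub>R b"] by simp
      then have "norm (x + t n *\<^sub>R b) > R" "norm x > R" using that t[of n] nb by auto
      then show "\<phi> (x + t n *\<^sub>R b) = 0" "\<phi> x = 0" using R S(3) by force+
    qed
    have cont: "continuous_on UNIV (\<lambda>x. v x * ((\<phi> (x + t n *\<^sub>R b) - \<phi> x) / t n))"
      "continuous_on UNIV (\<lambda>x. v x * \<phi> (x + t n *\<^sub>R b))" "continuous_on UNIV (\<lambda>x. v x * \<phi> x)"
      "continuous_on UNIV (\<lambda>x. v (x - t n *\<^sub>R b) * \<phi> x)" for n
      by (intro continuous_intros vc \<phi>c continuous_on_compose2[OF \<phi>c] continuous_on_compose2[OF vc]; use t[of n] in simp)+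
    \<comment> \<open>A change of variables by \<open>t n *\<^sub>R b\<close> turns the forward
      quotient of \<open>\<phi>\<close> into the backward quotient of \<open>v\<close>.\<close>
    have shift: "(LINT x|lebesgue. v x * ((\<phi> (x + t n *\<^sub>R b) - \<phi> x) / t n))
        = (LINT x|lebesgue. - ((v (x - t n *\<^sub>R b) - v x) / (- t n) * \<phi> x))" for n
    proof -
      have i1: "integrable lebesgue (\<lambda>x. v x * \<phi> (x + t n *\<^sub>R b))"
        by (rule continuous_compact_support_integrable[OF cont(2) compact_cball[of 0 "R + 1"]]) (use far in auto)
      have i2: "integrable lebesgue (\<lambda>x. v x * \<phi> x)"
        by (rule continuous_compact_support_integrable[OF cont(3) compact_cball[of 0 "R + 1"]]) (use far in auto)
      have i3: "integrable lebesgue (\<lambda>x. v (x - t n *\<^sub>R b) * \<phi> x)"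
        by (rule continuous_compact_support_integrable[OF cont(4) compact_cball[of 0 "R + 1"]]) (use far in auto)
      have s: "(LINT x|lebesgue. v (x - t n *\<^sub>R b) * \<phi> x) = (LINT x|lebesgue. v x * \<phi> (x + t n *\<^sub>R b))"
        using lebesgue_integral_affine[OF borel_measurable_continuous_onI[OF cont(4)], of 1 n "t n *\<^sub>R b"] by (simp add: add.commute)
      have "(LINT x|lebesgue. v x * ((\<phi> (x + t n *\<^sub>R b) - \<phi> x) / t n))
         = (LINT x|lebesgue. (v x * \<phi> (x + t n *\<^sub>R b) - v x * \<phi> x) / t n)"
        by (simp add: right_diff_distrib)
      also have "\<dots> = ((LINT x|lebesgue. v x * \<phi> (x + t n *\<^sub>R b)) - (LINT x|lebesgue. v x * \<phi> x)) / t n"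
        using i1 i2 by simp
      also have "\<dots> = ((LINT x|lebesgue. v (x - t n *\<^sub>R b) * \<phi> x) - (LINT x|lebesgue. v x * \<phi> x)) / t n"
        by (simp only: s)
      also have "\<dots> = (LINT x|lebesgue. (v (x - t n *\<^sub>R b) * \<phi> x - v x * \<phi> x) / t n)"
        using i3 i2 by simp
      also have "\<dots> = (LINT x|lebesgue. - ((v (x - t n *\<^sub>R b) - v x) / (- t n) * \<phi> x))"
        by (simp add: left_diff_distrib diff_divide_distrib)
      finally show ?thesis .
    qed
    have A: "(\<lambda>n. LINT x|lebesgue. v x * ((\<phi> (x + t n *\<^sub>R b) - \<phi> x) / t n)) \<longlonglongrightarrow> (LINT x|lebesgue. v x * pderiv_dir b \<phi> x)"
    proof (rule integral_dominated_convergence[where w="\<lambda>x. L' * (if x \<in> cball 0 (R + 1) then \<bar>v x\<bar> else 0)"])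
      have "integrable (lebesgue_on (cball 0 (R + 1))) (\<lambda>x. \<bar>v x\<bar>)"
      proof (rule integrable_abs)
        show "integrable (lebesgue_on (cball 0 (R + 1))) v"
        proof -
          have "integrable lborel (\<lambda>x. indicator (cball 0 (R + 1)) x *\<^sub>R v x)"
            by (intro borel_integrable_compact continuous_on_subset[OF vc]) auto
          then have "integrable lebesgue (\<lambda>x. indicator (cball 0 (R + 1)) x *\<^sub>R v x)"
            by (subst integrable_completion) (auto intro: borel_measurable_integrable)
          then show ?thesis by (subst integrable_restrict_space) auto
        qed
      qed
      then show "integrable lebesgue (\<lambda>x. L' * (if x \<in> cball 0 (R + 1) then \<bar>v x\<bar> else 0))"
        by (intro integrable_mult_right) (subst Lebesgue_Measure.integrable_restrict_UNIV, auto)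
      show "(\<lambda>x. v x * ((\<phi> (x + t n *\<^sub>R b) - \<phi> x) / t n)) \<in> borel_measurable lebesgue" for n
        using continuous_lebesgue_measurable[OF cont(1), where S=UNIV] unfolding lebesgue_on_UNIV_eq .
      show "(\<lambda>x. v x * pderiv_dir b \<phi> x) \<in> borel_measurable lebesgue"
        using vm test_fun_measurable[OF pderiv_test_fun[OF \<phi> b], of UNIV] unfolding lebesgue_on_UNIV_eq by (rule borel_measurable_times)
      have "(\<lambda>n. v x * ((\<phi> (x + t n *\<^sub>R b) - \<phi> x) / t n)) \<longlonglongrightarrow> v x * pderiv_dir b \<phi> x" for x
      proof -
        have "((\<lambda>s. \<phi> (x + s *\<^sub>R b)) has_derivative (\<lambda>s. \<Sum>c\<in>Basis. ((s *\<^sub>R b) \<bullet> c) * pderiv_dir c \<phi> (x + 0 *\<^sub>R b))) (at 0)"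
          by (rule has_derivative_compose[of "\<lambda>s. x + s *\<^sub>R b"])
            (auto intro!: derivative_eq_intros smooth_has_derivative[OF test_fun_smooth[OF \<phi>]])
        moreover have "(\<Sum>c\<in>Basis. ((s *\<^sub>R b) \<bullet> c) * pderiv_dir c \<phi> (x + 0 *\<^sub>R b)) = pderiv_dir b \<phi> x * s" for s
        proof -
          have "(\<Sum>c\<in>Basis. ((s *\<^sub>R b) \<bullet> c) * pderiv_dir c \<phi> (x + 0 *\<^sub>R b)) = (\<Sum>c\<in>Basis. if c = b then pderiv_dir b \<phi> x * s else 0)"
            using b by (intro sum.cong) (auto simp: inner_Basis)
          then show ?thesis using b by simp
        qed
        ultimately have "((\<lambda>s. \<phi> (x + s *\<^sub>R b)) has_real_derivative pderiv_dir b \<phi> x) (at 0)"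
          by (simp add: has_field_derivative_def fun_eq_iff)
        then have D: "((\<lambda>s. (\<phi> (x + s *\<^sub>R b) - \<phi> x) / s) \<longlongrightarrow> pderiv_dir b \<phi> x) (at 0)" by (simp add: DERIV_def)
        have "filterlim t (at 0) sequentially" using t tl by (auto simp: filterlim_at less_imp_neq[symmetric] intro!: always_eventually) 
        from filterlim_compose[OF D this] show ?thesis by (intro tendsto_intros)
      qed
      then show "AE x in lebesgue. (\<lambda>n. v x * ((\<phi> (x + t n *\<^sub>R b) - \<phi> x) / t n)) \<longlonglongrightarrow> v x * pderiv_dir b \<phi> x" by simp
      have "\<bar>v x * ((\<phi> (x + t n *\<^sub>R b) - \<phi> x) / t n)\<bar> \<le> L' * (if x \<in> cball 0 (R + 1) then \<bar>v x\<bar> else 0)" for n x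
      proof (cases "x \<in> cball 0 (R + 1)")
        case True
        have "\<bar>(\<phi> (x + t n *\<^sub>R b) - \<phi> x) / t n\<bar> \<le> L'"
          using L'(2)[of "x + t n *\<^sub>R b" x] t[of n] nb by (simp add: abs_divide divide_le_eq)
        then have "\<bar>v x\<bar> * \<bar>(\<phi> (x + t n *\<^sub>R b) - \<phi> x) / t n\<bar> \<le> \<bar>v x\<bar> * L'" by (intro mult_left_mono) auto
        then show ?thesis using True by (simp only: abs_mult if_True mult.commute)
      next
        case False
        then show ?thesis using far[OF False] by simp
      qed
      then show "AE x in lebesgue. norm (v x * ((\<phi> (x + t n *\<^sub>R b) - \<phi> x) / t n)) \<le> L' * (if x \<in> cball 0 (R + 1) then \<bar>v x\<bar> else 0)" for n
        by simp
    qed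
    have B: "(\<lambda>n. LINT x|lebesgue. - ((v (x - t n *\<^sub>R b) - v x) / (- t n) * \<phi> x)) \<longlonglongrightarrow> (LINT x|lebesgue. - (G x * \<phi> x))"
    proof (rule integral_dominated_convergence[where w="\<lambda>x. \<bar>L\<bar> * \<bar>\<phi> x\<bar>"])
      show "integrable lebesgue (\<lambda>x. \<bar>L\<bar> * \<bar>\<phi> x\<bar>)" using test_fun_integrable[OF \<phi>] by simp
      have m: "\<phi> \<in> borel_measurable lebesgue" using test_fun_measurable[OF \<phi>, of UNIV] unfolding lebesgue_on_UNIV_eq .
      show "(\<lambda>x. - (G x * \<phi> x)) \<in> borel_measurable lebesgue" using G m by simp
      have "continuous_on UNIV (\<lambda>x. - ((v (x - t n *\<^sub>R b) - v x) / (- t n) * \<phi> x))" for n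
        by (intro continuous_intros vc \<phi>c continuous_on_compose2[OF vc]) (use t[of n] in auto)
      then show "(\<lambda>x. - ((v (x - t n *\<^sub>R b) - v x) / (- t n) * \<phi> x)) \<in> borel_measurable lebesgue" for n
        using continuous_lebesgue_measurable[of _ UNIV] unfolding lebesgue_on_UNIV_eq by blast
      have f: "filterlim (\<lambda>n. - t n) (at 0) sequentially"
        using t tendsto_minus[OF tl] by (auto simp: filterlim_at less_imp_neq[symmetric] intro!: always_eventually)
      show "AE x in lebesgue. (\<lambda>n. - ((v (x - t n *\<^sub>R b) - v x) / (- t n) * \<phi> x)) \<longlonglongrightarrow> - (G x * \<phi> x)" using d
      proof eventually_elim
        case (elim x)
        from filterlim_compose[OF elim f] have "(\<lambda>n. (v (x - t n *\<^sub>R b) - v x) / (- t n)) \<longlonglongrightarrow> G x" by simp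
        then show ?case by (intro tendsto_intros)
      qed
      have "\<bar>- ((v (x - t n *\<^sub>R b) - v x) / (- t n) * \<phi> x)\<bar> \<le> \<bar>L\<bar> * \<bar>\<phi> x\<bar>" for n x
        using q[of "- t n" x] t[of n] unfolding abs_minus_cancel abs_mult by (intro mult_right_mono) auto
      then show "AE x in lebesgue. norm (- ((v (x - t n *\<^sub>R b) - v x) / (- t n) * \<phi> x)) \<le> \<bar>L\<bar> * \<bar>\<phi> x\<bar>" for n
        by (simp only: real_norm_def AE_I2)
    qed
    have "(LINT x|lebesgue. v x * pderiv_dir b \<phi> x) = (LINT x|lebesgue. - (G x * \<phi> x))"
      by (rule LIMSEQ_unique[OF A B[folded shift]])
    then show "L2_inner \<Omega> v (pderiv_dir b \<phi>) = - L2_inner \<Omega> G \<phi>" using full[OF S(3)] full[OF S(4)] by simp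
  qed
qed

section \<open>Functions in H10\<close>

lemma L2_inner_tendsto:
  assumes "u \<in> L2 S" "w \<in> L2 S" "\<And>n. f n \<in> L2 S" "(\<lambda>n. L2_norm S (\<lambda>x. w x - f n x)) \<longlonglongrightarrow> 0"
  shows "(\<lambda>n. L2_inner S u (f n)) \<longlonglongrightarrow> L2_inner S u w"
proof -
  have "(\<lambda>n. L2_inner S u w - L2_inner S u (f n)) \<longlonglongrightarrow> 0"
  proof (rule Lim_null_comparison)
    show "\<forall>\<^sub>F n in sequentially. norm (L2_inner S u w - L2_inner S u (f n)) \<le> L2_norm S u * L2_norm S (\<lambda>x. w x - f n x)"
      using L2_Cauchy_Schwarz[OF assms(1) L2_diff[OF assms(2,3)]] L2_inner_diff_right[OF assms(2,3,1)]
      by (intro always_eventually) simp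
    show "(\<lambda>n. L2_norm S u * L2_norm S (\<lambda>x. w x - f n x)) \<longlonglongrightarrow> 0" using tendsto_mult_right_zero[OF assms(4)] .
  qed
  from tendsto_diff[OF tendsto_const[of "L2_inner S u w"] this] show ?thesis by simp
qed

lemma test_fun_L2:
  assumes "\<phi> \<in> test_fun \<Omega>" "S \<in> sets lebesgue" shows "\<phi> \<in> L2 S"
proof -
  obtain M where M: "M \<ge> 0" "\<And>x. \<bar>\<phi> x\<bar> \<le> M" using test_fun_bounded[OF assms(1)] by blast
  have "integrable lebesgue (\<lambda>x. \<phi> x * \<phi> x)"
    by (rule test_fun_mult_integrable[OF assms(1) test_fun_integrable[OF assms(1)]])
  then have "\<phi> \<in> L2 UNIV" using test_fun_measurable[OF assms(1), of UNIV]
    unfolding L2_def lebesgue_on_UNIV_eq by (simp add: power2_eq_square)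
  then show ?thesis using L2_subset(1)[of UNIV S] assms(2) by auto
qed

lemma test_fun_has_weak_pderiv:
  assumes \<phi>: "\<phi> \<in> test_fun \<Omega>'" and b: "b \<in> Basis" and \<Omega>: "\<Omega> \<in> sets lebesgue"
  shows "has_weak_pderiv \<Omega> b \<phi> (pderiv_dir b \<phi>)"
proof -
  obtain L where L: "L \<ge> 0" "\<And>x y. \<bar>\<phi> x - \<phi> y\<bar> \<le> L * norm (x - y)"
    "\<And>x h. \<bar>\<Sum>b\<in>Basis. (h \<bullet> b) * pderiv_dir b \<phi> x\<bar> \<le> L * norm h" using test_fun_Lipschitz[OF \<phi>] by blast
  show ?thesis
  proof (rule Lipschitz_has_weak_pderiv[OF b L(2) _ _ \<Omega>])
    show "pderiv_dir b \<phi> \<in> borel_measurable lebesgue"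
      using test_fun_measurable[OF pderiv_test_fun[OF \<phi> b], of UNIV] unfolding lebesgue_on_UNIV_eq .
    have "((\<lambda>t. (\<phi> (x + t *\<^sub>R b) - \<phi> x) / t) \<longlongrightarrow> pderiv_dir b \<phi> x) (at 0)" for x
    proof -
      have "((\<lambda>s. \<phi> (x + s *\<^sub>R b)) has_derivative (\<lambda>s. \<Sum>c\<in>Basis. ((s *\<^sub>R b) \<bullet> c) * pderiv_dir c \<phi> (x + 0 *\<^sub>R b))) (at 0)"
        by (rule has_derivative_compose[of "\<lambda>s. x + s *\<^sub>R b"])
          (auto intro!: derivative_eq_intros smooth_has_derivative[OF test_fun_smooth[OF \<phi>]])
      moreover have "(\<Sum>c\<in>Basis. ((s *\<^sub>R b) \<bullet> c) * pderiv_dir c \<phi> (x + 0 *\<^sub>R b)) = pderiv_dir b \<phi> x * s" for s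
      proof -
        have "(\<Sum>c\<in>Basis. ((s *\<^sub>R b) \<bullet> c) * pderiv_dir c \<phi> (x + 0 *\<^sub>R b)) = (\<Sum>c\<in>Basis. if c = b then pderiv_dir b \<phi> x * s else 0)"
          using b by (intro sum.cong) (auto simp: inner_Basis)
        then show ?thesis using b by simp
      qed
      ultimately have "((\<lambda>s. \<phi> (x + s *\<^sub>R b)) has_real_derivative pderiv_dir b \<phi> x) (at 0)"
        by (simp add: has_field_derivative_def fun_eq_iff)
      then show ?thesis by (simp add: DERIV_def)
    qed
    then show "AE x in lebesgue. ((\<lambda>t. (\<phi> (x + t *\<^sub>R b) - \<phi> x) / t) \<longlongrightarrow> pderiv_dir b \<phi> x) (at 0)" by simp
  qed
qed

lemma test_fun_H1:
  assumes "\<phi> \<in> test_fun \<Omega>'" "open \<Omega>" shows "\<phi> \<in> H1 \<Omega>"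
proof (rule H1I)
  have \<Omega>: "\<Omega> \<in> sets lebesgue" using assms(2) by auto
  show "\<phi> \<in> L2 \<Omega>" by (rule test_fun_L2[OF assms(1) \<Omega>])
  fix b :: 'a assume b: "b \<in> Basis"
  show "pderiv_dir b \<phi> \<in> L2 \<Omega> \<and> has_weak_pderiv \<Omega> b \<phi> (pderiv_dir b \<phi>)"
    using test_fun_L2[OF pderiv_test_fun[OF assms(1) b] \<Omega>] test_fun_has_weak_pderiv[OF assms(1) b \<Omega>] by simp
qed

lemma H1_diff_test_fun:
  assumes "open \<Omega>" "u \<in> H1 \<Omega>" "\<phi> \<in> test_fun \<Omega>" "b \<in> Basis"
  shows "L2_norm \<Omega> (weak_pderiv \<Omega> b (\<lambda>x. u x - \<phi> x)) = L2_norm \<Omega> (\<lambda>x. weak_pderiv \<Omega> b u x - pderiv_dir b \<phi> x)"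
proof (rule L2_norm_cong_AE)
  show \<Omega>: "\<Omega> \<in> sets lebesgue" using assms(1) by auto
  show "(\<lambda>x. weak_pderiv \<Omega> b u x - pderiv_dir b \<phi> x) \<in> L2 \<Omega>"
    by (rule L2_diff[OF H1_weak_pderiv(2)[OF assms(1,2,4)] test_fun_L2[OF pderiv_test_fun[OF assms(3,4)] \<Omega>]])
  show "AE x in lebesgue_on \<Omega>. weak_pderiv \<Omega> b u x - pderiv_dir b \<phi> x = weak_pderiv \<Omega> b (\<lambda>x. u x - \<phi> x) x"
    using H1_diff(2)[OF assms(1,2) test_fun_H1[OF assms(3,1)] assms(4)]
      weak_pderiv_AE[OF assms(1,4) test_fun_has_weak_pderiv[OF assms(3,4) \<Omega>]]
    by eventually_elim simp
qed

lemma H10_H1: "u \<in> H10 \<Omega> \<Longrightarrow> u \<in> H1 \<Omega>" by (simp add: H10_def)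

lemma H10_sequence:
  assumes "open \<Omega>" "u \<in> H10 \<Omega>"
  obtains \<phi> where "\<And>n::nat. \<phi> n \<in> test_fun \<Omega>" "(\<lambda>n. L2_norm \<Omega> (\<lambda>x. u x - \<phi> n x)) \<longlonglongrightarrow> 0"
    "\<And>b. b \<in> Basis \<Longrightarrow> (\<lambda>n. L2_norm \<Omega> (\<lambda>x. weak_pderiv \<Omega> b u x - pderiv_dir b (\<phi> n) x)) \<longlonglongrightarrow> 0"
proof -
  have "\<exists>\<phi>. \<phi> \<in> test_fun \<Omega> \<and> H1_norm \<Omega> (\<lambda>x. u x - \<phi> x) < 1 / real (Suc n)" for n
  proof -
    have "\<forall>\<epsilon>>0. \<exists>\<phi>\<in>test_fun \<Omega>. H1_norm \<Omega> (\<lambda>x. u x - \<phi> x) < \<epsilon>" "1 / real (Suc n) > 0"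
      using assms(2) by (simp_all add: H10_def)
    then show ?thesis by blast
  qed
  then obtain \<phi> where \<phi>: "\<And>n::nat. \<phi> n \<in> test_fun \<Omega>" "\<And>n. H1_norm \<Omega> (\<lambda>x. u x - \<phi> n x) < 1 / real (Suc n)" by metis
  have lim: "(\<lambda>n. 1 / real (Suc n)) \<longlonglongrightarrow> 0" by (rule LIMSEQ_Suc[OF lim_1_over_n])
  show ?thesis
  proof (rule that[OF \<phi>(1)])
    show "(\<lambda>n. L2_norm \<Omega> (\<lambda>x. u x - \<phi> n x)) \<longlonglongrightarrow> 0"
    proof (rule Lim_null_comparison[OF _ lim], intro always_eventually allI)
      fix n show "norm (L2_norm \<Omega> (\<lambda>x. u x - \<phi> n x)) \<le> 1 / real (Suc n)"
        using L2_norm_le_H1_norm[of \<Omega> "\<lambda>x. u x - \<phi> n x"] \<phi>(2)[of n] unfolding real_norm_def abs_of_nonneg[OF L2_norm_nonneg] by linarith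
    qed
    fix b :: 'a assume b: "b \<in> Basis"
    show "(\<lambda>n. L2_norm \<Omega> (\<lambda>x. weak_pderiv \<Omega> b u x - pderiv_dir b (\<phi> n) x)) \<longlonglongrightarrow> 0"
    proof (rule Lim_null_comparison[OF _ lim], intro always_eventually allI)
      fix n show "norm (L2_norm \<Omega> (\<lambda>x. weak_pderiv \<Omega> b u x - pderiv_dir b (\<phi> n) x)) \<le> 1 / real (Suc n)"
        using weak_pderiv_le_H1_norm[OF b, of \<Omega> "\<lambda>x. u x - \<phi> n x"] \<phi>(2)[of n]
          H1_diff_test_fun[OF assms(1) H10_H1[OF assms(2)] \<phi>(1) b, of n]
        unfolding real_norm_def abs_of_nonneg[OF L2_norm_nonneg] by linarith
    qed
  qed
qed

lemma H10I:
  assumes "open \<Omega>" "u \<in> H1 \<Omega>" "\<And>n::nat. \<phi> n \<in> test_fun \<Omega>" "(\<lambda>n. L2_norm \<Omega> (\<lambda>x. u x - \<phi> n x)) \<longlonglongrightarrow> 0"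
    "\<And>b. b \<in> Basis \<Longrightarrow> (\<lambda>n. L2_norm \<Omega> (\<lambda>x. weak_pderiv \<Omega> b u x - pderiv_dir b (\<phi> n) x)) \<longlonglongrightarrow> 0"
  shows "u \<in> H10 \<Omega>"
  unfolding H10_def
proof (intro CollectI conjI allI impI assms(2))
  fix e :: real assume e: "e > 0"
  have "(\<lambda>n. L2_norm \<Omega> (\<lambda>x. u x - \<phi> n x) + (\<Sum>b\<in>Basis. L2_norm \<Omega> (\<lambda>x. weak_pderiv \<Omega> b u x - pderiv_dir b (\<phi> n) x)))
      \<longlonglongrightarrow> 0 + (\<Sum>b\<in>(Basis::'a set). 0)"
    by (intro tendsto_intros assms(4,5))
  then have "(\<lambda>n. L2_norm \<Omega> (\<lambda>x. u x - \<phi> n x) + (\<Sum>b\<in>Basis. L2_norm \<Omega> (\<lambda>x. weak_pderiv \<Omega> b u x - pderiv_dir b (\<phi> n) x)))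
      \<longlonglongrightarrow> 0" by simp
  then have "\<forall>\<^sub>F n in sequentially. L2_norm \<Omega> (\<lambda>x. u x - \<phi> n x) + (\<Sum>b\<in>Basis. L2_norm \<Omega> (\<lambda>x. weak_pderiv \<Omega> b u x - pderiv_dir b (\<phi> n) x)) < e"
    using e by (rule order_tendstoD(2))
  then obtain n where n: "L2_norm \<Omega> (\<lambda>x. u x - \<phi> n x) + (\<Sum>b\<in>Basis. L2_norm \<Omega> (\<lambda>x. weak_pderiv \<Omega> b u x - pderiv_dir b (\<phi> n) x)) < e"
    unfolding eventually_sequentially by blast
  have "H1_norm \<Omega> (\<lambda>x. u x - \<phi> n x) \<le> L2_norm \<Omega> (\<lambda>x. u x - \<phi> n x) + (\<Sum>b\<in>Basis. L2_norm \<Omega> (weak_pderiv \<Omega> b (\<lambda>x. u x - \<phi> n x)))"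
    by (rule H1_norm_le)
  also have "(\<Sum>b\<in>Basis. L2_norm \<Omega> (weak_pderiv \<Omega> b (\<lambda>x. u x - \<phi> n x))) = (\<Sum>b\<in>Basis. L2_norm \<Omega> (\<lambda>x. weak_pderiv \<Omega> b u x - pderiv_dir b (\<phi> n) x))"
    by (intro sum.cong refl H1_diff_test_fun[OF assms(1,2,3)])
  finally show "\<exists>\<phi>\<in>test_fun \<Omega>. H1_norm \<Omega> (\<lambda>x. u x - \<phi> x) < e" using n assms(3)[of n] by (intro bexI[of _ "\<phi> n"]) auto
qed

lemma H10_diff:
  assumes "open \<Omega>" "u \<in> H10 \<Omega>" "v \<in> H10 \<Omega>" shows "(\<lambda>x. u x - v x) \<in> H10 \<Omega>"
proof -
  have \<Omega>: "\<Omega> \<in> sets lebesgue" using assms(1) by auto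
  obtain \<phi> where \<phi>: "\<And>n::nat. \<phi> n \<in> test_fun \<Omega>" "(\<lambda>n. L2_norm \<Omega> (\<lambda>x. u x - \<phi> n x)) \<longlonglongrightarrow> 0"
    "\<And>b. b \<in> Basis \<Longrightarrow> (\<lambda>n. L2_norm \<Omega> (\<lambda>x. weak_pderiv \<Omega> b u x - pderiv_dir b (\<phi> n) x)) \<longlonglongrightarrow> 0"
    using H10_sequence[OF assms(1,2)] by blast
  obtain \<psi> where \<psi>: "\<And>n::nat. \<psi> n \<in> test_fun \<Omega>" "(\<lambda>n. L2_norm \<Omega> (\<lambda>x. v x - \<psi> n x)) \<longlonglongrightarrow> 0"
    "\<And>b. b \<in> Basis \<Longrightarrow> (\<lambda>n. L2_norm \<Omega> (\<lambda>x. weak_pderiv \<Omega> b v x - pderiv_dir b (\<psi> n) x)) \<longlonglongrightarrow> 0"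
    using H10_sequence[OF assms(1,3)] by blast
  have u1: "u \<in> H1 \<Omega>" "v \<in> H1 \<Omega>" using assms H10_H1 by auto
  have t: "(\<lambda>n. L2_norm \<Omega> (\<lambda>x. f x - g n x)) \<longlonglongrightarrow> 0"
    if a: "\<And>n. AE x in lebesgue_on \<Omega>. (f1 x - g1 n x) - (f2 x - g2 n x) = f x - g n x"
      and l: "(\<lambda>n. L2_norm \<Omega> (\<lambda>x. f1 x - g1 n x)) \<longlonglongrightarrow> 0" "(\<lambda>n. L2_norm \<Omega> (\<lambda>x. f2 x - g2 n x)) \<longlonglongrightarrow> 0"
      and L: "f1 \<in> L2 \<Omega>" "f2 \<in> L2 \<Omega>" "\<And>n. g1 n \<in> L2 \<Omega>" "\<And>n. g2 n \<in> L2 \<Omega>" for f1 f2 f :: "'a \<Rightarrow> real" and g1 g2 g :: "nat \<Rightarrow> 'a \<Rightarrow> real"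
  proof (rule Lim_null_comparison)
    show "\<forall>\<^sub>F n in sequentially. norm (L2_norm \<Omega> (\<lambda>x. f x - g n x)) \<le> L2_norm \<Omega> (\<lambda>x. f1 x - g1 n x) + L2_norm \<Omega> (\<lambda>x. f2 x - g2 n x)"
    proof (intro always_eventually allI)
      fix n
      have d: "(\<lambda>x. f1 x - g1 n x) \<in> L2 \<Omega>" "(\<lambda>x. f2 x - g2 n x) \<in> L2 \<Omega>" using L by (auto intro: L2_diff)
      show "norm (L2_norm \<Omega> (\<lambda>x. f x - g n x)) \<le> L2_norm \<Omega> (\<lambda>x. f1 x - g1 n x) + L2_norm \<Omega> (\<lambda>x. f2 x - g2 n x)"
        using L2_triangle_diff[OF d] L2_norm_cong_AE[OF \<Omega> L2_diff[OF d] a] by simp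
    qed
    show "(\<lambda>n. L2_norm \<Omega> (\<lambda>x. f1 x - g1 n x) + L2_norm \<Omega> (\<lambda>x. f2 x - g2 n x)) \<longlonglongrightarrow> 0" using tendsto_add[OF l] by simp
  qed
  show ?thesis
  proof (rule H10I[OF assms(1)])
    show "(\<lambda>x. u x - v x) \<in> H1 \<Omega>" by (rule H1_diff(1)[OF assms(1) u1])
    show "(\<lambda>x. \<phi> n x - \<psi> n x) \<in> test_fun \<Omega>" for n by (rule test_fun_diff[OF \<phi>(1) \<psi>(1)])
    show "(\<lambda>n. L2_norm \<Omega> (\<lambda>x. u x - v x - (\<phi> n x - \<psi> n x))) \<longlonglongrightarrow> 0"
      by (rule t[OF _ \<phi>(2) \<psi>(2)]) (use u1 H1_L2 test_fun_L2[OF \<phi>(1) \<Omega>] test_fun_L2[OF \<psi>(1) \<Omega>] in auto)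
    fix b :: 'a assume b: "b \<in> Basis"
    have p: "pderiv_dir b (\<lambda>x. \<phi> n x - \<psi> n x) = (\<lambda>x. pderiv_dir b (\<phi> n) x - pderiv_dir b (\<psi> n) x)" for n
      by (rule pderiv_dir_diff[OF test_fun_smooth[OF \<phi>(1)] test_fun_smooth[OF \<psi>(1)]])
    show "(\<lambda>n. L2_norm \<Omega> (\<lambda>x. weak_pderiv \<Omega> b (\<lambda>x. u x - v x) x - pderiv_dir b (\<lambda>x. \<phi> n x - \<psi> n x) x)) \<longlonglongrightarrow> 0"
      unfolding p
    proof (rule t[OF _ \<phi>(3)[OF b] \<psi>(3)[OF b]])
      show "AE x in lebesgue_on \<Omega>. weak_pderiv \<Omega> b u x - pderiv_dir b (\<phi> n) x - (weak_pderiv \<Omega> b v x - pderiv_dir b (\<psi> n) x)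
         = weak_pderiv \<Omega> b (\<lambda>x. u x - v x) x - (pderiv_dir b (\<phi> n) x - pderiv_dir b (\<psi> n) x)" for n
        using H1_diff(2)[OF assms(1) u1 b] by eventually_elim simp
      show "weak_pderiv \<Omega> b u \<in> L2 \<Omega>" "weak_pderiv \<Omega> b v \<in> L2 \<Omega>" using H1_weak_pderiv(2)[OF assms(1) _ b] u1 by auto
      show "pderiv_dir b (\<phi> n) \<in> L2 \<Omega>" "pderiv_dir b (\<psi> n) \<in> L2 \<Omega>" for n
        using test_fun_L2[OF pderiv_test_fun[OF \<phi>(1) b] \<Omega>] test_fun_L2[OF pderiv_test_fun[OF \<psi>(1) b] \<Omega>] by auto
    qed
  qed
qed

text \<open>Weak divergences are tested with smooth functions of compact support only. Density of
  these in \<open>H10\<close> and continuity of both sides extend the identity; this is where the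
  zero boundary values of \<open>w\<close> enter.\<close>

lemma has_weak_div_H10:
  assumes \<Omega>: "open \<Omega>" and q: "\<And>b. b \<in> Basis \<Longrightarrow> (\<lambda>x. q x \<bullet> b) \<in> L2 \<Omega>" and g: "g \<in> L2 \<Omega>"
    and div: "has_weak_div \<Omega> q g" and w: "w \<in> H10 \<Omega>"
  shows "(\<Sum>b\<in>Basis. L2_inner \<Omega> (\<lambda>x. q x \<bullet> b) (weak_pderiv \<Omega> b w)) = - L2_inner \<Omega> g w"
proof -
  have \<Omega>m: "\<Omega> \<in> sets lebesgue" using \<Omega> by auto
  obtain \<phi> where \<phi>: "\<And>n::nat. \<phi> n \<in> test_fun \<Omega>" "(\<lambda>n. L2_norm \<Omega> (\<lambda>x. w x - \<phi> n x)) \<longlonglongrightarrow> 0"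
    "\<And>b. b \<in> Basis \<Longrightarrow> (\<lambda>n. L2_norm \<Omega> (\<lambda>x. weak_pderiv \<Omega> b w x - pderiv_dir b (\<phi> n) x)) \<longlonglongrightarrow> 0"
    using H10_sequence[OF \<Omega> w] by blast
  have p: "pderiv_dir b (\<phi> n) \<in> L2 \<Omega>" if "b \<in> Basis" for b n by (rule test_fun_L2[OF pderiv_test_fun[OF \<phi>(1) that] \<Omega>m])
  have e: "(\<Sum>b\<in>Basis. L2_inner \<Omega> (\<lambda>x. q x \<bullet> b) (pderiv_dir b (\<phi> n))) = - L2_inner \<Omega> g (\<phi> n)" for n
  proof -
    have "(\<Sum>b\<in>Basis. L2_inner \<Omega> (\<lambda>x. q x \<bullet> b) (pderiv_dir b (\<phi> n))) = (LINT x|lebesgue_on \<Omega>. (\<Sum>b\<in>Basis. (q x \<bullet> b) * pderiv_dir b (\<phi> n) x))"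
      unfolding L2_inner_def by (rule Bochner_Integration.integral_sum[symmetric]) (rule L2_mult_integrable[OF q p])
    also have "(\<lambda>x. \<Sum>b\<in>Basis. (q x \<bullet> b) * pderiv_dir b (\<phi> n) x) = (\<lambda>x. q x \<bullet> (\<Sum>b\<in>Basis. pderiv_dir b (\<phi> n) x *\<^sub>R b))"
      by (simp add: inner_sum_right mult.commute)
    finally show ?thesis using div \<phi>(1) unfolding has_weak_div_def by simp
  qed
  have "(\<lambda>n. \<Sum>b\<in>Basis. L2_inner \<Omega> (\<lambda>x. q x \<bullet> b) (pderiv_dir b (\<phi> n))) \<longlonglongrightarrow> (\<Sum>b\<in>Basis. L2_inner \<Omega> (\<lambda>x. q x \<bullet> b) (weak_pderiv \<Omega> b w))"
    by (intro tendsto_sum L2_inner_tendsto q p \<phi>(3) H1_weak_pderiv(2)[OF \<Omega> H10_H1[OF w]])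
  moreover have "(\<lambda>n. - L2_inner \<Omega> g (\<phi> n)) \<longlonglongrightarrow> - L2_inner \<Omega> g w"
    by (intro tendsto_minus L2_inner_tendsto g \<phi>(2) H1_L2[OF H10_H1[OF w]] test_fun_L2[OF \<phi>(1) \<Omega>m])
  ultimately show ?thesis unfolding e by (rule LIMSEQ_unique)
qed

section \<open>Translation estimates and the Poincare inequality\<close>

lemma nn_integral_square_eq_L2_norm:
  assumes "w \<in> L2 S" "w \<in> borel_measurable borel" "S \<in> sets borel"
  shows "(\<integral>\<^sup>+x. ennreal ((w x)\<^sup>2) * indicator S x \<partial>lborel) = ennreal ((L2_norm S w)\<^sup>2)"
proof -
  have S: "S \<in> sets lebesgue" using assms(3) by simp
  let ?f = "\<lambda>x. if x \<in> S then (w x)\<^sup>2 else 0"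
  have "integrable lebesgue ?f" using L2_square_integrable[OF assms(1)] S by (simp add: Lebesgue_Measure.integrable_restrict_UNIV)
  moreover have m: "?f \<in> borel_measurable lborel" using assms(2,3) by measurable
  ultimately have i: "integrable lborel ?f" by (simp add: integrable_completion)
  have "(\<integral>\<^sup>+x. ennreal ((w x)\<^sup>2) * indicator S x \<partial>lborel) = (\<integral>\<^sup>+x. ennreal (?f x) \<partial>lborel)"
    by (intro nn_integral_cong) (auto simp: indicator_def)
  also have "\<dots> = ennreal (LINT x|lborel. ?f x)" by (rule nn_integral_eq_integral[OF i]) auto
  also have "(LINT x|lborel. ?f x) = (LINT x|lebesgue. ?f x)" using m by (simp add: integral_completion)
  also have "\<dots> = (L2_norm S w)\<^sup>2" unfolding L2_norm_square using S by (simp add: Lebesgue_Measure.integral_restrict_UNIV)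
  finally show ?thesis .
qed

text \<open>The fundamental theorem of calculus and the Cauchy-Schwarz inequality on an interval of
  length one. The extended nonnegative integral is the form to which Tonelli's theorem is applied
  afterwards.\<close>

lemma square_increment_le:
  assumes d: "\<And>s. (f has_real_derivative k s) (at s)" and k: "continuous_on UNIV k"
  shows "ennreal ((f 1 - f 0)\<^sup>2) \<le> (\<integral>\<^sup>+s. ennreal ((k s)\<^sup>2) * indicator {0..1::real} s \<partial>lborel)"
proof -
  let ?S = "{0..1::real}"
  have S: "?S \<in> lmeasurable" by simp
  have km: "k \<in> borel_measurable (lebesgue_on ?S)" by (rule continuous_lebesgue_measurable[OF k])
  have "bounded (k ` ?S)"
    by (intro compact_imp_bounded compact_continuous_image continuous_on_subset[OF k]) auto
  then obtain M where M: "\<And>y. y \<in> k ` ?S \<Longrightarrow> norm y \<le> M" unfolding bounded_iff by blast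
  have kL: "k \<in> L2 ?S"
  proof (rule L2_mono[OF km L2_const[OF S, of M]], rule AE_I2)
    fix s assume "s \<in> space (lebesgue_on ?S)"
    then have "k s \<in> k ` ?S" by simp
    then show "\<bar>k s\<bar> \<le> \<bar>M\<bar>" using M[of "k s"] by simp
  qed
  have "(k has_integral (f 1 - f 0)) ?S"
    by (rule fundamental_theorem_of_calculus)
      (use d in \<open>auto simp: has_real_derivative_iff_has_vector_derivative intro: has_vector_derivative_at_within\<close>)
  moreover have "(k has_integral (LINT s|lebesgue_on ?S. k s)) ?S"
    by (rule has_integral_integral_lebesgue_on[OF L2_integrable[OF S kL]]) auto
  ultimately have "f 1 - f 0 = (LINT s|lebesgue_on ?S. k s)" by (rule has_integral_unique)
  also have "\<dots> = L2_inner ?S k (\<lambda>s. 1)" by (simp add: L2_inner_def)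
  finally have "\<bar>f 1 - f 0\<bar> \<le> L2_norm ?S k * L2_norm ?S (\<lambda>s. 1)" using L2_Cauchy_Schwarz[OF kL L2_const[OF S]] by simp
  then have "\<bar>f 1 - f 0\<bar> \<le> L2_norm ?S k" by (simp add: L2_norm_const[OF S])
  then have "(f 1 - f 0)\<^sup>2 \<le> (L2_norm ?S k)\<^sup>2" by (simp add: abs_le_square_iff[symmetric])
  then have "ennreal ((f 1 - f 0)\<^sup>2) \<le> ennreal ((L2_norm ?S k)\<^sup>2)" by (rule ennreal_leI)
  also have "\<dots> = (\<integral>\<^sup>+s. ennreal ((k s)\<^sup>2) * indicator ?S s \<partial>lborel)"
    by (rule nn_integral_square_eq_L2_norm[symmetric, OF kL borel_measurable_continuous_onI[OF k]]) auto
  finally show ?thesis .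
qed

text \<open>With \<open>A\<close> the whole domain this is the Poincare inequality; with \<open>A\<close> a piece of the domain near a boundary
  point it expresses that the boundary values vanish there.\<close>

lemma test_fun_translation_bound:
  fixes \<phi> :: "'a::euclidean_space \<Rightarrow> real"
  assumes \<phi>: "\<phi> \<in> test_fun \<Omega>" and \<Omega>: "open \<Omega>" and A: "open A" and B: "open B"
    and out: "\<And>x. x \<in> A \<Longrightarrow> x + h \<notin> \<Omega>" and path: "\<And>x s. x \<in> A \<Longrightarrow> 0 \<le> s \<Longrightarrow> s \<le> 1 \<Longrightarrow> x + s *\<^sub>R h \<in> B"
  shows "L2_norm A \<phi> \<le> norm h * (\<Sum>b\<in>Basis. L2_norm (B \<inter> \<Omega>) (pderiv_dir b \<phi>))"
proof -
  define D where "D y = (\<Sum>b\<in>Basis. (h \<bullet> b) * pderiv_dir b \<phi> y)" for y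
  obtain S where S: "compact S" "S \<subseteq> \<Omega>" "\<And>x. x \<notin> S \<Longrightarrow> \<phi> x = 0" "\<And>b x. x \<notin> S \<Longrightarrow> pderiv_dir b \<phi> x = 0"
    using test_fun_support[OF \<phi>] by blast
  have Am: "A \<in> sets lebesgue" "A \<in> sets borel" and Bm: "B \<in> sets lebesgue" "B \<in> sets borel" "B \<inter> \<Omega> \<in> sets lebesgue"
    using A B \<Omega> by auto
  have pL: "pderiv_dir b \<phi> \<in> L2 T" if "b \<in> Basis" "T \<in> sets lebesgue" for b T
    by (rule test_fun_L2[OF pderiv_test_fun[OF \<phi> that(1)] that(2)])
  have Dc: "continuous_on UNIV D" unfolding D_def
    by (intro continuous_intros test_fun_continuous[OF pderiv_test_fun[OF \<phi>]])
  have DL: "D \<in> L2 T" if "T \<in> sets lebesgue" for T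
    unfolding D_def by (intro L2_sum L2_cmult pL that)
  have Db [measurable]: "D \<in> borel_measurable borel" by (rule borel_measurable_continuous_onI[OF Dc])
  have \<phi>b [measurable]: "\<phi> \<in> borel_measurable borel" by (rule borel_measurable_continuous_onI[OF test_fun_continuous[OF \<phi>]])
  note Am(2)[measurable] Bm(2)[measurable]
  \<comment> \<open>The cutoff by \<open>B\<close> does not change the path integrals, which stay in
    \<open>B\<close>, and it leaves a function on the whole space whose integral is invariant under
    translation.\<close>
  define g where "g y = ennreal ((D y)\<^sup>2) * indicator B y" for y
  have gm [measurable]: "g \<in> borel_measurable borel" unfolding g_def by measurable
  have pt: "ennreal ((\<phi> x)\<^sup>2) * indicator A x \<le> (\<integral>\<^sup>+s. g (x + s *\<^sub>R h) * indicator {0..1::real} s \<partial>lborel)" for x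
  proof (cases "x \<in> A")
    case True
    have "((\<lambda>s. \<phi> (x + s *\<^sub>R h)) has_real_derivative D (x + s *\<^sub>R h)) (at s)" for s
    proof -
      have "((\<lambda>s. \<phi> (x + s *\<^sub>R h)) has_derivative (\<lambda>r. \<Sum>c\<in>Basis. ((r *\<^sub>R h) \<bullet> c) * pderiv_dir c \<phi> (x + s *\<^sub>R h))) (at s)"
        by (rule has_derivative_compose[of "\<lambda>s. x + s *\<^sub>R h"])
          (auto intro!: derivative_eq_intros smooth_has_derivative[OF test_fun_smooth[OF \<phi>]])
      moreover have "(\<lambda>r. \<Sum>c\<in>Basis. ((r *\<^sub>R h) \<bullet> c) * pderiv_dir c \<phi> (x + s *\<^sub>R h)) = (*) (D (x + s *\<^sub>R h))"
        unfolding D_def by (rule ext) (simp add: sum_distrib_left mult_ac)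
      ultimately show ?thesis by (simp add: has_field_derivative_def)
    qed
    moreover have "continuous_on UNIV (\<lambda>s. D (x + s *\<^sub>R h))"
      by (intro continuous_on_compose2[OF Dc] continuous_intros) auto
    ultimately have "ennreal ((\<phi> (x + 1 *\<^sub>R h) - \<phi> (x + 0 *\<^sub>R h))\<^sup>2) \<le> (\<integral>\<^sup>+s. ennreal ((D (x + s *\<^sub>R h))\<^sup>2) * indicator {0..1::real} s \<partial>lborel)"
      by (rule square_increment_le)
    moreover have "\<phi> (x + h) = 0" using out[OF True] S(2,3) by blast
    moreover have "(\<integral>\<^sup>+s. ennreal ((D (x + s *\<^sub>R h))\<^sup>2) * indicator {0..1::real} s \<partial>lborel) = (\<integral>\<^sup>+s. g (x + s *\<^sub>R h) * indicator {0..1::real} s \<partial>lborel)"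
      using path[OF True] by (intro nn_integral_cong) (auto simp: g_def indicator_def)
    ultimately show ?thesis using True by simp
  qed simp
  have "ennreal ((L2_norm A \<phi>)\<^sup>2) = (\<integral>\<^sup>+x. ennreal ((\<phi> x)\<^sup>2) * indicator A x \<partial>lborel)"
    by (rule nn_integral_square_eq_L2_norm[symmetric, OF test_fun_L2[OF \<phi> Am(1)] \<phi>b Am(2)])
  also have "\<dots> \<le> (\<integral>\<^sup>+x. \<integral>\<^sup>+s. g (x + s *\<^sub>R h) * indicator {0..1::real} s \<partial>lborel \<partial>lborel)"
    by (intro nn_integral_mono pt)
  also have "\<dots> = (\<integral>\<^sup>+s. \<integral>\<^sup>+x. g (x + s *\<^sub>R h) * indicator {0..1::real} s \<partial>lborel \<partial>lborel)"
    by (rule lborel_pair.Fubini') measurable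
  also have "\<dots> = (\<integral>\<^sup>+s. (\<integral>\<^sup>+x. g x \<partial>lborel) * indicator {0..1::real} s \<partial>lborel)"
  proof (rule nn_integral_cong)
    fix s :: real
    have "(\<integral>\<^sup>+x. g (x + s *\<^sub>R h) * indicator {0..1::real} s \<partial>lborel) = (\<integral>\<^sup>+x. g (x + s *\<^sub>R h) \<partial>lborel) * indicator {0..1::real} s"
      by (rule nn_integral_multc) measurable
    also have "(\<integral>\<^sup>+x. g (x + s *\<^sub>R h) \<partial>lborel) = (\<integral>\<^sup>+x. g x \<partial>lborel)"
      using nn_integral_lborel_affine[OF gm, of 1 "s *\<^sub>R h"] by (simp add: add.commute)
    finally show "(\<integral>\<^sup>+x. g (x + s *\<^sub>R h) * indicator {0..1::real} s \<partial>lborel) = (\<integral>\<^sup>+x. g x \<partial>lborel) * indicator {0..1::real} s" .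
  qed
  also have "\<dots> = (\<integral>\<^sup>+x. g x \<partial>lborel)" by (subst nn_integral_cmult) auto
  also have "\<dots> = ennreal ((L2_norm B D)\<^sup>2)" unfolding g_def
    by (rule nn_integral_square_eq_L2_norm[OF DL[OF Bm(1)] Db Bm(2)])
  finally have "(L2_norm A \<phi>)\<^sup>2 \<le> (L2_norm B D)\<^sup>2" by simp
  then have "L2_norm A \<phi> \<le> L2_norm B D" by (rule power2_le_imp_le) simp
  \<comment> \<open>Test functions vanish outside \<Omega> together with their derivatives.
    Restricting to \<Omega> is what lets the bound survive the passage to limits in
    \<open>H10\<close>.\<close>
  also have "L2_norm B D = L2_norm (B \<inter> \<Omega>) D"
  proof -
    have "(\<lambda>x. if x \<in> B then D x else 0) = (\<lambda>x. if x \<in> B \<inter> \<Omega> then D x else 0)"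
    proof
      fix x
      have "D x = 0" if "x \<notin> \<Omega>"
      proof -
        have "x \<notin> S" using S(2) that by blast
        then show ?thesis unfolding D_def by (simp add: S(4))
      qed
      then show "(if x \<in> B then D x else 0) = (if x \<in> B \<inter> \<Omega> then D x else 0)" by auto
    qed
    then show ?thesis using L2_norm_restrict[OF Bm(1), of D] L2_norm_restrict[OF Bm(3), of D] by (simp only:)
  qed
  also have "\<dots> \<le> (\<Sum>b\<in>Basis. L2_norm (B \<inter> \<Omega>) (\<lambda>y. (h \<bullet> b) * pderiv_dir b \<phi> y))"
    unfolding D_def by (rule L2_norm_sum_le) (intro L2_cmult pL Bm)
  also have "\<dots> \<le> (\<Sum>b\<in>Basis. norm h * L2_norm (B \<inter> \<Omega>) (pderiv_dir b \<phi>))"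
    unfolding L2_norm_cmult by (intro sum_mono mult_right_mono) (auto simp: Basis_le_norm)
  finally show ?thesis by (simp add: sum_distrib_left)
qed

text \<open>Density of the test functions. Here \<open>A\<close> has to lie in \<Omega>, because the
  values of \<open>u\<close> elsewhere carry no meaning.\<close>

lemma H10_translation_bound:
  fixes u :: "'a::euclidean_space \<Rightarrow> real"
  assumes u: "u \<in> H10 \<Omega>" and \<Omega>: "open \<Omega>" and A: "open A" "A \<subseteq> \<Omega>" and B: "open B"
    and out: "\<And>x. x \<in> A \<Longrightarrow> x + h \<notin> \<Omega>" and path: "\<And>x s. x \<in> A \<Longrightarrow> 0 \<le> s \<Longrightarrow> s \<le> 1 \<Longrightarrow> x + s *\<^sub>R h \<in> B"
  shows "L2_norm A u \<le> norm h * (\<Sum>b\<in>Basis. L2_norm (B \<inter> \<Omega>) (weak_pderiv \<Omega> b u))"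
proof -
  have m: "\<Omega> \<in> sets lebesgue" "A \<in> sets lebesgue" "B \<inter> \<Omega> \<in> sets lebesgue" using \<Omega> A B by auto
  obtain \<phi> where \<phi>: "\<And>n::nat. \<phi> n \<in> test_fun \<Omega>" "(\<lambda>n. L2_norm \<Omega> (\<lambda>x. u x - \<phi> n x)) \<longlonglongrightarrow> 0"
    "\<And>b. b \<in> Basis \<Longrightarrow> (\<lambda>n. L2_norm \<Omega> (\<lambda>x. weak_pderiv \<Omega> b u x - pderiv_dir b (\<phi> n) x)) \<longlonglongrightarrow> 0"
    using H10_sequence[OF \<Omega> u] by blast
  have sub: "(\<lambda>n. L2_norm T (f n)) \<longlonglongrightarrow> L2_norm T g"
    if "T \<in> sets lebesgue" "T \<subseteq> \<Omega>" "\<And>n. f n \<in> L2 \<Omega>" "g \<in> L2 \<Omega>" "(\<lambda>n. L2_norm \<Omega> (\<lambda>x. g x - f n x)) \<longlonglongrightarrow> 0" for T f and g :: "'a \<Rightarrow> real"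
  proof (rule L2_norm_tendsto)
    show "f n \<in> L2 T" for n by (rule L2_subset(1)[OF m(1) that(1-3)])
    show "g \<in> L2 T" by (rule L2_subset(1)[OF m(1) that(1,2,4)])
    show "(\<lambda>n. L2_norm T (\<lambda>x. f n x - g x)) \<longlonglongrightarrow> 0"
    proof (rule Lim_null_comparison[OF _ that(5)], intro always_eventually allI)
      fix n show "norm (L2_norm T (\<lambda>x. f n x - g x)) \<le> L2_norm \<Omega> (\<lambda>x. g x - f n x)"
        using L2_subset(2)[OF m(1) that(1,2) L2_diff[OF that(4) that(3)[of n]]] L2_norm_minus_commute[of T "f n" g] by simp
    qed
  qed
  have "(\<lambda>n. L2_norm A (\<phi> n)) \<longlonglongrightarrow> L2_norm A u"
    by (rule sub[OF m(2) A(2) test_fun_L2[OF \<phi>(1) m(1)] H1_L2[OF H10_H1[OF u]] \<phi>(2)])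
  moreover have "(\<lambda>n. norm h * (\<Sum>b\<in>Basis. L2_norm (B \<inter> \<Omega>) (pderiv_dir b (\<phi> n)))) \<longlonglongrightarrow> norm h * (\<Sum>b\<in>Basis. L2_norm (B \<inter> \<Omega>) (weak_pderiv \<Omega> b u))"
  proof (intro tendsto_intros tendsto_sum)
    fix b :: 'a assume b: "b \<in> Basis"
    show "(\<lambda>n. L2_norm (B \<inter> \<Omega>) (pderiv_dir b (\<phi> n))) \<longlonglongrightarrow> L2_norm (B \<inter> \<Omega>) (weak_pderiv \<Omega> b u)"
      by (rule sub[OF m(3) _ test_fun_L2[OF pderiv_test_fun[OF \<phi>(1) b] m(1)] H1_weak_pderiv(2)[OF \<Omega> H10_H1[OF u] b] \<phi>(3)[OF b]]) auto
  qed
  ultimately show ?thesis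
    by (rule LIMSEQ_le) (use test_fun_translation_bound[OF \<phi>(1) \<Omega> A(1) B out path] in auto)
qed

lemma H10_Poincare:
  fixes \<Omega> :: "'a::euclidean_space set"
  assumes \<Omega>: "open \<Omega>" "bounded \<Omega>"
  obtains C where "C \<ge> 0" "\<And>u. u \<in> H10 \<Omega> \<Longrightarrow> L2_norm \<Omega> u \<le> C * (\<Sum>b\<in>Basis. L2_norm \<Omega> (weak_pderiv \<Omega> b u))"
proof -
  obtain R where R: "\<And>x. x \<in> \<Omega> \<Longrightarrow> norm x \<le> R" using \<Omega>(2) by (auto simp: bounded_iff)
  obtain e :: 'a where e: "e \<in> Basis" using nonempty_Basis by blast
  \<comment> \<open>Longer than the diameter of \<Omega>, which is at most
    \<open>2 * \<bar>R\<bar>\<close>, so the translate of \<Omega> misses \<Omega>.\<close>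
  define h where "h = (2 * \<bar>R\<bar> + 1) *\<^sub>R e"
  have nh: "norm h = 2 * \<bar>R\<bar> + 1" using e by (simp add: h_def)
  have out: "x + h \<notin> \<Omega>" if "x \<in> \<Omega>" for x
  proof
    assume "x + h \<in> \<Omega>"
    then have "norm (x + h) \<le> R" "norm x \<le> R" using R that by auto
    moreover have "norm h \<le> norm (x + h) + norm x" using norm_triangle_ineq4[of "x + h" x] by simp
    ultimately show False using nh by linarith
  qed
  show ?thesis
  proof (rule that[of "norm h"])
    show "L2_norm \<Omega> u \<le> norm h * (\<Sum>b\<in>Basis. L2_norm \<Omega> (weak_pderiv \<Omega> b u))" if "u \<in> H10 \<Omega>" for u
      using H10_translation_bound[OF that \<Omega>(1) \<Omega>(1) subset_refl open_UNIV out] by simp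
  qed simp
qed

section \<open>Lipschitz functions vanishing on the boundary\<close>

lemma difference_quotient_tendsto:
  fixes v :: "'a::euclidean_space \<Rightarrow> real"
  assumes "v differentiable (at x)"
  shows "((\<lambda>t. (v (x + t *\<^sub>R b) - v x) / t) \<longlongrightarrow> pderiv_dir b v x) (at 0)"
proof -
  have d: "(v has_derivative frechet_derivative v (at x)) (at x)" using assms frechet_derivative_works by blast
  have "((\<lambda>s. v (x + s *\<^sub>R b)) has_derivative (\<lambda>s. frechet_derivative v (at x) (s *\<^sub>R b))) (at 0)"
    by (rule has_derivative_compose[of "\<lambda>s. x + s *\<^sub>R b"]) (use d in \<open>auto intro!: derivative_eq_intros\<close>)
  moreover have "frechet_derivative v (at x) (s *\<^sub>R b) = pderiv_dir b v x * s" for s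
    using linear_scale[OF has_derivative_linear[OF d]] by (simp add: pderiv_dir_def)
  ultimately have "((\<lambda>s. v (x + s *\<^sub>R b)) has_real_derivative pderiv_dir b v x) (at 0)"
    by (simp add: has_field_derivative_def)
  then show ?thesis by (simp add: DERIV_def)
qed

text \<open>Continuous difference quotients converge to it off the null set
  \<open>N\<close>.\<close>

lemma pderiv_dir_measurable:
  fixes v :: "'a::euclidean_space \<Rightarrow> real"
  assumes c: "continuous_on UNIV v" and N: "negligible N" and d: "\<And>x. x \<notin> N \<Longrightarrow> v differentiable (at x)"
  shows "pderiv_dir b v \<in> borel_measurable lebesgue"
proof -
  define t where "t n = 1 / real (Suc n)" for n
  have "t \<longlonglongrightarrow> 0" unfolding t_def by (rule LIMSEQ_Suc[OF lim_1_over_n])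
  moreover have "t n \<noteq> 0" for n by (simp add: t_def)
  ultimately have f: "filterlim t (at 0) sequentially" by (simp add: filterlim_at)
  have U: "UNIV \<in> sets (lebesgue :: 'a measure)" by simp
  have "pderiv_dir b v measurable_on UNIV"
  proof (rule measurable_on_limit[OF _ N])
    fix n
    have "continuous_on UNIV (\<lambda>x. (v (x + t n *\<^sub>R b) - v x) / t n)"
      by (intro continuous_intros c continuous_on_compose2[OF c]) (auto simp: t_def)
    then have "(\<lambda>x. (v (x + t n *\<^sub>R b) - v x) / t n) \<in> borel_measurable (lebesgue_on UNIV)"
      by (rule continuous_lebesgue_measurable)
    then show "(\<lambda>x. (v (x + t n *\<^sub>R b) - v x) / t n) measurable_on UNIV"
      by (rule measurable_on_iff_borel_measurable[OF U, THEN iffD2])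
  next
    fix x assume "x \<in> UNIV - N"
    then show "(\<lambda>n. (v (x + t n *\<^sub>R b) - v x) / t n) \<longlonglongrightarrow> pderiv_dir b v x"
      using filterlim_compose[OF difference_quotient_tendsto[OF d] f] by simp
  qed
  then show ?thesis unfolding measurable_on_iff_borel_measurable[OF U] lebesgue_on_UNIV_eq .
qed

lemma Lipschitz_continuous:
  fixes v :: "'a::euclidean_space \<Rightarrow> real"
  assumes L: "\<And>x y. \<bar>v x - v y\<bar> \<le> L * norm (x - y)" shows "continuous_on UNIV v"
proof -
  have La: "\<bar>v x - v y\<bar> \<le> \<bar>L\<bar> * norm (x - y)" for x y
    by (rule order_trans[OF L mult_right_mono]) auto
  show ?thesis
    by (rule lipschitz_on_continuous_on[of "\<bar>L\<bar>"], rule lipschitz_onI) (use La in \<open>auto simp: dist_norm\<close>)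
qed

lemma Lipschitz_pderiv_bound:
  fixes v :: "'a::euclidean_space \<Rightarrow> real"
  assumes L: "\<And>x y. \<bar>v x - v y\<bar> \<le> L * norm (x - y)" and b: "b \<in> Basis" and d: "v differentiable (at x)"
  shows "\<bar>pderiv_dir b v x\<bar> \<le> L"
proof (rule tendsto_upperbound[OF tendsto_rabs[OF difference_quotient_tendsto[OF d]]])
  have "\<bar>(v (x + t *\<^sub>R b) - v x) / t\<bar> \<le> L" if "t \<noteq> 0" for t
    using L[of "x + t *\<^sub>R b" x] b that by (simp add: abs_divide divide_le_eq)
  then show "\<forall>\<^sub>F t in at 0. \<bar>(v (x + t *\<^sub>R b) - v x) / t\<bar> \<le> L" by (simp add: eventually_at_filter)
qed simp

text \<open>Each \<open>w n\<close> is replaced by a test function within 1/(n+1) of it, and the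
  triangle inequality does the rest.\<close>

lemma H10_closed:
  assumes \<Omega>: "open \<Omega>" and u: "u \<in> H1 \<Omega>" and w: "\<And>n::nat. w n \<in> H10 \<Omega>"
    and l: "(\<lambda>n. L2_norm \<Omega> (\<lambda>x. u x - w n x)) \<longlonglongrightarrow> 0"
    "\<And>b. b \<in> Basis \<Longrightarrow> (\<lambda>n. L2_norm \<Omega> (\<lambda>x. weak_pderiv \<Omega> b u x - weak_pderiv \<Omega> b (w n) x)) \<longlonglongrightarrow> 0"
  shows "u \<in> H10 \<Omega>"
proof -
  have \<Omega>m: "\<Omega> \<in> sets lebesgue" using \<Omega> by auto
  have "\<exists>\<phi>. \<phi> \<in> test_fun \<Omega> \<and> H1_norm \<Omega> (\<lambda>x. w n x - \<phi> x) < 1 / real (Suc n)" for n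
  proof -
    have "\<forall>\<epsilon>>0. \<exists>\<phi>\<in>test_fun \<Omega>. H1_norm \<Omega> (\<lambda>x. w n x - \<phi> x) < \<epsilon>" "1 / real (Suc n) > 0"
      using w[of n] by (simp_all add: H10_def)
    then show ?thesis by blast
  qed
  then obtain \<phi> where \<phi>: "\<And>n::nat. \<phi> n \<in> test_fun \<Omega>" "\<And>n. H1_norm \<Omega> (\<lambda>x. w n x - \<phi> n x) < 1 / real (Suc n)" by metis
  have lim: "(\<lambda>n. 1 / real (Suc n)) \<longlonglongrightarrow> 0" by (rule LIMSEQ_Suc[OF lim_1_over_n])
  have key: "(\<lambda>n. L2_norm \<Omega> (\<lambda>x. f x - h n x)) \<longlonglongrightarrow> 0"
    if a: "(\<lambda>n. L2_norm \<Omega> (\<lambda>x. f x - g n x)) \<longlonglongrightarrow> 0" and c: "\<And>n. L2_norm \<Omega> (\<lambda>x. g n x - h n x) \<le> 1 / real (Suc n)"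
      and L: "f \<in> L2 \<Omega>" "\<And>n. g n \<in> L2 \<Omega>" "\<And>n. h n \<in> L2 \<Omega>" for f and g h :: "nat \<Rightarrow> 'a \<Rightarrow> real"
  proof (rule Lim_null_comparison)
    show "\<forall>\<^sub>F n in sequentially. norm (L2_norm \<Omega> (\<lambda>x. f x - h n x)) \<le> L2_norm \<Omega> (\<lambda>x. f x - g n x) + 1 / real (Suc n)"
    proof (intro always_eventually allI)
      fix n
      have "L2_norm \<Omega> (\<lambda>x. f x - h n x) \<le> L2_norm \<Omega> (\<lambda>x. f x - g n x) + L2_norm \<Omega> (\<lambda>x. g n x - h n x)"
        using L2_triangle[OF L2_diff[OF L(1,2)] L2_diff[OF L(2,3)], of n n] by simp
      then show "norm (L2_norm \<Omega> (\<lambda>x. f x - h n x)) \<le> L2_norm \<Omega> (\<lambda>x. f x - g n x) + 1 / real (Suc n)"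
        using c[of n] by simp
    qed
    show "(\<lambda>n. L2_norm \<Omega> (\<lambda>x. f x - g n x) + 1 / real (Suc n)) \<longlonglongrightarrow> 0" using tendsto_add[OF a lim] by simp
  qed
  have w1: "w n \<in> H1 \<Omega>" for n by (rule H10_H1[OF w])
  show ?thesis
  proof (rule H10I[OF \<Omega> u \<phi>(1)])
    show "(\<lambda>n. L2_norm \<Omega> (\<lambda>x. u x - \<phi> n x)) \<longlonglongrightarrow> 0"
    proof (rule key[OF l(1) _ H1_L2[OF u] H1_L2[OF w1] test_fun_L2[OF \<phi>(1) \<Omega>m]])
      fix n show "L2_norm \<Omega> (\<lambda>x. w n x - \<phi> n x) \<le> 1 / real (Suc n)"
        using L2_norm_le_H1_norm[of \<Omega> "\<lambda>x. w n x - \<phi> n x"] \<phi>(2)[of n] by linarith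
    qed
    fix b :: 'a assume b: "b \<in> Basis"
    show "(\<lambda>n. L2_norm \<Omega> (\<lambda>x. weak_pderiv \<Omega> b u x - pderiv_dir b (\<phi> n) x)) \<longlonglongrightarrow> 0"
    proof (rule key[OF l(2)[OF b] _ H1_weak_pderiv(2)[OF \<Omega> u b] H1_weak_pderiv(2)[OF \<Omega> w1 b] test_fun_L2[OF pderiv_test_fun[OF \<phi>(1) b] \<Omega>m]])
      fix n show "L2_norm \<Omega> (\<lambda>x. weak_pderiv \<Omega> b (w n) x - pderiv_dir b (\<phi> n) x) \<le> 1 / real (Suc n)"
        using weak_pderiv_le_H1_norm[OF b, of \<Omega> "\<lambda>x. w n x - \<phi> n x"] \<phi>(2)[of n] H1_diff_test_fun[OF \<Omega> w1 \<phi>(1) b, of n n] by linarith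
    qed
  qed
qed

text \<open>A class that contains the finite element functions and is stable under composition with
  a continuously differentiable 1-Lipschitz function. The exceptional set \<open>N\<close> makes the
  classical partial derivative available as a concrete weak derivative.\<close>

locale ae_smooth_Lipschitz =
  fixes v :: "'a::euclidean_space \<Rightarrow> real" and L :: real and N :: "'a set"
  assumes Lipschitz: "\<bar>v x - v y\<bar> \<le> L * norm (x - y)" and N: "negligible N" and diff: "x \<notin> N \<Longrightarrow> v differentiable (at x)"
begin

lemma continuous: "continuous_on S v"
  using Lipschitz_continuous[of v L, OF Lipschitz] continuous_on_subset by blast

lemma pderiv_measurable: "pderiv_dir b v \<in> borel_measurable lebesgue"
  by (rule pderiv_dir_measurable[OF continuous N diff])

lemma weak_pderiv: "b \<in> Basis \<Longrightarrow> \<Omega> \<in> sets lebesgue \<Longrightarrow> has_weak_pderiv \<Omega> b v (pderiv_dir b v)"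
proof (rule Lipschitz_has_weak_pderiv[OF _ Lipschitz _ pderiv_measurable])
  assume "b \<in> Basis"
  have "AE x in lebesgue. x \<notin> N" using N by (simp add: negligible_iff_null_sets AE_not_in)
  then show "AE x in lebesgue. ((\<lambda>t. (v (x + t *\<^sub>R b) - v x) / t) \<longlongrightarrow> pderiv_dir b v x) (at 0)"
    by eventually_elim (rule difference_quotient_tendsto[OF diff])
qed

lemma pderiv_bound: "b \<in> Basis \<Longrightarrow> AE x in lebesgue. \<bar>pderiv_dir b v x\<bar> \<le> L"
proof -
  assume b: "b \<in> Basis"
  have "AE x in lebesgue. x \<notin> N" using N by (simp add: negligible_iff_null_sets AE_not_in)
  then show ?thesis by eventually_elim (rule Lipschitz_pderiv_bound[OF Lipschitz b diff])
qed

lemma in_H1: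
  assumes \<Omega>: "open \<Omega>" "bounded \<Omega>"
  shows "v \<in> H1 \<Omega>" and "b \<in> Basis \<Longrightarrow> pderiv_dir b v \<in> L2 \<Omega>"
    and "b \<in> Basis \<Longrightarrow> AE x in lebesgue_on \<Omega>. pderiv_dir b v x = weak_pderiv \<Omega> b v x"
proof -
  have \<Omega>m: "\<Omega> \<in> sets lebesgue" "\<Omega> \<in> lmeasurable" using \<Omega> by (auto intro: lmeasurable_open)
  have "bounded (v ` closure \<Omega>)"
    using \<Omega> by (intro compact_imp_bounded compact_continuous_image continuous) (simp add: compact_closure)
  then obtain M where M: "\<And>y. y \<in> v ` closure \<Omega> \<Longrightarrow> norm y \<le> M" unfolding bounded_iff by blast
  have vL: "v \<in> L2 \<Omega>"
  proof (rule L2_mono[OF continuous_lebesgue_measurable[OF continuous] L2_const[OF \<Omega>m(2), of M]], rule AE_I2)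
    fix x assume "x \<in> space (lebesgue_on \<Omega>)"
    then have "v x \<in> v ` closure \<Omega>" using closure_subset by auto
    then show "\<bar>v x\<bar> \<le> \<bar>M\<bar>" using M[of "v x"] by simp
  qed
  show pL: "pderiv_dir b v \<in> L2 \<Omega>" if b: "b \<in> Basis" for b
  proof (rule L2_mono[OF measurable_restrict_space1[OF pderiv_measurable] L2_const[OF \<Omega>m(2), of L]])
    have "AE x in lebesgue. x \<in> \<Omega> \<longrightarrow> \<bar>pderiv_dir b v x\<bar> \<le> \<bar>L\<bar>" using pderiv_bound[OF b] by eventually_elim auto
    then show "AE x in lebesgue_on \<Omega>. \<bar>pderiv_dir b v x\<bar> \<le> \<bar>L\<bar>" using \<Omega>m(1) by (simp add: AE_restrict_space_iff)
  qed
  show "v \<in> H1 \<Omega>" by (rule H1I[OF vL]) (use pL weak_pderiv[OF _ \<Omega>m(1)] in blast)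
  show "AE x in lebesgue_on \<Omega>. pderiv_dir b v x = weak_pderiv \<Omega> b v x" if b: "b \<in> Basis"
    by (rule weak_pderiv_AE[OF \<Omega>(1) b weak_pderiv[OF b \<Omega>m(1)]])
qed

text \<open>Compact support in \<Omega> leaves room for mollification, and mollification commutes
  with the weak derivative, so values and derivatives converge together.\<close>

lemma in_H10:
  assumes \<Omega>: "open \<Omega>" "bounded \<Omega>" and S: "compact S" "S \<noteq> {}" "S \<subseteq> \<Omega>" and z: "\<And>x. x \<notin> S \<Longrightarrow> v x = 0"
  shows "v \<in> H10 \<Omega>"
proof -
  have \<Omega>m: "\<Omega> \<in> sets lebesgue" "\<Omega> \<in> lmeasurable" using \<Omega> by (auto intro: lmeasurable_open)
  have vi: "integrable lebesgue v" by (rule continuous_compact_support_integrable[OF continuous S(1) z])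
  have restr: "(\<lambda>x. if x \<in> \<Omega> then f x else 0) = f" if "\<And>x. x \<notin> S \<Longrightarrow> f x = 0" for f :: "'a \<Rightarrow> real"
    using that S(3) by (auto simp: fun_eq_iff)
  have vL: "v \<in> L2 UNIV" using L2_restrict_iff[OF \<Omega>m(1), of v] restr[OF z] H1_L2[OF in_H1(1)[OF \<Omega>]] by simp
  have pz: "pderiv_dir b v x = 0" if "x \<notin> S" for b x
  proof (rule pderiv_dir_eqI[where f'="\<lambda>h. 0"], rule has_derivative_transform_within_open)
    show "((\<lambda>x. 0) has_derivative (\<lambda>h. 0)) (at x)" by (rule has_derivative_const)
    show "open (- S)" using compact_imp_closed[OF S(1)] by (rule open_Compl)
    show "x \<in> - S" using that by simp
    show "0 = v y" if "y \<in> - S" for y using z[of y] that by simp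
  qed
  have pL: "pderiv_dir b v \<in> L2 UNIV" if "b \<in> Basis" for b
    using L2_restrict_iff[OF \<Omega>m(1), of "pderiv_dir b v"] restr[OF pz] in_H1(2)[OF \<Omega> that] by simp
  have pi: "integrable lebesgue (pderiv_dir b v)" if "b \<in> Basis" for b
    using L2_integrable[OF \<Omega>m(2) in_H1(2)[OF \<Omega> that]] Lebesgue_Measure.integrable_restrict_UNIV[OF \<Omega>m(1), of "pderiv_dir b v"] restr[OF pz] by simp
  obtain r where r: "r > 0" "{x. infdist x S \<le> r} \<subseteq> \<Omega>" "compact {x. infdist x S \<le> r}"
    using compact_infdist_neighbourhood[OF S(1,2) \<Omega>(1) S(3)] by blast
  \<comment> \<open>Dropping the first \<open>m\<close> mollifiers keeps every support inside the
    \<open>r\<close>-neighbourhood of \<open>S\<close>, a compact subset of \<Omega>.\<close>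
  obtain m where m: "1 / real (Suc m) < r" using nat_approx_posE[OF r(1)] by blast
  define \<phi> where "\<phi> n = conv (moll (n + m)) v" for n
  have \<phi>t: "\<phi> n \<in> test_fun \<Omega>" for n
  proof (rule test_funI[OF _ r(3,2)])
    show "smooth (\<phi> n)" unfolding \<phi>_def by (rule smooth_conv[OF moll_test_fun vi])
    fix x assume x: "x \<notin> {x. infdist x S \<le> r}"
    show "\<phi> n x = 0" unfolding \<phi>_def
    proof (rule conv_moll_eq_0)
      fix y assume y: "dist x y < 1 / real (Suc (n + m))"
      have "1 / real (Suc (n + m)) \<le> 1 / real (Suc m)" by (simp add: frac_le)
      then have "dist x y < r" using y m by linarith
      moreover have "infdist x S \<le> dist x y" if "y \<in> S" using infdist_le[OF that] .
      ultimately show "v y = 0" using x z[of y] by force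
    qed
  qed
  have p\<phi>: "pderiv_dir b (\<phi> n) = conv (moll (n + m)) (pderiv_dir b v)" if b: "b \<in> Basis" for b n
  proof
    fix x
    have "pderiv_dir b (\<phi> n) x = conv (pderiv_dir b (moll (n + m))) v x"
      unfolding \<phi>_def by (simp only: pderiv_dir_conv[OF moll_test_fun vi b])
    also have "\<dots> = conv (moll (n + m)) (pderiv_dir b v) x"
    proof -
      have "conv (pderiv_dir b (moll (n + m))) (\<lambda>x. if x \<in> UNIV then v x else 0) x
          = conv (moll (n + m)) (\<lambda>x. if x \<in> UNIV then pderiv_dir b v x else 0) x"
        by (rule conv_weak_pderiv[OF open_UNIV b weak_pderiv[OF b] moll_test_fun moll_eq_0 subset_UNIV]) simp_all
      then show ?thesis by simp
    qed
    finally show "pderiv_dir b (\<phi> n) x = conv (moll (n + m)) (pderiv_dir b v) x" .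
  qed
  have conv_lim: "(\<lambda>n. L2_norm \<Omega> (\<lambda>x. f x - conv (moll (n + m)) f x)) \<longlonglongrightarrow> 0" if f: "integrable lebesgue f" "f \<in> L2 UNIV" for f
  proof (rule Lim_null_comparison)
    show "(\<lambda>n. L2_norm UNIV (\<lambda>x. conv (moll (n + m)) f x - f x)) \<longlonglongrightarrow> 0"
      by (rule LIMSEQ_ignore_initial_segment[OF conv_moll_tendsto_L2[OF f]])
    show "\<forall>\<^sub>F n in sequentially. norm (L2_norm \<Omega> (\<lambda>x. f x - conv (moll (n + m)) f x)) \<le> L2_norm UNIV (\<lambda>x. conv (moll (n + m)) f x - f x)"
    proof (intro always_eventually allI)
      fix n
      have "L2_norm \<Omega> (\<lambda>x. f x - conv (moll (n + m)) f x) \<le> L2_norm UNIV (\<lambda>x. f x - conv (moll (n + m)) f x)"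
        by (rule L2_subset(2)[OF _ \<Omega>m(1) subset_UNIV L2_diff[OF f(2) conv_moll_L2(1)[OF f]]]) simp
      then show "norm (L2_norm \<Omega> (\<lambda>x. f x - conv (moll (n + m)) f x)) \<le> L2_norm UNIV (\<lambda>x. conv (moll (n + m)) f x - f x)"
        using L2_norm_minus_commute[of UNIV f] by simp
    qed
  qed
  show ?thesis
  proof (rule H10I[OF \<Omega>(1) in_H1(1)[OF \<Omega>] \<phi>t])
    show "(\<lambda>n. L2_norm \<Omega> (\<lambda>x. v x - \<phi> n x)) \<longlonglongrightarrow> 0" unfolding \<phi>_def by (rule conv_lim[OF vi vL])
    fix b :: 'a assume b: "b \<in> Basis"
    have "L2_norm \<Omega> (\<lambda>x. weak_pderiv \<Omega> b v x - pderiv_dir b (\<phi> n) x) = L2_norm \<Omega> (\<lambda>x. pderiv_dir b v x - pderiv_dir b (\<phi> n) x)" for n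
    proof (rule L2_norm_cong_AE[OF \<Omega>m(1)])
      show "(\<lambda>x. pderiv_dir b v x - pderiv_dir b (\<phi> n) x) \<in> L2 \<Omega>"
        by (rule L2_diff[OF in_H1(2)[OF \<Omega> b] test_fun_L2[OF pderiv_test_fun[OF \<phi>t b] \<Omega>m(1)]])
      show "AE x in lebesgue_on \<Omega>. pderiv_dir b v x - pderiv_dir b (\<phi> n) x = weak_pderiv \<Omega> b v x - pderiv_dir b (\<phi> n) x"
        using in_H1(3)[OF \<Omega> b] by eventually_elim simp
    qed
    then show "(\<lambda>n. L2_norm \<Omega> (\<lambda>x. weak_pderiv \<Omega> b v x - pderiv_dir b (\<phi> n) x)) \<longlonglongrightarrow> 0"
      unfolding p\<phi>[OF b] using conv_lim[OF pi[OF b] pL[OF b]] by simp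
  qed
qed

end

text \<open>The nonzero branch is \<open>(\<bar>s\<bar> - d)\<^sup>2 / s\<close>, which makes this a continuously differentiable truncation: composed with a function
  vanishing on the boundary it produces compact support.\<close>

definition soft_cut :: "real \<Rightarrow> real \<Rightarrow> real" where
  "soft_cut d s = (if \<bar>s\<bar> \<le> d then 0 else s - 2 * d * sgn s + d\<^sup>2 / s)"

lemma soft_cut_derivative:
  assumes d: "d > 0"
  shows "(soft_cut d has_real_derivative (if \<bar>s\<bar> \<le> d then 0 else 1 - d\<^sup>2 / s\<^sup>2)) (at s)"
proof -
  have out: "((\<lambda>s. s - 2 * d * c + d\<^sup>2 / s) has_real_derivative (1 - d\<^sup>2 / s\<^sup>2)) (at s)" if "s \<noteq> 0" for s c
    using that by (auto intro!: derivative_eq_intros simp: power2_eq_square)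
  \<comment> \<open>Quadratic contact with zero where \<open>\<bar>s\<bar> = d\<close>. It yields
    derivative zero at the junctions, where neither formula holds on both sides.\<close>
  have bd: "\<bar>soft_cut d y\<bar> \<le> (y - s)\<^sup>2 / d" if "\<bar>s\<bar> = d" for s y
  proof (cases "\<bar>y\<bar> \<le> d")
    case True then show ?thesis using d by (simp add: soft_cut_def)
  next
    case False
    then have y0: "\<bar>y\<bar> > d" by simp
    have e: "soft_cut d y = (\<bar>y\<bar> - d)\<^sup>2 / y"
      using False d y0 by (auto simp: soft_cut_def power2_eq_square field_simps sgn_if)
    have "(\<bar>y\<bar> - d)\<^sup>2 \<le> (y - s)\<^sup>2" using that abs_triangle_ineq3[of y s] by (simp add: abs_le_square_iff[symmetric])
    then show ?thesis unfolding e abs_divide using y0 d by (simp add: frac_le)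
  qed
  consider "\<bar>s\<bar> < d" | "s > d" | "s < - d" | "\<bar>s\<bar> = d" by linarith
  then show ?thesis
  proof cases
    case 1
    have "(soft_cut d has_real_derivative 0) (at s)"
    proof (rule has_field_derivative_transform_within_open[of "\<lambda>_. 0" _ _ "{-d<..<d}"])
      show "0 = soft_cut d y" if "y \<in> {-d<..<d}" for y using that by (auto simp: soft_cut_def)
    qed (use 1 in auto)
    then show ?thesis using 1 by simp
  next
    case 2
    have "(soft_cut d has_real_derivative (1 - d\<^sup>2 / s\<^sup>2)) (at s)"
    proof (rule has_field_derivative_transform_within_open[OF out[of s 1], of "{d<..}"])
      show "y - 2 * d * 1 + d\<^sup>2 / y = soft_cut d y" if "y \<in> {d<..}" for y using that d by (auto simp: soft_cut_def sgn_if)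
    qed (use 2 d in auto)
    then show ?thesis using 2 d by simp
  next
    case 3
    have "(soft_cut d has_real_derivative (1 - d\<^sup>2 / s\<^sup>2)) (at s)"
    proof (rule has_field_derivative_transform_within_open[OF out[of s "-1"], of "{..<-d}"])
      show "y - 2 * d * (- 1) + d\<^sup>2 / y = soft_cut d y" if "y \<in> {..<-d}" for y using that d by (auto simp: soft_cut_def sgn_if)
    qed (use 3 d in auto)
    then show ?thesis using 3 d by simp
  next
    case 4
    have "((\<lambda>h. (soft_cut d (s + h) - soft_cut d s) / h) \<longlongrightarrow> 0) (at 0)"
    proof (rule Lim_null_comparison)
      have "norm ((soft_cut d (s + h) - soft_cut d s) / h) \<le> \<bar>h\<bar> / d" if "h \<noteq> 0" for h
      proof -
        have "soft_cut d s = 0" using 4 by (simp add: soft_cut_def)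
        then have "\<bar>soft_cut d (s + h) - soft_cut d s\<bar> \<le> h\<^sup>2 / d" using bd[OF 4, of "s + h"] by simp
        then have "\<bar>soft_cut d (s + h) - soft_cut d s\<bar> / \<bar>h\<bar> \<le> h\<^sup>2 / d / \<bar>h\<bar>" by (rule divide_right_mono) simp
        then show ?thesis using that by (simp add: abs_divide power2_eq_square field_simps)
      qed
      then show "\<forall>\<^sub>F h in at 0. norm ((soft_cut d (s + h) - soft_cut d s) / h) \<le> \<bar>h\<bar> / d" by (simp add: eventually_at_filter)
      have "((\<lambda>h. \<bar>h\<bar> / d) \<longlongrightarrow> \<bar>0\<bar> / d) (at 0)" using d by (intro tendsto_intros) auto
      then show "((\<lambda>h. \<bar>h\<bar> / d) \<longlongrightarrow> 0) (at 0)" by simp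
    qed
    then show ?thesis using 4 by (simp add: DERIV_def)
  qed
qed

lemma soft_cut_bounds:
  assumes d: "d > 0"
  shows "\<bar>soft_cut d s - s\<bar> \<le> 2 * d" "0 \<le> (if \<bar>s\<bar> \<le> d then 0 else 1 - d\<^sup>2 / s\<^sup>2)" "(if \<bar>s\<bar> \<le> d then 0 else 1 - d\<^sup>2 / s\<^sup>2) \<le> 1"
    "\<bar>soft_cut d s - soft_cut d t\<bar> \<le> \<bar>s - t\<bar>"
proof -
  have q: "d\<^sup>2 / s\<^sup>2 \<le> 1" if "\<not> \<bar>s\<bar> \<le> d" for s
  proof -
    have "d\<^sup>2 \<le> \<bar>s\<bar>\<^sup>2" using that d by (intro power_mono) auto
    moreover have "s \<noteq> 0" using that d by auto
    ultimately show ?thesis by (simp add: divide_le_eq)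
  qed
  show "0 \<le> (if \<bar>s\<bar> \<le> d then 0 else 1 - d\<^sup>2 / s\<^sup>2)" for s using q by auto
  show "(if \<bar>s\<bar> \<le> d then 0 else 1 - d\<^sup>2 / s\<^sup>2) \<le> 1" for s by auto
  show "\<bar>soft_cut d s - s\<bar> \<le> 2 * d"
  proof (cases "\<bar>s\<bar> \<le> d")
    case False
    then have "\<bar>d\<^sup>2 / s\<bar> \<le> d" using d by (simp add: abs_divide power2_eq_square divide_le_eq)
    moreover have "s > 0 \<Longrightarrow> d\<^sup>2 / s \<ge> 0" "s < 0 \<Longrightarrow> d\<^sup>2 / s \<le> 0" by (auto simp: divide_le_0_iff)
    ultimately show ?thesis using False d by (auto simp: soft_cut_def sgn_if)
  qed (use d in \<open>simp add: soft_cut_def\<close>)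
  have "norm (soft_cut d s - soft_cut d t) \<le> 1 * norm (s - t)"
  proof (rule field_differentiable_bound[of UNIV "soft_cut d" "\<lambda>s. if \<bar>s\<bar> \<le> d then 0 else 1 - d\<^sup>2 / s\<^sup>2"])
    show "(soft_cut d has_real_derivative (if \<bar>s\<bar> \<le> d then 0 else 1 - d\<^sup>2 / s\<^sup>2)) (at s within UNIV)" for s
      using soft_cut_derivative[OF d, of s] by simp
    show "norm (if \<bar>s\<bar> \<le> d then 0 else 1 - d\<^sup>2 / s\<^sup>2) \<le> 1" for s using q[of s] by auto
  qed auto
  then show "\<bar>soft_cut d s - soft_cut d t\<bar> \<le> \<bar>s - t\<bar>" by simp
qed

text \<open>Truncation at the level 1/(n+1) gives compact support in \<Omega>, because
  \<open>v\<close> is continuous and vanishes outside. The derivatives of the truncations converge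
  to those of \<open>v\<close> where \<open>v\<close> is nonzero; where \<open>v\<close> is zero
  they are all zero, and \<open>flat\<close> makes this the correct limit.\<close>

lemma (in ae_smooth_Lipschitz) in_H10_zero_boundary:
  assumes \<Omega>: "open \<Omega>" "bounded \<Omega>" "\<Omega> \<noteq> {}" and z: "\<And>x. x \<notin> \<Omega> \<Longrightarrow> v x = 0"
    and flat: "\<And>x b. x \<notin> N \<Longrightarrow> v x = 0 \<Longrightarrow> b \<in> Basis \<Longrightarrow> pderiv_dir b v x = 0"
  shows "v \<in> H10 \<Omega>"
proof -
  have \<Omega>m: "\<Omega> \<in> sets lebesgue" "\<Omega> \<in> lmeasurable" using \<Omega> by (auto intro: lmeasurable_open)
  define d where "d n = 1 / real (Suc n)" for n
  have d: "d n > 0" for n by (simp add: d_def)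
  have dl: "d \<longlonglongrightarrow> 0" unfolding d_def by (rule LIMSEQ_Suc[OF lim_1_over_n])
  define w where "w n x = soft_cut (d n) (v x)" for n x
  define c where "c n s = (if \<bar>s\<bar> \<le> d n then 0 else 1 - (d n)\<^sup>2 / s\<^sup>2)" for n and s :: real
  have c01: "0 \<le> c n s" "c n s \<le> 1" for n s using soft_cut_bounds(2,3)[OF d[of n], of s] by (auto simp: c_def)
  have wd: "(w n has_derivative (\<lambda>h. c n (v x) * frechet_derivative v (at x) h)) (at x)" if "x \<notin> N" for n x
  proof -
    have "(v has_derivative frechet_derivative v (at x)) (at x)" using diff[OF that] frechet_derivative_works by blast
    from has_derivative_compose[OF this soft_cut_derivative[OF d[of n], of "v x", unfolded has_field_derivative_def]]
    show ?thesis by (simp add: w_def[abs_def] c_def)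
  qed
  have pw: "pderiv_dir b (w n) x = c n (v x) * pderiv_dir b v x" if "x \<notin> N" for n b x
    using pderiv_dir_eqI[OF wd[OF that]] by (simp add: pderiv_dir_def)
  have W: "ae_smooth_Lipschitz (w n) L N" for n
  proof
    show "\<bar>w n x - w n y\<bar> \<le> L * norm (x - y)" for x y
      using soft_cut_bounds(4)[OF d[of n], of "v x" "v y"] Lipschitz[of x y] by (simp add: w_def)
    show "negligible N" by (rule N)
    show "w n differentiable (at x)" if "x \<notin> N" for x using wd[OF that] by (rule differentiableI)
  qed
  obtain a where a: "a \<in> \<Omega>" using \<Omega>(3) by blast
  have wH: "w n \<in> H10 \<Omega>" for n
  proof (rule ae_smooth_Lipschitz.in_H10[OF W \<Omega>(1,2)])
    \<comment> \<open>The point \<open>a\<close> makes the compact set nonempty, as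
      \<open>in_H10\<close> requires.\<close>
    let ?S = "insert a (v -` (- {- d n<..<d n}) \<inter> closure \<Omega>)"
    have "closed (v -` (- {- d n<..<d n}))" by (rule continuous_closed_vimage) (use continuous[of UNIV] in \<open>auto simp: continuous_on_eq_continuous_at\<close>)
    then show "compact ?S" using \<Omega>(2) by (intro compact_insert closed_Int_compact) (auto simp: compact_closure)
    show "?S \<noteq> {}" by simp
    show "?S \<subseteq> \<Omega>" using a z d[of n] by force
    show "w n x = 0" if "x \<notin> ?S" for x
    proof (cases "x \<in> \<Omega>")
      case True
      then have "x \<in> closure \<Omega>" using closure_subset by blast
      then have "\<bar>v x\<bar> \<le> d n" using that by auto
      then show ?thesis by (simp add: w_def soft_cut_def)
    next
      case False then show ?thesis using z[OF False] d[of n] by (simp add: w_def soft_cut_def)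
    qed
  qed
  have NAE: "AE x in lebesgue_on \<Omega>. x \<notin> N"
  proof -
    have "AE x in lebesgue. x \<notin> N" using N by (simp add: negligible_iff_null_sets AE_not_in)
    then have "AE x in lebesgue. x \<in> \<Omega> \<longrightarrow> x \<notin> N" by eventually_elim simp
    then show ?thesis using \<Omega>m(1) by (simp add: AE_restrict_space_iff)
  qed
  have wm: "w n \<in> borel_measurable (lebesgue_on \<Omega>)" for n using L2_measurable[OF H1_L2[OF H10_H1[OF wH]]] .
  have vm: "v \<in> borel_measurable (lebesgue_on \<Omega>)" using L2_measurable[OF H1_L2[OF in_H1(1)[OF \<Omega>(1,2)]]] .
  show ?thesis
  proof (rule H10_closed[OF \<Omega>(1) in_H1(1)[OF \<Omega>(1,2)] wH])
    have "(\<lambda>n. L2_norm \<Omega> (\<lambda>x. w n x - v x)) \<longlonglongrightarrow> 0"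
    proof (rule L2_norm_dominated_convergence[OF wm vm L2_const[OF \<Omega>m(2), of 2]])
      have b: "\<bar>w n x - v x\<bar> \<le> 2 * d n" for n x using soft_cut_bounds(1)[OF d] by (simp add: w_def)
      have "(\<lambda>n. w n x) \<longlonglongrightarrow> v x" for x
      proof -
        have "(\<lambda>n. w n x - v x) \<longlonglongrightarrow> 0"
          by (rule Lim_null_comparison[OF _ tendsto_mult_right_zero[OF dl, of 2]]) (use b in simp)
        then show ?thesis by (simp add: LIM_zero_iff)
      qed
      then show "AE x in lebesgue_on \<Omega>. (\<lambda>n. w n x) \<longlonglongrightarrow> v x" by simp
      have "d n \<le> 1" for n by (simp add: d_def)
      then have "\<bar>w n x - v x\<bar> \<le> 2" for n x using b[of n x] by (smt (verit))
      then show "AE x in lebesgue_on \<Omega>. \<bar>w n x - v x\<bar> \<le> 2" for n by simp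
    qed
    then show "(\<lambda>n. L2_norm \<Omega> (\<lambda>x. v x - w n x)) \<longlonglongrightarrow> 0" unfolding L2_norm_minus_commute[of \<Omega> v] .
    fix b :: 'a assume b: "b \<in> Basis"
    have "(\<lambda>n. L2_norm \<Omega> (\<lambda>x. weak_pderiv \<Omega> b (w n) x - weak_pderiv \<Omega> b v x)) \<longlonglongrightarrow> 0"
    proof (rule L2_norm_dominated_convergence)
      show "weak_pderiv \<Omega> b (w n) \<in> borel_measurable (lebesgue_on \<Omega>)" for n
        by (rule L2_measurable[OF H1_weak_pderiv(2)[OF \<Omega>(1) H10_H1[OF wH] b]])
      show "weak_pderiv \<Omega> b v \<in> borel_measurable (lebesgue_on \<Omega>)"
        by (rule L2_measurable[OF H1_weak_pderiv(2)[OF \<Omega>(1) in_H1(1)[OF \<Omega>(1,2)] b]])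
      show "(\<lambda>x. \<bar>weak_pderiv \<Omega> b v x\<bar>) \<in> L2 \<Omega>"
        using H1_weak_pderiv(2)[OF \<Omega>(1) in_H1(1)[OF \<Omega>(1,2)] b] by (auto simp: L2_def)
      have eq: "AE x in lebesgue_on \<Omega>. weak_pderiv \<Omega> b (w n) x = c n (v x) * weak_pderiv \<Omega> b v x" for n
        using ae_smooth_Lipschitz.in_H1(3)[OF W \<Omega>(1,2) b, of n] in_H1(3)[OF \<Omega>(1,2) b] NAE
        by eventually_elim (simp add: pw)
      have zero: "AE x in lebesgue_on \<Omega>. v x = 0 \<longrightarrow> weak_pderiv \<Omega> b v x = 0"
        using in_H1(3)[OF \<Omega>(1,2) b] NAE by eventually_elim (use flat b in auto)
      have "AE x in lebesgue_on \<Omega>. \<forall>n. weak_pderiv \<Omega> b (w n) x = c n (v x) * weak_pderiv \<Omega> b v x"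
        using eq by (simp add: AE_all_countable)
      then show "AE x in lebesgue_on \<Omega>. (\<lambda>n. weak_pderiv \<Omega> b (w n) x) \<longlonglongrightarrow> weak_pderiv \<Omega> b v x" using zero
      proof eventually_elim
        case (elim x)
        show ?case
        proof (cases "v x = 0")
          case True
          then show ?thesis using elim by simp
        next
          case False
          have "(\<lambda>n. c n (v x)) \<longlonglongrightarrow> 1 - 0\<^sup>2 / (v x)\<^sup>2"
          proof (rule Lim_transform_eventually)
            show "(\<lambda>n. 1 - (d n)\<^sup>2 / (v x)\<^sup>2) \<longlonglongrightarrow> 1 - 0\<^sup>2 / (v x)\<^sup>2" using False by (intro tendsto_intros dl) auto
            have "\<forall>\<^sub>F n in sequentially. d n < \<bar>v x\<bar>" using order_tendstoD(2)[OF dl, of "\<bar>v x\<bar>"] False by simp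
            then show "\<forall>\<^sub>F n in sequentially. 1 - (d n)\<^sup>2 / (v x)\<^sup>2 = c n (v x)" by eventually_elim (simp add: c_def)
          qed
          then have "(\<lambda>n. c n (v x) * weak_pderiv \<Omega> b v x) \<longlonglongrightarrow> 1 * weak_pderiv \<Omega> b v x" by (intro tendsto_mult tendsto_const) simp
          then show ?thesis using elim by simp
        qed
      qed
      show "AE x in lebesgue_on \<Omega>. \<bar>weak_pderiv \<Omega> b (w n) x - weak_pderiv \<Omega> b v x\<bar> \<le> \<bar>weak_pderiv \<Omega> b v x\<bar>" for n
        using eq[of n]
      proof eventually_elim
        case (elim x)
        have "c n (v x) * weak_pderiv \<Omega> b v x - weak_pderiv \<Omega> b v x = - ((1 - c n (v x)) * weak_pderiv \<Omega> b v x)" by (simp add: algebra_simps)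
        then have "\<bar>weak_pderiv \<Omega> b (w n) x - weak_pderiv \<Omega> b v x\<bar> = (1 - c n (v x)) * \<bar>weak_pderiv \<Omega> b v x\<bar>"
          using elim c01[of n "v x"] by (simp add: abs_mult)
        also have "\<dots> \<le> 1 * \<bar>weak_pderiv \<Omega> b v x\<bar>" using c01[of n "v x"] by (intro mult_right_mono) auto
        finally show ?case by simp
      qed
    qed
    then show "(\<lambda>n. L2_norm \<Omega> (\<lambda>x. weak_pderiv \<Omega> b v x - weak_pderiv \<Omega> b (w n) x)) \<longlonglongrightarrow> 0"
      unfolding L2_norm_minus_commute[of \<Omega> "weak_pderiv \<Omega> b v"] .
  qed
qed

section \<open>Continuous piecewise linear functions\<close>

definition vertices :: "(real^2) set \<Rightarrow> (real^2) set" where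
  "vertices K = {z. z extreme_point_of K}"

lemma triangle:
  fixes K :: "(real^2) set"
  assumes "2 simplex K"
  shows "finite (vertices K)" "\<not> affine_dependent (vertices K)" "K = convex hull (vertices K)"
    "card (vertices K) = 3" "compact K" "convex K" "interior K \<noteq> {}"
proof -
  obtain C where C: "\<not> affine_dependent C" "int (card C) = 2 + 1" "K = convex hull C"
    using assms unfolding simplex_def by blast
  have v: "vertices K = C"
    unfolding vertices_def C(3) using extreme_point_of_convex_hull_affine_independent[OF C(1)] by auto
  have f: "finite C" by (rule aff_independent_finite[OF C(1)])
  show "finite (vertices K)" "\<not> affine_dependent (vertices K)" "K = convex hull (vertices K)" "card (vertices K) = 3"
    unfolding v using C f by auto
  show "compact K" unfolding C(3) using f by (intro compact_convex_hull finite_imp_compact)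
  show "convex K" unfolding C(3) by simp
  have "card C = Suc (DIM(real^2))" using C(2) by simp
  then show "interior K \<noteq> {}" unfolding C(3) using interior_convex_hull_eq_empty C(1) by blast
qed

lemma triangle_combination:
  assumes "2 simplex K" "x \<in> K"
  obtains \<mu> where "\<And>z. z \<in> vertices K \<Longrightarrow> 0 \<le> \<mu> z" "sum \<mu> (vertices K) = (1::real)" "(\<Sum>z\<in>vertices K. \<mu> z *\<^sub>R z) = x"
proof -
  have "x \<in> convex hull (vertices K)" using triangle(3)[OF assms(1)] assms(2) by simp
  then show ?thesis using that unfolding convex_hull_finite[OF triangle(1)[OF assms(1)]] by blast
qed

lemma affine_combination:
  fixes g :: "'a::real_inner"
  assumes "sum \<mu> A = (1::real)"
  shows "c + g \<bullet> (\<Sum>z\<in>A. \<mu> z *\<^sub>R z) = (\<Sum>z\<in>A. \<mu> z * (c + g \<bullet> z))"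
proof -
  have "(\<Sum>z\<in>A. \<mu> z * (c + g \<bullet> z)) = (\<Sum>z\<in>A. \<mu> z) * c + (\<Sum>z\<in>A. \<mu> z * (g \<bullet> z))"
    by (simp add: distrib_left sum.distrib sum_distrib_right)
  then show ?thesis using assms by (simp add: inner_sum_right)
qed

text \<open>Differences to one fixed vertex are linearly independent, so a linear map with the
  prescribed increments exists; \<open>g\<close> is the vector representing it.\<close>

lemma affine_interpolation:
  fixes q :: "'a::euclidean_space \<Rightarrow> real"
  assumes "\<not> affine_dependent V" "V \<noteq> {}"
  obtains c g where "\<And>z. z \<in> V \<Longrightarrow> c + g \<bullet> z = q z"
proof -
  obtain a where a: "a \<in> V" using assms(2) by blast
  have "independent ((\<lambda>x. - a + x) ` (V - {a}))" using assms(1) affine_dependent_iff_dependent2[OF a] by simp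
  from linear_independent_extend[OF this, of "\<lambda>y. q (a + y) - q a"]
  obtain f where f: "linear f" "\<forall>y\<in>(\<lambda>x. - a + x) ` (V - {a}). f y = q (a + y) - q a" by blast
  define g where "g = (\<Sum>b\<in>Basis. f b *\<^sub>R b)"
  have fg: "f y = g \<bullet> y" for y
  proof -
    have "f y = f (\<Sum>b\<in>Basis. (y \<bullet> b) *\<^sub>R b)" by (simp add: euclidean_representation)
    also have "\<dots> = (\<Sum>b\<in>Basis. (y \<bullet> b) * f b)" by (simp add: linear_sum[OF f(1)] linear_scale[OF f(1)])
    also have "\<dots> = g \<bullet> y" by (simp add: g_def inner_sum_left) (simp add: inner_commute mult.commute)
    finally show ?thesis .
  qed
  show ?thesis
  proof (rule that[of "q a - g \<bullet> a" g])
    fix z assume z: "z \<in> V"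
    show "q a - g \<bullet> a + g \<bullet> z = q z"
    proof (cases "z = a")
      case False
      then have "f (- a + z) = q z - q a" using f(2) z by force
      then show ?thesis unfolding fg by (simp add: inner_diff_right)
    qed simp
  qed
qed

section \<open>Gluing affine pieces over a conforming triangulation\<close>

locale fe_mesh =
  fixes \<Omega> :: "(real^2) set" and \<T> :: "(real^2) set set"
  assumes polygonal: "polygonal_domain \<Omega>" and mesh: "conforming_triangulation \<Omega> \<T>"
begin

lemma open_domain: "open \<Omega>" and bounded_domain: "bounded \<Omega>"
  and interior_closure_domain: "interior (closure \<Omega>) = \<Omega>" and domain_nonempty: "\<Omega> \<noteq> {}"
  using polygonal by (auto simp: polygonal_domain_def)

lemma domain_lebesgue: "\<Omega> \<in> sets lebesgue" using open_domain by auto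

lemma finite_mesh: "finite \<T>"
  and face_mesh: "K \<in> \<T> \<Longrightarrow> K' \<in> \<T> \<Longrightarrow> (K \<inter> K') face_of K"
  and mesh_simplex: "K \<in> \<T> \<Longrightarrow> 2 simplex K" and mesh_Union: "\<Union>\<T> = closure \<Omega>"
  using mesh by (auto simp: conforming_triangulation_def triangulation_def)

lemma mesh_subset: "K \<in> \<T> \<Longrightarrow> K \<subseteq> closure \<Omega>" using mesh_Union by blast

lemma mesh_interior_subset: "K \<in> \<T> \<Longrightarrow> interior K \<subseteq> \<Omega>"
  using interior_mono[OF mesh_subset] interior_closure_domain by blast

lemma mesh_compact: "K \<in> \<T> \<Longrightarrow> compact K" using triangle(5)[OF mesh_simplex] .

lemma interior_nodes_eq: "interior_nodes \<Omega> \<T> = \<Omega> \<inter> (\<Union>K\<in>\<T>. vertices K)"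
  by (auto simp: interior_nodes_def vertices_def)

lemma finite_interior_nodes: "finite (interior_nodes \<Omega> \<T>)"
  unfolding interior_nodes_eq using finite_mesh triangle(1)[OF mesh_simplex] by auto

text \<open>Conformity makes the intersection a common face. By the Krein-Milman theorem it is the
  hull of its extreme points, which are vertices of both triangles, and there the two affine
  functions agree. Hence pieces chosen separately on each triangle glue together.\<close>

lemma affine_agree_face:
  assumes K: "K \<in> \<T>" and K': "K' \<in> \<T>" and x: "x \<in> K" "x \<in> K'"
    and e: "\<And>z. z \<in> vertices K \<Longrightarrow> c + g \<bullet> z = q z" "\<And>z. z \<in> vertices K' \<Longrightarrow> c' + g' \<bullet> z = q z"
  shows "c + g \<bullet> x = c' + g' \<bullet> x"
proof -
  let ?F = "K \<inter> K'"
  have F: "?F face_of K" "?F face_of K'" using face_mesh[OF K K'] face_mesh[OF K' K] by (auto simp: Int_commute)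
  have "compact ?F" "convex ?F"
    using mesh_compact[OF K] mesh_compact[OF K'] triangle(6)[OF mesh_simplex] K K' by (auto intro: compact_Int convex_Int)
  then have "?F = convex hull {z. z extreme_point_of ?F}" by (rule Krein_Milman_Minkowski)
  moreover have "convex hull {z. z extreme_point_of ?F} \<subseteq> {y. (g - g') \<bullet> y = c' - c}"
  proof (rule hull_minimal)
    show "{z. z extreme_point_of ?F} \<subseteq> {y. (g - g') \<bullet> y = c' - c}"
    proof clarify
      fix z assume "z extreme_point_of ?F"
      then have "z \<in> vertices K" "z \<in> vertices K'"
        using extreme_point_of_face[OF F(1)] extreme_point_of_face[OF F(2)] by (auto simp: vertices_def)
      then show "(g - g') \<bullet> z = c' - c" using e(1)[of z] e(2)[of z] by (simp add: inner_diff_left)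
    qed
    show "convex {y. (g - g') \<bullet> y = c' - c}" by (rule convex_hyperplane)
  qed
  ultimately have "(g - g') \<bullet> x = c' - c" using x by blast
  then show ?thesis by (simp add: inner_diff_left)
qed

text \<open>This is why zero values at boundary vertices give zero on the whole boundary: a boundary
  point puts no weight on an interior vertex. Close to \<open>a\<close> the ray from
  \<open>a\<close> through \<open>x\<close> lies in \<Omega>; every triangle containing such a point
  \<open>y\<close> also contains the end point \<open>w\<close> of the ray in the triangle, by the
  face property. Contracting a neighbourhood of \<open>y\<close> towards \<open>w\<close> therefore
  stays in the mesh and covers a neighbourhood of \<open>x\<close>.\<close>

lemma interior_vertex_imp_interior:
  assumes K: "K \<in> \<T>" and mu: "\<And>z. z \<in> vertices K \<Longrightarrow> 0 \<le> \<mu> z" "sum \<mu> (vertices K) = (1::real)" "(\<Sum>z\<in>vertices K. \<mu> z *\<^sub>R z) = x"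
    and a: "a \<in> vertices K" "\<mu> a > 0" "a \<in> \<Omega>"
  shows "x \<in> \<Omega>"
proof (cases "\<mu> a = 1")
  case True
  have fin: "finite (vertices K)" by (rule triangle(1)[OF mesh_simplex[OF K]])
  have "sum \<mu> (vertices K - {a}) = 0" using mu(2) True a(1) fin by (simp add: sum.remove)
  then have "\<mu> z = 0" if "z \<in> vertices K - {a}" for z
    using sum_nonneg_eq_0_iff[of "vertices K - {a}" \<mu>] mu(1) fin that by auto
  then have "(\<Sum>z\<in>vertices K. \<mu> z *\<^sub>R z) = a" using fin a(1) True by (simp add: sum.remove)
  then show ?thesis using mu(3) a(3) by simp
next
  case False
  let ?V = "vertices K"
  have fin: "finite ?V" by (rule triangle(1)[OF mesh_simplex[OF K]])
  have s: "sum \<mu> (?V - {a}) = 1 - \<mu> a" using mu(2) a(1) fin by (simp add: sum.remove)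
  have "sum \<mu> (?V - {a}) \<ge> 0" using mu(1) by (intro sum_nonneg) auto
  then have r: "1 - \<mu> a > 0" using s False by simp
  \<comment> \<open>The point where the ray from \<open>a\<close> through \<open>x\<close> meets the
    side opposite \<open>a\<close>: the other weights, renormalised.\<close>
  define w where "w = (\<Sum>z\<in>?V - {a}. (\<mu> z / (1 - \<mu> a)) *\<^sub>R z)"
  have wx: "x = \<mu> a *\<^sub>R a + (1 - \<mu> a) *\<^sub>R w"
    using r mu(3) fin a(1) by (simp add: w_def scaleR_sum_right sum.remove)
  have wh: "w \<in> convex hull (?V - {a})"
    unfolding w_def convex_hull_finite[OF finite_Diff[OF fin]]
    by (intro CollectI exI[of _ "\<lambda>z. \<mu> z / (1 - \<mu> a)"]) (use r s mu(1) in \<open>auto simp: sum_divide_distrib[symmetric]\<close>)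
  have wK: "w \<in> K" using wh hull_mono[of "?V - {a}" ?V convex] triangle(3)[OF mesh_simplex[OF K]] by auto
  have "?V - {a} \<subseteq> K - {a}" using triangle(3)[OF mesh_simplex[OF K]] hull_subset[of ?V convex] by auto
  moreover have "convex (K - {a})" using a(1) extreme_point_of_stillconvex[of K a] triangle(6)[OF mesh_simplex[OF K]] by (auto simp: vertices_def)
  ultimately have "convex hull (?V - {a}) \<subseteq> K - {a}" by (rule hull_minimal)
  then have wa: "w \<noteq> a" using wh by auto
  have aK: "a \<in> K" using a(1) by (simp add: vertices_def extreme_point_of_def)
  obtain e where e: "e > 0" "ball a e \<subseteq> \<Omega>" using open_domain a(3) by (meson openE)
  \<comment> \<open>Small enough to keep \<open>y\<close> in the ball around \<open>a\<close>, and
    not beyond \<open>x\<close>, which sits at parameter \<open>1 - \<mu> a\<close>.\<close>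
  define t where "t = min (1 - \<mu> a) (e / (2 * norm (w - a)))"
  have nw: "norm (w - a) > 0" using wa by simp
  have t: "t > 0" "t \<le> 1 - \<mu> a" using r e nw by (auto simp: t_def)
  have t1: "t < 1" using t a(2) by simp
  define y where "y = a + t *\<^sub>R (w - a)"
  have "t * norm (w - a) \<le> e / 2"
  proof -
    have "t \<le> e / (2 * norm (w - a))" by (simp add: t_def)
    then have "t * norm (w - a) \<le> e / (2 * norm (w - a)) * norm (w - a)" using nw by (intro mult_right_mono) auto
    then show ?thesis using nw by simp
  qed
  then have "y \<in> ball a e" using t e(1) by (simp add: y_def dist_norm)
  then have y\<Omega>: "y \<in> \<Omega>" using e by blast
  have yseg: "y \<in> open_segment a w" unfolding in_segment y_def using wa t t1
    by (intro conjI exI[of _ t]) (auto simp: algebra_simps)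
  define \<S> where "\<S> = {K'\<in>\<T>. y \<in> K'}"
  have wS: "w \<in> K'" if "K' \<in> \<S>" for K'
  proof -
    have K': "K' \<in> \<T>" "y \<in> K'" using that by (auto simp: \<S>_def)
    have "y \<in> K" using yseg open_closed_segment[of y a w] closed_segment_subset[OF aK wK triangle(6)[OF mesh_simplex[OF K]]] by blast
    \<comment> \<open>A face that contains an inner point of a segment contains both end
      points.\<close>
    then have "a \<in> K \<inter> K' \<and> w \<in> K \<inter> K'"
      using face_mesh[OF K K'(1)] aK wK K'(2) yseg unfolding face_of_def by blast
    then show ?thesis by simp
  qed
  have "closed (\<Union>(\<T> - \<S>))" using finite_mesh mesh_compact by (auto intro!: closed_Union compact_imp_closed)
  moreover have "y \<notin> \<Union>(\<T> - \<S>)" by (auto simp: \<S>_def)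
  ultimately have "open (\<Omega> - \<Union>(\<T> - \<S>))" "y \<in> \<Omega> - \<Union>(\<T> - \<S>)" using open_domain y\<Omega> by auto
  then obtain r where r': "r > 0" "ball y r \<subseteq> \<Omega> - \<Union>(\<T> - \<S>)" by (meson openE)
  \<comment> \<open>Locates \<open>x\<close> on the segment from \<open>y\<close> to
    \<open>w\<close>; the homothety with centre \<open>w\<close> and ratio \<open>1 - s\<close> maps
    the ball around \<open>y\<close> onto the one around \<open>x\<close>.\<close>
  define s where "s = (1 - \<mu> a - t) / (1 - t)"
  have s01: "0 \<le> s" "s < 1" using t t1 a(2) by (auto simp: s_def field_simps)
  have xs: "x = (1 - s) *\<^sub>R y + s *\<^sub>R w"
  proof -
    have s1: "(1 - s) * (1 - t) = \<mu> a" using t1 unfolding s_def by (simp add: field_simps)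
    have "(1 - s) *\<^sub>R y + s *\<^sub>R w = ((1 - s) * (1 - t)) *\<^sub>R a + ((1 - s) * t + s) *\<^sub>R w"
      by (simp add: y_def algebra_simps)
    moreover have "(1 - s) * t + s = 1 - (1 - s) * (1 - t)" by (simp add: algebra_simps)
    ultimately show ?thesis using wx s1 by simp
  qed
  have "ball x ((1 - s) * r) \<subseteq> closure \<Omega>"
  proof
    fix x' assume x': "x' \<in> ball x ((1 - s) * r)"
    define y' where "y' = y + (1 / (1 - s)) *\<^sub>R (x' - x)"
    have "norm (x' - x) < (1 - s) * r" using x' by (simp add: dist_norm norm_minus_commute)
    then have "y' \<in> ball y r" using s01 by (simp add: y'_def dist_norm divide_less_eq mult.commute)
    then have y'2: "y' \<in> \<Omega>" "y' \<notin> \<Union>(\<T> - \<S>)" using r' by auto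
    then obtain K' where K': "K' \<in> \<T>" "y' \<in> K'" using mesh_Union closure_subset by blast
    then have KS: "K' \<in> \<S>" using y'2 by blast
    have "x' = (1 - s) *\<^sub>R y' + s *\<^sub>R w"
      using s01 xs by (simp add: y'_def scaleR_add_right)
    then have "x' \<in> K'"
      using convexD_alt[OF triangle(6)[OF mesh_simplex[OF K'(1)]] K'(2) wS[OF KS], of s] s01 by simp
    then show "x' \<in> closure \<Omega>" using K'(1) mesh_Union by blast
  qed
  then have "x \<in> interior (closure \<Omega>)" using s01 r'(1) by (intro interiorI[of "ball x ((1 - s) * r)"]) auto
  then show ?thesis by (simp add: interior_closure_domain)
qed

lemma Vh_affine:
  assumes "v \<in> Vh \<Omega> \<T>" "K \<in> \<T>"
  obtains c g where "\<And>x. x \<in> K \<Longrightarrow> v x = c + g \<bullet> x"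
  using assms by (auto simp: Vh_def)

lemma vertices_subset: "vertices K \<subseteq> K" by (auto simp: vertices_def extreme_point_of_def)

lemma Vh_combination:
  assumes v: "v \<in> Vh \<Omega> \<T>" and K: "K \<in> \<T>"
    and mu: "sum \<mu> (vertices K) = (1::real)" "(\<Sum>z\<in>vertices K. \<mu> z *\<^sub>R z) = x" "x \<in> K"
  shows "v x = (\<Sum>z\<in>vertices K. \<mu> z * v z)"
proof -
  obtain c g where cg: "\<And>x. x \<in> K \<Longrightarrow> v x = c + g \<bullet> x" using Vh_affine[OF v K] by blast
  have "v x = (\<Sum>z\<in>vertices K. \<mu> z * (c + g \<bullet> z))" using cg[OF mu(3)] affine_combination[OF mu(1)] mu(2) by simp
  then show ?thesis using cg vertices_subset by (simp add: subset_eq)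
qed

lemma Vh_outside: "v \<in> Vh \<Omega> \<T> \<Longrightarrow> x \<notin> \<Omega> \<Longrightarrow> v x = 0" by (simp add: Vh_def)

lemma Vh_cases:
  assumes "v \<in> Vh \<Omega> \<T>"
  obtains "v x = 0" "x \<notin> \<Omega>" | K \<mu> where "x \<in> K" "K \<in> \<T>" "\<And>z. z \<in> vertices K \<Longrightarrow> 0 \<le> \<mu> z" "sum \<mu> (vertices K) = (1::real)"
    "(\<Sum>z\<in>vertices K. \<mu> z *\<^sub>R z) = x" "v x = (\<Sum>z\<in>vertices K. \<mu> z * v z)"
proof (cases "x \<in> \<Omega>")
  case True
  then obtain K where K: "K \<in> \<T>" "x \<in> K" using mesh_Union closure_subset by blast
  obtain \<mu> where mu: "\<And>z. z \<in> vertices K \<Longrightarrow> 0 \<le> \<mu> z" "sum \<mu> (vertices K) = (1::real)" "(\<Sum>z\<in>vertices K. \<mu> z *\<^sub>R z) = x"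
    using triangle_combination[OF mesh_simplex[OF K(1)] K(2)] by blast
  show ?thesis using that(2)[OF K(2,1) mu Vh_combination[OF assms K(1) mu(2,3) K(2)]] by blast
qed (use that(1) Vh_outside[OF assms] in blast)

lemma Vh_eq:
  assumes "v \<in> Vh \<Omega> \<T>" "w \<in> Vh \<Omega> \<T>" "\<And>i. i \<in> interior_nodes \<Omega> \<T> \<Longrightarrow> v i = w i"
  shows "v = w"
proof
  fix x
  show "v x = w x"
  proof (rule Vh_cases[OF assms(1), of x])
    assume "v x = 0" "x \<notin> \<Omega>"
    then show ?thesis using Vh_outside[OF assms(2)] by simp
  next
    fix K \<mu> assume K: "x \<in> K" "K \<in> \<T>" "sum \<mu> (vertices K) = (1::real)"
      "(\<Sum>z\<in>vertices K. \<mu> z *\<^sub>R z) = x" "v x = (\<Sum>z\<in>vertices K. \<mu> z * v z)"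
    have "v z = w z" if "z \<in> vertices K" for z
      using assms(3)[of z] that K(2) Vh_outside[OF assms(1), of z] Vh_outside[OF assms(2), of z]
      by (cases "z \<in> \<Omega>") (auto simp: interior_nodes_eq)
    then show ?thesis using Vh_combination[OF assms(2) K(2,3,4,1)] K(5) by simp
  qed
qed

text \<open>On a triangle the values are convex combinations of vertex values, and these are zero at
  boundary vertices. Membership in \<open>Kh\<close> thus becomes a condition on interior nodes
  alone.\<close>

lemma Vh_nonneg:
  assumes "v \<in> Vh \<Omega> \<T>" "\<And>i. i \<in> interior_nodes \<Omega> \<T> \<Longrightarrow> 0 \<le> v i"
  shows "0 \<le> v x"
proof (rule Vh_cases[OF assms(1), of x])
  fix K \<mu> assume K: "x \<in> K" "K \<in> \<T>" "\<And>z. z \<in> vertices K \<Longrightarrow> 0 \<le> \<mu> z" "v x = (\<Sum>z\<in>vertices K. \<mu> z * v z)"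
  have "0 \<le> v z" if "z \<in> vertices K" for z
    using assms(2)[of z] that K(2) Vh_outside[OF assms(1), of z] by (cases "z \<in> \<Omega>") (auto simp: interior_nodes_eq)
  then show ?thesis unfolding K(4) using K(3) by (intro sum_nonneg mult_nonneg_nonneg)
qed simp

lemma Vh_zero: "(\<lambda>x. 0) \<in> Vh \<Omega> \<T>"
  by (auto simp: Vh_def intro!: exI[of _ 0])

lemma Vh_add_cmult:
  assumes "v \<in> Vh \<Omega> \<T>" "w \<in> Vh \<Omega> \<T>" shows "(\<lambda>x. v x + r * w x) \<in> Vh \<Omega> \<T>"
  unfolding Vh_def
proof (intro CollectI conjI ballI allI impI)
  show "continuous_on (closure \<Omega>) (\<lambda>x. v x + r * w x)" using assms by (auto simp: Vh_def intro!: continuous_intros)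
  show "v x + r * w x = 0" if "x \<notin> \<Omega>" for x
    using Vh_outside[OF assms(1) that] Vh_outside[OF assms(2) that] by simp
  fix K assume K: "K \<in> \<T>"
  obtain c g where cg: "\<And>x. x \<in> K \<Longrightarrow> v x = c + g \<bullet> x" using Vh_affine[OF assms(1) K] by blast
  obtain c' g' where cg': "\<And>x. x \<in> K \<Longrightarrow> w x = c' + g' \<bullet> x" using Vh_affine[OF assms(2) K] by blast
  show "\<exists>c g. \<forall>x\<in>K. v x + r * w x = c + g \<bullet> x"
    using cg cg' by (intro exI[of _ "c + r * c'"] exI[of _ "g + r *\<^sub>R g'"]) (auto simp: inner_add_left algebra_simps)
qed

lemma Vh_sum:
  assumes "\<And>i. i \<in> I \<Longrightarrow> v i \<in> Vh \<Omega> \<T>" shows "(\<lambda>x. \<Sum>i\<in>I. p i * v i x) \<in> Vh \<Omega> \<T>"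
  using assms
proof (induction I rule: infinite_finite_induct)
  case (insert i I)
  then show ?case using Vh_add_cmult[of "\<lambda>x. \<Sum>i\<in>I. p i * v i x" "v i" "p i"] by (simp add: add.commute)
qed (use Vh_zero in auto)

text \<open>Each triangle gets the affine interpolant of \<open>q\<close>, which is zero at boundary
  vertices. Agreement on common faces makes the choice of a triangle immaterial and gives
  continuity; on the boundary the function vanishes because no weight falls on interior vertices
  there.\<close>

lemma Vh_interpolation:
  obtains v where "v \<in> Vh \<Omega> \<T>" "\<And>i. i \<in> interior_nodes \<Omega> \<T> \<Longrightarrow> v i = p i"
proof -
  define q where "q z = (if z \<in> \<Omega> then p z else 0)" for z
  have "\<forall>K\<in>\<T>. \<exists>cg. \<forall>z\<in>vertices K. fst cg + snd cg \<bullet> z = q z"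
  proof
    fix K assume K: "K \<in> \<T>"
    have "vertices K \<noteq> {}" using triangle(4)[OF mesh_simplex[OF K]] by auto
    then obtain c g where "\<And>z. z \<in> vertices K \<Longrightarrow> c + g \<bullet> z = q z"
      using affine_interpolation[OF triangle(2)[OF mesh_simplex[OF K]]] by blast
    then show "\<exists>cg. \<forall>z\<in>vertices K. fst cg + snd cg \<bullet> z = q z" by (intro exI[of _ "(c, g)"]) auto
  qed
  then obtain cg where cg: "\<And>K z. K \<in> \<T> \<Longrightarrow> z \<in> vertices K \<Longrightarrow> fst (cg K) + snd (cg K) \<bullet> z = q z" by metis
  define v where "v x = (if x \<in> closure \<Omega> then let K = (SOME K. K \<in> \<T> \<and> x \<in> K) in fst (cg K) + snd (cg K) \<bullet> x else 0)" for x
  have vK: "v x = fst (cg K) + snd (cg K) \<bullet> x" if K: "K \<in> \<T>" "x \<in> K" for K x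
  proof -
    let ?K = "SOME K. K \<in> \<T> \<and> x \<in> K"
    have "?K \<in> \<T> \<and> x \<in> ?K" by (rule someI[where P="\<lambda>K. K \<in> \<T> \<and> x \<in> K"]) (use K in simp)
    then have "fst (cg ?K) + snd (cg ?K) \<bullet> x = fst (cg K) + snd (cg K) \<bullet> x"
      using affine_agree_face[of ?K K x "fst (cg ?K)" "snd (cg ?K)" q "fst (cg K)" "snd (cg K)"] K cg by blast
    moreover have "x \<in> closure \<Omega>" using K mesh_Union by blast
    ultimately show ?thesis by (simp add: v_def Let_def)
  qed
  show ?thesis
  proof (rule that[of v])
    show "v \<in> Vh \<Omega> \<T>" unfolding Vh_def
    proof (intro CollectI conjI ballI allI impI)
      have "continuous_on (\<Union>K\<in>\<T>. K) v"
      proof (rule continuous_on_closed_Union[OF finite_mesh])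
        show "closed K" if "K \<in> \<T>" for K using mesh_compact[OF that] by (rule compact_imp_closed)
        show "continuous_on K v" if K: "K \<in> \<T>" for K
        proof (rule continuous_on_eq)
          show "continuous_on K (\<lambda>x. fst (cg K) + snd (cg K) \<bullet> x)" by (intro continuous_intros)
        qed (use vK[OF K] in auto)
      qed
      then show "continuous_on (closure \<Omega>) v" using mesh_Union by simp
      show "\<exists>c g. \<forall>x\<in>K. v x = c + g \<bullet> x" if "K \<in> \<T>" for K using vK[OF that] by blast
      show "v x = 0" if x: "x \<notin> \<Omega>" for x
      proof (cases "x \<in> closure \<Omega>")
        case True
        then obtain K where K: "K \<in> \<T>" "x \<in> K" using mesh_Union by blast
        obtain \<mu> where mu: "\<And>z. z \<in> vertices K \<Longrightarrow> 0 \<le> \<mu> z" "sum \<mu> (vertices K) = (1::real)" "(\<Sum>z\<in>vertices K. \<mu> z *\<^sub>R z) = x"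
          using triangle_combination[OF mesh_simplex[OF K(1)] K(2)] by blast
        have "v x = (\<Sum>z\<in>vertices K. \<mu> z * (fst (cg K) + snd (cg K) \<bullet> z))"
          using vK[OF K] affine_combination[OF mu(2), of "fst (cg K)" "snd (cg K)"] mu(3) by simp
        also have "\<dots> = (\<Sum>z\<in>vertices K. \<mu> z * q z)" using cg[OF K(1)] by simp
        also have "\<dots> = 0"
        proof (intro sum.neutral ballI)
          fix z assume z: "z \<in> vertices K"
          show "\<mu> z * q z = 0"
            using interior_vertex_imp_interior[OF K(1) mu z] x mu(1)[OF z] by (cases "z \<in> \<Omega>") (auto simp: q_def less_le)
        qed
        finally show ?thesis .
      qed (simp add: v_def)
    qed
    show "v i = p i" if i: "i \<in> interior_nodes \<Omega> \<T>" for i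
    proof -
      obtain K where K: "K \<in> \<T>" "i \<in> vertices K" "i \<in> \<Omega>" using i by (auto simp: interior_nodes_eq)
      then have "v i = q i" using vK[OF K(1), of i] cg[OF K(1,2)] vertices_subset by auto
      then show ?thesis using K by (simp add: q_def)
    qed
  qed
qed

text \<open>Existence is interpolation; uniqueness of a function in \<open>Vh\<close> with given
  interior nodal values makes the definite description denote it.\<close>

lemma nodal_basis:
  assumes "i \<in> interior_nodes \<Omega> \<T>"
  shows "nodal_basis \<Omega> \<T> i \<in> Vh \<Omega> \<T>" "j \<in> interior_nodes \<Omega> \<T> \<Longrightarrow> nodal_basis \<Omega> \<T> i j = (if j = i then 1 else 0)"
proof -
  let ?P = "\<lambda>v. v \<in> Vh \<Omega> \<T> \<and> (\<forall>j\<in>interior_nodes \<Omega> \<T>. v j = (if j = i then 1 else 0))"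
  obtain v where v: "v \<in> Vh \<Omega> \<T>" "\<And>j. j \<in> interior_nodes \<Omega> \<T> \<Longrightarrow> v j = (if j = i then 1 else 0)"
    using Vh_interpolation[of "\<lambda>j. if j = i then 1 else 0"] by blast
  have "?P (nodal_basis \<Omega> \<T> i)" unfolding nodal_basis_def
  proof (rule theI[of ?P])
    show "?P v" using v by blast
    show "w = v" if "?P w" for w by (rule Vh_eq) (use that v in auto)
  qed
  then show "nodal_basis \<Omega> \<T> i \<in> Vh \<Omega> \<T>" "j \<in> interior_nodes \<Omega> \<T> \<Longrightarrow> nodal_basis \<Omega> \<T> i j = (if j = i then 1 else 0)" by auto
qed

lemma nodal_fun_Vh: "nodal_fun \<Omega> \<T> p \<in> Vh \<Omega> \<T>"
  using Vh_sum[of "interior_nodes \<Omega> \<T>" "nodal_basis \<Omega> \<T>" p] nodal_basis(1) by (simp add: nodal_fun_def[abs_def])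

lemma nodal_fun_node: "i \<in> interior_nodes \<Omega> \<T> \<Longrightarrow> nodal_fun \<Omega> \<T> p i = p i"
  using finite_interior_nodes nodal_basis(2) by (simp add: nodal_fun_def if_distrib[of "(*) _"] cong: if_cong)

lemma Vh_eq_nodal_fun: "v \<in> Vh \<Omega> \<T> \<Longrightarrow> v = nodal_fun \<Omega> \<T> v"
  by (rule Vh_eq[OF _ nodal_fun_Vh]) (simp_all add: nodal_fun_node)

lemma nodal_basis_nonneg: "i \<in> interior_nodes \<Omega> \<T> \<Longrightarrow> 0 \<le> nodal_basis \<Omega> \<T> i x"
  by (rule Vh_nonneg[OF nodal_basis(1)]) (auto simp: nodal_basis(2))

end

section \<open>Finite element functions as elements of H10\<close>

context fe_mesh begin

text \<open>The segment from \<open>x\<close> to \<open>y\<close> may cross many triangles and may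
  leave \<Omega>, which need not be convex. Its parameter interval is covered by finitely many
  closed sets, one for each triangle and one for the complement of \<Omega>; a Lipschitz bound valid
  on each of them holds on the whole interval, however often the pieces are revisited.\<close>

lemma Vh_Lipschitz:
  assumes v: "v \<in> Vh \<Omega> \<T>"
  obtains L where "\<And>x y. \<bar>v x - v y\<bar> \<le> L * norm (x - y)"
proof -
  have "\<forall>K\<in>\<T>. \<exists>cg. \<forall>x\<in>K. v x = fst cg + snd cg \<bullet> x" using v by (simp add: Vh_def)
  then obtain cg where cg: "\<And>K x. K \<in> \<T> \<Longrightarrow> x \<in> K \<Longrightarrow> v x = fst (cg K) + snd (cg K) \<bullet> x" by metis
  define L where "L = (\<Sum>K\<in>\<T>. norm (snd (cg K)))"
  have L: "norm (snd (cg K)) \<le> L" if "K \<in> \<T>" for K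
    unfolding L_def using finite_mesh that by (intro member_le_sum) auto
  have L0: "L \<ge> 0" by (simp add: L_def sum_nonneg)
  have "\<bar>v x - v y\<bar> \<le> L * norm (x - y)" for x y
  proof -
    define p where "p t = x + t *\<^sub>R (y - x)" for t
    have pc: "continuous_on UNIV p" unfolding p_def by (intro continuous_intros)
    have pd: "p s - p t = (s - t) *\<^sub>R (y - x)" for s t by (simp add: p_def algebra_simps)
    have "(L * norm (y - x))-lipschitz_on {0..1} (\<lambda>t. v (p t))"
    proof (rule lipschitz_on_closed_Union[where I="insert (- \<Omega>) \<T>" and U="\<lambda>S. p -` S"])
      fix S assume S: "S \<in> insert (- \<Omega>) \<T>"
      have "closed S" using S open_domain mesh_compact compact_imp_closed by auto
      then show "closed (p -` S)" using pc by (intro closed_vimage) auto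
      show "(L * norm (y - x))-lipschitz_on (p -` S) (\<lambda>t. v (p t))"
      proof (rule lipschitz_onI)
        show "0 \<le> L * norm (y - x)" using L0 by simp
        fix s t assume st: "s \<in> p -` S" "t \<in> p -` S"
        show "dist (v (p s)) (v (p t)) \<le> L * norm (y - x) * dist s t"
        proof (cases "S = - \<Omega>")
          case True
          then have "v (p s) = 0" "v (p t) = 0" using st Vh_outside[OF v] by auto
          then show ?thesis using L0 by simp
        next
          case False
          then have K: "S \<in> \<T>" using S by simp
          have "v (p s) - v (p t) = snd (cg S) \<bullet> (p s - p t)"
            using cg[OF K, of "p s"] cg[OF K, of "p t"] st by (simp add: inner_diff_right)
          then have "\<bar>v (p s) - v (p t)\<bar> \<le> norm (snd (cg S)) * norm (p s - p t)" by (simp add: Cauchy_Schwarz_ineq2)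
          also have "\<dots> \<le> L * norm (p s - p t)" using L[OF K] by (rule mult_right_mono) simp
          finally show ?thesis by (simp add: pd dist_real_def mult_ac)
        qed
      qed
    next
      show "{0..1} \<subseteq> (\<Union>S\<in>insert (- \<Omega>) \<T>. p -` S)"
      proof
        fix t show "t \<in> (\<Union>S\<in>insert (- \<Omega>) \<T>. p -` S)"
          using mesh_Union closure_subset[of \<Omega>] by (cases "p t \<in> \<Omega>") auto
      qed
    qed (use finite_mesh L0 in auto)
    from lipschitz_onD[OF this, of 1 0] show ?thesis by (simp add: p_def dist_real_def norm_minus_commute abs_minus_commute)
  qed
  then show ?thesis using that by blast
qed

lemma Vh_has_derivative:
  assumes K: "K \<in> \<T>" "\<And>x. x \<in> K \<Longrightarrow> v x = c + g \<bullet> x" and x: "x \<in> interior K"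
  shows "(v has_derivative (\<lambda>h. g \<bullet> h)) (at x)"
proof (rule has_derivative_transform_within_open)
  show "((\<lambda>x. c + g \<bullet> x) has_derivative (\<lambda>h. g \<bullet> h)) (at x)" by (auto intro!: derivative_eq_intros)
  show "open (interior K)" by simp
  show "c + g \<bullet> y = v y" if "y \<in> interior K" for y
    using K(2)[of y] that interior_subset[of K] by auto
qed (rule x)

lemma Vh_ae_smooth_Lipschitz:
  assumes v: "v \<in> Vh \<Omega> \<T>"
  obtains L N where "ae_smooth_Lipschitz v L N" "\<And>x b. x \<notin> N \<Longrightarrow> v x = 0 \<Longrightarrow> b \<in> Basis \<Longrightarrow> pderiv_dir b v x = 0"
proof -
  obtain L where L: "\<And>x y. \<bar>v x - v y\<bar> \<le> L * norm (x - y)" using Vh_Lipschitz[OF v] by blast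
  have "\<forall>K\<in>\<T>. \<exists>cg. \<forall>x\<in>K. v x = fst cg + snd cg \<bullet> x" using v by (simp add: Vh_def)
  then obtain cg where cg: "\<And>K x. K \<in> \<T> \<Longrightarrow> x \<in> K \<Longrightarrow> v x = fst (cg K) + snd (cg K) \<bullet> x" by metis
  \<comment> \<open>The zero line of a nonconstant piece is put into the null set, so that off it a
    zero of \<open>v\<close> occurs only where the gradient vanishes, as
    \<open>in_H10_zero_boundary\<close> requires.\<close>
  define H where "H K = (if snd (cg K) = 0 then {} else {x. snd (cg K) \<bullet> x = - fst (cg K)})" for K
  define N where "N = (\<Union>K\<in>\<T>. frontier K \<union> H K)"
  have "negligible (frontier K \<union> H K)" if "K \<in> \<T>" for K
    using negligible_convex_frontier[OF triangle(6)[OF mesh_simplex[OF that]]] negligible_hyperplane[of "snd (cg K)" "- fst (cg K)"]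
    by (auto simp: H_def)
  then have N: "negligible N" unfolding N_def using finite_mesh by (intro negligible_Union) auto
  have cases: "(\<exists>K\<in>\<T>. x \<in> interior K) \<or> x \<in> - closure \<Omega>" if "x \<notin> N" for x
  proof (cases "x \<in> closure \<Omega>")
    case True
    then obtain K where K: "K \<in> \<T>" "x \<in> K" using mesh_Union by blast
    then have "x \<notin> frontier K" using that by (auto simp: N_def)
    then have "x \<in> interior K" using K(2) closure_subset unfolding frontier_def by blast
    then show ?thesis using K(1) by blast
  qed simp
  have out: "(v has_derivative (\<lambda>h. 0)) (at x)" if "x \<in> - closure \<Omega>" for x
  proof (rule has_derivative_transform_within_open)
    show "((\<lambda>x. 0) has_derivative (\<lambda>h. 0)) (at x)" by (rule has_derivative_const)
    show "0 = v y" if "y \<in> - closure \<Omega>" for y using Vh_outside[OF v, of y] that closure_subset by auto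
  qed (use that in auto)
  show ?thesis
  proof (rule that[of L N])
    show "ae_smooth_Lipschitz v L N"
    proof
      show "v differentiable (at x)" if "x \<notin> N" for x
        using cases[OF that] Vh_has_derivative[OF _ cg] out differentiableI by blast
    qed (use L N in auto)
    fix x and b :: "real^2" assume x: "x \<notin> N" "v x = 0" "b \<in> Basis"
    show "pderiv_dir b v x = 0"
    proof (cases "x \<in> - closure \<Omega>")
      case True
      then show ?thesis using pderiv_dir_eqI[OF out] by blast
    next
      case False
      then obtain K where K: "K \<in> \<T>" "x \<in> interior K" using cases[OF x(1)] by blast
      have "snd (cg K) = 0"
      proof (rule ccontr)
        assume n: "snd (cg K) \<noteq> 0"
        have "snd (cg K) \<bullet> x = - fst (cg K)" using cg[OF K(1), of x] K(2) interior_subset[of K] x(2) by auto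
        then show False using x(1) K(1) n by (auto simp: N_def H_def)
      qed
      then show ?thesis using pderiv_dir_eqI[OF Vh_has_derivative[OF K(1) cg K(2)]] K(1) by simp
    qed
  qed
qed

lemma Vh_H10:
  assumes "v \<in> Vh \<Omega> \<T>" shows "v \<in> H10 \<Omega>"
proof -
  obtain L N where A: "ae_smooth_Lipschitz v L N"
    and N: "\<And>x b. x \<notin> N \<Longrightarrow> v x = 0 \<Longrightarrow> b \<in> Basis \<Longrightarrow> pderiv_dir b v x = 0"
    using Vh_ae_smooth_Lipschitz[OF assms] by blast
  show ?thesis
    by (rule ae_smooth_Lipschitz.in_H10_zero_boundary[OF A open_domain bounded_domain domain_nonempty])
      (use Vh_outside[OF assms] N in auto)
qed

lemma Vh_weak_pderiv:
  assumes v: "v \<in> Vh \<Omega> \<T>" and K: "K \<in> \<T>" "\<And>x. x \<in> K \<Longrightarrow> v x = c + g \<bullet> x" and b: "b \<in> Basis"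
  shows "AE x in lebesgue_on (interior K). weak_pderiv \<Omega> b v x = g \<bullet> b"
proof -
  obtain L N where A: "ae_smooth_Lipschitz v L N"
    and "\<And>x b. x \<notin> N \<Longrightarrow> v x = 0 \<Longrightarrow> b \<in> Basis \<Longrightarrow> pderiv_dir b v x = 0"
    using Vh_ae_smooth_Lipschitz[OF v] by blast
  have "AE x in lebesgue_on \<Omega>. pderiv_dir b v x = weak_pderiv \<Omega> b v x"
    by (rule ae_smooth_Lipschitz.in_H1(3)[OF A open_domain bounded_domain b])
  then have "AE x in lebesgue. x \<in> \<Omega> \<longrightarrow> pderiv_dir b v x = weak_pderiv \<Omega> b v x"
    using domain_lebesgue by (simp add: AE_restrict_space_iff)
  then have "AE x in lebesgue. x \<in> interior K \<longrightarrow> weak_pderiv \<Omega> b v x = g \<bullet> b"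
  proof eventually_elim
    case (elim x)
    show ?case
    proof
      assume x: "x \<in> interior K"
      then show "weak_pderiv \<Omega> b v x = g \<bullet> b"
        using elim mesh_interior_subset[OF K(1)] pderiv_dir_eqI[OF Vh_has_derivative[OF K(1) K(2) x]] by auto
    qed
  qed
  then show ?thesis by (simp add: AE_restrict_space_iff)
qed

end

section \<open>The energy form\<close>

lemma has_weak_pderiv_cmult: "has_weak_pderiv \<Omega> b u g \<Longrightarrow> has_weak_pderiv \<Omega> b (\<lambda>x. r * u x) (\<lambda>x. r * g x)"
  by (auto simp: has_weak_pderiv_def loc_integrable_def L2_inner_def mult.assoc)

lemma H1_cmult:
  assumes "open \<Omega>" "u \<in> H1 \<Omega>"
  shows "(\<lambda>x. r * u x) \<in> H1 \<Omega>"
    and "b \<in> Basis \<Longrightarrow> AE x in lebesgue_on \<Omega>. r * weak_pderiv \<Omega> b u x = weak_pderiv \<Omega> b (\<lambda>x. r * u x) x"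
proof -
  show "(\<lambda>x. r * u x) \<in> H1 \<Omega>"
  proof (rule H1I[where g="\<lambda>b x. r * weak_pderiv \<Omega> b u x"])
    show "(\<lambda>x. r * u x) \<in> L2 \<Omega>" by (rule L2_cmult[OF H1_L2[OF assms(2)]])
    fix b :: 'a assume b: "b \<in> Basis"
    show "(\<lambda>x. r * weak_pderiv \<Omega> b u x) \<in> L2 \<Omega> \<and> has_weak_pderiv \<Omega> b (\<lambda>x. r * u x) (\<lambda>x. r * weak_pderiv \<Omega> b u x)"
      using L2_cmult[OF H1_weak_pderiv(2)[OF assms b]] has_weak_pderiv_cmult[OF H1_weak_pderiv(1)[OF assms b]] by blast
  qed
  show "AE x in lebesgue_on \<Omega>. r * weak_pderiv \<Omega> b u x = weak_pderiv \<Omega> b (\<lambda>x. r * u x) x" if "b \<in> Basis"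
    by (rule weak_pderiv_AE[OF assms(1) that has_weak_pderiv_cmult[OF H1_weak_pderiv(1)[OF assms that]]])
qed

lemma H1_zero: "open \<Omega> \<Longrightarrow> (\<lambda>x. 0) \<in> H1 \<Omega>"
  by (rule H1I[where g="\<lambda>b x. 0"]) (auto simp: has_weak_pderiv_def loc_integrable_def L2_inner_def)

lemma H1_lincomb:
  assumes "open \<Omega>" "\<And>i. i \<in> I \<Longrightarrow> v i \<in> H1 \<Omega>" shows "(\<lambda>x. \<Sum>i\<in>I. p i * v i x) \<in> H1 \<Omega>"
  using assms(2)
proof (induction I rule: infinite_finite_induct)
  case (insert i I)
  have "(\<lambda>x. (\<Sum>i\<in>I. p i * v i x) - (- p i) * v i x) \<in> H1 \<Omega>"
    using insert by (intro H1_diff(1)[OF assms(1)] H1_cmult(1)[OF assms(1)]) auto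
  then show ?case using insert by (simp add: add.commute)
qed (use H1_zero[OF assms(1)] in auto)

lemma weak_grad_inner_Basis: "c \<in> Basis \<Longrightarrow> weak_grad \<Omega> u x \<bullet> c = weak_pderiv \<Omega> c u x"
proof -
  assume c: "c \<in> Basis"
  have "weak_grad \<Omega> u x \<bullet> c = (\<Sum>b\<in>Basis. if b = c then weak_pderiv \<Omega> c u x else 0)"
    unfolding weak_grad_def inner_sum_left using c by (intro sum.cong) (auto simp: inner_Basis)
  then show ?thesis using c by simp
qed

lemma bilin_a_commute: "bilin_a \<Omega> d v w = bilin_a \<Omega> d w v"
  by (simp add: bilin_a_def inner_commute)

locale diffusion =
  fixes \<Omega> :: "(real^2) set" and d :: "real^2 \<Rightarrow> real" and M :: real
  assumes domain: "open \<Omega>" "bounded \<Omega>"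
    and coeff: "(\<lambda>x. d x ^ 3) \<in> borel_measurable (lebesgue_on \<Omega>)" "AE x in lebesgue_on \<Omega>. \<bar>d x ^ 3\<bar> \<le> M"
begin

lemma flux_L2: "v \<in> H1 \<Omega> \<Longrightarrow> b \<in> Basis \<Longrightarrow> (\<lambda>x. d x ^ 3 * weak_pderiv \<Omega> b v x) \<in> L2 \<Omega>"
  by (rule L2_bounded_mult(1)[OF H1_weak_pderiv(2)[OF domain(1)] coeff])

lemma bilin_a_eq:
  assumes "v \<in> H1 \<Omega>" "w \<in> H1 \<Omega>"
  shows "bilin_a \<Omega> d v w = (\<Sum>b\<in>Basis. L2_inner \<Omega> (\<lambda>x. d x ^ 3 * weak_pderiv \<Omega> b v x) (weak_pderiv \<Omega> b w))"
proof -
  have "(d x ^ 3 *\<^sub>R weak_grad \<Omega> v x) \<bullet> weak_grad \<Omega> w x = (\<Sum>b\<in>Basis. d x ^ 3 * weak_pderiv \<Omega> b v x * weak_pderiv \<Omega> b w x)" for x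
    by (subst euclidean_inner) (simp add: weak_grad_inner_Basis mult.assoc)
  then have "bilin_a \<Omega> d v w = (LINT x|lebesgue_on \<Omega>. (\<Sum>b\<in>Basis. d x ^ 3 * weak_pderiv \<Omega> b v x * weak_pderiv \<Omega> b w x))"
    by (simp add: bilin_a_def)
  also have "\<dots> = (\<Sum>b\<in>Basis. L2_inner \<Omega> (\<lambda>x. d x ^ 3 * weak_pderiv \<Omega> b v x) (weak_pderiv \<Omega> b w))"
    unfolding L2_inner_def
    by (rule Bochner_Integration.integral_sum)
      (rule L2_mult_integrable[OF flux_L2[OF assms(1)] H1_weak_pderiv(2)[OF domain(1) assms(2)]])
  finally show ?thesis .
qed

lemma L2_inner_cong_AE:
  assumes "u \<in> L2 \<Omega>" "v \<in> L2 \<Omega>" "w \<in> L2 \<Omega>" "AE x in lebesgue_on \<Omega>. v x = w x"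
  shows "L2_inner \<Omega> u v = L2_inner \<Omega> u w"
  unfolding L2_inner_def
  by (rule integral_cong_AE)
    (use L2_measurable[OF assms(1)] L2_measurable[OF assms(2)] L2_measurable[OF assms(3)] assms(4) in \<open>auto elim: eventually_mono\<close>)

lemma bilin_a_diff_right:
  assumes "u \<in> H1 \<Omega>" "v \<in> H1 \<Omega>" "w \<in> H1 \<Omega>"
  shows "bilin_a \<Omega> d u (\<lambda>x. v x - w x) = bilin_a \<Omega> d u v - bilin_a \<Omega> d u w"
proof -
  have vw: "(\<lambda>x. v x - w x) \<in> H1 \<Omega>" by (rule H1_diff(1)[OF domain(1) assms(2,3)])
  have "L2_inner \<Omega> (\<lambda>x. d x ^ 3 * weak_pderiv \<Omega> b u x) (weak_pderiv \<Omega> b (\<lambda>x. v x - w x))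
      = L2_inner \<Omega> (\<lambda>x. d x ^ 3 * weak_pderiv \<Omega> b u x) (weak_pderiv \<Omega> b v) - L2_inner \<Omega> (\<lambda>x. d x ^ 3 * weak_pderiv \<Omega> b u x) (weak_pderiv \<Omega> b w)"
    if b: "b \<in> Basis" for b
  proof -
    note L = flux_L2[OF assms(1) b] H1_weak_pderiv(2)[OF domain(1) assms(2) b] H1_weak_pderiv(2)[OF domain(1) assms(3) b]
    have "L2_inner \<Omega> (\<lambda>x. d x ^ 3 * weak_pderiv \<Omega> b u x) (\<lambda>x. weak_pderiv \<Omega> b v x - weak_pderiv \<Omega> b w x)
        = L2_inner \<Omega> (\<lambda>x. d x ^ 3 * weak_pderiv \<Omega> b u x) (weak_pderiv \<Omega> b (\<lambda>x. v x - w x))"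
      by (rule L2_inner_cong_AE[OF L(1) L2_diff[OF L(2,3)] H1_weak_pderiv(2)[OF domain(1) vw b] H1_diff(2)[OF domain(1) assms(2,3) b]])
    then show ?thesis using L2_inner_diff_right[OF L(2,3,1)] by simp
  qed
  then show ?thesis by (simp add: bilin_a_eq assms vw sum_subtractf)
qed

lemma bilin_a_cmult_right:
  assumes "u \<in> H1 \<Omega>" "v \<in> H1 \<Omega>"
  shows "bilin_a \<Omega> d u (\<lambda>x. r * v x) = r * bilin_a \<Omega> d u v"
proof -
  have rv: "(\<lambda>x. r * v x) \<in> H1 \<Omega>" by (rule H1_cmult(1)[OF domain(1) assms(2)])
  have "L2_inner \<Omega> (\<lambda>x. d x ^ 3 * weak_pderiv \<Omega> b u x) (weak_pderiv \<Omega> b (\<lambda>x. r * v x))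
      = r * L2_inner \<Omega> (\<lambda>x. d x ^ 3 * weak_pderiv \<Omega> b u x) (weak_pderiv \<Omega> b v)"
    if b: "b \<in> Basis" for b
  proof -
    note L = flux_L2[OF assms(1) b] H1_weak_pderiv(2)[OF domain(1) assms(2) b]
    have "L2_inner \<Omega> (\<lambda>x. d x ^ 3 * weak_pderiv \<Omega> b u x) (\<lambda>x. r * weak_pderiv \<Omega> b v x)
        = L2_inner \<Omega> (\<lambda>x. d x ^ 3 * weak_pderiv \<Omega> b u x) (weak_pderiv \<Omega> b (\<lambda>x. r * v x))"
      by (rule L2_inner_cong_AE[OF L(1) L2_cmult[OF L(2)] H1_weak_pderiv(2)[OF domain(1) rv b] H1_cmult(2)[OF domain(1) assms(2) b]])
    moreover have "L2_inner \<Omega> (\<lambda>x. d x ^ 3 * weak_pderiv \<Omega> b u x) (\<lambda>x. r * weak_pderiv \<Omega> b v x)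
        = (LINT x|lebesgue_on \<Omega>. r * ((d x ^ 3 * weak_pderiv \<Omega> b u x) * weak_pderiv \<Omega> b v x))"
      unfolding L2_inner_def by (intro Bochner_Integration.integral_cong) auto
    ultimately show ?thesis by (simp add: L2_inner_def)
  qed
  then show ?thesis by (simp add: bilin_a_eq assms rv sum_distrib_left)
qed

lemma bilin_a_zero_right:
  assumes "u \<in> H1 \<Omega>" shows "bilin_a \<Omega> d u (\<lambda>x. 0) = 0"
  using bilin_a_cmult_right[OF assms assms, of 0] by simp

lemma bilin_a_sum_right:
  assumes "u \<in> H1 \<Omega>" "finite I" "\<And>i. i \<in> I \<Longrightarrow> v i \<in> H1 \<Omega>"
  shows "bilin_a \<Omega> d u (\<lambda>x. \<Sum>i\<in>I. p i * v i x) = (\<Sum>i\<in>I. p i * bilin_a \<Omega> d u (v i))"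
  using assms(2,3)
proof (induction I)
  case (insert i I)
  have I: "(\<lambda>x. \<Sum>i\<in>I. p i * v i x) \<in> H1 \<Omega>" using insert.prems by (intro H1_lincomb[OF domain(1)]) auto
  have i1: "v i \<in> H1 \<Omega>" using insert.prems by simp
  note i = i1 H1_cmult(1)[OF domain(1) i1, of "- p i"]
  have "bilin_a \<Omega> d u (\<lambda>x. (\<Sum>i\<in>I. p i * v i x) - (- p i) * v i x) = (\<Sum>i\<in>I. p i * bilin_a \<Omega> d u (v i)) - (- p i) * bilin_a \<Omega> d u (v i)"
    unfolding bilin_a_diff_right[OF assms(1) I i(2)] bilin_a_cmult_right[OF assms(1) i(1)] using insert by simp
  then show ?case using insert.hyps by (simp add: add.commute)
qed (use bilin_a_zero_right[OF assms(1)] in simp)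

lemma bilin_a_bound:
  assumes "u \<in> H1 \<Omega>" "v \<in> H1 \<Omega>"
  shows "\<bar>bilin_a \<Omega> d u v\<bar> \<le> \<bar>M\<bar> * (\<Sum>b\<in>Basis. L2_norm \<Omega> (weak_pderiv \<Omega> b u) * L2_norm \<Omega> (weak_pderiv \<Omega> b v))"
proof -
  have "\<bar>bilin_a \<Omega> d u v\<bar> \<le> (\<Sum>b\<in>Basis. \<bar>L2_inner \<Omega> (\<lambda>x. d x ^ 3 * weak_pderiv \<Omega> b u x) (weak_pderiv \<Omega> b v)\<bar>)"
    unfolding bilin_a_eq[OF assms] by (rule sum_abs)
  also have "\<dots> \<le> (\<Sum>b\<in>Basis. \<bar>M\<bar> * (L2_norm \<Omega> (weak_pderiv \<Omega> b u) * L2_norm \<Omega> (weak_pderiv \<Omega> b v)))"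
  proof (rule sum_mono)
    fix b :: "real^2" assume b: "b \<in> Basis"
    note L = H1_weak_pderiv(2)[OF domain(1) assms(1) b] H1_weak_pderiv(2)[OF domain(1) assms(2) b]
    have "\<bar>L2_inner \<Omega> (\<lambda>x. d x ^ 3 * weak_pderiv \<Omega> b u x) (weak_pderiv \<Omega> b v)\<bar>
        \<le> L2_norm \<Omega> (\<lambda>x. d x ^ 3 * weak_pderiv \<Omega> b u x) * L2_norm \<Omega> (weak_pderiv \<Omega> b v)"
      by (rule L2_Cauchy_Schwarz[OF flux_L2[OF assms(1) b] L(2)])
    also have "\<dots> \<le> \<bar>M\<bar> * L2_norm \<Omega> (weak_pderiv \<Omega> b u) * L2_norm \<Omega> (weak_pderiv \<Omega> b v)"
      by (rule mult_right_mono[OF L2_bounded_mult(2)[OF L(1) coeff]]) simp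
    finally show "\<bar>L2_inner \<Omega> (\<lambda>x. d x ^ 3 * weak_pderiv \<Omega> b u x) (weak_pderiv \<Omega> b v)\<bar>
        \<le> \<bar>M\<bar> * (L2_norm \<Omega> (weak_pderiv \<Omega> b u) * L2_norm \<Omega> (weak_pderiv \<Omega> b v))" by (simp add: mult.assoc)
  qed
  finally show ?thesis by (simp add: sum_distrib_left)
qed

lemma bilin_a_coercive:
  assumes "u \<in> H1 \<Omega>" and m: "AE x in lebesgue_on \<Omega>. m \<le> d x ^ 3"
  shows "m * (\<Sum>b\<in>Basis. (L2_norm \<Omega> (weak_pderiv \<Omega> b u))\<^sup>2) \<le> bilin_a \<Omega> d u u"
  unfolding bilin_a_eq[OF assms(1,1)] sum_distrib_left
proof (rule sum_mono)
  fix b :: "real^2" assume b: "b \<in> Basis"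
  note L = H1_weak_pderiv(2)[OF domain(1) assms(1) b]
  have "m * (L2_norm \<Omega> (weak_pderiv \<Omega> b u))\<^sup>2 = (LINT x|lebesgue_on \<Omega>. m * (weak_pderiv \<Omega> b u x)\<^sup>2)"
    by (simp add: L2_norm_square)
  also have "\<dots> \<le> (LINT x|lebesgue_on \<Omega>. d x ^ 3 * weak_pderiv \<Omega> b u x * weak_pderiv \<Omega> b u x)"
  proof (rule integral_mono_AE)
    show "integrable (lebesgue_on \<Omega>) (\<lambda>x. m * (weak_pderiv \<Omega> b u x)\<^sup>2)" using L2_square_integrable[OF L] by simp
    show "integrable (lebesgue_on \<Omega>) (\<lambda>x. d x ^ 3 * weak_pderiv \<Omega> b u x * weak_pderiv \<Omega> b u x)"
      by (rule L2_mult_integrable[OF flux_L2[OF assms(1) b] L])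
    show "AE x in lebesgue_on \<Omega>. m * (weak_pderiv \<Omega> b u x)\<^sup>2 \<le> d x ^ 3 * weak_pderiv \<Omega> b u x * weak_pderiv \<Omega> b u x"
      using m
    proof eventually_elim
      case (elim x)
      then have "m * (weak_pderiv \<Omega> b u x)\<^sup>2 \<le> d x ^ 3 * (weak_pderiv \<Omega> b u x)\<^sup>2" by (rule mult_right_mono) simp
      then show ?case by (simp add: power2_eq_square mult.assoc)
    qed
  qed
  finally show "m * (L2_norm \<Omega> (weak_pderiv \<Omega> b u))\<^sup>2 \<le> L2_inner \<Omega> (\<lambda>x. d x ^ 3 * weak_pderiv \<Omega> b u x) (weak_pderiv \<Omega> b u)"
    by (simp add: L2_inner_def)
qed

end

lemma L2_inner_sum_right:
  assumes "u \<in> L2 S" "finite I" "\<And>i. i \<in> I \<Longrightarrow> v i \<in> L2 S"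
  shows "L2_inner S u (\<lambda>x. \<Sum>i\<in>I. p i * v i x) = (\<Sum>i\<in>I. p i * L2_inner S u (v i))"
proof -
  have "L2_inner S u (\<lambda>x. \<Sum>i\<in>I. p i * v i x) = (LINT x|lebesgue_on S. (\<Sum>i\<in>I. p i * (u x * v i x)))"
    unfolding L2_inner_def by (intro Bochner_Integration.integral_cong) (auto simp: sum_distrib_left mult_ac)
  also have "\<dots> = (\<Sum>i\<in>I. LINT x|lebesgue_on S. p i * (u x * v i x))"
    using L2_mult_integrable[OF assms(1,3)] by (intro Bochner_Integration.integral_sum) auto
  finally show ?thesis by (simp add: L2_inner_def)
qed

section \<open>The abstract error estimate\<close>

locale discrete_obstacle = fe_mesh \<Omega> \<T> + diffusion \<Omega> d M
  for \<Omega> \<T> d M +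
  fixes m :: real and f P lam p l :: "real^2 \<Rightarrow> real" and \<gamma> :: real
  assumes m: "m > 0" "AE x in lebesgue_on \<Omega>. m \<le> d x ^ 3" and f: "f \<in> L2 \<Omega>" and P: "solves_obstacle \<Omega> d f P"
    and lam: "lam \<in> L2 \<Omega>" "has_weak_div \<Omega> (\<lambda>x. d x ^ 3 *\<^sub>R weak_grad \<Omega> P x) (\<lambda>x. - lam x - f x)"
    and \<gamma>: "\<gamma> > 0" and nodal: "solves_nodal_mixed \<Omega> \<T> d f \<gamma> p l"
begin

abbreviation "Ph \<equiv> nodal_fun \<Omega> \<T> p"

text \<open>Multiplied by \<open>\<gamma>\<close>, the second nodal equation reads
  \<open>\<gamma> * l i = max 0 (\<gamma> * l i - p i)\<close>. If the second argument is
  nonnegative then \<open>p i = 0\<close>; otherwise \<open>l i = 0\<close> and \<open>p i\<close>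
  is positive. The size of \<open>\<gamma>\<close> is irrelevant.\<close>

lemma complementarity:
  assumes "i \<in> interior_nodes \<Omega> \<T>"
  shows "0 \<le> p i" "0 \<le> l i" "p i * l i = 0"
proof -
  have l: "l i = inverse \<gamma> * max 0 (\<gamma> * l i - p i)" using nodal assms by (auto simp: solves_nodal_mixed_def)
  show l0: "0 \<le> l i" by (subst l) (use \<gamma> in simp)
  have "\<gamma> * l i = \<gamma> * (inverse \<gamma> * max 0 (\<gamma> * l i - p i))" by (rule arg_cong[OF l])
  also have "\<dots> = max 0 (\<gamma> * l i - p i)" using \<gamma> by simp
  finally have c: "\<gamma> * l i = max 0 (\<gamma> * l i - p i)" .
  then have "p i = 0 \<or> (l i = 0 \<and> p i \<ge> 0)"
  proof (cases "\<gamma> * l i - p i \<ge> 0")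
    case False
    then show ?thesis using c \<gamma> by auto
  qed auto
  then show "0 \<le> p i" "p i * l i = 0" by auto
qed

lemma Ph_Vh: "Ph \<in> Vh \<Omega> \<T>" by (rule nodal_fun_Vh)

lemma Ph_nonneg: "0 \<le> Ph x"
  by (rule Vh_nonneg[OF Ph_Vh]) (simp add: nodal_fun_node complementarity(1))

lemma Vh_H1: "v \<in> Vh \<Omega> \<T> \<Longrightarrow> v \<in> H1 \<Omega>" by (rule H10_H1[OF Vh_H10])

text \<open>Up to the symmetry of the form, the nodal equations are the residual tested with the
  basis functions, and expanding \<open>w\<close> in the basis combines them. The masses of the
  basis functions are the weights because the multiplier is lumped at the nodes.\<close>

lemma discrete_residual:
  assumes w: "w \<in> Vh \<Omega> \<T>"
  shows "bilin_a \<Omega> d Ph w - L2_inner \<Omega> f w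
    = (\<Sum>i\<in>interior_nodes \<Omega> \<T>. w i * ((LINT x|lebesgue_on \<Omega>. nodal_basis \<Omega> \<T> i x) * l i))"
proof -
  let ?I = "interior_nodes \<Omega> \<T>" and ?\<phi> = "nodal_basis \<Omega> \<T>"
  have b1: "?\<phi> i \<in> H1 \<Omega>" if "i \<in> ?I" for i by (rule Vh_H1[OF nodal_basis(1)[OF that]])
  have sum: "w = (\<lambda>x. \<Sum>i\<in>?I. w i * ?\<phi> i x)" using Vh_eq_nodal_fun[OF w] by (simp add: nodal_fun_def[abs_def])
  have row: "bilin_a \<Omega> d Ph (?\<phi> i) - L2_inner \<Omega> f (?\<phi> i) = (LINT x|lebesgue_on \<Omega>. ?\<phi> i x) * l i" if i: "i \<in> ?I" for i
  proof -
    have "bilin_a \<Omega> d Ph (?\<phi> i) = bilin_a \<Omega> d (?\<phi> i) (\<lambda>x. \<Sum>j\<in>?I. p j * ?\<phi> j x)"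
      by (subst bilin_a_commute) (simp add: nodal_fun_def[abs_def])
    also have "\<dots> = (\<Sum>j\<in>?I. p j * bilin_a \<Omega> d (?\<phi> i) (?\<phi> j))"
      by (rule bilin_a_sum_right[OF b1[OF i] finite_interior_nodes b1])
    also have "\<dots> = (\<Sum>j\<in>?I. bilin_a \<Omega> d (?\<phi> j) (?\<phi> i) * p j)"
      by (simp add: bilin_a_commute[of \<Omega> d "?\<phi> i"] mult.commute)
    finally have A: "bilin_a \<Omega> d Ph (?\<phi> i) = (\<Sum>j\<in>?I. bilin_a \<Omega> d (?\<phi> j) (?\<phi> i) * p j)" .
    have n: "(\<Sum>j\<in>?I. bilin_a \<Omega> d (?\<phi> j) (?\<phi> i) * p j) - (LINT x|lebesgue_on \<Omega>. ?\<phi> i x) * (inverse \<gamma> * max 0 (\<gamma> * l i - p i))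
        = L2_inner \<Omega> f (?\<phi> i)" "l i = inverse \<gamma> * max 0 (\<gamma> * l i - p i)"
      using nodal i unfolding solves_nodal_mixed_def by auto
    show ?thesis using n(1) unfolding n(2)[symmetric] A by linarith
  qed
  have "bilin_a \<Omega> d Ph w = (\<Sum>i\<in>?I. w i * bilin_a \<Omega> d Ph (?\<phi> i))"
    using bilin_a_sum_right[OF Vh_H1[OF Ph_Vh] finite_interior_nodes, where p=w and v="?\<phi>"] b1
    unfolding sum[symmetric] by blast
  moreover have "L2_inner \<Omega> f w = (\<Sum>i\<in>?I. w i * L2_inner \<Omega> f (?\<phi> i))"
    using L2_inner_sum_right[OF f finite_interior_nodes, where p=w and v="?\<phi>"] H1_L2[OF b1]
    unfolding sum[symmetric] by blast
  ultimately have "bilin_a \<Omega> d Ph w - L2_inner \<Omega> f w = (\<Sum>i\<in>?I. w i * (bilin_a \<Omega> d Ph (?\<phi> i) - L2_inner \<Omega> f (?\<phi> i)))"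
    by (simp add: right_diff_distrib sum_subtractf)
  then show ?thesis using row by simp
qed

text \<open>Every summand of the residual is nonnegative: masses and multipliers are, and where the
  multiplier is nonzero the pressure is zero, which leaves the nonnegative factor
  \<open>v i\<close>.\<close>

lemma discrete_variational_inequality:
  assumes v: "v \<in> Kh \<Omega> \<T>"
  shows "L2_inner \<Omega> f (\<lambda>x. v x - Ph x) \<le> bilin_a \<Omega> d Ph (\<lambda>x. v x - Ph x)"
proof -
  have vV: "v \<in> Vh \<Omega> \<T>" using v by (simp add: Kh_def)
  have w: "(\<lambda>x. v x - Ph x) \<in> Vh \<Omega> \<T>" using Vh_add_cmult[OF vV Ph_Vh, of "-1"] by simp
  have "0 \<le> (\<Sum>i\<in>interior_nodes \<Omega> \<T>. (v i - Ph i) * ((LINT x|lebesgue_on \<Omega>. nodal_basis \<Omega> \<T> i x) * l i))"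
  proof (rule sum_nonneg)
    fix i assume i: "i \<in> interior_nodes \<Omega> \<T>"
    have "0 \<le> v i" using v i by (auto simp: Kh_def interior_nodes_eq)
    moreover have "0 \<le> (LINT x|lebesgue_on \<Omega>. nodal_basis \<Omega> \<T> i x)"
      by (intro Bochner_Integration.integral_nonneg nodal_basis_nonneg[OF i])
    moreover have "l i = 0 \<or> p i = 0" using complementarity(3)[OF i] by auto
    ultimately show "0 \<le> (v i - Ph i) * ((LINT x|lebesgue_on \<Omega>. nodal_basis \<Omega> \<T> i x) * l i)"
      unfolding nodal_fun_node[OF i] using complementarity(2)[OF i] by auto
  qed
  then show ?thesis using discrete_residual[OF w] by simp
qed

lemma P_H10: "P \<in> H10 \<Omega>" using P by (simp add: solves_obstacle_def Kset_def)

lemma Ph_Kset: "Ph \<in> Kset \<Omega>" using Vh_H10[OF Ph_Vh] Ph_nonneg by (simp add: Kset_def)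

text \<open>The definition of \<open>lam\<close> through a weak divergence becomes an identity that
  may be tested with any element of \<open>H10\<close>, in particular with differences involving
  \<open>P\<close> and discrete functions.\<close>

lemma continuous_residual:
  assumes w: "w \<in> H10 \<Omega>"
  shows "bilin_a \<Omega> d P w = L2_inner \<Omega> lam w + L2_inner \<Omega> f w"
proof -
  have q: "(\<lambda>x. (d x ^ 3 *\<^sub>R weak_grad \<Omega> P x) \<bullet> b) = (\<lambda>x. d x ^ 3 * weak_pderiv \<Omega> b P x)" if "b \<in> Basis" for b
    by (simp add: weak_grad_inner_Basis[OF that])
  have qL: "(\<lambda>x. (d x ^ 3 *\<^sub>R weak_grad \<Omega> P x) \<bullet> b) \<in> L2 \<Omega>" if "b \<in> Basis" for b
    unfolding q[OF that] by (rule flux_L2[OF H10_H1[OF P_H10] that])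
  have g: "(\<lambda>x. - lam x - f x) \<in> L2 \<Omega>" by (intro L2_diff L2_minus lam f)
  have "(\<Sum>b\<in>Basis. L2_inner \<Omega> (\<lambda>x. (d x ^ 3 *\<^sub>R weak_grad \<Omega> P x) \<bullet> b) (weak_pderiv \<Omega> b w)) = - L2_inner \<Omega> (\<lambda>x. - lam x - f x) w"
    by (rule has_weak_div_H10[OF open_domain qL g lam(2) w])
  moreover have "bilin_a \<Omega> d P w = (\<Sum>b\<in>Basis. L2_inner \<Omega> (\<lambda>x. (d x ^ 3 *\<^sub>R weak_grad \<Omega> P x) \<bullet> b) (weak_pderiv \<Omega> b w))"
    unfolding bilin_a_eq[OF H10_H1[OF P_H10] H10_H1[OF w]] by (intro sum.cong refl) (simp only: q)
  moreover have "L2_inner \<Omega> (\<lambda>x. - lam x - f x) w = - (L2_inner \<Omega> lam w + L2_inner \<Omega> f w)"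
  proof -
    have "L2_inner \<Omega> (\<lambda>x. - lam x - f x) w = (LINT x|lebesgue_on \<Omega>. - (lam x * w x + f x * w x))"
      unfolding L2_inner_def by (intro Bochner_Integration.integral_cong) (auto simp: algebra_simps)
    then show ?thesis
      using L2_mult_integrable[OF lam(1) H1_L2[OF H10_H1[OF w]]] L2_mult_integrable[OF f H1_L2[OF H10_H1[OF w]]]
      by (simp add: L2_inner_def)
  qed
  ultimately show ?thesis by simp
qed

lemma energy_error:
  assumes v: "v \<in> Kh \<Omega> \<T>"
  shows "bilin_a \<Omega> d (\<lambda>x. P x - Ph x) (\<lambda>x. P x - Ph x)
    \<le> bilin_a \<Omega> d (\<lambda>x. P x - Ph x) (\<lambda>x. P x - v x) + L2_norm \<Omega> lam * L2_norm \<Omega> (\<lambda>x. P x - v x)"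
proof -
  have vV: "v \<in> Vh \<Omega> \<T>" using v by (simp add: Kh_def)
  have H: "P \<in> H1 \<Omega>" "Ph \<in> H1 \<Omega>" "v \<in> H1 \<Omega>" using H10_H1[OF P_H10] Vh_H1[OF Ph_Vh] Vh_H1[OF vV] by auto
  have H0: "v \<in> H10 \<Omega>" "Ph \<in> H10 \<Omega>" by (rule Vh_H10[OF vV], rule Vh_H10[OF Ph_Vh])
  note L = H1_L2[OF H(1)] H1_L2[OF H(2)] H1_L2[OF H(3)]
  have e: "(\<lambda>x. P x - Ph x) \<in> H1 \<Omega>" and ev: "(\<lambda>x. P x - v x) \<in> H1 \<Omega>" "(\<lambda>x. v x - Ph x) \<in> H1 \<Omega>" using H by (auto intro: H1_diff(1)[OF open_domain])
  let ?A = "bilin_a \<Omega> d"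
  have r: "?A (\<lambda>x. P x - Ph x) w = ?A P w - ?A Ph w" if "w \<in> H1 \<Omega>" for w
    using bilin_a_diff_right[OF that H(1,2)] by (simp add: bilin_a_commute[of \<Omega> d _ w])
  have "?A (\<lambda>x. P x - Ph x) (\<lambda>x. P x - Ph x) = ?A (\<lambda>x. P x - Ph x) (\<lambda>x. P x - v x) + ?A (\<lambda>x. P x - Ph x) (\<lambda>x. v x - Ph x)"
    using bilin_a_diff_right[OF e H(1,2)] bilin_a_diff_right[OF e H(1,3)] bilin_a_diff_right[OF e H(3,2)] by simp
  moreover have "?A (\<lambda>x. P x - Ph x) (\<lambda>x. v x - Ph x) \<le> L2_inner \<Omega> lam (\<lambda>x. v x - Ph x)"
    using r[OF ev(2)] continuous_residual[OF H10_diff[OF open_domain H0]] discrete_variational_inequality[OF v] by simp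
  moreover have "L2_inner \<Omega> lam (\<lambda>x. v x - Ph x) = - L2_inner \<Omega> lam (\<lambda>x. P x - v x) - L2_inner \<Omega> lam (\<lambda>x. Ph x - P x)"
    by (simp add: L2_inner_diff_right[OF _ _ lam(1)] L)
  moreover have "- L2_inner \<Omega> lam (\<lambda>x. P x - v x) \<le> L2_norm \<Omega> lam * L2_norm \<Omega> (\<lambda>x. P x - v x)"
    using L2_Cauchy_Schwarz[OF lam(1) H1_L2[OF ev(1)]] by linarith
  \<comment> \<open>The discrete solution is admissible in the continuous problem, since it lies in
    \<open>H10\<close> and is nonnegative everywhere and not merely at the nodes. The resulting sign
    lets this part of the multiplier term be dropped.\<close>
  moreover have "0 \<le> L2_inner \<Omega> lam (\<lambda>x. Ph x - P x)"
  proof -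
    have "L2_inner \<Omega> f (\<lambda>x. Ph x - P x) \<le> ?A P (\<lambda>x. Ph x - P x)" using P Ph_Kset by (simp add: solves_obstacle_def)
    then show ?thesis using continuous_residual[OF H10_diff[OF open_domain H0(2) P_H10]] by simp
  qed
  ultimately show ?thesis by linarith
qed

text \<open>In the constant, each factor two counts the coordinate directions, \<open>C + 1\<close>
  leads from the gradient to the full norm, and \<open>2 * \<bar>M\<bar> / m\<close> and
  \<open>1 / sqrt m\<close> come from solving a quadratic inequality for the energy of the
  error.\<close>

lemma Falk_estimate:
  assumes v: "v \<in> Kh \<Omega> \<T>" and C: "C \<ge> 0" "\<And>u. u \<in> H10 \<Omega> \<Longrightarrow> L2_norm \<Omega> u \<le> C * (\<Sum>b\<in>Basis. L2_norm \<Omega> (weak_pderiv \<Omega> b u))"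
  shows "H1_norm \<Omega> (\<lambda>x. P x - Ph x)
    \<le> 2 * (C + 1) * (2 * \<bar>M\<bar> / m + 1 / sqrt m) * (H1_norm \<Omega> (\<lambda>x. P x - v x) + sqrt (L2_norm \<Omega> lam) * sqrt (L2_norm \<Omega> (\<lambda>x. P x - v x)))"
proof -
  define e where "e x = P x - Ph x" for x
  define w where "w x = P x - v x" for x
  define X where "X = H1_norm \<Omega> w"
  define Y where "Y = L2_norm \<Omega> lam * L2_norm \<Omega> w"
  define E where "E = sqrt (\<Sum>b\<in>Basis. (L2_norm \<Omega> (weak_pderiv \<Omega> b e))\<^sup>2)"
  have vV: "v \<in> Vh \<Omega> \<T>" using v by (simp add: Kh_def)
  have e0: "e \<in> H10 \<Omega>" unfolding e_def by (rule H10_diff[OF open_domain P_H10 Vh_H10[OF Ph_Vh]])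
  have w0: "w \<in> H10 \<Omega>" unfolding w_def by (rule H10_diff[OF open_domain P_H10 Vh_H10[OF vV]])
  have card2: "card (Basis :: (real^2) set) = 2" by simp
  have X0: "X \<ge> 0" unfolding X_def H1_norm_def by (simp add: sum_nonneg)
  have Y0: "Y \<ge> 0" by (simp add: Y_def)
  have E0: "E \<ge> 0" unfolding E_def by (simp add: sum_nonneg)
  have Eb: "L2_norm \<Omega> (weak_pderiv \<Omega> b e) \<le> E" if "b \<in> Basis" for b
    unfolding E_def
  proof (rule real_le_rsqrt)
    show "(L2_norm \<Omega> (weak_pderiv \<Omega> b e))\<^sup>2 \<le> (\<Sum>b\<in>Basis. (L2_norm \<Omega> (weak_pderiv \<Omega> b e))\<^sup>2)"
      using that by (intro member_le_sum) auto
  qed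
  have "m * E\<^sup>2 \<le> bilin_a \<Omega> d e e"
    using bilin_a_coercive[OF H10_H1[OF e0] m(2)] by (simp add: E_def sum_nonneg)
  also have "\<dots> \<le> bilin_a \<Omega> d e w + Y" using energy_error[OF v] unfolding e_def w_def Y_def .
  also have "bilin_a \<Omega> d e w \<le> \<bar>M\<bar> * (2 * E * X)"
  proof -
    have "bilin_a \<Omega> d e w \<le> \<bar>M\<bar> * (\<Sum>b\<in>Basis. L2_norm \<Omega> (weak_pderiv \<Omega> b e) * L2_norm \<Omega> (weak_pderiv \<Omega> b w))"
      using bilin_a_bound[OF H10_H1[OF e0] H10_H1[OF w0]] by linarith
    also have "\<dots> \<le> \<bar>M\<bar> * (\<Sum>b\<in>(Basis::(real^2) set). E * X)"
      unfolding X_def using Eb E0 weak_pderiv_le_H1_norm[of _ \<Omega> w] by (intro mult_left_mono sum_mono mult_mono) auto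
    finally show ?thesis using card2 by simp
  qed
  finally have q: "m * E\<^sup>2 \<le> 2 * \<bar>M\<bar> * X * E + Y" by (simp add: mult_ac)
  \<comment> \<open>After division by \<open>m\<close> the inequality reads
    \<open>E\<^sup>2 \<le> a * E + s\<^sup>2\<close>, which forces \<open>E \<le> a + s\<close>; the
    square root of the multiplier term arises here.\<close>
  define a where "a = 2 * \<bar>M\<bar> * X / m"
  define s where "s = sqrt (Y / m)"
  have a0: "a \<ge> 0" and s0: "s \<ge> 0" using X0 Y0 m(1) by (auto simp: a_def s_def)
  have q': "E\<^sup>2 \<le> a * E + s\<^sup>2" using q m(1) Y0 by (simp add: a_def s_def field_simps)
  have Eas: "E \<le> a + s"
  proof (rule ccontr)
    assume "\<not> E \<le> a + s"
    then have E: "E > a + s" by simp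
    then have "E * E > (a + s) * E" using a0 s0 by (intro mult_strict_right_mono) auto
    moreover have "s * E \<ge> s * s" using E a0 s0 by (intro mult_left_mono) auto
    ultimately show False using q' by (simp add: power2_eq_square algebra_simps)
  qed
  have sY: "s = 1 / sqrt m * (sqrt (L2_norm \<Omega> lam) * sqrt (L2_norm \<Omega> w))"
    by (simp add: s_def Y_def real_sqrt_divide real_sqrt_mult)
  let ?Z = "sqrt (L2_norm \<Omega> lam) * sqrt (L2_norm \<Omega> w)"
  have Z0: "?Z \<ge> 0" by simp
  have "H1_norm \<Omega> e \<le> L2_norm \<Omega> e + (\<Sum>b\<in>Basis. L2_norm \<Omega> (weak_pderiv \<Omega> b e))" by (rule H1_norm_le)
  also have "\<dots> \<le> (C + 1) * (\<Sum>b\<in>Basis. L2_norm \<Omega> (weak_pderiv \<Omega> b e))" using C(2)[OF e0] by (simp add: algebra_simps)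
  also have "\<dots> \<le> (C + 1) * (\<Sum>b\<in>(Basis::(real^2) set). E)" using Eb C(1) by (intro mult_left_mono sum_mono) auto
  also have "\<dots> = 2 * (C + 1) * E" using card2 by simp
  also have "\<dots> \<le> 2 * (C + 1) * ((2 * \<bar>M\<bar> / m + 1 / sqrt m) * (X + ?Z))"
  proof (rule mult_left_mono)
    \<comment> \<open>The two nonnegative mixed terms are added so that the bound factors.\<close>
    have "a + s \<le> (2 * \<bar>M\<bar> / m) * X + (1 / sqrt m) * ?Z + ((2 * \<bar>M\<bar> / m) * ?Z + (1 / sqrt m) * X)"
      using X0 Z0 m(1) by (simp add: a_def sY)
    also have "\<dots> = (2 * \<bar>M\<bar> / m + 1 / sqrt m) * (X + ?Z)" by (simp add: distrib_left distrib_right)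
    finally show "E \<le> (2 * \<bar>M\<bar> / m + 1 / sqrt m) * (X + ?Z)" using Eas by simp
  qed (use C(1) in simp)
  finally show ?thesis unfolding e_def[abs_def, symmetric] w_def[abs_def, symmetric] X_def by (simp only: mult.assoc e_def[abs_def] w_def[abs_def])
qed

end

section \<open>Taylor expansion of functions in H2\<close>

lemma continuous_L2:
  fixes f :: "'a::euclidean_space \<Rightarrow> real"
  assumes "continuous_on UNIV f" "compact T" shows "f \<in> L2 T"
proof -
  have Tm: "T \<in> lmeasurable" using assms(2) lmeasurable_compact by blast
  have "bounded (f ` T)" by (intro compact_imp_bounded compact_continuous_image continuous_on_subset[OF assms(1)] assms(2)) auto
  then obtain M where M: "\<And>y. y \<in> f ` T \<Longrightarrow> norm y \<le> M" unfolding bounded_iff by blast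
  show ?thesis
  proof (rule L2_mono[OF continuous_lebesgue_measurable[OF assms(1)] L2_const[OF Tm, of M]], rule AE_I2)
    fix x assume "x \<in> space (lebesgue_on T)"
    then show "\<bar>f x\<bar> \<le> \<bar>M\<bar>" using M[of "f x"] by simp
  qed
qed

lemma smooth_L2: "smooth f \<Longrightarrow> compact T \<Longrightarrow> f \<in> L2 T"
  by (rule continuous_L2[OF smooth_continuous])

text \<open>For \<open>f s = w (a + s *\<^sub>R (x - a))\<close> the derivative of
  \<open>s * f' s - f s\<close> is \<open>s * f'' s\<close>, so the remainder of the expansion at
  \<open>x\<close>, evaluated at \<open>a\<close>, is the integral of the latter over the unit
  interval. The weight \<open>s\<close> is essential: its square cancels the Jacobian of the
  contraction towards \<open>a\<close> in the plane, which would otherwise blow up as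
  \<open>s\<close> tends to zero.\<close>

lemma Taylor_L2:
  fixes w :: "real^2 \<Rightarrow> real"
  assumes w: "smooth w" and T: "compact T" "convex T" and a: "a \<in> T" and \<delta>: "\<delta> \<ge> 0" "\<And>x. x \<in> T \<Longrightarrow> norm (x - a) \<le> \<delta>"
  shows "L2_norm T (\<lambda>x. w a - w x - (\<Sum>b\<in>Basis. pderiv_dir b w x * ((a - x) \<bullet> b)))
    \<le> \<delta>\<^sup>2 * (\<Sum>b\<in>Basis. \<Sum>c\<in>Basis. L2_norm T (pderiv_dir c (pderiv_dir b w)))"
proof -
  define R where "R x = w a - w x - (\<Sum>b\<in>Basis. pderiv_dir b w x * ((a - x) \<bullet> b))" for x
  define G where "G y = (\<Sum>b\<in>Basis. \<Sum>c\<in>Basis. \<bar>pderiv_dir c (pderiv_dir b w) y\<bar>)" for y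
  have s1: "smooth (pderiv_dir b w)" if "b \<in> Basis" for b by (rule smooth_pderiv[OF w that])
  have s2: "smooth (pderiv_dir c (pderiv_dir b w))" if "b \<in> Basis" "c \<in> Basis" for b c by (rule smooth_pderiv[OF s1[OF that(1)] that(2)])
  have Rc: "continuous_on UNIV R" unfolding R_def
    by (intro continuous_intros smooth_continuous w s1)
  have Gc: "continuous_on UNIV G" unfolding G_def
    by (intro continuous_intros smooth_continuous s2)
  have Tm: "T \<in> sets lebesgue" "T \<in> sets borel" "T \<in> lmeasurable" using T(1) by (auto simp: lmeasurable_compact borel_compact)
  have cL: "f \<in> L2 T" if "continuous_on UNIV f" for f :: "real^2 \<Rightarrow> real" by (rule continuous_L2[OF that T(1)])
  have Rb: "R \<in> borel_measurable borel" by (rule borel_measurable_continuous_onI[OF Rc])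
  have Gb [measurable]: "G \<in> borel_measurable borel" by (rule borel_measurable_continuous_onI[OF Gc])
  note Tm(2)[measurable]
  define g where "g y = ennreal ((G y)\<^sup>2) * indicator T y" for y
  have gm [measurable]: "g \<in> borel_measurable borel" unfolding g_def by measurable
  \<comment> \<open>A majorant of the squared integrand; \<open>\<delta> ^ 4\<close> is the square
    of the bound for two offsets \<open>x - a\<close>.\<close>
  define k where "k x s = ennreal (\<delta> ^ 4 * s\<^sup>2) * g (a + s *\<^sub>R (x - a)) * indicator {0..1::real} s" for x s
  have pt: "ennreal ((R x)\<^sup>2) * indicator T x \<le> (\<integral>\<^sup>+s. k x s \<partial>lborel)" for x
  proof (cases "x \<in> T")
    case True
    define f1 where "f1 s = (\<Sum>b\<in>Basis. ((x - a) \<bullet> b) * pderiv_dir b w (a + s *\<^sub>R (x - a)))" for s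
    define f2 where "f2 s = (\<Sum>b\<in>Basis. ((x - a) \<bullet> b) * (\<Sum>c\<in>Basis. ((x - a) \<bullet> c) * pderiv_dir c (pderiv_dir b w) (a + s *\<^sub>R (x - a))))" for s
    have D: "((\<lambda>s. v (a + s *\<^sub>R (x - a))) has_real_derivative (\<Sum>b\<in>Basis. ((x - a) \<bullet> b) * pderiv_dir b v (a + s *\<^sub>R (x - a)))) (at s)"
      if "smooth v" for v s
    proof -
      have "((\<lambda>s. v (a + s *\<^sub>R (x - a))) has_derivative (\<lambda>r. \<Sum>c\<in>Basis. ((r *\<^sub>R (x - a)) \<bullet> c) * pderiv_dir c v (a + s *\<^sub>R (x - a)))) (at s)"
        by (rule has_derivative_compose[of "\<lambda>s. a + s *\<^sub>R (x - a)"])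
          (auto intro!: derivative_eq_intros smooth_has_derivative[OF that])
      moreover have "(\<lambda>r. \<Sum>c\<in>Basis. ((r *\<^sub>R (x - a)) \<bullet> c) * pderiv_dir c v (a + s *\<^sub>R (x - a))) = (*) (\<Sum>b\<in>Basis. ((x - a) \<bullet> b) * pderiv_dir b v (a + s *\<^sub>R (x - a)))"
        by (rule ext) (simp add: sum_distrib_left mult_ac)
      ultimately show ?thesis by (simp add: has_field_derivative_def)
    qed
    have d1: "((\<lambda>s. w (a + s *\<^sub>R (x - a))) has_real_derivative f1 s) (at s)" for s unfolding f1_def by (rule D[OF w])
    have d2: "(f1 has_real_derivative f2 s) (at s)" for s unfolding f1_def f2_def
      by (intro DERIV_sum DERIV_cmult D s1)
    have "((\<lambda>s. s * f1 s - w (a + s *\<^sub>R (x - a))) has_real_derivative (s * f2 s)) (at s)" for s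
      using DERIV_diff[OF DERIV_mult[OF DERIV_ident d2] d1, of s] by (simp add: mult.commute)
    moreover have "continuous_on UNIV (\<lambda>s. s * f2 s)" unfolding f2_def
      by (intro continuous_intros continuous_on_compose2[OF smooth_continuous[OF s2, of _ _ UNIV]]) auto
    ultimately have "ennreal (((1 * f1 1 - w (a + 1 *\<^sub>R (x - a))) - (0 * f1 0 - w (a + 0 *\<^sub>R (x - a))))\<^sup>2)
        \<le> (\<integral>\<^sup>+s. ennreal ((s * f2 s)\<^sup>2) * indicator {0..1::real} s \<partial>lborel)"
      by (rule square_increment_le)
    moreover have "(1 * f1 1 - w (a + 1 *\<^sub>R (x - a))) - (0 * f1 0 - w (a + 0 *\<^sub>R (x - a))) = R x"
    proof -
      have "f1 1 = - (\<Sum>b\<in>Basis. pderiv_dir b w x * ((a - x) \<bullet> b))"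
        unfolding f1_def sum_negf[symmetric] by (intro sum.cong) (auto simp: inner_diff_left algebra_simps)
      then show ?thesis by (simp add: R_def)
    qed
    moreover have "(\<integral>\<^sup>+s. ennreal ((s * f2 s)\<^sup>2) * indicator {0..1::real} s \<partial>lborel) \<le> (\<integral>\<^sup>+s. k x s \<partial>lborel)"
    proof (rule nn_integral_mono)
      fix s :: real
      show "ennreal ((s * f2 s)\<^sup>2) * indicator {0..1::real} s \<le> k x s"
      proof (cases "s \<in> {0..1}")
        case s: True
        have "a + s *\<^sub>R (x - a) = (1 - s) *\<^sub>R a + s *\<^sub>R x" by (simp add: algebra_simps)
        then have inT: "a + s *\<^sub>R (x - a) \<in> T" using convexD_alt[OF T(2) a True, of s] s by simp
        have n: "\<bar>(x - a) \<bullet> b\<bar> \<le> \<delta>" if "b \<in> Basis" for b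
          using Basis_le_norm[OF that, of "x - a"] \<delta>(2)[OF True] by linarith
        let ?y = "a + s *\<^sub>R (x - a)"
        have "\<bar>f2 s\<bar> \<le> (\<Sum>b\<in>Basis. \<bar>((x - a) \<bullet> b) * (\<Sum>c\<in>Basis. ((x - a) \<bullet> c) * pderiv_dir c (pderiv_dir b w) ?y)\<bar>)"
          unfolding f2_def by (rule sum_abs)
        also have "\<dots> \<le> (\<Sum>b\<in>Basis. \<delta> * (\<Sum>c\<in>Basis. \<delta> * \<bar>pderiv_dir c (pderiv_dir b w) ?y\<bar>))"
        proof (rule sum_mono)
          fix b :: "real^2" assume b: "b \<in> Basis"
          have "\<bar>\<Sum>c\<in>Basis. ((x - a) \<bullet> c) * pderiv_dir c (pderiv_dir b w) ?y\<bar> \<le> (\<Sum>c\<in>Basis. \<bar>((x - a) \<bullet> c) * pderiv_dir c (pderiv_dir b w) ?y\<bar>)"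
            by (rule sum_abs)
          also have "\<dots> \<le> (\<Sum>c\<in>Basis. \<delta> * \<bar>pderiv_dir c (pderiv_dir b w) ?y\<bar>)"
            unfolding abs_mult by (intro sum_mono mult_right_mono n) auto
          finally show "\<bar>((x - a) \<bullet> b) * (\<Sum>c\<in>Basis. ((x - a) \<bullet> c) * pderiv_dir c (pderiv_dir b w) ?y)\<bar>
              \<le> \<delta> * (\<Sum>c\<in>Basis. \<delta> * \<bar>pderiv_dir c (pderiv_dir b w) ?y\<bar>)"
            unfolding abs_mult[of "(x - a) \<bullet> b"] using n[OF b] \<delta>(1) by (intro mult_mono) auto
        qed
        also have "\<dots> = \<delta>\<^sup>2 * G ?y" by (simp add: G_def sum_distrib_left power2_eq_square mult.assoc)
        finally have "\<bar>s * f2 s\<bar> \<le> s * (\<delta>\<^sup>2 * G ?y)" using s by (simp add: abs_mult mult_left_mono)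
        then have "\<bar>s * f2 s\<bar>\<^sup>2 \<le> (s * (\<delta>\<^sup>2 * G ?y))\<^sup>2" by (rule power_mono) simp
        then have "(s * f2 s)\<^sup>2 \<le> \<delta> ^ 4 * s\<^sup>2 * (G ?y)\<^sup>2" by (simp add: power_mult_distrib mult_ac)
        then have "ennreal ((s * f2 s)\<^sup>2) \<le> ennreal (\<delta> ^ 4 * s\<^sup>2 * (G ?y)\<^sup>2)" by (rule ennreal_leI)
        then show ?thesis using s inT by (simp add: k_def g_def ennreal_mult)
      qed (simp add: k_def)
    qed
    ultimately show ?thesis using True by simp
  qed simp
  have "ennreal ((L2_norm T R)\<^sup>2) = (\<integral>\<^sup>+x. ennreal ((R x)\<^sup>2) * indicator T x \<partial>lborel)"
    by (rule nn_integral_square_eq_L2_norm[symmetric, OF cL[OF Rc] Rb Tm(2)])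
  also have "\<dots> \<le> (\<integral>\<^sup>+x. \<integral>\<^sup>+s. k x s \<partial>lborel \<partial>lborel)" by (intro nn_integral_mono pt)
  also have "\<dots> = (\<integral>\<^sup>+s. \<integral>\<^sup>+x. k x s \<partial>lborel \<partial>lborel)"
    by (rule lborel_pair.Fubini') (unfold k_def, measurable)
  also have "\<dots> \<le> (\<integral>\<^sup>+s. (ennreal (\<delta> ^ 4) * (\<integral>\<^sup>+x. g x \<partial>lborel)) * indicator {0..1::real} s \<partial>lborel)"
  proof (rule nn_integral_mono)
    fix s :: real
    show "(\<integral>\<^sup>+x. k x s \<partial>lborel) \<le> (ennreal (\<delta> ^ 4) * (\<integral>\<^sup>+x. g x \<partial>lborel)) * indicator {0..1::real} s"
    proof (cases "s = 0")
      \<comment> \<open>The contraction degenerates at \<open>s = 0\<close>, but there the weight is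
        zero.\<close>
      case True then show ?thesis by (simp add: k_def)
    next
      case False
      have eq: "(\<lambda>x. g (a + s *\<^sub>R (x - a))) = (\<lambda>x. g ((a - s *\<^sub>R a) + s *\<^sub>R x))" by (simp add: algebra_simps)
      have "(\<integral>\<^sup>+x. k x s \<partial>lborel) = (\<integral>\<^sup>+x. (ennreal (\<delta> ^ 4 * s\<^sup>2) * indicator {0..1} s) * g ((a - s *\<^sub>R a) + s *\<^sub>R x) \<partial>lborel)"
        unfolding k_def using fun_cong[OF eq] by (intro nn_integral_cong) (simp add: mult_ac)
      also have "\<dots> = (ennreal (\<delta> ^ 4 * s\<^sup>2) * indicator {0..1} s) * (\<integral>\<^sup>+x. g ((a - s *\<^sub>R a) + s *\<^sub>R x) \<partial>lborel)"
        by (rule nn_integral_cmult) measurable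
      also have "\<dots> = ennreal (\<delta> ^ 4) * (ennreal (\<bar>s\<bar> ^ DIM(real^2)) * (\<integral>\<^sup>+x. g ((a - s *\<^sub>R a) + s *\<^sub>R x) \<partial>lborel)) * indicator {0..1} s"
        by (simp add: ennreal_mult mult_ac)
      also have "\<dots> = ennreal (\<delta> ^ 4) * (\<integral>\<^sup>+x. g x \<partial>lborel) * indicator {0..1} s"
        by (simp only: nn_integral_lborel_affine[OF gm False, of "a - s *\<^sub>R a", symmetric])
      finally show ?thesis by simp
    qed
  qed
  also have "\<dots> = ennreal (\<delta> ^ 4) * (\<integral>\<^sup>+x. g x \<partial>lborel)" by (subst nn_integral_cmult) auto
  also have "(\<integral>\<^sup>+x. g x \<partial>lborel) = ennreal ((L2_norm T G)\<^sup>2)" unfolding g_def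
    by (rule nn_integral_square_eq_L2_norm[OF cL[OF Gc] Gb Tm(2)])
  also have "ennreal (\<delta> ^ 4) * ennreal ((L2_norm T G)\<^sup>2) = ennreal ((\<delta>\<^sup>2 * L2_norm T G)\<^sup>2)"
    using \<delta>(1) by (simp add: ennreal_mult[symmetric] power_mult_distrib)
  finally have "(L2_norm T R)\<^sup>2 \<le> (\<delta>\<^sup>2 * L2_norm T G)\<^sup>2" by simp
  then have "L2_norm T R \<le> \<delta>\<^sup>2 * L2_norm T G" by (rule power2_le_imp_le) simp
  also have "\<dots> \<le> \<delta>\<^sup>2 * (\<Sum>b\<in>Basis. \<Sum>c\<in>Basis. L2_norm T (pderiv_dir c (pderiv_dir b w)))"
  proof (rule mult_left_mono)
    have aL: "(\<lambda>y. \<bar>pderiv_dir c (pderiv_dir b w) y\<bar>) \<in> L2 T" if "b \<in> Basis" "c \<in> Basis" for b c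
      by (intro cL continuous_intros smooth_continuous s2 that)
    have n: "L2_norm T (\<lambda>y. \<bar>f y\<bar>) = L2_norm T f" for f by (simp add: L2_norm_def L2_inner_def)
    have "L2_norm T G \<le> (\<Sum>b\<in>Basis. L2_norm T (\<lambda>y. \<Sum>c\<in>Basis. \<bar>pderiv_dir c (pderiv_dir b w) y\<bar>))"
      unfolding G_def by (intro L2_norm_sum_le L2_sum aL)
    also have "\<dots> \<le> (\<Sum>b\<in>Basis. \<Sum>c\<in>Basis. L2_norm T (\<lambda>y. \<bar>pderiv_dir c (pderiv_dir b w) y\<bar>))"
      by (intro sum_mono L2_norm_sum_le aL)
    finally show "L2_norm T G \<le> (\<Sum>b\<in>Basis. \<Sum>c\<in>Basis. L2_norm T (pderiv_dir c (pderiv_dir b w)))" by (simp add: n)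
  qed simp
  finally show ?thesis unfolding R_def[abs_def] .
qed

lemma offset_mult:
  assumes T: "T \<in> sets lebesgue" and f: "f \<in> L2 T" and \<delta>: "\<delta> \<ge> 0" "\<And>x. x \<in> T \<Longrightarrow> norm (x - a) \<le> \<delta>" and b: "b \<in> Basis"
  shows "(\<lambda>x. f x * ((a - x) \<bullet> b)) \<in> L2 T" "L2_norm T (\<lambda>x. f x * ((a - x) \<bullet> b)) \<le> \<delta> * L2_norm T f"
proof -
  have "continuous_on UNIV (\<lambda>x. (a - x) \<bullet> b)" by (intro continuous_intros)
  then have m: "(\<lambda>x. (a - x) \<bullet> b) \<in> borel_measurable (lebesgue_on T)" by (rule continuous_lebesgue_measurable)
  have "\<bar>(a - x) \<bullet> b\<bar> \<le> \<delta>" if "x \<in> T" for x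
    using Basis_le_norm[OF b, of "a - x"] \<delta>(2)[OF that] by (simp add: norm_minus_commute)
  then have ae: "AE x in lebesgue_on T. \<bar>(a - x) \<bullet> b\<bar> \<le> \<delta>" by (intro AE_I2) simp
  show "(\<lambda>x. f x * ((a - x) \<bullet> b)) \<in> L2 T" "L2_norm T (\<lambda>x. f x * ((a - x) \<bullet> b)) \<le> \<delta> * L2_norm T f"
    using L2_bounded_mult[OF f m ae] \<delta>(1) by (auto simp: mult.commute)
qed

text \<open>A function known up to null sets has no value at a point. The limit of its local means
  stands in for it; existence of the limit is proved for functions in \<open>H2\<close>.\<close>

definition point_value :: "'a::euclidean_space set \<Rightarrow> ('a \<Rightarrow> real) \<Rightarrow> 'a \<Rightarrow> real" where
  "point_value \<Omega> u a = lim (\<lambda>n. conv (moll n) (\<lambda>x. if x \<in> \<Omega> then u x else 0) a)"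

locale H2_function =
  fixes \<Omega> :: "(real^2) set" and u :: "real^2 \<Rightarrow> real"
  assumes dom: "open \<Omega>" "bounded \<Omega>" and H2: "u \<in> H2 \<Omega>"
begin

abbreviation "du b \<equiv> weak_pderiv \<Omega> b u"
abbreviation "ddu b c \<equiv> weak_pderiv \<Omega> c (weak_pderiv \<Omega> b u)"
abbreviation "um n \<equiv> conv (moll n) (\<lambda>x. if x \<in> \<Omega> then u x else 0)"

lemma dom_sets: "\<Omega> \<in> sets lebesgue" "\<Omega> \<in> lmeasurable"
  using dom lmeasurable_open by auto

lemma u_H1: "u \<in> H1 \<Omega>" and du_H1: "b \<in> Basis \<Longrightarrow> du b \<in> H1 \<Omega>"
  using H2 by (auto simp: H2_def)

lemma u_L2: "u \<in> L2 \<Omega>" by (rule H1_L2[OF u_H1])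
lemma du_L2: "b \<in> Basis \<Longrightarrow> du b \<in> L2 \<Omega>" by (rule H1_L2[OF du_H1])
lemma ddu_L2: "b \<in> Basis \<Longrightarrow> c \<in> Basis \<Longrightarrow> ddu b c \<in> L2 \<Omega>" by (rule H1_weak_pderiv(2)[OF dom(1) du_H1])

lemma restrict_integrable:
  assumes "f \<in> L2 \<Omega>"
  shows "integrable lebesgue (\<lambda>x. if x \<in> \<Omega> then f x else 0)" "(\<lambda>x. if x \<in> \<Omega> then f x else 0) \<in> L2 UNIV"
  using L2_integrable[OF dom_sets(2) assms] L2_restrict_iff[OF dom_sets(1)] assms dom_sets(1)
  by (auto simp: Lebesgue_Measure.integrable_restrict_UNIV)

lemma um_smooth: "smooth (um n)" by (rule smooth_conv[OF moll_test_fun restrict_integrable(1)[OF u_L2]])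

lemma moll_limit:
  assumes T: "T \<in> sets lebesgue" "T \<subseteq> \<Omega>" and f: "f \<in> L2 \<Omega>"
    and g: "\<forall>\<^sub>F n in sequentially. \<forall>x\<in>T. g n x = conv (moll n) (\<lambda>x. if x \<in> \<Omega> then f x else 0) x"
  shows "(\<lambda>n. L2_norm T (\<lambda>x. g n x - f x)) \<longlonglongrightarrow> 0"
proof (rule Lim_null_comparison[OF _ conv_moll_tendsto_L2[OF restrict_integrable[OF f]]])
  let ?f = "\<lambda>x. if x \<in> \<Omega> then f x else 0"
  show "\<forall>\<^sub>F n in sequentially. norm (L2_norm T (\<lambda>x. g n x - f x)) \<le> L2_norm UNIV (\<lambda>x. conv (moll n) ?f x - ?f x)"
    using g
  proof eventually_elim
    case (elim n)
    have "L2_norm T (\<lambda>x. g n x - f x) = L2_norm T (\<lambda>x. conv (moll n) ?f x - ?f x)"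
      by (rule L2_norm_cong) (use elim T(2) in auto)
    also have "\<dots> \<le> L2_norm UNIV (\<lambda>x. conv (moll n) ?f x - ?f x)"
      by (rule L2_subset(2)[OF _ T(1) subset_UNIV L2_diff[OF conv_moll_L2(1)[OF restrict_integrable[OF f]] restrict_integrable(2)[OF f]]]) simp
    finally show ?case by simp
  qed
qed

text \<open>Mollification commutes with weak derivatives once the kernel around every point of
  \<open>T\<close> fits into \<Omega>; the radius is 2/(n+1) because the derivative of the kernel is
  shown to vanish from there on. Derivatives are moved off the kernel outermost first, which
  exchanges the two indices of \<open>ddu\<close>; summation over both indices absorbs this.\<close>

lemma um_derivatives:
  assumes T: "compact T" "T \<subseteq> \<Omega>" and b: "b \<in> Basis" and c: "c \<in> Basis"
  shows "\<forall>\<^sub>F n in sequentially. \<forall>x\<in>T. pderiv_dir b (um n) x = conv (moll n) (\<lambda>x. if x \<in> \<Omega> then du b x else 0) x"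
    and "\<forall>\<^sub>F n in sequentially. \<forall>x\<in>T. pderiv_dir c (pderiv_dir b (um n)) x = conv (moll n) (\<lambda>x. if x \<in> \<Omega> then ddu c b x else 0) x"
proof -
  obtain r where "r > 0" "(\<Union>x\<in>T. cball x r) \<subseteq> \<Omega>"
    using compact_subset_open_imp_cball_epsilon_subset[OF T(1) dom(1) T(2)] .
  then have r: "r > 0" "\<And>x. x \<in> T \<Longrightarrow> cball x r \<subseteq> \<Omega>" by auto
  have "(\<lambda>n. 2 * (1 / real (Suc n))) \<longlonglongrightarrow> 2 * 0" by (rule tendsto_mult[OF tendsto_const LIMSEQ_Suc[OF lim_1_over_n]])
  then have "\<forall>\<^sub>F n in sequentially. 2 * (1 / real (Suc n)) < r" by (rule order_tendstoD(2)) (use r(1) in simp)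
  then have ev: "\<forall>\<^sub>F n in sequentially. \<forall>x\<in>T. cball x (2 / real (Suc n)) \<subseteq> \<Omega>"
  proof eventually_elim
    case (elim n)
    show ?case
    proof
      fix x assume "x \<in> T"
      then show "cball x (2 / real (Suc n)) \<subseteq> \<Omega>" using r(2)[of x] subset_cball[of "2 / real (Suc n)" r x] elim by simp
    qed
  qed
  have i: "integrable lebesgue (\<lambda>x. if x \<in> \<Omega> then u x else 0)" by (rule restrict_integrable(1)[OF u_L2])
  have m0: "moll n z = 0" if "2 / real (Suc n) \<le> norm z" for n and z :: "real^2"
  proof (rule moll_eq_0)
    have "1 / real (Suc n) \<le> 2 / real (Suc n)" by (simp add: divide_right_mono)
    then show "1 / real (Suc n) \<le> norm z" using that by linarith
  qed
  show "\<forall>\<^sub>F n in sequentially. \<forall>x\<in>T. pderiv_dir b (um n) x = conv (moll n) (\<lambda>x. if x \<in> \<Omega> then du b x else 0) x"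
    using ev
  proof eventually_elim
    case (elim n)
    then show ?case unfolding pderiv_dir_conv[OF moll_test_fun i b]
      using conv_weak_pderiv[OF dom(1) b H1_weak_pderiv(1)[OF dom(1) u_H1 b] moll_test_fun m0] by blast
  qed
  show "\<forall>\<^sub>F n in sequentially. \<forall>x\<in>T. pderiv_dir c (pderiv_dir b (um n)) x = conv (moll n) (\<lambda>x. if x \<in> \<Omega> then ddu c b x else 0) x"
    using ev
  proof eventually_elim
    case (elim n)
    show ?case
    proof
      fix x assume "x \<in> T"
      then have x: "cball x (2 / real (Suc n)) \<subseteq> \<Omega>" using elim by blast
      have "pderiv_dir c (pderiv_dir b (um n)) x = conv (pderiv_dir c (pderiv_dir b (moll n))) (\<lambda>x. if x \<in> \<Omega> then u x else 0) x"
        unfolding pderiv_dir_conv[OF moll_test_fun i b] pderiv_dir_conv[OF pderiv_test_fun[OF moll_test_fun b] i c] ..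
      also have "\<dots> = conv (pderiv_dir b (moll n)) (\<lambda>x. if x \<in> \<Omega> then du c x else 0) x"
        by (rule conv_weak_pderiv[OF dom(1) c H1_weak_pderiv(1)[OF dom(1) u_H1 c] pderiv_test_fun[OF moll_test_fun b] pderiv_moll_eq_0 x])
      also have "\<dots> = conv (moll n) (\<lambda>x. if x \<in> \<Omega> then ddu c b x else 0) x"
        by (rule conv_weak_pderiv[OF dom(1) b H1_weak_pderiv(1)[OF dom(1) du_H1[OF c] b] moll_test_fun m0 x])
      finally show "pderiv_dir c (pderiv_dir b (um n)) x = conv (moll n) (\<lambda>x. if x \<in> \<Omega> then ddu c b x else 0) x" .
    qed
  qed
qed

lemma um_limits:
  assumes T: "compact T" "T \<subseteq> \<Omega>"
  shows "(\<lambda>n. L2_norm T (\<lambda>x. um n x - u x)) \<longlonglongrightarrow> 0"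
    and "b \<in> Basis \<Longrightarrow> (\<lambda>n. L2_norm T (\<lambda>x. pderiv_dir b (um n) x - du b x)) \<longlonglongrightarrow> 0"
    and "b \<in> Basis \<Longrightarrow> c \<in> Basis \<Longrightarrow> (\<lambda>n. L2_norm T (\<lambda>x. pderiv_dir c (pderiv_dir b (um n)) x - ddu c b x)) \<longlonglongrightarrow> 0"
proof -
  have Tm: "T \<in> sets lebesgue" using T(1) lmeasurable_compact by blast
  show "(\<lambda>n. L2_norm T (\<lambda>x. um n x - u x)) \<longlonglongrightarrow> 0" by (rule moll_limit[OF Tm T(2) u_L2]) simp
  show "(\<lambda>n. L2_norm T (\<lambda>x. pderiv_dir b (um n) x - du b x)) \<longlonglongrightarrow> 0" if "b \<in> Basis"
    by (rule moll_limit[OF Tm T(2) du_L2[OF that] um_derivatives(1)[OF T that that]])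
  show "(\<lambda>n. L2_norm T (\<lambda>x. pderiv_dir c (pderiv_dir b (um n)) x - ddu c b x)) \<longlonglongrightarrow> 0" if "b \<in> Basis" "c \<in> Basis"
    by (rule moll_limit[OF Tm T(2) ddu_L2[OF that(2,1)] um_derivatives(2)[OF T that]])
qed

text \<open>The value at \<open>a\<close> of the difference of two mollifications is Taylor
  remainder plus function plus linear part, and all three have small norm over a ball around
  \<open>a\<close>. Hence the values form a Cauchy sequence.\<close>

lemma um_convergent:
  assumes a: "a \<in> \<Omega>"
  shows "(\<lambda>n. um n a) \<longlonglongrightarrow> point_value \<Omega> u a"
proof -
  obtain r where r: "r > 0" "cball a r \<subseteq> \<Omega>" using dom(1) a by (meson open_contains_cball)
  define T where "T = cball a r"
  have T: "compact T" "T \<subseteq> \<Omega>" "convex T" "a \<in> T" "T \<in> lmeasurable" "T \<in> sets lebesgue" using r by (auto simp: T_def)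
  have n: "norm (x - a) \<le> r" if "x \<in> T" for x using that by (simp add: T_def dist_norm norm_minus_commute)
  define \<epsilon> where "\<epsilon> k = r\<^sup>2 * (\<Sum>b\<in>Basis. \<Sum>c\<in>Basis. L2_norm T (\<lambda>x. pderiv_dir c (pderiv_dir b (um k)) x - ddu c b x))
     + L2_norm T (\<lambda>x. um k x - u x) + (\<Sum>b\<in>Basis. r * L2_norm T (\<lambda>x. pderiv_dir b (um k) x - du b x))" for k
  have "\<epsilon> \<longlonglongrightarrow> r\<^sup>2 * (\<Sum>b\<in>(Basis::(real^2) set). \<Sum>c\<in>(Basis::(real^2) set). 0) + 0 + (\<Sum>b\<in>(Basis::(real^2) set). r * 0)"
    unfolding \<epsilon>_def[abs_def] by (intro tendsto_intros um_limits[OF T(1,2)])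
  then have \<epsilon>0: "\<epsilon> \<longlonglongrightarrow> 0" by simp
  \<comment> \<open>The norm of the constant one over the ball; dividing by it turns the norm of a
    constant into its modulus.\<close>
  define s where "s = sqrt (measure lebesgue T)"
  have "measure lebesgue T > 0" unfolding T_def using r(1) by (simp add: content_cball_pos)
  then have s: "s > 0" by (simp add: s_def)
  have sub: "f \<in> L2 T" if "f \<in> L2 \<Omega>" for f by (rule L2_subset(1)[OF dom_sets(1) T(6,2) that])
  note sm = um_smooth smooth_pderiv[OF um_smooth]
  have key: "\<bar>um k a - um l a\<bar> * s \<le> \<epsilon> k + \<epsilon> l" for k l
  proof -
    define w where "w x = um k x - um l x" for x
    have w: "smooth w" unfolding w_def by (intro smooth_diff um_smooth)
    have p: "pderiv_dir b w = (\<lambda>x. pderiv_dir b (um k) x - pderiv_dir b (um l) x)" for b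
      unfolding w_def by (rule pderiv_dir_diff[OF um_smooth um_smooth])
    have pp: "pderiv_dir c (pderiv_dir b w) = (\<lambda>x. pderiv_dir c (pderiv_dir b (um k)) x - pderiv_dir c (pderiv_dir b (um l)) x)" if "b \<in> Basis" for b c
      unfolding p by (rule pderiv_dir_diff[OF sm(2)[OF that] sm(2)[OF that]])
    have tri: "L2_norm T (\<lambda>x. f x - g x) \<le> L2_norm T (\<lambda>x. f x - h x) + L2_norm T (\<lambda>x. g x - h x)" if "f \<in> L2 T" "g \<in> L2 T" "h \<in> L2 T" for f g h
      using L2_triangle_diff[OF L2_diff[OF that(1,3)] L2_diff[OF that(2,3)]] by simp
    have wL: "w \<in> L2 T" by (rule smooth_L2[OF w T(1)])
    have pL: "pderiv_dir b w \<in> L2 T" if "b \<in> Basis" for b by (rule smooth_L2[OF smooth_pderiv[OF w that] T(1)])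
    define R where "R x = w a - w x - (\<Sum>b\<in>Basis. pderiv_dir b w x * ((a - x) \<bullet> b))" for x
    have RL: "R \<in> L2 T" unfolding R_def
      by (intro L2_diff L2_const[OF T(5)] wL L2_sum offset_mult(1)[OF T(6) pL _ n]) (use r in auto)
    have "\<bar>w a\<bar> * s = L2_norm T (\<lambda>x. w a)" using L2_norm_const[OF T(5)] by (simp add: s_def)
    also have "\<dots> = L2_norm T (\<lambda>x. R x + w x + (\<Sum>b\<in>Basis. pderiv_dir b w x * ((a - x) \<bullet> b)))" by (simp add: R_def)
    also have "\<dots> \<le> L2_norm T R + L2_norm T w + (\<Sum>b\<in>Basis. L2_norm T (\<lambda>x. pderiv_dir b w x * ((a - x) \<bullet> b)))"
      by (rule L2_norm_le_add3[OF RL wL offset_mult(1)[OF T(6) pL _ n]]) (use r in auto)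
    also have "L2_norm T R \<le> r\<^sup>2 * (\<Sum>b\<in>Basis. \<Sum>c\<in>Basis. L2_norm T (pderiv_dir c (pderiv_dir b w)))"
      unfolding R_def by (rule Taylor_L2[OF w T(1,3,4) _ n]) (use r in auto)
    also have "\<dots> \<le> r\<^sup>2 * (\<Sum>b\<in>Basis. \<Sum>c\<in>Basis. L2_norm T (\<lambda>x. pderiv_dir c (pderiv_dir b (um k)) x - ddu c b x)
        + L2_norm T (\<lambda>x. pderiv_dir c (pderiv_dir b (um l)) x - ddu c b x))"
    proof (intro mult_left_mono sum_mono)
      fix b c :: "real^2" assume bc: "b \<in> Basis" "c \<in> Basis"
      show "L2_norm T (pderiv_dir c (pderiv_dir b w)) \<le> L2_norm T (\<lambda>x. pderiv_dir c (pderiv_dir b (um k)) x - ddu c b x)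
          + L2_norm T (\<lambda>x. pderiv_dir c (pderiv_dir b (um l)) x - ddu c b x)"
        unfolding pp[OF bc(1)]
        by (rule tri[OF smooth_L2[OF smooth_pderiv[OF sm(2)[OF bc(1)] bc(2)] T(1)] smooth_L2[OF smooth_pderiv[OF sm(2)[OF bc(1)] bc(2)] T(1)]
          sub[OF ddu_L2[OF bc(2,1)]]])
    qed simp
    also have "L2_norm T w \<le> L2_norm T (\<lambda>x. um k x - u x) + L2_norm T (\<lambda>x. um l x - u x)"
      unfolding w_def by (rule tri[OF smooth_L2[OF um_smooth T(1)] smooth_L2[OF um_smooth T(1)] sub[OF u_L2]])
    also have "(\<Sum>b\<in>Basis. L2_norm T (\<lambda>x. pderiv_dir b w x * ((a - x) \<bullet> b)))
        \<le> (\<Sum>b\<in>Basis. r * (L2_norm T (\<lambda>x. pderiv_dir b (um k) x - du b x) + L2_norm T (\<lambda>x. pderiv_dir b (um l) x - du b x)))"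
    proof (rule sum_mono)
      fix b :: "real^2" assume b: "b \<in> Basis"
      have "L2_norm T (\<lambda>x. pderiv_dir b w x * ((a - x) \<bullet> b)) \<le> r * L2_norm T (pderiv_dir b w)"
        by (rule offset_mult(2)[OF T(6) pL[OF b] _ n b]) (use r in auto)
      also have "\<dots> \<le> r * (L2_norm T (\<lambda>x. pderiv_dir b (um k) x - du b x) + L2_norm T (\<lambda>x. pderiv_dir b (um l) x - du b x))"
        unfolding p
        by (rule mult_left_mono[OF tri[OF smooth_L2[OF sm(2)[OF b] T(1)] smooth_L2[OF sm(2)[OF b] T(1)] sub[OF du_L2[OF b]]]]) (use r(1) in simp)
      finally show "L2_norm T (\<lambda>x. pderiv_dir b w x * ((a - x) \<bullet> b))
        \<le> r * (L2_norm T (\<lambda>x. pderiv_dir b (um k) x - du b x) + L2_norm T (\<lambda>x. pderiv_dir b (um l) x - du b x))" .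
    qed
    finally have "\<bar>w a\<bar> * s \<le> \<epsilon> k + \<epsilon> l" by (simp add: \<epsilon>_def sum.distrib distrib_left add_ac)
    then show ?thesis by (simp add: w_def)
  qed
  have "Cauchy (\<lambda>n. um n a)"
  proof (rule CauchyI)
    fix e :: real assume e: "e > 0"
    then have "e * s / 2 > 0" using s by simp
    from order_tendstoD(2)[OF \<epsilon>0 this] obtain N where N: "\<And>n. n \<ge> N \<Longrightarrow> \<epsilon> n < e * s / 2"
      unfolding eventually_sequentially by blast
    have "norm (um k a - um l a) < e" if "k \<ge> N" "l \<ge> N" for k l
    proof -
      have "\<bar>um k a - um l a\<bar> * s < e * s" using key[of k l] N[OF that(1)] N[OF that(2)] by linarith
      then show ?thesis using s by simp
    qed
    then show "\<exists>N. \<forall>k\<ge>N. \<forall>l\<ge>N. norm (um k a - um l a) < e" by blast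
  qed
  then have "convergent (\<lambda>n. um n a)" by (rule Cauchy_convergent)
  then show ?thesis unfolding point_value_def by (simp add: convergent_LIMSEQ_iff)
qed

text \<open>The expansion of the mollifications passes to the limit. Their derivatives converge on
  compact subsets of \<Omega> only, so triangles that touch the boundary need an exhaustion.\<close>

lemma Taylor_weak:
  assumes T: "compact T" "convex T" "T \<subseteq> \<Omega>" and a: "a \<in> T" and \<delta>: "\<delta> \<ge> 0" "\<And>x. x \<in> T \<Longrightarrow> norm (x - a) \<le> \<delta>"
  shows "L2_norm T (\<lambda>x. point_value \<Omega> u a - u x - (\<Sum>b\<in>Basis. du b x * ((a - x) \<bullet> b)))
    \<le> \<delta>\<^sup>2 * (\<Sum>b\<in>Basis. \<Sum>c\<in>Basis. L2_norm T (ddu b c))"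
proof -
  have Tm: "T \<in> sets lebesgue" "T \<in> lmeasurable" using T(1) lmeasurable_compact by auto
  have sub: "f \<in> L2 T" if "f \<in> L2 \<Omega>" for f by (rule L2_subset(1)[OF dom_sets(1) Tm(1) T(3) that])
  note sm = um_smooth smooth_pderiv[OF um_smooth]
  define R where "R n x = um n a - um n x - (\<Sum>b\<in>Basis. pderiv_dir b (um n) x * ((a - x) \<bullet> b))" for n x
  define R' where "R' x = point_value \<Omega> u a - u x - (\<Sum>b\<in>Basis. du b x * ((a - x) \<bullet> b))" for x
  have pL: "pderiv_dir b (um n) \<in> L2 T" if "b \<in> Basis" for b n by (rule smooth_L2[OF sm(2)[OF that] T(1)])
  have RL: "R n \<in> L2 T" for n unfolding R_def
    by (intro L2_diff L2_const[OF Tm(2)] smooth_L2 um_smooth T(1) L2_sum offset_mult(1)[OF Tm(1) pL \<delta>])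
  have R'L: "R' \<in> L2 T" unfolding R'_def
    by (intro L2_diff L2_const[OF Tm(2)] sub u_L2 L2_sum offset_mult(1)[OF Tm(1) sub[OF du_L2] \<delta>])
  have "(\<lambda>n. L2_norm T (\<lambda>x. R n x - R' x)) \<longlonglongrightarrow> 0"
  proof (rule Lim_null_comparison)
    let ?B = "\<lambda>n. \<bar>um n a - point_value \<Omega> u a\<bar> * sqrt (measure lebesgue T) + L2_norm T (\<lambda>x. um n x - u x)
        + (\<Sum>b\<in>Basis. \<delta> * L2_norm T (\<lambda>x. pderiv_dir b (um n) x - du b x))"
    show "\<forall>\<^sub>F n in sequentially. norm (L2_norm T (\<lambda>x. R n x - R' x)) \<le> ?B n"
    proof (intro always_eventually allI)
      fix n
      have dL: "(\<lambda>x. pderiv_dir b (um n) x - du b x) \<in> L2 T" if "b \<in> Basis" for b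
        by (intro L2_diff pL sub du_L2 that)
      have e: "(\<lambda>x. R n x - R' x) = (\<lambda>x. (um n a - point_value \<Omega> u a) + (- (um n x - u x)) + (\<Sum>b\<in>Basis. - ((pderiv_dir b (um n) x - du b x) * ((a - x) \<bullet> b))))"
        by (simp add: R_def R'_def left_diff_distrib sum_subtractf sum_negf fun_eq_iff)
      have "L2_norm T (\<lambda>x. R n x - R' x) \<le> L2_norm T (\<lambda>x. um n a - point_value \<Omega> u a) + L2_norm T (\<lambda>x. - (um n x - u x))
         + (\<Sum>b\<in>Basis. L2_norm T (\<lambda>x. - ((pderiv_dir b (um n) x - du b x) * ((a - x) \<bullet> b))))"
        unfolding e
        by (intro L2_norm_le_add3 L2_const[OF Tm(2)] L2_minus L2_diff smooth_L2 um_smooth T(1) sub u_L2 offset_mult(1)[OF Tm(1) dL \<delta>])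
      also have "\<dots> \<le> ?B n"
        unfolding L2_norm_minus L2_norm_const[OF Tm(2)]
        by (intro add_mono order_refl sum_mono offset_mult(2)[OF Tm(1) dL \<delta>])
      finally show "norm (L2_norm T (\<lambda>x. R n x - R' x)) \<le> ?B n" by simp
    qed
    have "?B \<longlonglongrightarrow> \<bar>point_value \<Omega> u a - point_value \<Omega> u a\<bar> * sqrt (measure lebesgue T) + 0 + (\<Sum>b\<in>(Basis::(real^2) set). \<delta> * 0)"
      using a T(3) by (intro tendsto_intros um_convergent um_limits[OF T(1,3)]) auto
    then show "?B \<longlonglongrightarrow> 0" by simp
  qed
  then have l: "(\<lambda>n. L2_norm T (R n)) \<longlonglongrightarrow> L2_norm T R'" by (rule L2_norm_tendsto[OF RL R'L])
  have "(\<lambda>n. \<delta>\<^sup>2 * (\<Sum>b\<in>Basis. \<Sum>c\<in>Basis. L2_norm T (pderiv_dir c (pderiv_dir b (um n))))) \<longlonglongrightarrow> \<delta>\<^sup>2 * (\<Sum>b\<in>Basis. \<Sum>c\<in>Basis. L2_norm T (ddu c b))"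
    by (intro tendsto_intros L2_norm_tendsto smooth_L2 smooth_pderiv um_smooth T(1) sub ddu_L2 um_limits[OF T(1,3)])
  from LIMSEQ_le[OF l this] have "L2_norm T R' \<le> \<delta>\<^sup>2 * (\<Sum>b\<in>Basis. \<Sum>c\<in>Basis. L2_norm T (ddu c b))"
    using Taylor_L2[OF um_smooth T(1,2) a \<delta>] unfolding R_def[abs_def] by blast
  also have "(\<Sum>b\<in>Basis. \<Sum>c\<in>Basis. L2_norm T (ddu c b)) = (\<Sum>b\<in>Basis. \<Sum>c\<in>Basis. L2_norm T (ddu b c))" by (rule sum.swap)
  finally show ?thesis unfolding R'_def[abs_def] .
qed

lemma point_value_nonneg:
  assumes "AE x in lebesgue_on \<Omega>. 0 \<le> u x" "a \<in> \<Omega>" shows "0 \<le> point_value \<Omega> u a"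
proof (rule LIMSEQ_le_const[OF um_convergent[OF assms(2)]])
  have "AE x in lebesgue. x \<in> \<Omega> \<longrightarrow> 0 \<le> u x" using assms(1) dom_sets(1) by (simp add: AE_restrict_space_iff)
  then have "0 \<le> um n a" for n unfolding conv_def
    by (intro integral_nonneg_AE) (auto elim!: eventually_mono intro!: mult_nonneg_nonneg moll_nonneg)
  then show "\<exists>N. \<forall>n\<ge>N. 0 \<le> um n a" by blast
qed

text \<open>The expansion read backwards: the constant is remainder plus \<open>u\<close> plus
  linear part. Applied to small balls near a boundary vertex, each term is compared with the square
  root of the area.\<close>

lemma point_value_bound:
  assumes T: "compact T" "convex T" "T \<subseteq> \<Omega>" and a: "a \<in> T" and \<delta>: "\<delta> \<ge> 0" "\<And>x. x \<in> T \<Longrightarrow> norm (x - a) \<le> \<delta>"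
  shows "\<bar>point_value \<Omega> u a\<bar> * sqrt (measure lebesgue T)
    \<le> \<delta>\<^sup>2 * (\<Sum>b\<in>Basis. \<Sum>c\<in>Basis. L2_norm T (ddu b c)) + L2_norm T u + (\<Sum>b\<in>Basis. \<delta> * L2_norm T (du b))"
proof -
  have Tm: "T \<in> sets lebesgue" "T \<in> lmeasurable" using T(1) lmeasurable_compact by auto
  have sub: "f \<in> L2 T" if "f \<in> L2 \<Omega>" for f by (rule L2_subset(1)[OF dom_sets(1) Tm(1) T(3) that])
  define R' where "R' x = point_value \<Omega> u a - u x - (\<Sum>b\<in>Basis. du b x * ((a - x) \<bullet> b))" for x
  have R'L: "R' \<in> L2 T" unfolding R'_def
    by (intro L2_diff L2_const[OF Tm(2)] sub u_L2 L2_sum offset_mult(1)[OF Tm(1) sub[OF du_L2] \<delta>])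
  have "\<bar>point_value \<Omega> u a\<bar> * sqrt (measure lebesgue T) = L2_norm T (\<lambda>x. point_value \<Omega> u a)" using L2_norm_const[OF Tm(2)] by simp
  also have "\<dots> = L2_norm T (\<lambda>x. R' x + u x + (\<Sum>b\<in>Basis. du b x * ((a - x) \<bullet> b)))" by (simp add: R'_def)
  also have "\<dots> \<le> L2_norm T R' + L2_norm T u + (\<Sum>b\<in>Basis. L2_norm T (\<lambda>x. du b x * ((a - x) \<bullet> b)))"
    by (rule L2_norm_le_add3[OF R'L sub[OF u_L2] offset_mult(1)[OF Tm(1) sub[OF du_L2] \<delta>]])
  also have "\<dots> \<le> \<delta>\<^sup>2 * (\<Sum>b\<in>Basis. \<Sum>c\<in>Basis. L2_norm T (ddu b c)) + L2_norm T u + (\<Sum>b\<in>Basis. \<delta> * L2_norm T (du b))"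
    unfolding R'_def[abs_def] by (intro add_mono order_refl Taylor_weak[OF T a \<delta>] sum_mono offset_mult(2)[OF Tm(1) sub[OF du_L2] \<delta>])
  finally show ?thesis .
qed

end

section \<open>Interpolation of functions in H2\<close>

text \<open>Near each of its points a polyhedron coincides with its tangent cone.\<close>

lemma polyhedron_cone_near:
  fixes K :: "'a::euclidean_space set"
  assumes K: "polyhedron K"
  obtains r where "r > 0" "\<And>y t. norm (y - a) < r \<Longrightarrow> 0 < t \<Longrightarrow> t \<le> 1 \<Longrightarrow> a + t *\<^sub>R (y - a) \<in> K \<Longrightarrow> y \<in> K"
proof (cases "a \<in> K")
  case True
  obtain F where F: "finite F" "K = \<Inter>F" "\<forall>h\<in>F. \<exists>n \<beta>. n \<noteq> 0 \<and> h = {x. n \<bullet> x \<le> \<beta>}"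
    using K unfolding polyhedron_def by blast
  \<comment> \<open>Only half-spaces with \<open>a\<close> in their interior restrict
    \<open>r\<close>. The others have \<open>a\<close> on their boundary line or plane and are
    invariant under scaling about \<open>a\<close>.\<close>
  have "open (\<Inter>(interior ` {h\<in>F. a \<in> interior h}))" using F(1) by (intro open_Inter) auto
  moreover have "a \<in> \<Inter>(interior ` {h\<in>F. a \<in> interior h})" by auto
  ultimately obtain r where r: "r > 0" "ball a r \<subseteq> \<Inter>(interior ` {h\<in>F. a \<in> interior h})" by (meson openE)
  show ?thesis
  proof (rule that[OF r(1)])
    fix y t assume y: "norm (y - a) < r" "0 < t" "t \<le> 1" "a + t *\<^sub>R (y - a) \<in> K"
    show "y \<in> K" unfolding F(2)
    proof
      fix h assume h: "h \<in> F"
      obtain n \<beta> where n: "n \<noteq> 0" "h = {x. n \<bullet> x \<le> \<beta>}" using F(3) h by blast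
      show "y \<in> h"
      proof (cases "a \<in> interior h")
        case True
        have "y \<in> ball a r" using y(1) by (simp add: dist_norm norm_minus_commute)
        then have "y \<in> interior h" using r(2) h True by blast
        then show ?thesis using interior_subset by blast
      next
        case False
        then have "\<beta> \<le> n \<bullet> a" using n by (simp add: interior_halfspace_le)
        moreover have "n \<bullet> (a + t *\<^sub>R (y - a)) \<le> \<beta>" using y(4) F(2) h n(2) by auto
        ultimately have "t * (n \<bullet> (y - a)) \<le> 0" by (simp add: inner_add_right)
        then have "n \<bullet> (y - a) \<le> 0" using y(2) by (simp add: mult_le_0_iff)
        moreover have "n \<bullet> a \<le> \<beta>" using \<open>a \<in> K\<close> F(2) h n(2) by auto
        ultimately show ?thesis using n(2) by (simp add: inner_diff_right)
      qed
    qed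
  qed
next
  case False
  have "open (- K)" using polyhedron_imp_closed[OF K] by (rule open_Compl)
  then obtain r where r: "r > 0" "ball a r \<subseteq> - K" using False by (meson ComplI openE)
  show ?thesis
  proof (rule that[OF r(1)])
    fix y t assume y: "norm (y - a) < r" "0 < t" "t \<le> 1" "a + t *\<^sub>R (y - a) \<in> K"
    have "t * norm (y - a) \<le> 1 * norm (y - a)" using y by (intro mult_right_mono) auto
    then have "a + t *\<^sub>R (y - a) \<in> ball a r" using y by (simp add: dist_norm)
    then show "y \<in> K" using r(2) y(4) by blast
  qed
qed

text \<open>Since \<open>interior (closure \<Omega>) = \<Omega>\<close>, points off the closure
  occur arbitrarily close to \<open>a\<close>, with small balls around them. Within the radius where
  every triangle agrees with its tangent cone at \<open>a\<close>, scaling towards \<open>a\<close>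
  cannot move such a ball into a triangle.\<close>

lemma (in fe_mesh) exterior_cone:
  assumes a: "a \<notin> \<Omega>"
  obtains y \<rho> where "\<rho> > 0" "\<And>t z. 0 < t \<Longrightarrow> t \<le> 1 \<Longrightarrow> norm (z - (a + t *\<^sub>R (y - a))) < t * \<rho> \<Longrightarrow> z \<notin> \<Omega>"
proof -
  have "\<exists>r>0. \<forall>y t. norm (y - a) < r \<longrightarrow> 0 < t \<longrightarrow> t \<le> 1 \<longrightarrow> a + t *\<^sub>R (y - a) \<in> K \<longrightarrow> y \<in> K" if "K \<in> \<T>" for K
    by (rule polyhedron_cone_near[OF simplex_imp_polyhedron[OF mesh_simplex[OF that]], of a]) blast
  then obtain R where R: "\<And>K. K \<in> \<T> \<Longrightarrow> R K > 0"
    "\<And>K y t. K \<in> \<T> \<Longrightarrow> norm (y - a) < R K \<Longrightarrow> 0 < t \<Longrightarrow> t \<le> 1 \<Longrightarrow> a + t *\<^sub>R (y - a) \<in> K \<Longrightarrow> y \<in> K" by metis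
  define r where "r = Min (insert 1 (R ` \<T>))"
  have r: "r > 0" "\<And>K. K \<in> \<T> \<Longrightarrow> r \<le> R K" unfolding r_def using finite_mesh R(1) by auto
  have "a \<notin> interior (closure \<Omega>)" using a interior_closure_domain by simp
  then have "\<not> ball a r \<subseteq> closure \<Omega>" using interiorI[of "ball a r" a "closure \<Omega>"] r(1) by auto
  then obtain y where y: "y \<in> ball a r" "y \<notin> closure \<Omega>" by blast
  have "open (ball a r - closure \<Omega>)" by (intro open_Diff) auto
  then obtain \<rho> where \<rho>: "\<rho> > 0" "ball y \<rho> \<subseteq> ball a r - closure \<Omega>" using y by (meson DiffI openE)
  show ?thesis
  proof (rule that[OF \<rho>(1)])
    fix t z assume t: "0 < t" "t \<le> 1" and z: "norm (z - (a + t *\<^sub>R (y - a))) < t * \<rho>"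
    define z' where "z' = a + (1 / t) *\<^sub>R (z - a)"
    have zz: "z = a + t *\<^sub>R (z' - a)" using t by (simp add: z'_def)
    have "z - (a + t *\<^sub>R (y - a)) = t *\<^sub>R (z' - y)" by (simp add: zz algebra_simps)
    then have "t * norm (z' - y) < t * \<rho>" using z t by simp
    then have "z' \<in> ball y \<rho>" using t by (simp add: dist_norm norm_minus_commute)
    then have z': "norm (z' - a) < r" "z' \<notin> closure \<Omega>" using \<rho>(2) by (auto simp: dist_norm norm_minus_commute)
    show "z \<notin> \<Omega>"
    proof
      assume "z \<in> \<Omega>"
      then obtain K where K: "K \<in> \<T>" "z \<in> K" using mesh_Union closure_subset[of \<Omega>] by blast
      have "norm (z' - a) < R K" using z'(1) r(2)[OF K(1)] by linarith
      then have "z' \<in> K" using R(2)[OF K(1) _ t] K(2) zz by simp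
      then show False using z'(2) mesh_subset[OF K(1)] by blast
    qed
  qed
qed

locale mesh_interpolation = fe_mesh \<Omega> \<T> + H2_function \<Omega> u for \<Omega> \<T> u +
  assumes zero_trace: "u \<in> H10 \<Omega>"
begin

text \<open>Outside \<Omega> the value is fixed at the zero that functions in \<open>Vh\<close> take
  there; \<open>boundary_vertex_limit\<close> shows that this is the right value for
  \<open>u\<close>.\<close>

definition node_value :: "real^2 \<Rightarrow> real" where
  "node_value a = (if a \<in> \<Omega> then point_value \<Omega> u a else 0)"

definition hess :: "(real^2) set \<Rightarrow> real" where
  "hess S = (\<Sum>b\<in>Basis. \<Sum>c\<in>Basis. L2_norm S (ddu b c))"

lemma subset_L2: "T \<in> sets lebesgue \<Longrightarrow> T \<subseteq> \<Omega> \<Longrightarrow> f \<in> L2 \<Omega> \<Longrightarrow> f \<in> L2 T"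
  by (rule L2_subset(1)[OF dom_sets(1)])

lemma hess_mono:
  assumes "S \<in> sets lebesgue" "T \<in> sets lebesgue" "AE x in lebesgue. x \<in> T \<longrightarrow> x \<in> S" "S \<subseteq> \<Omega>" "T \<subseteq> \<Omega>"
  shows "hess T \<le> hess S"
  unfolding hess_def
proof (intro sum_mono)
  fix b c :: "real^2" assume "b \<in> Basis" "c \<in> Basis"
  from ddu_L2[OF this] show "L2_norm T (ddu b c) \<le> L2_norm S (ddu b c)"
    by (intro L2_norm_mono_set_AE[OF assms(1-3)] subset_L2[OF assms(1,4)] subset_L2[OF assms(2,5)])
qed

lemma hess_nonneg: "0 \<le> hess S" by (simp add: hess_def sum_nonneg)

text \<open>A scaling argument. At distance of order \<open>t n\<close> from \<open>a\<close> a ball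
  of comparable radius fits into the triangle, and translating it out of \<Omega> along the exterior
  cone bounds the norm of \<open>u\<close> on it by \<open>t n\<close> times the norm of the
  gradient over a neighbourhood shrinking to \<open>a\<close>. Dividing by the square root of the
  area, also of order \<open>t n\<close>, leaves gradient norms that tend to zero and a second
  derivative term of order \<open>t n\<close>.\<close>

lemma boundary_vertex_limit:
  assumes K: "K \<in> \<T>" and a: "a \<in> K" "a \<notin> \<Omega>" and c: "c \<in> interior K" and t: "\<And>n. 0 < t n" "\<And>n. t n \<le> (1::real)" "t \<longlonglongrightarrow> 0"
  shows "(\<lambda>n. point_value \<Omega> u (a + t n *\<^sub>R (c - a))) \<longlonglongrightarrow> 0"
proof -
  obtain y \<rho> where \<rho>: "\<rho> > 0" and ext: "\<And>t z. 0 < t \<Longrightarrow> t \<le> 1 \<Longrightarrow> norm (z - (a + t *\<^sub>R (y - a))) < t * \<rho> \<Longrightarrow> z \<notin> \<Omega>"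
    by (rule exterior_cone[OF a(2)], rule that) auto
  obtain k where k: "k > 0" "cball c k \<subseteq> interior K" using c open_interior[of K] unfolding open_contains_cball by blast
  have cK: "convex K" by (rule triangle(6)[OF mesh_simplex[OF K]])
  \<comment> \<open>The ball of radius \<open>t n * R\<close> around \<open>a\<close> contains
    \<open>B n\<close>; the larger radius \<open>t n * R'\<close> leaves room for the translation
    paths as well.\<close>
  define R where "R = norm (c - a) + k + 1"
  have R: "R > 0" unfolding R_def using k(1) norm_ge_zero[of "c - a"] by linarith
  define R' where "R' = R * (\<rho> + norm (y - a)) / \<rho>"
  have RR': "R \<le> R'" using R \<rho> by (simp add: R'_def field_simps)
  define B where "B n = cball (a + t n *\<^sub>R (c - a)) (t n * k)" for n
  have Bin: "B n \<subseteq> interior K" for n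
  proof
    fix x assume x: "x \<in> B n"
    define z where "z = a + (1 / t n) *\<^sub>R (x - a)"
    have xz: "x = a - t n *\<^sub>R (a - z)" using t(1)[of n] by (simp add: z_def)
    have "x - (a + t n *\<^sub>R (c - a)) = t n *\<^sub>R (z - c)" by (simp add: xz algebra_simps)
    then have "t n * norm (z - c) \<le> t n * k" using x t(1)[of n] by (simp add: B_def dist_norm norm_minus_commute)
    then have "z \<in> cball c k" using t(1)[of n] by (simp add: dist_norm norm_minus_commute)
    then have "z \<in> interior K" using k by blast
    then show "x \<in> interior K" unfolding xz using mem_interior_convex_shrink[OF cK _ a(1) t(1,2)] by blast
  qed
  have B\<Omega>: "B n \<subseteq> \<Omega>" for n using Bin mesh_interior_subset[OF K] by blast
  have Bball: "x \<in> ball a (t n * R)" if "x \<in> B n" for x n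
  proof -
    have "norm (x - a) \<le> norm (x - (a + t n *\<^sub>R (c - a))) + norm (t n *\<^sub>R (c - a))"
      using norm_triangle_ineq[of "x - (a + t n *\<^sub>R (c - a))" "t n *\<^sub>R (c - a)"] by simp
    also have "\<dots> \<le> t n * k + t n * norm (c - a)" using that t(1)[of n] by (simp add: B_def dist_norm norm_minus_commute)
    also have "\<dots> < t n * R" using t(1)[of n] by (simp add: R_def algebra_simps)
    finally show ?thesis by (simp add: dist_norm norm_minus_commute)
  qed
  define D where "D n = ball a (t n * R') \<inter> \<Omega>" for n
  have Dm: "D n \<in> sets lebesgue" for n using open_domain by (auto simp: D_def)
  have Bm: "B n \<in> sets lebesgue" for n by (simp add: B_def)
  have D\<Omega>: "D n \<subseteq> \<Omega>" for n by (auto simp: D_def)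
  have BD: "B n \<subseteq> D n" for n
  proof
    fix x assume x: "x \<in> B n"
    have "t n * R \<le> t n * R'" using RR' t(1)[of n] by (intro mult_left_mono) auto
    then show "x \<in> D n" using Bball[OF x] B\<Omega>[of n] x by (auto simp: D_def)
  qed
  define g where "g n = (\<Sum>b\<in>Basis. L2_norm (D n) (du b))" for n
  have g0: "g \<longlonglongrightarrow> 0"
  proof -
    have "(\<lambda>n. L2_norm (D n) (du b)) \<longlonglongrightarrow> 0" if b: "b \<in> Basis" for b
    proof (rule L2_square_tendsto_0[OF du_L2[OF b] dom_sets(1) Dm D\<Omega>])
      have "AE x in lebesgue. x \<noteq> a" by (rule AE_I'[of "{a}"]) auto
      then have "AE x in lebesgue. x \<in> \<Omega> \<longrightarrow> (\<forall>\<^sub>F n in sequentially. x \<notin> D n)"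
      proof eventually_elim
        case (elim x)
        have "(\<lambda>n. t n * R') \<longlonglongrightarrow> 0 * R'" by (intro tendsto_mult t(3) tendsto_const)
        then have "\<forall>\<^sub>F n in sequentially. t n * R' < norm (x - a)" by (rule order_tendstoD(2)) (use elim in simp)
        then have "\<forall>\<^sub>F n in sequentially. x \<notin> D n" by eventually_elim (simp add: D_def dist_norm norm_minus_commute)
        then show ?case by blast
      qed
      then show "AE x in lebesgue_on \<Omega>. \<forall>\<^sub>F n in sequentially. x \<notin> D n" using dom_sets(1) by (simp add: AE_restrict_space_iff)
    qed
    then have "g \<longlonglongrightarrow> (\<Sum>b\<in>(Basis::(real^2) set). 0)" unfolding g_def[abs_def] by (intro tendsto_sum)
    then show ?thesis by simp
  qed
  define V where "V = sqrt (unit_ball_vol 2)"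
  have V: "V > 0" by (simp add: V_def)
  define c1 where "c1 = R / (\<rho> * k) * norm (y - a)"
  have key: "\<bar>point_value \<Omega> u (a + t n *\<^sub>R (c - a))\<bar> * V \<le> t n * k * hess \<Omega> + (c1 + 1) * g n" if small: "t n * R / \<rho> \<le> 1" for n
  proof -
    let ?q = "point_value \<Omega> u (a + t n *\<^sub>R (c - a))"
    \<comment> \<open>At parameter \<open>s\<close> the exterior cone has radius
      \<open>s * \<rho>\<close>. This choice makes it \<open>t n * R\<close>, so every point of that
      ball around \<open>a\<close> is shifted out of \<Omega>.\<close>
    define s where "s = t n * R / \<rho>"
    have s: "0 < s" "s \<le> 1" "s * \<rho> = t n * R" using t(1)[of n] R \<rho> small by (auto simp: s_def)
    have tk: "t n * k > 0" using t(1)[of n] k(1) by simp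
    have "measure lebesgue (B n) = unit_ball_vol 2 * (t n * k)\<^sup>2"
      unfolding B_def using content_cball[of "t n * k" "a + t n *\<^sub>R (c - a)"] tk by simp
    then have mB: "sqrt (measure lebesgue (B n)) = V * (t n * k)" using tk by (simp add: V_def real_sqrt_mult)
    have uA: "L2_norm (ball a (s * \<rho>) \<inter> \<Omega>) u \<le> norm (s *\<^sub>R (y - a)) * (\<Sum>b\<in>Basis. L2_norm (ball a (s * (\<rho> + norm (y - a))) \<inter> \<Omega>) (du b))"
    proof (rule H10_translation_bound[OF zero_trace open_domain])
      show "open (ball a (s * \<rho>) \<inter> \<Omega>)" "ball a (s * \<rho>) \<inter> \<Omega> \<subseteq> \<Omega>" "open (ball a (s * (\<rho> + norm (y - a))))"
        using open_domain by auto
      show "x + s *\<^sub>R (y - a) \<notin> \<Omega>" if "x \<in> ball a (s * \<rho>) \<inter> \<Omega>" for x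
        using ext[OF s(1,2), of "x + s *\<^sub>R (y - a)"] that by (simp add: dist_norm norm_minus_commute)
      show "x + r *\<^sub>R s *\<^sub>R (y - a) \<in> ball a (s * (\<rho> + norm (y - a)))" if x: "x \<in> ball a (s * \<rho>) \<inter> \<Omega>" "0 \<le> r" "r \<le> 1" for x r
      proof -
        have "norm (x + r *\<^sub>R s *\<^sub>R (y - a) - a) \<le> norm (x - a) + norm (r *\<^sub>R s *\<^sub>R (y - a))"
          using norm_triangle_ineq[of "x - a" "r *\<^sub>R s *\<^sub>R (y - a)"] by (simp add: algebra_simps)
        also have "norm (r *\<^sub>R s *\<^sub>R (y - a)) = r * (s * norm (y - a))" using x s by simp
        also have "r * (s * norm (y - a)) \<le> 1 * (s * norm (y - a))" using x s by (intro mult_right_mono) auto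
        also have "norm (x - a) < s * \<rho>" using x by (simp add: dist_norm norm_minus_commute)
        finally show ?thesis by (simp add: dist_norm norm_minus_commute distrib_left)
      qed
    qed
    have eq: "s * (\<rho> + norm (y - a)) = t n * R'" using \<rho> by (simp add: s_def R'_def)
    have ub: "L2_norm (B n) u \<le> s * norm (y - a) * g n"
    proof -
      have "L2_norm (B n) u \<le> L2_norm (ball a (s * \<rho>) \<inter> \<Omega>) u"
      proof (rule L2_subset(2)[OF _ Bm])
        show "ball a (s * \<rho>) \<inter> \<Omega> \<in> sets lebesgue" using open_domain by auto
        then show "u \<in> L2 (ball a (s * \<rho>) \<inter> \<Omega>)" by (rule subset_L2) (use u_L2 in auto)
        show "B n \<subseteq> ball a (s * \<rho>) \<inter> \<Omega>" using Bball[of _ n] B\<Omega>[of n] s(3) by auto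
      qed
      then show ?thesis using uA s(1) unfolding eq g_def D_def by simp
    qed
    have db: "(\<Sum>b\<in>Basis. (t n * k) * L2_norm (B n) (du b)) \<le> (t n * k) * g n"
      unfolding g_def sum_distrib_left using tk
      by (intro sum_mono mult_left_mono L2_subset(2)[OF Dm Bm BD subset_L2[OF Dm D\<Omega> du_L2]]) auto
    have "\<bar>?q\<bar> * sqrt (measure lebesgue (B n)) \<le> (t n * k)\<^sup>2 * (\<Sum>b\<in>Basis. \<Sum>c\<in>Basis. L2_norm (B n) (ddu b c)) + L2_norm (B n) u
        + (\<Sum>b\<in>Basis. (t n * k) * L2_norm (B n) (du b))"
    proof (rule point_value_bound)
      show "compact (B n)" "convex (B n)" "B n \<subseteq> \<Omega>" using B\<Omega> by (auto simp: B_def)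
      show "a + t n *\<^sub>R (c - a) \<in> B n" "0 \<le> t n * k" using tk by (auto simp: B_def)
      show "norm (x - (a + t n *\<^sub>R (c - a))) \<le> t n * k" if "x \<in> B n" for x using that by (simp add: B_def dist_norm norm_minus_commute)
    qed
    also have "\<dots> \<le> (t n * k)\<^sup>2 * hess \<Omega> + s * norm (y - a) * g n + (t n * k) * g n"
    proof -
      have "hess (B n) \<le> hess \<Omega>" by (rule hess_mono[OF dom_sets(1) Bm]) (use B\<Omega> in auto)
      then have "(t n * k)\<^sup>2 * hess (B n) \<le> (t n * k)\<^sup>2 * hess \<Omega>" by (rule mult_left_mono) simp
      then show ?thesis using ub db unfolding hess_def by linarith
    qed
    also have "s = (t n * k) * (R / (\<rho> * k))" using k(1) by (simp add: s_def)
    finally have 1: "\<bar>?q\<bar> * (V * (t n * k)) \<le> (t n * k)\<^sup>2 * hess \<Omega> + (t n * k) * (R / (\<rho> * k)) * norm (y - a) * g n + (t n * k) * g n"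
      unfolding mB .
    have alg: "(Q * V) * \<tau> \<le> (\<tau> * H + (e * N + 1) * G) * \<tau>"
      if "Q * (V * \<tau>) \<le> \<tau>\<^sup>2 * H + \<tau> * e * N * G + \<tau> * G" for Q \<tau> H e N G :: real
      using that by (simp add: power2_eq_square algebra_simps)
    show ?thesis unfolding c1_def by (rule mult_right_le_imp_le[OF alg[OF 1] tk])
  qed
  have ev: "\<forall>\<^sub>F n in sequentially. t n * R / \<rho> \<le> 1"
  proof -
    have "(\<lambda>n. t n * (R / \<rho>)) \<longlonglongrightarrow> 0 * (R / \<rho>)" by (intro tendsto_mult t(3) tendsto_const)
    then have "\<forall>\<^sub>F n in sequentially. t n * (R / \<rho>) < 1" by (rule order_tendstoD(2)) simp
    then show ?thesis by eventually_elim simp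
  qed
  show ?thesis
  proof (rule Lim_null_comparison)
    show "\<forall>\<^sub>F n in sequentially. norm (point_value \<Omega> u (a + t n *\<^sub>R (c - a))) \<le> (t n * k * hess \<Omega> + (c1 + 1) * g n) / V"
      using ev by eventually_elim (use key V in \<open>simp add: pos_le_divide_eq\<close>)
    have "(\<lambda>n. (t n * k * hess \<Omega> + (c1 + 1) * g n) / V) \<longlonglongrightarrow> (0 * k * hess \<Omega> + (c1 + 1) * 0) / V"
      using V by (intro tendsto_intros t(3) g0) auto
    then show "(\<lambda>n. (t n * k * hess \<Omega> + (c1 + 1) * g n) / V) \<longlonglongrightarrow> 0" by simp
  qed
qed

text \<open>\<open>Taylor_weak\<close> asks for a compact convex subset of \<Omega> that contains
  the point of expansion, whereas a triangle may touch the boundary. Shrunk copies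
  \<open>S n\<close> of the triangle exhaust its interior. A vertex in \<Omega> is joined to them by
  a convex hull; a boundary vertex is approached by points of the copies, at which the values tend
  to zero.\<close>

lemma vertex_estimate:
  assumes K: "K \<in> \<T>" and a: "a \<in> K"
  shows "L2_norm (interior K) (\<lambda>x. node_value a - u x - (\<Sum>b\<in>Basis. du b x * ((a - x) \<bullet> b))) \<le> (diameter K)\<^sup>2 * hess (interior K)"
proof -
  have cK: "convex K" "compact K" "interior K \<noteq> {}" using triangle(5,6,7)[OF mesh_simplex[OF K]] by auto
  obtain c where c: "c \<in> interior K" using cK(3) by blast
  have I: "interior K \<in> sets lebesgue" "interior K \<subseteq> \<Omega>" "interior K \<in> lmeasurable"
    using mesh_interior_subset[OF K] lmeasurable_open[OF bounded_interior[OF compact_imp_bounded[OF cK(2)]]] by auto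
  have nd: "norm (x - y) \<le> diameter K" if "x \<in> K" "y \<in> K" for x y
    using diameter_bounded_bound[OF compact_imp_bounded[OF cK(2)] that] by (simp add: dist_norm)
  have d0: "diameter K \<ge> 0" by (rule diameter_ge_0[OF compact_imp_bounded[OF cK(2)]])
  \<comment> \<open>Two successors keep \<open>t n\<close> strictly below one, which the division by
    \<open>1 - t n\<close> needs.\<close>
  define t where "t n = 1 / real (Suc (Suc n))" for n
  have t: "0 < t n" "t n < 1" "t n \<le> 1" for n by (auto simp: t_def)
  have t0: "t \<longlonglongrightarrow> 0" unfolding t_def by (rule LIMSEQ_Suc[OF LIMSEQ_Suc[OF lim_1_over_n]])
  define S where "S n = (\<lambda>x. x - t n *\<^sub>R (x - c)) ` K" for n
  have Sin: "S n \<subseteq> interior K" for n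
    unfolding S_def using mem_interior_convex_shrink[OF cK(1) c _ t(1,3)] by blast
  have Scompact: "compact (S n)" for n unfolding S_def by (intro compact_continuous_image continuous_intros cK)
  have Sconvex: "convex (S n)" for n
  proof -
    have "S n = (\<lambda>x. t n *\<^sub>R c + x) ` ((\<lambda>x. (1 - t n) *\<^sub>R x) ` K)" unfolding S_def image_image by (auto simp: algebra_simps)
    then show ?thesis using cK(1) by (simp add: convex_translation convex_scaling)
  qed
  have Sm: "S n \<in> sets lebesgue" for n using Scompact[of n] lmeasurable_compact by blast
  have ex: "\<forall>\<^sub>F n in sequentially. x \<in> S n" if x: "x \<in> interior K" for x
  proof -
    \<comment> \<open>The preimage of \<open>x\<close> under the shrinking map tends to
      \<open>x\<close>, so it eventually lies in the triangle.\<close>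
    have "(\<lambda>n. x + (t n / (1 - t n)) *\<^sub>R (x - c)) \<longlonglongrightarrow> x + (0 / (1 - 0)) *\<^sub>R (x - c)" by (intro tendsto_intros t0) auto
    then have "(\<lambda>n. x + (t n / (1 - t n)) *\<^sub>R (x - c)) \<longlonglongrightarrow> x" by simp
    from topological_tendstoD[OF this open_interior x]
    show ?thesis
    proof eventually_elim
      case (elim n)
      let ?z = "x + (t n / (1 - t n)) *\<^sub>R (x - c)"
      have e: "(1 - t n) * (t n / (1 - t n)) = t n" using t(2)[of n] by simp
      have "x + s *\<^sub>R (x - c) - t n *\<^sub>R (x + s *\<^sub>R (x - c) - c) = x + ((1 - t n) * s - t n) *\<^sub>R (x - c)" for s
        by (simp add: algebra_simps)
      from this[of "t n / (1 - t n)"] have "x = ?z - t n *\<^sub>R (?z - c)" by (simp only: e) simp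
      moreover have "?z \<in> K" using elim interior_subset by blast
      ultimately show ?case unfolding S_def by (rule image_eqI)
    qed
  qed
  have L: "f \<in> L2 (interior K)" if "f \<in> L2 \<Omega>" for f using subset_L2[OF I(1,2) that] .
  define r where "r z q x = q - u x - (\<Sum>b\<in>Basis. du b x * ((z - x) \<bullet> b))" for z :: "real^2" and q x
  have rL: "r z q \<in> L2 (interior K)" if "z \<in> K" for z q unfolding r_def
    by (intro L2_diff L2_const[OF I(3)] L u_L2 L2_sum offset_mult(1)[OF I(1) L[OF du_L2] d0])
      (use nd that interior_subset[of K] in auto)
  have exA: "AE x in lebesgue_on (interior K). \<forall>\<^sub>F n in sequentially. x \<in> S (n + m)" for m
    by (rule AE_I2, rule sequentially_offset, rule ex) simp
  have "L2_norm (interior K) (r a (node_value a)) \<le> (diameter K)\<^sup>2 * hess (interior K)"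
  proof (cases "a \<in> \<Omega>")
    case True
    have nv: "node_value a = point_value \<Omega> u a" using True by (simp add: node_value_def)
    show ?thesis
    proof (rule L2_norm_le_exhaustion[OF rL[OF a] I(1) Sm Sin])
      show "AE x in lebesgue_on (interior K). \<forall>\<^sub>F n in sequentially. x \<in> S n" using exA[of 0] by simp
      fix n
      define T where "T = convex hull (insert a (S n))"
      have T: "compact T" "convex T" "a \<in> T" "S n \<subseteq> T"
        unfolding T_def using Scompact hull_subset[of "insert a (S n)" convex] by (auto intro!: compact_convex_hull compact_insert)
      \<comment> \<open>Adjoining one point of the triangle keeps its interior convex, so the hull
        \<open>T\<close> exceeds the interior by at most the null set \<open>{a}\<close>.\<close>
      have "convex (insert a (interior K))"
      proof (rule convexI)
        fix x y and \<alpha> \<beta> :: real assume xy: "x \<in> insert a (interior K)" "y \<in> insert a (interior K)" and ab: "0 \<le> \<alpha>" "0 \<le> \<beta>" "\<alpha> + \<beta> = 1"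
        have shr: "\<alpha> *\<^sub>R a + \<beta> *\<^sub>R y \<in> insert a (interior K)" if "y \<in> interior K" "0 \<le> \<beta>" "\<alpha> + \<beta> = 1" "0 \<le> \<alpha>" for \<alpha> \<beta> y
        proof (cases "\<beta> = 0")
          case False
          have "a - \<beta> *\<^sub>R (a - y) \<in> interior K"
            using mem_interior_convex_shrink[OF cK(1) that(1) a, of \<beta>] that False by auto
          moreover have "a - \<beta> *\<^sub>R (a - y) = \<alpha> *\<^sub>R a + \<beta> *\<^sub>R y" using that(3) by (simp add: algebra_simps flip: scaleR_add_left)
          ultimately show ?thesis by simp
        qed (use that in auto)
        show "\<alpha> *\<^sub>R x + \<beta> *\<^sub>R y \<in> insert a (interior K)"
        proof (cases "x = a")
          case True
          then show ?thesis
          proof (cases "y = a")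
            case True
            then show ?thesis using \<open>x = a\<close> ab by (simp flip: scaleR_add_left)
          qed (use shr[of y \<beta> \<alpha>] xy ab in auto)
        next
          case False
          then have xi: "x \<in> interior K" using xy by auto
          show ?thesis
          proof (cases "y = a")
            case True
            then show ?thesis using shr[of x \<alpha> \<beta>] xi ab by (auto simp: add.commute)
          next
            case False
            then have "y \<in> interior K" using xy by auto
            then show ?thesis using convexD[OF convex_interior[OF cK(1)] xi _ ab] by blast
          qed
        qed
      qed
      then have TI: "T \<subseteq> insert a (interior K)" unfolding T_def using Sin[of n] by (intro hull_minimal) auto
      have T\<Omega>: "T \<subseteq> \<Omega>" using TI I(2) True by auto
      have TK: "T \<subseteq> K" using TI a interior_subset by auto
      have Tm: "T \<in> sets lebesgue" "T \<in> lmeasurable" using T(1) lmeasurable_compact by auto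
      have ae: "AE x in lebesgue. x \<in> T \<longrightarrow> x \<in> interior K"
        by (rule AE_I'[of "{a}"]) (use TI in auto)
      have rT: "r a (node_value a) \<in> L2 T" unfolding r_def
        by (intro L2_diff L2_const[OF Tm(2)] subset_L2[OF Tm(1) T\<Omega>] u_L2 L2_sum offset_mult(1)[OF Tm(1) subset_L2[OF Tm(1) T\<Omega> du_L2] d0])
          (use nd a TK in auto)
      have "L2_norm (S n) (r a (node_value a)) \<le> L2_norm T (r a (node_value a))"
        by (rule L2_subset(2)[OF Tm(1) Sm T(4) rT])
      also have "\<dots> \<le> (diameter K)\<^sup>2 * hess T" unfolding r_def nv hess_def
        by (rule Taylor_weak[OF T(1,2) T\<Omega> T(3) d0]) (use nd a TK in auto)
      also have "\<dots> \<le> (diameter K)\<^sup>2 * hess (interior K)"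
        by (intro mult_left_mono hess_mono I Tm(1) ae T\<Omega>) simp
      finally show "L2_norm (S n) (r a (node_value a)) \<le> (diameter K)\<^sup>2 * hess (interior K)" .
    qed
  next
    case False
    have nv: "node_value a = 0" using False by (simp add: node_value_def)
    define p where "p n = a + t n *\<^sub>R (c - a)" for n
    define q where "q n = point_value \<Omega> u (p n)" for n
    have q0: "q \<longlonglongrightarrow> 0" unfolding q_def[abs_def] p_def by (rule boundary_vertex_limit[OF K a False c t(1,3) t0])
    have pS: "p n \<in> S n" for n unfolding p_def S_def using a by (intro image_eqI[of _ _ a]) (auto simp: algebra_simps)
    have pK: "p n \<in> K" for n using pS[of n] Sin[of n] interior_subset by blast
    \<comment> \<open>The cost of moving the point of expansion from \<open>p n\<close> to
      \<open>a\<close>: the change of the value, and the gradient times the offset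
      \<open>p n - a\<close>.\<close>
    define \<epsilon> where "\<epsilon> n = \<bar>q n\<bar> * sqrt (measure lebesgue (interior K)) + (\<Sum>b\<in>Basis. (t n * norm (c - a)) * L2_norm (interior K) (du b))" for n
    have "\<epsilon> \<longlonglongrightarrow> \<bar>0\<bar> * sqrt (measure lebesgue (interior K)) + (\<Sum>b\<in>(Basis::(real^2) set). (0 * norm (c - a)) * L2_norm (interior K) (du b))"
      unfolding \<epsilon>_def[abs_def] by (intro tendsto_intros q0 t0)
    then have \<epsilon>0: "\<epsilon> \<longlonglongrightarrow> 0" by simp
    have bound: "L2_norm (S n) (r a 0) \<le> (diameter K)\<^sup>2 * hess (interior K) + \<epsilon> n" for n
    proof -
      have S\<Omega>: "S n \<subseteq> \<Omega>" using Sin I(2) by blast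
      have "L2_norm (S n) (r (p n) (q n)) \<le> (diameter K)\<^sup>2 * hess (S n)" unfolding r_def q_def hess_def
        by (rule Taylor_weak[OF Scompact Sconvex S\<Omega> pS d0]) (use nd pK Sin interior_subset[of K] in blast)
      also have "\<dots> \<le> (diameter K)\<^sup>2 * hess (interior K)"
        by (intro mult_left_mono hess_mono I Sm S\<Omega>) (use Sin in auto)
      finally have 1: "L2_norm (S n) (r (p n) (q n)) \<le> (diameter K)\<^sup>2 * hess (interior K)" .
      have e: "(\<lambda>x. r (p n) (q n) x - r a 0 x) = (\<lambda>x. q n + (\<Sum>b\<in>Basis. - ((t n * ((c - a) \<bullet> b)) * du b x)))"
      proof (rule ext)
        fix x
        have "(\<Sum>b\<in>Basis. du b x * ((a - x) \<bullet> b)) - (\<Sum>b\<in>Basis. du b x * ((p n - x) \<bullet> b)) = (\<Sum>b\<in>Basis. - ((t n * ((c - a) \<bullet> b)) * du b x))"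
          unfolding sum_subtractf[symmetric] by (intro sum.cong refl) (simp add: p_def algebra_simps inner_add_left inner_diff_left)
        then show "r (p n) (q n) x - r a 0 x = q n + (\<Sum>b\<in>Basis. - ((t n * ((c - a) \<bullet> b)) * du b x))"
          unfolding r_def by linarith
      qed
      have "L2_norm (interior K) (\<lambda>x. r (p n) (q n) x - r a 0 x) \<le> L2_norm (interior K) (\<lambda>x. q n) + L2_norm (interior K) (\<lambda>x. (\<Sum>b\<in>Basis. - ((t n * ((c - a) \<bullet> b)) * du b x)))"
        unfolding e by (intro L2_triangle L2_const[OF I(3)] L2_sum L2_minus L2_cmult L du_L2)
      also have "L2_norm (interior K) (\<lambda>x. (\<Sum>b\<in>Basis. - ((t n * ((c - a) \<bullet> b)) * du b x))) \<le> (\<Sum>b\<in>Basis. L2_norm (interior K) (\<lambda>x. - ((t n * ((c - a) \<bullet> b)) * du b x)))"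
        by (intro L2_norm_sum_le L2_minus L2_cmult L du_L2)
      also have "\<dots> \<le> (\<Sum>b\<in>Basis. (t n * norm (c - a)) * L2_norm (interior K) (du b))"
        unfolding L2_norm_minus L2_norm_cmult using t(1)[of n]
        by (intro sum_mono mult_right_mono) (auto simp: abs_mult Basis_le_norm)
      finally have 2: "L2_norm (interior K) (\<lambda>x. r (p n) (q n) x - r a 0 x) \<le> \<epsilon> n"
        unfolding \<epsilon>_def L2_norm_const[OF I(3)] by simp
      have rS: "r (p n) (q n) \<in> L2 (S n)" "r a 0 \<in> L2 (S n)" "(\<lambda>x. r (p n) (q n) x - r a 0 x) \<in> L2 (interior K)"
        using L2_subset(1)[OF I(1) Sm Sin rL] pK a L2_diff[OF rL rL] by auto
      have "L2_norm (S n) (r a 0) \<le> L2_norm (S n) (r (p n) (q n)) + L2_norm (S n) (\<lambda>x. r (p n) (q n) x - r a 0 x)"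
        by (rule L2_norm_le_triangle[OF rS(2,1)])
      also have "L2_norm (S n) (\<lambda>x. r (p n) (q n) x - r a 0 x) \<le> L2_norm (interior K) (\<lambda>x. r (p n) (q n) x - r a 0 x)"
        by (rule L2_subset(2)[OF I(1) Sm Sin rS(3)])
      finally show ?thesis using 1 2 by linarith
    qed
    show ?thesis unfolding nv
    proof (rule field_le_epsilon)
      fix e :: real assume e: "e > 0"
      obtain m where m: "\<And>n. n \<ge> m \<Longrightarrow> \<epsilon> n < e" using order_tendstoD(2)[OF \<epsilon>0 e] unfolding eventually_sequentially by blast
      \<comment> \<open>The first \<open>m\<close> copies are skipped, so that
        \<open>\<epsilon>\<close> stays below \<open>e\<close> along the whole exhaustion.\<close>
      show "L2_norm (interior K) (r a 0) \<le> (diameter K)\<^sup>2 * hess (interior K) + e"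
      proof (rule L2_norm_le_exhaustion[OF rL[OF a] I(1) Sm Sin exA[of m]])
        show "L2_norm (S (n + m)) (r a 0) \<le> (diameter K)\<^sup>2 * hess (interior K) + e" for n
          using bound[of "n + m"] m[of "n + m"] by simp
      qed
    qed
  qed
  then show ?thesis by (simp only: r_def[abs_def])
qed

end

section \<open>Affine functions on a triangle and the geometry of the mesh\<close>

lemma affine_triangle_bound:
  assumes K: "2 simplex K" and x: "x \<in> K"
  shows "\<bar>c + g \<bullet> x\<bar> \<le> (\<Sum>z\<in>vertices K. \<bar>c + g \<bullet> z\<bar>)"
proof (rule triangle_combination[OF K x])
  fix \<mu> assume mu: "\<And>z. z \<in> vertices K \<Longrightarrow> 0 \<le> \<mu> z" "sum \<mu> (vertices K) = (1::real)" "(\<Sum>z\<in>vertices K. \<mu> z *\<^sub>R z) = x"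
  have "\<bar>c + g \<bullet> x\<bar> = \<bar>\<Sum>z\<in>vertices K. \<mu> z * (c + g \<bullet> z)\<bar>"
    using affine_combination[OF mu(2), of c g] mu(3) by simp
  also have "\<dots> \<le> (\<Sum>z\<in>vertices K. \<bar>\<mu> z * (c + g \<bullet> z)\<bar>)" by (rule sum_abs)
  also have "\<dots> \<le> (\<Sum>z\<in>vertices K. \<bar>c + g \<bullet> z\<bar>)"
  proof (rule sum_mono)
    fix z assume z: "z \<in> vertices K"
    have "\<mu> z \<le> 1" using member_le_sum[of z "vertices K" \<mu>] z mu(1,2) triangle(1)[OF K] by auto
    then have "\<mu> z * \<bar>c + g \<bullet> z\<bar> \<le> 1 * \<bar>c + g \<bullet> z\<bar>" by (intro mult_right_mono) auto
    then show "\<bar>\<mu> z * (c + g \<bullet> z)\<bar> \<le> \<bar>c + g \<bullet> z\<bar>" using mu(1)[OF z] by (simp add: abs_mult)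
  qed
  finally show ?thesis .
qed

text \<open>Across a ball of radius \<open>r\<close> the affine function varies by
  \<open>2 * r * norm g\<close> in the direction of \<open>g\<close>, while its values in the
  triangle are bounded by those at the vertices. The supremum over inscribed balls brings in the
  incircle diameter.\<close>

lemma affine_incircle_bound:
  assumes K: "2 simplex K"
  shows "incircle_diameter K * norm g \<le> 2 * (\<Sum>z\<in>vertices K. \<bar>c + g \<bullet> z\<bar>)" "0 < incircle_diameter K"
proof -
  have ball: "2 * r * norm g \<le> 2 * (\<Sum>z\<in>vertices K. \<bar>c + g \<bullet> z\<bar>)" if "0 < r" "cball x r \<subseteq> K" for r x c g
  proof (cases "g = 0")
    case False
    define w where "w = (r / norm g) *\<^sub>R g"
    have "norm w = r" using False \<open>0 < r\<close> by (simp add: w_def)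
    then have "x + w \<in> K" "x - w \<in> K" using that(2) by (auto simp: dist_norm)
    note b = affine_triangle_bound[OF K this(1), of c g] affine_triangle_bound[OF K this(2), of c g]
    have "g \<bullet> w = r * norm g" using False by (simp add: w_def power2_norm_eq_inner[symmetric] power2_eq_square)
    then have "2 * r * norm g = (c + g \<bullet> (x + w)) - (c + g \<bullet> (x - w))" by (simp add: inner_add_right inner_diff_right)
    then show ?thesis using b by linarith
  qed (simp add: sum_nonneg)
  let ?S = "{2 * r |r. 0 < r \<and> (\<exists>x. cball x r \<subseteq> K)}"
  obtain x where "x \<in> interior K" using triangle(7)[OF K] by blast
  then obtain r where r: "0 < r" "cball x r \<subseteq> interior K" using open_interior[of K] unfolding open_contains_cball by blast
  then have rS: "2 * r \<in> ?S" using interior_subset by blast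
  obtain b :: "real^2" where b: "b \<in> Basis" using nonempty_Basis by blast
  \<comment> \<open>The same inequality with a unit vector in place of \<open>g\<close> bounds the
    radii, so that the supremum is a genuine one.\<close>
  have "bdd_above ?S"
    by (rule bdd_aboveI[of _ "2 * (\<Sum>z\<in>vertices K. \<bar>0 + b \<bullet> z\<bar>)"]) (use ball[of _ _ b 0] b in auto)
  then have "2 * r \<le> incircle_diameter K" unfolding incircle_diameter_def by (rule cSup_upper[OF rS])
  then show "0 < incircle_diameter K" using r(1) by linarith
  show "incircle_diameter K * norm g \<le> 2 * (\<Sum>z\<in>vertices K. \<bar>c + g \<bullet> z\<bar>)"
  proof (cases "g = 0")
    case False
    have "incircle_diameter K \<le> 2 * (\<Sum>z\<in>vertices K. \<bar>c + g \<bullet> z\<bar>) / norm g" unfolding incircle_diameter_def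
    proof (rule cSup_least)
      show "?S \<noteq> {}" using rS by blast
      fix s assume "s \<in> ?S"
      then show "s \<le> 2 * (\<Sum>z\<in>vertices K. \<bar>c + g \<bullet> z\<bar>) / norm g" using ball[of _ _ g c] False by (auto simp: pos_le_divide_eq)
    qed
    then show ?thesis using False by (simp add: pos_le_divide_eq)
  qed (simp add: sum_nonneg)
qed

lemma triangle_diameter_pos:
  fixes K :: "(real^2) set"
  assumes K: "2 simplex K" shows "0 < diameter K"
proof -
  obtain x where "x \<in> interior K" using triangle(7)[OF K] by blast
  then obtain r where r: "0 < r" "cball x r \<subseteq> interior K" using open_interior[of K] unfolding open_contains_cball by blast
  have "diameter (cball x r) \<le> diameter K"
    by (rule diameter_subset) (use r(2) interior_subset[of K] compact_imp_bounded[OF triangle(5)[OF K]] in auto)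
  then show ?thesis using r(1) by (simp add: diameter_cball)
qed

context fe_mesh begin

lemma diameter_le_mesh_size: "K \<in> \<T> \<Longrightarrow> diameter K \<le> mesh_size \<T>"
  unfolding mesh_size_def using finite_mesh by (intro Max_ge) auto

lemma mesh_nonempty: "\<T> \<noteq> {}"   using mesh_Union domain_nonempty closure_subset[of \<Omega>] by blast

lemma mesh_size_bounds: "0 < mesh_size \<T>" "mesh_size \<T> \<le> diameter \<Omega>"
proof -
  obtain K where K: "K \<in> \<T>" using mesh_nonempty by blast
  show "0 < mesh_size \<T>" using diameter_le_mesh_size[OF K] triangle_diameter_pos[OF mesh_simplex[OF K]] by linarith
  have "diameter K \<le> diameter \<Omega>" if "K \<in> \<T>" for K
    using diameter_subset[OF mesh_subset[OF that] bounded_closure[OF bounded_domain]] diameter_closure[OF bounded_domain] by simp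
  then show "mesh_size \<T> \<le> diameter \<Omega>" unfolding mesh_size_def using finite_mesh mesh_nonempty by simp
qed

lemma shape_regular_pos: "shape_regular \<sigma> \<T> \<Longrightarrow> 0 < \<sigma>"
proof -
  assume s: "shape_regular \<sigma> \<T>"
  obtain K where K: "K \<in> \<T>" using mesh_nonempty by blast
  have "0 < \<sigma> * incircle_diameter K"
    using s K triangle_diameter_pos[OF mesh_simplex[OF K]] unfolding shape_regular_def by force
  then show ?thesis using affine_incircle_bound(2)[OF mesh_simplex[OF K]] by (simp add: zero_less_mult_iff)
qed

lemma AE_mesh_interior: "AE x in lebesgue. x \<in> \<Omega> \<longrightarrow> (\<exists>K\<in>\<T>. x \<in> interior K)"
proof -
  have "negligible (\<Union>K\<in>\<T>. frontier K)"
    using finite_mesh negligible_convex_frontier[OF triangle(6)[OF mesh_simplex]] by (intro negligible_Union) auto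
  then have "AE x in lebesgue. x \<notin> (\<Union>K\<in>\<T>. frontier K)"
    by (intro AE_I'[of "\<Union>K\<in>\<T>. frontier K"]) (auto simp: negligible_iff_null_sets)
  then show ?thesis
  proof eventually_elim
    case (elim x)
    show ?case
    proof
      assume "x \<in> \<Omega>"
      then obtain K where K: "K \<in> \<T>" "x \<in> K" using mesh_Union closure_subset[of \<Omega>] by blast
      then have "x \<in> interior K" using elim closure_subset[of K] unfolding frontier_def by blast
      then show "\<exists>K\<in>\<T>. x \<in> interior K" using K(1) by blast
    qed
  qed
qed

text \<open>A face that meets the interior of a triangle is the triangle itself, so each of the two
  contains the other.\<close>

lemma mesh_interior_unique:
  assumes "K \<in> \<T>" "K' \<in> \<T>" "x \<in> interior K" "x \<in> interior K'" shows "K = K'"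
proof -
  have "L \<subseteq> L'" if "L \<in> \<T>" "L' \<in> \<T>" "x \<in> interior L" "x \<in> interior L'" for L L'
  proof -
    have "x \<in> (L \<inter> L') \<inter> interior L" using that interior_subset by blast
    then have "L \<inter> L' = L" using face_of_disjoint_interior[OF face_mesh[OF that(1,2)]] by blast
    then show ?thesis by blast
  qed
  then show ?thesis using assms by blast
qed

lemma mesh_L2_norm:
  assumes f: "f \<in> L2 \<Omega>"
  shows "(L2_norm \<Omega> f)\<^sup>2 = (\<Sum>K\<in>\<T>. (L2_norm (interior K) f)\<^sup>2)"
proof -
  let ?F = "\<lambda>K x. if x \<in> interior K then (f x)\<^sup>2 else 0"
  have Im: "interior K \<in> sets lebesgue" for K :: "(real^2) set" by auto
  have int: "integrable lebesgue (?F K)" if "K \<in> \<T>" for K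
    using L2_square_integrable[OF L2_subset(1)[OF domain_lebesgue Im mesh_interior_subset[OF that] f]]
    by (subst Lebesgue_Measure.integrable_restrict_UNIV[OF Im])
  have ae: "AE x in lebesgue. (if x \<in> \<Omega> then (f x)\<^sup>2 else 0) = (\<Sum>K\<in>\<T>. ?F K x)"
    using AE_mesh_interior
  proof eventually_elim
    case (elim x)
    show ?case
    proof (cases "x \<in> \<Omega>")
      case True
      then obtain K where K: "K \<in> \<T>" "x \<in> interior K" using elim by blast
      have "?F L x = (if L = K then (f x)\<^sup>2 else 0)" if "L \<in> \<T>" for L
      proof (cases "x \<in> interior L")
        case True
        then show ?thesis using mesh_interior_unique[OF that K(1) True K(2)] by simp
      next
        case False
        then have "L \<noteq> K" using K(2) by blast
        then show ?thesis using False by simp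
      qed
      then have "(\<Sum>L\<in>\<T>. ?F L x) = (\<Sum>L\<in>\<T>. if L = K then (f x)\<^sup>2 else 0)" by (rule sum.cong[OF refl])
      then show ?thesis using True K(1) finite_mesh by simp
    next
      case False
      then have "?F L x = 0" if "L \<in> \<T>" for L using mesh_interior_subset[OF that] by auto
      then show ?thesis using False by simp
    qed
  qed
  have m: "(\<lambda>x. if x \<in> \<Omega> then (f x)\<^sup>2 else 0) \<in> borel_measurable lebesgue"
    using L2_square_integrable[OF f]
    by (intro borel_measurable_integrable) (subst Lebesgue_Measure.integrable_restrict_UNIV[OF domain_lebesgue])
  have "(L2_norm \<Omega> f)\<^sup>2 = (LINT x|lebesgue. (if x \<in> \<Omega> then (f x)\<^sup>2 else 0))"
    unfolding L2_norm_square by (rule Lebesgue_Measure.integral_restrict_UNIV[OF domain_lebesgue, symmetric])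
  also have "\<dots> = (LINT x|lebesgue. (\<Sum>K\<in>\<T>. ?F K x))"
    by (rule integral_cong_AE[OF m _ ae]) (intro borel_measurable_sum borel_measurable_integrable int)
  also have "\<dots> = (\<Sum>K\<in>\<T>. LINT x|lebesgue. ?F K x)" by (intro Bochner_Integration.integral_sum int)
  also have "\<dots> = (\<Sum>K\<in>\<T>. (L2_norm (interior K) f)\<^sup>2)"
    unfolding L2_norm_square by (intro sum.cong refl Lebesgue_Measure.integral_restrict_UNIV Im)
  finally show ?thesis .
qed

end

context mesh_interpolation begin

text \<open>The local bounds are squared and summed over the disjoint interiors. The factor two is
  the square root of the number of second partial derivatives, since \<open>hess\<close> adds norms
  where the seminorm adds squares.\<close>

lemma mesh_hess_bound:
  assumes f: "f \<in> L2 \<Omega>" and A: "A \<ge> 0" and b: "\<And>K. K \<in> \<T> \<Longrightarrow> L2_norm (interior K) f \<le> A * hess (interior K)"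
  shows "L2_norm \<Omega> f \<le> 2 * A * H2_seminorm \<Omega> u"
proof -
  have hess2: "(hess S)\<^sup>2 \<le> 4 * (\<Sum>b\<in>Basis. \<Sum>c\<in>Basis. (L2_norm S (ddu b c))\<^sup>2)" for S
  proof -
    have "(hess S)\<^sup>2 \<le> (\<Sum>b\<in>Basis. (\<Sum>c\<in>Basis. L2_norm S (ddu b c))\<^sup>2) * real (card (Basis :: (real^2) set))"
      unfolding hess_def by (rule sum_squared_le_sum_of_squares)
    also have "\<dots> \<le> (\<Sum>b\<in>Basis. (\<Sum>c\<in>Basis. (L2_norm S (ddu b c))\<^sup>2) * real (card (Basis :: (real^2) set))) * real (card (Basis :: (real^2) set))"
      by (intro mult_right_mono sum_mono sum_squared_le_sum_of_squares) simp
    finally show ?thesis by (simp add: sum_distrib_right[symmetric] sum_distrib_left[symmetric] mult.commute)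
  qed
  have "(L2_norm \<Omega> f)\<^sup>2 = (\<Sum>K\<in>\<T>. (L2_norm (interior K) f)\<^sup>2)" by (rule mesh_L2_norm[OF f])
  also have "\<dots> \<le> (\<Sum>K\<in>\<T>. A\<^sup>2 * (4 * (\<Sum>b\<in>Basis. \<Sum>c\<in>Basis. (L2_norm (interior K) (ddu b c))\<^sup>2)))"
  proof (rule sum_mono)
    fix K assume "K \<in> \<T>"
    then have "(L2_norm (interior K) f)\<^sup>2 \<le> A\<^sup>2 * (hess (interior K))\<^sup>2"
      using power_mono[OF b] by (simp add: power_mult_distrib)
    also have "\<dots> \<le> A\<^sup>2 * (4 * (\<Sum>b\<in>Basis. \<Sum>c\<in>Basis. (L2_norm (interior K) (ddu b c))\<^sup>2))"
      by (intro mult_left_mono hess2) simp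
    finally show "(L2_norm (interior K) f)\<^sup>2 \<le> \<dots>" .
  qed
  also have "\<dots> = 4 * A\<^sup>2 * (\<Sum>K\<in>\<T>. \<Sum>b\<in>Basis. \<Sum>c\<in>Basis. (L2_norm (interior K) (ddu b c))\<^sup>2)"
    by (simp add: sum_distrib_left mult_ac)
  also have "(\<Sum>K\<in>\<T>. \<Sum>b\<in>Basis. \<Sum>c\<in>Basis. (L2_norm (interior K) (ddu b c))\<^sup>2)
      = (\<Sum>b\<in>Basis. \<Sum>c\<in>Basis. \<Sum>K\<in>\<T>. (L2_norm (interior K) (ddu b c))\<^sup>2)"
    by (subst sum.swap) (intro sum.cong refl sum.swap)
  also have "\<dots> = (\<Sum>b\<in>Basis. \<Sum>c\<in>Basis. (L2_norm \<Omega> (ddu b c))\<^sup>2)"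
    by (intro sum.cong refl mesh_L2_norm[symmetric] ddu_L2)
  also have "\<dots> = (H2_seminorm \<Omega> u)\<^sup>2" by (simp add: H2_seminorm_def sum_nonneg)
  finally have "(L2_norm \<Omega> f)\<^sup>2 \<le> (2 * A * H2_seminorm \<Omega> u)\<^sup>2" by (simp add: power_mult_distrib)
  moreover have "0 \<le> 2 * A * H2_seminorm \<Omega> u" using A by (simp add: H2_seminorm_def sum_nonneg)
  ultimately show ?thesis by (rule power2_le_imp_le)
qed

text \<open>Value and gradient of one affine function are bounded by its vertex values, which yields
  both estimates at once. The 3 counts the vertices, the second constant has a further factor two
  from \<open>affine_incircle_bound\<close>, and shape regularity trades the incircle diameter for
  the diameter of the triangle.\<close>

lemma element_estimate:
  assumes v: "v \<in> Vh \<Omega> \<T>" "\<And>i. i \<in> interior_nodes \<Omega> \<T> \<Longrightarrow> v i = point_value \<Omega> u i" and K: "K \<in> \<T>"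
  shows "L2_norm (interior K) (\<lambda>x. u x - v x) \<le> 3 * (diameter K)\<^sup>2 * hess (interior K)"
    and "b \<in> Basis \<Longrightarrow> shape_regular \<sigma> \<T> \<Longrightarrow>
      L2_norm (interior K) (weak_pderiv \<Omega> b (\<lambda>x. u x - v x)) \<le> 6 * \<sigma> * diameter K * hess (interior K)"
proof -
  let ?I = "interior K"
  note simplex = mesh_simplex[OF K]
  have I: "?I \<in> sets lebesgue" "?I \<subseteq> \<Omega>" "?I \<in> lmeasurable"
    using mesh_interior_subset[OF K] lmeasurable_open[OF bounded_interior[OF compact_imp_bounded[OF mesh_compact[OF K]]]] by auto
  have L: "f \<in> L2 ?I" if "f \<in> L2 \<Omega>" for f using subset_L2[OF I(1,2) that] .
  have nd: "norm (x - y) \<le> diameter K" if "x \<in> K" "y \<in> K" for x y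
    using diameter_bounded_bound[OF compact_imp_bounded[OF mesh_compact[OF K]] that] by (simp add: dist_norm)
  have d0: "0 < diameter K" by (rule triangle_diameter_pos[OF simplex])
  obtain c g where cg: "\<And>x. x \<in> K \<Longrightarrow> v x = c + g \<bullet> x" using Vh_affine[OF v(1) K] by blast
  have vL: "v \<in> L2 \<Omega>" and vH: "v \<in> H1 \<Omega>" using H10_H1[OF Vh_H10[OF v(1)]] H1_L2 by auto
  have uH: "u \<in> H1 \<Omega>" using H10_H1[OF zero_trace] .
  have vert: "z \<in> K" "v z = node_value z" if "z \<in> vertices K" for z
  proof -
    show "z \<in> K" using vertices_subset that by blast
    show "v z = node_value z"
    proof (cases "z \<in> \<Omega>")
      case True
      then have "z \<in> interior_nodes \<Omega> \<T>" using that K unfolding interior_nodes_eq by blast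
      then show ?thesis using v(2) True by (simp add: node_value_def)
    qed (simp add: node_value_def Vh_outside[OF v(1)])
  qed
  define r where "r z x = node_value z - u x - (\<Sum>b\<in>Basis. du b x * ((z - x) \<bullet> b))" for z x
  have rL: "r z \<in> L2 ?I" if "z \<in> vertices K" for z unfolding r_def
    by (intro L2_diff L2_const[OF I(3)] L u_L2 L2_sum offset_mult(1)[OF I(1) L[OF du_L2] less_imp_le[OF d0]])
      (use nd vert(1)[OF that] interior_subset[of K] in auto)
  have rb: "L2_norm ?I (r z) \<le> (diameter K)\<^sup>2 * hess ?I" if "z \<in> vertices K" for z
    unfolding r_def by (rule vertex_estimate[OF K vert(1)[OF that]])
  define R where "R x = (\<Sum>z\<in>vertices K. \<bar>r z x\<bar>)" for x
  have absL: "(\<lambda>x. \<bar>r z x\<bar>) \<in> L2 ?I" if "z \<in> vertices K" for z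
    by (rule L2_mono[OF _ rL[OF that]]) (use L2_measurable[OF rL[OF that]] in auto)
  have RL: "R \<in> L2 ?I" unfolding R_def[abs_def] by (intro L2_sum absL)
  have "L2_norm ?I R \<le> (\<Sum>z\<in>vertices K. L2_norm ?I (\<lambda>x. \<bar>r z x\<bar>))"
    unfolding R_def[abs_def] by (intro L2_norm_sum_le absL)
  also have "\<dots> = (\<Sum>z\<in>vertices K. L2_norm ?I (r z))" by (simp add: L2_norm_def L2_inner_def)
  also have "\<dots> \<le> (\<Sum>z\<in>vertices K. (diameter K)\<^sup>2 * hess ?I)" by (intro sum_mono rb)
  also have "\<dots> = 3 * (diameter K)\<^sup>2 * hess ?I" using triangle(4)[OF simplex] by simp
  finally have RB: "L2_norm ?I R \<le> 3 * (diameter K)\<^sup>2 * hess ?I" .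
  have R0: "0 \<le> R x" for x by (simp add: R_def sum_nonneg)
  text \<open>The remainders are the values at the vertices of an affine function, namely of \<open>v\<close> minus the formal Taylor
    polynomial of \<open>u\<close> at \<open>x\<close>.\<close>
  have Req: "R x = (\<Sum>z\<in>vertices K. \<bar>(v x - u x - (g - weak_grad \<Omega> u x) \<bullet> x) + (g - weak_grad \<Omega> u x) \<bullet> z\<bar>)" if "x \<in> K" for x
    unfolding R_def
  proof (intro sum.cong refl arg_cong[where f=abs])
    fix z assume z: "z \<in> vertices K"
    have "(\<Sum>b\<in>Basis. du b x * ((z - x) \<bullet> b)) = weak_grad \<Omega> u x \<bullet> (z - x)"
      by (simp add: weak_grad_def inner_sum_left inner_commute[of "z - x"])
    moreover have "node_value z = c + g \<bullet> z" using vert[OF z] cg by simp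
    ultimately show "r z x = (v x - u x - (g - weak_grad \<Omega> u x) \<bullet> x) + (g - weak_grad \<Omega> u x) \<bullet> z"
      unfolding r_def cg[OF that] by (simp add: inner_diff_left inner_diff_right)
  qed
  \<comment> \<open>At \<open>x\<close> itself the affine function takes the value
    \<open>v x - u x\<close>.\<close>
  have val: "\<bar>u x - v x\<bar> \<le> \<bar>R x\<bar>" if "x \<in> K" for x
    using affine_triangle_bound[OF simplex that, of "v x - u x - (g - weak_grad \<Omega> u x) \<bullet> x" "g - weak_grad \<Omega> u x"]
    unfolding Req[OF that, symmetric] by simp
  have "L2_norm ?I (\<lambda>x. u x - v x) \<le> L2_norm ?I R"
    by (rule L2_norm_mono_AE[OF L2_measurable[OF L[OF L2_diff[OF u_L2 vL]]] RL])
      (use val interior_subset[of K] in \<open>auto intro!: AE_I2\<close>)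
  then show "L2_norm ?I (\<lambda>x. u x - v x) \<le> 3 * (diameter K)\<^sup>2 * hess ?I" using RB by linarith
  show "L2_norm ?I (weak_pderiv \<Omega> b (\<lambda>x. u x - v x)) \<le> 6 * \<sigma> * diameter K * hess ?I"
    if b: "b \<in> Basis" and \<sigma>: "shape_regular \<sigma> \<T>"
  proof -
    have s0: "0 < \<sigma>" by (rule shape_regular_pos[OF \<sigma>])
    have grad: "diameter K * \<bar>du b x - g \<bullet> b\<bar> \<le> 2 * \<sigma> * R x" if "x \<in> K" for x
    proof -
      have "\<bar>du b x - g \<bullet> b\<bar> = \<bar>(g - weak_grad \<Omega> u x) \<bullet> b\<bar>"
        by (simp add: inner_diff_left weak_grad_inner_Basis[OF b])
      also have "\<dots> \<le> norm (g - weak_grad \<Omega> u x)" by (rule Basis_le_norm[OF b])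
      finally have "diameter K * \<bar>du b x - g \<bullet> b\<bar> \<le> (\<sigma> * incircle_diameter K) * norm (g - weak_grad \<Omega> u x)"
        using \<sigma> K d0 affine_incircle_bound(2)[OF simplex] s0 unfolding shape_regular_def by (intro mult_mono) auto
      also have "\<dots> \<le> \<sigma> * (2 * R x)"
        using mult_left_mono[OF affine_incircle_bound(1)[OF simplex, of "g - weak_grad \<Omega> u x" "v x - u x - (g - weak_grad \<Omega> u x) \<bullet> x"], of \<sigma>] s0
        unfolding Req[OF that, symmetric] by (simp add: mult.assoc)
      finally show ?thesis by simp
    qed
    have ae: "AE x in lebesgue_on ?I. weak_pderiv \<Omega> b (\<lambda>x. u x - v x) x = du b x - g \<bullet> b"
    proof -
      have "AE x in lebesgue. x \<in> \<Omega> \<longrightarrow> du b x - weak_pderiv \<Omega> b v x = weak_pderiv \<Omega> b (\<lambda>x. u x - v x) x"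
        using H1_diff(2)[OF dom(1) uH vH b] dom_sets(1) by (simp add: AE_restrict_space_iff)
      moreover have "AE x in lebesgue. x \<in> ?I \<longrightarrow> weak_pderiv \<Omega> b v x = g \<bullet> b"
        using Vh_weak_pderiv[OF v(1) K cg b] I(1) by (simp add: AE_restrict_space_iff)
      ultimately have "AE x in lebesgue. x \<in> ?I \<longrightarrow> weak_pderiv \<Omega> b (\<lambda>x. u x - v x) x = du b x - g \<bullet> b"
        by eventually_elim (use I(2) in auto)
      then show ?thesis using I(1) by (simp add: AE_restrict_space_iff)
    qed
    have wL: "weak_pderiv \<Omega> b (\<lambda>x. u x - v x) \<in> L2 ?I"
      by (rule L[OF H1_weak_pderiv(2)[OF dom(1) H1_diff(1)[OF dom(1) uH vH] b]])
    have "L2_norm ?I (\<lambda>x. diameter K * weak_pderiv \<Omega> b (\<lambda>x. u x - v x) x) \<le> L2_norm ?I (\<lambda>x. (2 * \<sigma>) * R x)"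
    proof (rule L2_norm_mono_AE[OF L2_measurable[OF L2_cmult[OF wL]] L2_cmult[OF RL]])
      have "AE x in lebesgue_on ?I. x \<in> K" using interior_subset[of K] by (intro AE_I2) auto
      with ae show "AE x in lebesgue_on ?I. \<bar>diameter K * weak_pderiv \<Omega> b (\<lambda>x. u x - v x) x\<bar> \<le> \<bar>2 * \<sigma> * R x\<bar>"
      proof eventually_elim
        case (elim x)
        then show ?case using grad[OF elim(2)] d0 s0 R0[of x] by (simp add: abs_mult)
      qed
    qed
    then have "diameter K * L2_norm ?I (weak_pderiv \<Omega> b (\<lambda>x. u x - v x)) \<le> 2 * \<sigma> * L2_norm ?I R"
      unfolding L2_norm_cmult using d0 s0 by simp
    also have "\<dots> \<le> 2 * \<sigma> * (3 * (diameter K)\<^sup>2 * hess ?I)" using RB s0 by (intro mult_left_mono) auto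
    also have "\<dots> = diameter K * (6 * \<sigma> * diameter K * hess ?I)" by (simp add: power2_eq_square)
    finally show ?thesis using d0 by simp
  qed
qed

text \<open>Passing from \<open>hess\<close> to the seminorm doubles the elementwise constants 3 and
  6; the 24 arises from 12 by adding the two coordinate directions.\<close>

lemma interpolation_estimate:
  assumes v: "v \<in> Vh \<Omega> \<T>" "\<And>i. i \<in> interior_nodes \<Omega> \<T> \<Longrightarrow> v i = point_value \<Omega> u i" and \<sigma>: "shape_regular \<sigma> \<T>"
  shows "L2_norm \<Omega> (\<lambda>x. u x - v x) \<le> 6 * (mesh_size \<T>)\<^sup>2 * H2_seminorm \<Omega> u"
    and "H1_norm \<Omega> (\<lambda>x. u x - v x) \<le> (6 * mesh_size \<T> + 24 * \<sigma>) * mesh_size \<T> * H2_seminorm \<Omega> u"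
proof -
  note h = mesh_size_bounds(1) and s0 = shape_regular_pos[OF \<sigma>]
  have w: "(\<lambda>x. u x - v x) \<in> H1 \<Omega>" by (rule H1_diff(1)[OF dom(1) H10_H1[OF zero_trace] H10_H1[OF Vh_H10[OF v(1)]]])
  have d: "0 \<le> diameter K" "diameter K \<le> mesh_size \<T>" if "K \<in> \<T>" for K
    using triangle_diameter_pos[OF mesh_simplex[OF that]] diameter_le_mesh_size[OF that] by auto
  have 1: "L2_norm (interior K) (\<lambda>x. u x - v x) \<le> (3 * (mesh_size \<T>)\<^sup>2) * hess (interior K)" if "K \<in> \<T>" for K
  proof -
    have "3 * (diameter K)\<^sup>2 * hess (interior K) \<le> 3 * (mesh_size \<T>)\<^sup>2 * hess (interior K)"
      using d[OF that] hess_nonneg by (intro mult_right_mono mult_left_mono power_mono) auto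
    then show ?thesis using element_estimate(1)[OF v that] by linarith
  qed
  have 2: "L2_norm (interior K) (weak_pderiv \<Omega> b (\<lambda>x. u x - v x)) \<le> (6 * \<sigma> * mesh_size \<T>) * hess (interior K)"
    if "K \<in> \<T>" "b \<in> Basis" for K b
  proof -
    have "6 * \<sigma> * diameter K * hess (interior K) \<le> 6 * \<sigma> * mesh_size \<T> * hess (interior K)"
      using d[OF that(1)] hess_nonneg s0 by (intro mult_right_mono mult_left_mono) auto
    then show ?thesis using element_estimate(2)[OF v that \<sigma>] by linarith
  qed
  show L: "L2_norm \<Omega> (\<lambda>x. u x - v x) \<le> 6 * (mesh_size \<T>)\<^sup>2 * H2_seminorm \<Omega> u"
    using mesh_hess_bound[OF H1_L2[OF w] _ 1] by simp
  have G: "L2_norm \<Omega> (weak_pderiv \<Omega> b (\<lambda>x. u x - v x)) \<le> 12 * \<sigma> * mesh_size \<T> * H2_seminorm \<Omega> u" if "b \<in> Basis" for b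
    using mesh_hess_bound[OF H1_weak_pderiv(2)[OF dom(1) w that] _ 2[OF _ that]] s0 h by simp
  have "H1_norm \<Omega> (\<lambda>x. u x - v x) \<le> L2_norm \<Omega> (\<lambda>x. u x - v x) + (\<Sum>b\<in>Basis. L2_norm \<Omega> (weak_pderiv \<Omega> b (\<lambda>x. u x - v x)))"
    by (rule H1_norm_le)
  also have "\<dots> \<le> 6 * (mesh_size \<T>)\<^sup>2 * H2_seminorm \<Omega> u + (\<Sum>b\<in>(Basis :: (real^2) set). 12 * \<sigma> * mesh_size \<T> * H2_seminorm \<Omega> u)"
    by (intro add_mono sum_mono L G)
  also have "\<dots> = (6 * mesh_size \<T> + 24 * \<sigma>) * mesh_size \<T> * H2_seminorm \<Omega> u"
    by (simp add: power2_eq_square algebra_simps)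
  finally show "H1_norm \<Omega> (\<lambda>x. u x - v x) \<le> \<dots>" .
qed

end

section \<open>Convergence rate and final constants\<close>

context discrete_obstacle begin

lemma obstacle_H2_estimate:
  assumes C: "C \<ge> 0" "\<And>u. u \<in> H10 \<Omega> \<Longrightarrow> L2_norm \<Omega> u \<le> C * (\<Sum>b\<in>Basis. L2_norm \<Omega> (weak_pderiv \<Omega> b u))"
    and \<sigma>: "shape_regular \<sigma> \<T>" and H2: "P \<in> H2 \<Omega>"
  shows "H1_norm \<Omega> (\<lambda>x. P x - Ph x) \<le> 2 * (C + 1) * (2 * \<bar>M\<bar> / m + 1 / sqrt m) * (6 * diameter \<Omega> + 24 * \<sigma> + 3)
    * mesh_size \<T> * (H2_seminorm \<Omega> P + sqrt (L2_norm \<Omega> lam) * sqrt (H2_seminorm \<Omega> P))"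
proof -
  interpret mesh_interpolation \<Omega> \<T> P
    by unfold_locales (use domain H2 P_H10 in auto)
  let ?h = "mesh_size \<T>" and ?s = "H2_seminorm \<Omega> P"
  note h = mesh_size_bounds and s0 = shape_regular_pos[OF \<sigma>]
  obtain v where v: "v \<in> Vh \<Omega> \<T>" "\<And>i. i \<in> interior_nodes \<Omega> \<T> \<Longrightarrow> v i = point_value \<Omega> P i"
    using Vh_interpolation[of "point_value \<Omega> P"] by blast
  have "AE x in lebesgue_on \<Omega>. 0 \<le> P x" using P by (simp add: solves_obstacle_def Kset_def)
  \<comment> \<open>Means of a nonnegative function are nonnegative, so the interpolant is
    admissible in the discrete problem.\<close>
  then have "0 \<le> v i" if "i \<in> interior_nodes \<Omega> \<T>" for i
    using point_value_nonneg that v(2)[OF that] by (simp add: interior_nodes_def)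
  then have vK: "v \<in> Kh \<Omega> \<T>" using Vh_nonneg[OF v(1)] v(1) by (simp add: Kh_def)
  have ss: "0 \<le> ?s" by (simp add: H2_seminorm_def sum_nonneg)
  note e = interpolation_estimate[OF v \<sigma>]
  have "sqrt (L2_norm \<Omega> (\<lambda>x. P x - v x)) \<le> sqrt (6 * ?h\<^sup>2 * ?s)" using e(1) by simp
  also have "\<dots> = sqrt 6 * ?h * sqrt ?s" using h(1) by (simp add: real_sqrt_mult)
  also have "\<dots> \<le> 3 * ?h * sqrt ?s" using h(1) ss by (intro mult_right_mono real_le_lsqrt) auto
  finally have q: "sqrt (L2_norm \<Omega> (\<lambda>x. P x - v x)) \<le> 3 * ?h * sqrt ?s" .
  \<comment> \<open>One factor \<open>mesh_size\<close> is bounded by the diameter of \<Omega>,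
    which frees the constant from the mesh; the summand 3 majorises the \<open>sqrt 6\<close> of the
    multiplier term.\<close>
  let ?k = "6 * diameter \<Omega> + 24 * \<sigma> + 3"
  have "H1_norm \<Omega> (\<lambda>x. P x - v x) \<le> (6 * ?h + 24 * \<sigma>) * (?h * ?s)" using e(2) by (simp add: mult.assoc)
  also have "\<dots> \<le> ?k * (?h * ?s)" using h ss by (intro mult_right_mono) auto
  finally have 1: "H1_norm \<Omega> (\<lambda>x. P x - v x) \<le> ?k * (?h * ?s)" .
  have "sqrt (L2_norm \<Omega> lam) * sqrt (L2_norm \<Omega> (\<lambda>x. P x - v x)) \<le> sqrt (L2_norm \<Omega> lam) * (3 * ?h * sqrt ?s)"
    by (intro mult_left_mono q) simp
  also have "\<dots> = 3 * (?h * (sqrt (L2_norm \<Omega> lam) * sqrt ?s))" by simp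
  also have "\<dots> \<le> ?k * (?h * (sqrt (L2_norm \<Omega> lam) * sqrt ?s))"
    using h ss s0 by (intro mult_right_mono) auto
  finally have 2: "sqrt (L2_norm \<Omega> lam) * sqrt (L2_norm \<Omega> (\<lambda>x. P x - v x)) \<le> ?k * (?h * (sqrt (L2_norm \<Omega> lam) * sqrt ?s))" .
  have "H1_norm \<Omega> (\<lambda>x. P x - Ph x) \<le> 2 * (C + 1) * (2 * \<bar>M\<bar> / m + 1 / sqrt m)
      * (H1_norm \<Omega> (\<lambda>x. P x - v x) + sqrt (L2_norm \<Omega> lam) * sqrt (L2_norm \<Omega> (\<lambda>x. P x - v x)))"
    by (rule Falk_estimate[OF vK C])
  also have "\<dots> \<le> 2 * (C + 1) * (2 * \<bar>M\<bar> / m + 1 / sqrt m) * (?k * (?h * ?s) + ?k * (?h * (sqrt (L2_norm \<Omega> lam) * sqrt ?s)))"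
    using C(1) m(1) by (intro mult_left_mono add_mono 1 2) auto
  also have "\<dots> = 2 * (C + 1) * (2 * \<bar>M\<bar> / m + 1 / sqrt m) * ?k * ?h * (?s + sqrt (L2_norm \<Omega> lam) * sqrt ?s)"
  proof -
    have "E * (k * (h * s) + k * (h * t)) = E * k * h * (s + t)" for E k h s t :: real by (simp add: algebra_simps)
    then show ?thesis .
  qed
  finally show ?thesis .
qed

end

text \<open>Converting the essential supremum to a real number loses nothing: it is at most
  \<open>M\<close>, and any point that obeys the bound shows it to be nonnegative, so a null domain
  needs no separate case.\<close>

lemma Linf_norm_AE:
  assumes "u \<in> Linf \<Omega>" shows "AE x in lebesgue_on \<Omega>. \<bar>u x\<bar> \<le> Linf_norm \<Omega> u"
proof -
  let ?e = "esssup (lebesgue_on \<Omega>) (\<lambda>x. ereal \<bar>u x\<bar>)"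
  obtain M where u: "u \<in> borel_measurable (lebesgue_on \<Omega>)" and "AE x in lebesgue_on \<Omega>. \<bar>u x\<bar> \<le> M"
    using assms unfolding Linf_def by blast
  then have M: "?e \<le> ereal M" by (intro esssup_I) auto
  have "AE x in lebesgue_on \<Omega>. ereal \<bar>u x\<bar> \<le> ?e" by (rule esssup_AE)
  then show ?thesis
  proof eventually_elim
    case (elim x)
    then have "ereal 0 \<le> ?e" by (rule order_trans[rotated]) simp
    with M have "?e = ereal (real_of_ereal ?e)" by (cases ?e) auto
    then have "ereal \<bar>u x\<bar> \<le> ereal (real_of_ereal ?e)" using elim by simp
    then show ?case by (simp add: Linf_norm_def)
  qed
qed

theorem theorem2p4:
  fixes \<Omega> :: "(real^2) set" and d0 D :: real
  assumes "polygonal_domain \<Omega>" and "d0 > 0"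
  shows "\<exists>(C :: real) (C' :: real \<Rightarrow> real).
    \<forall>(d :: real^2 \<Rightarrow> real) (f :: real^2 \<Rightarrow> real) (P :: real^2 \<Rightarrow> real) (lam :: real^2 \<Rightarrow> real)
      (\<T> :: (real^2) set set) (\<gamma> :: real) (p :: real^2 \<Rightarrow> real) (l :: real^2 \<Rightarrow> real)
      (Ph :: real^2 \<Rightarrow> real).
      (\<lambda>x. d x ^ 3) \<in> Linf \<Omega> \<and> Linf_norm \<Omega> (\<lambda>x. d x ^ 3) = D \<and>
      (AE x in lebesgue_on \<Omega>. d x ^ 3 \<ge> d0 ^ 3) \<and>
      f \<in> L2 \<Omega> \<and>
      solves_obstacle \<Omega> d f P \<and>
      lam \<in> L2 \<Omega> \<and>
      has_weak_div \<Omega> (\<lambda>x. d x ^ 3 *\<^sub>R weak_grad \<Omega> P x) (\<lambda>x. - lam x - f x) \<and>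
      conforming_triangulation \<Omega> \<T> \<and>
      \<gamma> > 0 \<and> solves_nodal_mixed \<Omega> \<T> d f \<gamma> p l \<and> Ph = nodal_fun \<Omega> \<T> p
      \<longrightarrow>
      H1_norm \<Omega> (\<lambda>x. P x - Ph x)
        \<le> C * (INF v\<in>Kh \<Omega> \<T>. H1_norm \<Omega> (\<lambda>x. P x - v x)
                 + sqrt (L2_norm \<Omega> lam) * sqrt (L2_norm \<Omega> (\<lambda>x. P x - v x))) \<and>
      (\<forall>\<sigma>. shape_regular \<sigma> \<T> \<and> P \<in> H2 \<Omega> \<longrightarrow>
        H1_norm \<Omega> (\<lambda>x. P x - Ph x)
          \<le> C' \<sigma> * mesh_size \<T> * (H2_seminorm \<Omega> P
                 + sqrt (L2_norm \<Omega> lam) * sqrt (H2_seminorm \<Omega> P)))"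
proof -
  have \<Omega>: "open \<Omega>" "bounded \<Omega>" using assms(1) by (auto simp: polygonal_domain_def)
  obtain c where c: "c \<ge> 0" "\<And>u. u \<in> H10 \<Omega> \<Longrightarrow> L2_norm \<Omega> u \<le> c * (\<Sum>b\<in>Basis. L2_norm \<Omega> (weak_pderiv \<Omega> b u))"
    using H10_Poincare[OF \<Omega>] by blast
  \<comment> \<open>The constant of \<open>Falk_estimate\<close> with \<open>d0 ^ 3\<close> as lower
    and \<open>D\<close> as upper bound of the coefficient. The Poincare constant \<open>c\<close>
    belongs to \<Omega> alone, so \<open>A\<close> is fixed before coefficient, data and mesh
    appear.\<close>
  define A where "A = 2 * (c + 1) * (2 * \<bar>D\<bar> / d0 ^ 3 + 1 / sqrt (d0 ^ 3))"
  have A: "A > 0" unfolding A_def using c(1) assms(2) by (intro mult_pos_pos add_nonneg_pos) auto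
  show ?thesis
  proof (rule exI[of _ A], rule exI[of _ "\<lambda>\<sigma>. A * (6 * diameter \<Omega> + 24 * \<sigma> + 3)"], intro allI impI, elim conjE)
    fix d f P lam :: "real^2 \<Rightarrow> real" and \<T> \<gamma> and p l Ph :: "real^2 \<Rightarrow> real"
    assume d: "(\<lambda>x. d x ^ 3) \<in> Linf \<Omega>" "Linf_norm \<Omega> (\<lambda>x. d x ^ 3) = D" "AE x in lebesgue_on \<Omega>. d0 ^ 3 \<le> d x ^ 3"
      and f: "f \<in> L2 \<Omega>" "solves_obstacle \<Omega> d f P" "lam \<in> L2 \<Omega>"
        "has_weak_div \<Omega> (\<lambda>x. d x ^ 3 *\<^sub>R weak_grad \<Omega> P x) (\<lambda>x. - lam x - f x)" "conforming_triangulation \<Omega> \<T>"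
        "\<gamma> > 0" "solves_nodal_mixed \<Omega> \<T> d f \<gamma> p l" and Ph: "Ph = nodal_fun \<Omega> \<T> p"
    interpret discrete_obstacle \<Omega> \<T> d D "d0 ^ 3" f P lam p l \<gamma>
      by unfold_locales (use assms \<Omega> d f Linf_norm_AE[OF d(1)] in \<open>auto simp: Linf_def\<close>)
    let ?e = "\<lambda>v. H1_norm \<Omega> (\<lambda>x. P x - v x) + sqrt (L2_norm \<Omega> lam) * sqrt (L2_norm \<Omega> (\<lambda>x. P x - v x))"
    \<comment> \<open>With the constant divided out, the left side is a lower bound for every member
      of the set and hence for the infimum; the zero function makes the set nonempty.\<close>
    have "H1_norm \<Omega> (\<lambda>x. P x - Ph x) / A \<le> (INF v\<in>Kh \<Omega> \<T>. ?e v)"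
    proof (rule cINF_greatest)
      show "Kh \<Omega> \<T> \<noteq> {}" using Vh_zero by (auto simp: Kh_def)
      fix v assume "v \<in> Kh \<Omega> \<T>"
      from Falk_estimate[OF this c] show "H1_norm \<Omega> (\<lambda>x. P x - Ph x) / A \<le> ?e v"
        using A unfolding Ph A_def[symmetric] by (simp add: pos_divide_le_eq mult.commute)
    qed
    then show "H1_norm \<Omega> (\<lambda>x. P x - Ph x) \<le> A * (INF v\<in>Kh \<Omega> \<T>. ?e v) \<and>
      (\<forall>\<sigma>. shape_regular \<sigma> \<T> \<and> P \<in> H2 \<Omega> \<longrightarrow> H1_norm \<Omega> (\<lambda>x. P x - Ph x)
        \<le> A * (6 * diameter \<Omega> + 24 * \<sigma> + 3) * mesh_size \<T> * (H2_seminorm \<Omega> P + sqrt (L2_norm \<Omega> lam) * sqrt (H2_seminorm \<Omega> P)))"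
      using obstacle_H2_estimate[OF c] A unfolding Ph A_def[symmetric] by (simp add: pos_divide_le_eq mult.commute)
  qed
qed

end
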